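(* Let $F\colon\mathscr{D}\to\mathscr{E}$ be an exact morphism of strong, stable derivators and let $A$ be a small category. The canonical natural isomorphism $\sigma_A\colon F_A\circ\Sigma\xrightarrow{\cong}\Sigma\circ F_A$ (defined in the context as the inverse of the canonical comparison map $\psi\colon\Sigma\circ F_A\to F_A\circ\Sigma$) turns $F_A\colon\mathscr{D}(A)\to\mathscr{E}(A)$ into an exact functor with respect to canonical triangulations; that is, $(F_A,\sigma_A)$ is an exact functor of triangulated categories.
   Context: **Derivators.** $\mathbf{Cat}$ is the 2-category of small categories, $\mathbf{CAT}$ that of not necessarily small categories, $\mathbb{1}$ is the terminal category, $\pi_A\colon A\to\mathbb{1}$ the unique functor; objects $a\in A$ are identified with functors $a\colon\mathbb{1}\to A$. A prederivator is a strict 2-functor $\mathscr{D}\colon\mathbf{Cat}^{\mathrm{op}}\to\mathbf{CAT}$ (op reverses functors only); $u\colon A\to B$ induces $u^\ast\colon\mathscr{D}(B)\to\mathscr{D}(A)$, and $X_a:=a^\ast X$. It is a derivator if: (Der1) $\mathscr{D}$ sends coproducts to products; (Der2) $f$ in $\mathscr{D}(A)$ is an isomorphism iff $f_a$ is so for all $a\in A$; (Der3) each $u^\ast$ has a left adjoint $u_!$ and a right adjoint $u_\ast$ (left/right Kan extensions; write $\operatorname{colim}_A=(\pi_A)_!$, $\lim_A=(\pi_A)_\ast$); (Der4) for $u\colon A\to B$, $b\in B$, with projections $p\colon(u/b)\to A$, $q\colon(b/u)\to A$, the canonical mates $\operatorname{colim}_{(u/b)}p^\ast\to b^\ast u_!$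 and $b^\ast u_\ast\to\lim_{(b/u)}q^\ast$ are isomorphisms. The shifted derivator is $\mathscr{D}^B(A)=\mathscr{D}(B\times A)$. $\mathscr{D}$ is strong if $\mathscr{D}(A\times[1])\to\mathscr{D}(A)^{[1]}$ is full and essentially surjective for every $A$. **Pointed and stable.** $\mathscr{D}$ is pointed if $\mathscr{D}(\mathbb{1})$ has a zero object. Let $\square=[1]\times[1]$ with inclusions $i_\ulcorner\colon\ulcorner\to\square$ (omitting $(1,1)$) and $i_\lrcorner\colon\lrcorner\to\square$ (omitting $(0,0)$). $X\in\mathscr{D}(\square)$ is cocartesian (cartesian) if it lies in the essential image of $(i_\ulcorner)_!$ (of $(i_\lrcorner)_\ast$). A pointed derivator is stable if the cartesian and cocartesian squares coincide. Then the categories $\mathscr{D}(A)$ are additive. **Morphisms.** A morphism $F\colon\mathscr{D}\to\mathscr{E}$ is a pseudo-natural transformation: functors $F_A\colon\mathscr{D}(A)\to\mathscr{E}(A)$ and coherent natural isomorphisms $\gamma_u\colon u^\ast F_B\cong F_Au^\ast$ for $u\colon A\to B$. It induces $F^A\colon\mathscr{D}^A\to\mathscr{E}^A$. There are canonical mates $$u_!F_A\xrightarrow{\eta}u_!F_Au^\ast u_!\xrightarrow{\gamma_u^{-1}}u_!u^\ast F_Bu_!\xrightarrow{\varepsilon}F_Bu_!,\qquad F_Bu_\ast\xrightarrow{\eta}u_\ast u^\ast F_Bu_\ast\xrightarrow{\gamma_u}u_\ast F_Au^\ast u_\ast\xrightarrow{\varepsilon}u_\ast F_A,$$ and $F$ preserves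 left (right) Kan extensions along $u$ if the first (second) is an isomorphism. $F$ is right exact if it preserves left Kan extensions along $\emptyset\to\mathbb{1}$ (initial objects) and along $\ulcorner\to\mathbb{1}$ (pushouts); left exact is dual (terminal objects and limits of shape $\lrcorner$); exact means left and right exact. $F$ between pointed derivators is pointed if it preserves zero objects; such $F$ preserves right Kan extensions along sieves. **Suspension and comparison map.** With $i=(0,0)\colon\mathbb{1}\to\ulcorner$ (a sieve), $\Sigma=(1,1)^\ast(i_\ulcorner)_!\,i_\ast\colon\mathscr{D}(\mathbb{1})\to\mathscr{D}(\mathbb{1})$. For pointed $F$ the comparison map $\psi\colon\Sigma F_{\mathbb{1}}\to F_{\mathbb{1}}\Sigma$ is $$(1,1)^\ast(i_\ulcorner)_!\,i_\ast F_{\mathbb{1}}\xrightarrow{\cong}(1,1)^\ast(i_\ulcorner)_!F_\ulcorner i_\ast\to(1,1)^\ast F_\square(i_\ulcorner)_!\,i_\ast\xrightarrow{\cong}F_{\mathbb{1}}(1,1)^\ast(i_\ulcorner)_!\,i_\ast,$$ where the first map is the inverse of the mate $F_\ulcorner i_\ast\to i_\ast F_{\mathbb 1}$, the second is the mate for $(i_\ulcorner)_!$, and the third is $\gamma_{(1,1)}$. For right exact $F$ it is invertible; for exact $F$ between stable derivators set $\sigma=\sigma_{\mathbb{1}}=\psi^{-1}$, and define $\sigma_A$ by the same construction applied to $F^A\colon\mathscr{D}^A\to\mathscr{E}^A$ (so $\Sigma$ on $\mathscr{D}(A)=\mathscr{D}^A(\mathbb{1})$ is that of $\mathscr{D}^A$).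 **Canonical triangulations.** Let $\mathscr{D}$ be strong and stable. For $X\in\mathscr{D}(\square)$ with $X_{1,0}\cong X_{0,1}\cong0$, the unit $\eta\colon i_\ulcorner^\ast X\to i_\ast i^\ast i_\ulcorner^\ast X$ is invertible, and evaluating $(i_\ulcorner)_!i_\ast i^\ast i_\ulcorner^\ast X\xrightarrow{\eta^{-1}}(i_\ulcorner)_!i_\ulcorner^\ast X\xrightarrow{\varepsilon}X$ at $(1,1)$ gives $\varphi\colon\Sigma(X_{0,0})\to X_{1,1}$, invertible if $X$ is cocartesian. A coherent cofiber sequence is $Q\in\mathscr{D}([2]\times[1])$ with $Q_{2,0}\cong Q_{0,1}\cong 0$ and both squares cocartesian. Its standard triangle is $Q_{0,0}\to Q_{1,0}\to Q_{1,1}\to\Sigma Q_{0,0}$, where the last map is the composite of $Q_{1,1}\to Q_{2,1}$ with $\varphi^{-1}\colon Q_{2,1}\to\Sigma Q_{0,0}$ for the outer square (the restriction of $Q$ to $\{0,2\}\times[1]$). The canonical triangulation on $\mathscr{D}(\mathbb{1})$ has suspension $\Sigma$ and as distinguished triangles those isomorphic to standard triangles; the canonical triangulation on $\mathscr{D}(A)$ is that of $\mathscr{D}^A(\mathbb{1})$. These are triangulated categories. **Exact functors.** An exact functor $\mathcal{T}\to\mathcal{T}'$ of triangulated categories is a pair $(F,\sigma)$ of an additive functor $F$ and a natural transformation $\sigma\colon F\Sigma\to\Sigma F$ such that for every distinguished triangle $X\xrightarrow{f}Y\xrightarrow{g}Z\xrightarrow{h}\Sigma X$ in $\mathcal{T}$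 the triangle $FX\xrightarrow{Ff}FY\xrightarrow{Fg}FZ\xrightarrow{\sigma\circ Fh}\Sigma FX$ is distinguished in $\mathcal{T}'$. *)

theory Defs
  imports Main "HOL-Library.FuncSet"
begin

unbundle cardinal_syntax

section \<open>Categories, functors, natural transformations\<close>

text \<open>All operations are required to be \<^const>\<open>undefined\<close> outside their domain, so that
  equality of records is equality of categories, of functors and of natural transformations.
  This matters for the strict functoriality of prederivators.\<close>

record ('o, 'm) cat =
  Obj :: "'o set"
  Arr :: "'m set"
  Dom :: "'m \<Rightarrow> 'o"
  Cod :: "'m \<Rightarrow> 'o"
  Id :: "'o \<Rightarrow> 'm"
  Comp :: "'m \<Rightarrow> 'm \<Rightarrow> 'm" (infixr "\<cdot>\<index>" 70)

definition mk_cat ::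
  "'o set \<Rightarrow> 'm set \<Rightarrow> ('m \<Rightarrow> 'o) \<Rightarrow> ('m \<Rightarrow> 'o) \<Rightarrow> ('o \<Rightarrow> 'm) \<Rightarrow> ('m \<Rightarrow> 'm \<Rightarrow> 'm) \<Rightarrow> ('o, 'm) cat" where
  "mk_cat Ob Ar d c i m =
    \<lparr>Obj = Ob, Arr = Ar, Dom = restrict d Ar, Cod = restrict c Ar, Id = restrict i Ob,
     Comp = (\<lambda>g f. if g \<in> Ar \<and> f \<in> Ar \<and> c f = d g then m g f else undefined)\<rparr>"

definition Hom :: "('o, 'm) cat \<Rightarrow> 'o \<Rightarrow> 'o \<Rightarrow> 'm set" where
  "Hom C x y = {f \<in> Arr C. Dom C f = x \<and> Cod C f = y}"

definition category :: "('o, 'm) cat \<Rightarrow> bool" where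
  "category C \<longleftrightarrow>
    Dom C \<in> Arr C \<rightarrow>\<^sub>E Obj C \<and>
    Cod C \<in> Arr C \<rightarrow>\<^sub>E Obj C \<and>
    Id C \<in> extensional (Obj C) \<and>
    (\<forall>g f. \<not> (g \<in> Arr C \<and> f \<in> Arr C \<and> Cod C f = Dom C g) \<longrightarrow> g \<cdot>\<^bsub>C\<^esub> f = undefined) \<and>
    (\<forall>x\<in>Obj C. Id C x \<in> Hom C x x) \<and>
    (\<forall>g\<in>Arr C. \<forall>f\<in>Arr C. Cod C f = Dom C g \<longrightarrow> g \<cdot>\<^bsub>C\<^esub> f \<in> Hom C (Dom C f) (Cod C g)) \<and>
    (\<forall>f\<in>Arr C. f \<cdot>\<^bsub>C\<^esub> Id C (Dom C f) = f \<and> Id C (Cod C f) \<cdot>\<^bsub>C\<^esub> f = f) \<and>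
    (\<forall>h\<in>Arr C. \<forall>g\<in>Arr C. \<forall>f\<in>Arr C. Cod C f = Dom C g \<longrightarrow> Cod C g = Dom C h \<longrightarrow>
      (h \<cdot>\<^bsub>C\<^esub> g) \<cdot>\<^bsub>C\<^esub> f = h \<cdot>\<^bsub>C\<^esub> (g \<cdot>\<^bsub>C\<^esub> f))"

definition inverse_arrs :: "('o, 'm) cat \<Rightarrow> 'm \<Rightarrow> 'm \<Rightarrow> bool" where
  "inverse_arrs C f g \<longleftrightarrow>
    f \<in> Arr C \<and> g \<in> Hom C (Cod C f) (Dom C f) \<and>
    g \<cdot>\<^bsub>C\<^esub> f = Id C (Dom C f) \<and> f \<cdot>\<^bsub>C\<^esub> g = Id C (Cod C f)"

definition iso_arr :: "('o, 'm) cat \<Rightarrow> 'm \<Rightarrow> bool" where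
  "iso_arr C f \<longleftrightarrow> (\<exists>g. inverse_arrs C f g)"

definition inv_arr :: "('o, 'm) cat \<Rightarrow> 'm \<Rightarrow> 'm" where
  "inv_arr C f = (THE g. inverse_arrs C f g)"

definition iso_objs :: "('o, 'm) cat \<Rightarrow> 'o \<Rightarrow> 'o \<Rightarrow> bool" where
  "iso_objs C x y \<longleftrightarrow> (\<exists>f\<in>Hom C x y. iso_arr C f)"

definition initial_obj :: "('o, 'm) cat \<Rightarrow> 'o \<Rightarrow> bool" where
  "initial_obj C z \<longleftrightarrow> z \<in> Obj C \<and> (\<forall>x\<in>Obj C. \<exists>!f. f \<in> Hom C z x)"

definition terminal_obj :: "('o, 'm) cat \<Rightarrow> 'o \<Rightarrow> bool" where
  "terminal_obj C z \<longleftrightarrow> z \<in> Obj C \<and> (\<forall>x\<in>Obj C. \<exists>!f. f \<in> Hom C x z)"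

definition zero_obj :: "('o, 'm) cat \<Rightarrow> 'o \<Rightarrow> bool" where
  "zero_obj C z \<longleftrightarrow> initial_obj C z \<and> terminal_obj C z"

record ('o, 'm, 'p, 'n) funct =
  Fdom :: "('o, 'm) cat"
  Fcod :: "('p, 'n) cat"
  Fobj :: "'o \<Rightarrow> 'p"
  Farr :: "'m \<Rightarrow> 'n"

definition mk_fun ::
  "('o, 'm) cat \<Rightarrow> ('p, 'n) cat \<Rightarrow> ('o \<Rightarrow> 'p) \<Rightarrow> ('m \<Rightarrow> 'n) \<Rightarrow> ('o, 'm, 'p, 'n) funct" where
  "mk_fun C C' o' m' = \<lparr>Fdom = C, Fcod = C', Fobj = restrict o' (Obj C), Farr = restrict m' (Arr C)\<rparr>"

definition is_functor :: "('o, 'm, 'p, 'n) funct \<Rightarrow> bool" where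
  "is_functor F \<longleftrightarrow> (let C = Fdom F; C' = Fcod F in
    category C \<and> category C' \<and>
    Fobj F \<in> Obj C \<rightarrow>\<^sub>E Obj C' \<and>
    Farr F \<in> extensional (Arr C) \<and>
    (\<forall>f\<in>Arr C. Farr F f \<in> Hom C' (Fobj F (Dom C f)) (Fobj F (Cod C f))) \<and>
    (\<forall>x\<in>Obj C. Farr F (Id C x) = Id C' (Fobj F x)) \<and>
    (\<forall>g\<in>Arr C. \<forall>f\<in>Arr C. Cod C f = Dom C g \<longrightarrow> Farr F (g \<cdot>\<^bsub>C\<^esub> f) = Farr F g \<cdot>\<^bsub>C'\<^esub> Farr F f))"

definition idF :: "('o, 'm) cat \<Rightarrow> ('o, 'm, 'o, 'm) funct" where
  "idF C = mk_fun C C (\<lambda>x. x) (\<lambda>f. f)"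

definition compF ::
  "('p, 'n, 'q, 'l) funct \<Rightarrow> ('o, 'm, 'p, 'n) funct \<Rightarrow> ('o, 'm, 'q, 'l) funct" (infixr "\<circ>\<^sub>F" 70) where
  "G \<circ>\<^sub>F F = mk_fun (Fdom F) (Fcod G) (\<lambda>x. Fobj G (Fobj F x)) (\<lambda>f. Farr G (Farr F f))"

record ('o, 'm, 'p, 'n) ntrans =
  Nsrc :: "('o, 'm, 'p, 'n) funct"
  Ntgt :: "('o, 'm, 'p, 'n) funct"
  Ncomp :: "'o \<Rightarrow> 'n"

definition mk_nat ::
  "('o, 'm, 'p, 'n) funct \<Rightarrow> ('o, 'm, 'p, 'n) funct \<Rightarrow> ('o \<Rightarrow> 'n) \<Rightarrow> ('o, 'm, 'p, 'n) ntrans" where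
  "mk_nat F G t = \<lparr>Nsrc = F, Ntgt = G, Ncomp = restrict t (Obj (Fdom F))\<rparr>"

definition is_ntrans :: "('o, 'm, 'p, 'n) ntrans \<Rightarrow> bool" where
  "is_ntrans t \<longleftrightarrow> (let F = Nsrc t; G = Ntgt t; C = Fdom F; C' = Fcod F in
    is_functor F \<and> is_functor G \<and> Fdom G = C \<and> Fcod G = C' \<and>
    Ncomp t \<in> extensional (Obj C) \<and>
    (\<forall>x\<in>Obj C. Ncomp t x \<in> Hom C' (Fobj F x) (Fobj G x)) \<and>
    (\<forall>f\<in>Arr C. Ncomp t (Cod C f) \<cdot>\<^bsub>C'\<^esub> Farr F f = Farr G f \<cdot>\<^bsub>C'\<^esub> Ncomp t (Dom C f)))"

definition nat_iso :: "('o, 'm, 'p, 'n) ntrans \<Rightarrow> bool" where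
  "nat_iso t \<longleftrightarrow> is_ntrans t \<and> (\<forall>x\<in>Obj (Fdom (Nsrc t)). iso_arr (Fcod (Nsrc t)) (Ncomp t x))"

definition inv_nat :: "('o, 'm, 'p, 'n) ntrans \<Rightarrow> ('o, 'm, 'p, 'n) ntrans" where
  "inv_nat t = mk_nat (Ntgt t) (Nsrc t) (\<lambda>x. inv_arr (Fcod (Nsrc t)) (Ncomp t x))"

definition idN :: "('o, 'm, 'p, 'n) funct \<Rightarrow> ('o, 'm, 'p, 'n) ntrans" where
  "idN F = mk_nat F F (\<lambda>x. Id (Fcod F) (Fobj F x))"

text \<open>Vertical composition (first \<open>t\<close>, then \<open>s\<close>) and the two whiskerings.\<close>

definition vcomp ::
  "('o, 'm, 'p, 'n) ntrans \<Rightarrow> ('o, 'm, 'p, 'n) ntrans \<Rightarrow> ('o, 'm, 'p, 'n) ntrans" (infixr "\<cdot>\<^sub>N" 70) where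
  "s \<cdot>\<^sub>N t = mk_nat (Nsrc t) (Ntgt s) (\<lambda>x. Ncomp s x \<cdot>\<^bsub>Fcod (Nsrc t)\<^esub> Ncomp t x)"

definition whiskL ::
  "('p, 'n, 'q, 'l) funct \<Rightarrow> ('o, 'm, 'p, 'n) ntrans \<Rightarrow> ('o, 'm, 'q, 'l) ntrans" (infixr "\<circ>\<^sub>L" 75) where
  "G \<circ>\<^sub>L t = mk_nat (G \<circ>\<^sub>F Nsrc t) (G \<circ>\<^sub>F Ntgt t) (\<lambda>x. Farr G (Ncomp t x))"

definition whiskR ::
  "('p, 'n, 'q, 'l) ntrans \<Rightarrow> ('o, 'm, 'p, 'n) funct \<Rightarrow> ('o, 'm, 'q, 'l) ntrans" (infixr "\<circ>\<^sub>R" 75) where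
  "t \<circ>\<^sub>R F = mk_nat (Nsrc t \<circ>\<^sub>F F) (Ntgt t \<circ>\<^sub>F F) (\<lambda>x. Ncomp t (Fobj F x))"

definition full :: "('o, 'm, 'p, 'n) funct \<Rightarrow> bool" where
  "full F \<longleftrightarrow> (\<forall>x\<in>Obj (Fdom F). \<forall>y\<in>Obj (Fdom F).
    Hom (Fcod F) (Fobj F x) (Fobj F y) \<subseteq> Farr F ` Hom (Fdom F) x y)"

definition faithful :: "('o, 'm, 'p, 'n) funct \<Rightarrow> bool" where
  "faithful F \<longleftrightarrow> (\<forall>x\<in>Obj (Fdom F). \<forall>y\<in>Obj (Fdom F). inj_on (Farr F) (Hom (Fdom F) x y))"

definition ess_surj :: "('o, 'm, 'p, 'n) funct \<Rightarrow> bool" where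
  "ess_surj F \<longleftrightarrow> (\<forall>y\<in>Obj (Fcod F). \<exists>x\<in>Obj (Fdom F). iso_objs (Fcod F) (Fobj F x) y)"

definition equivalence :: "('o, 'm, 'p, 'n) funct \<Rightarrow> bool" where
  "equivalence F \<longleftrightarrow> is_functor F \<and> full F \<and> faithful F \<and> ess_surj F"

definition func_cat ::
  "('o, 'm) cat \<Rightarrow> ('p, 'n) cat \<Rightarrow> (('o, 'm, 'p, 'n) funct, ('o, 'm, 'p, 'n) ntrans) cat" where
  "func_cat J C = mk_cat
    {F. is_functor F \<and> Fdom F = J \<and> Fcod F = C}
    {t. is_ntrans t \<and> Fdom (Nsrc t) = J \<and> Fcod (Nsrc t) = C}
    Nsrc Ntgt idN vcomp"

definition prod_family :: "'i set \<Rightarrow> ('i \<Rightarrow> ('o, 'm) cat) \<Rightarrow> ('i \<Rightarrow> 'o, 'i \<Rightarrow> 'm) cat" where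
  "prod_family I C = mk_cat (\<Pi>\<^sub>E i\<in>I. Obj (C i)) (\<Pi>\<^sub>E i\<in>I. Arr (C i))
    (\<lambda>f. \<lambda>i\<in>I. Dom (C i) (f i)) (\<lambda>f. \<lambda>i\<in>I. Cod (C i) (f i))
    (\<lambda>x. \<lambda>i\<in>I. Id (C i) (x i)) (\<lambda>g f. \<lambda>i\<in>I. g i \<cdot>\<^bsub>C i\<^esub> f i)"

text \<open>\<open>\<eta>: 1 \<rightarrow> R L\<close> and \<open>\<epsilon>: L R \<rightarrow> 1\<close> exhibit \<open>L\<close> as left adjoint of \<open>R\<close>.\<close>

definition adjunction ::
  "('o, 'm, 'p, 'n) funct \<Rightarrow> ('p, 'n, 'o, 'm) funct \<Rightarrow>
   ('o, 'm, 'o, 'm) ntrans \<Rightarrow> ('p, 'n, 'p, 'n) ntrans \<Rightarrow> bool" where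
  "adjunction L R \<eta> \<epsilon> \<longleftrightarrow>
    is_functor L \<and> is_functor R \<and> Fdom R = Fcod L \<and> Fcod R = Fdom L \<and>
    is_ntrans \<eta> \<and> Nsrc \<eta> = idF (Fdom L) \<and> Ntgt \<eta> = R \<circ>\<^sub>F L \<and>
    is_ntrans \<epsilon> \<and> Nsrc \<epsilon> = L \<circ>\<^sub>F R \<and> Ntgt \<epsilon> = idF (Fdom R) \<and>
    (\<epsilon> \<circ>\<^sub>R L) \<cdot>\<^sub>N (L \<circ>\<^sub>L \<eta>) = idN L \<and>
    (R \<circ>\<^sub>L \<epsilon>) \<cdot>\<^sub>N (\<eta> \<circ>\<^sub>R R) = idN R"


section \<open>Small categories\<close>

text \<open>Small categories have their objects and arrows in the type \<open>'k uni\<close>, which is closed under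
  pairing. A set is small if its cardinality is less than that of \<open>'k\<close>.
  That cardinality is required to be infinite and regular, so that finite products, comma
  categories and small coproducts of small categories are small. For \<open>'k\<close> of inaccessible cardinality, i.e. of the cardinality of a Grothendieck universe,
  these are, up to renaming of elements, the usual small categories.\<close>

datatype 'k uni = Elt 'k | Num (unum: nat) | Tup (ufst: "'k uni") (usnd: "'k uni")

definition regular_universe :: "'k itself \<Rightarrow> bool" where
  "regular_universe TYPE('k) \<longleftrightarrow> infinite (UNIV :: 'k set) \<and> regularCard |UNIV :: 'k set|"

definition small :: "'k uni set \<Rightarrow> bool" where
  "small S \<longleftrightarrow> |S| <o |UNIV :: 'k set|"

type_synonym 'k scat = "('k uni, 'k uni) cat"
type_synonym 'k sfun = "('k uni, 'k uni, 'k uni, 'k uni) funct"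
type_synonym 'k snat = "('k uni, 'k uni, 'k uni, 'k uni) ntrans"

definition small_cat :: "'k scat \<Rightarrow> bool" where
  "small_cat A \<longleftrightarrow> category A \<and> small (Obj A) \<and> small (Arr A)"

definition small_fun :: "'k sfun \<Rightarrow> bool" where
  "small_fun u \<longleftrightarrow> is_functor u \<and> small_cat (Fdom u) \<and> small_cat (Fcod u)"

definition small_nat :: "'k snat \<Rightarrow> bool" where
  "small_nat \<alpha> \<longleftrightarrow> is_ntrans \<alpha> \<and> small_fun (Nsrc \<alpha>) \<and> small_fun (Ntgt \<alpha>)"

definition ord_cat :: "nat \<Rightarrow> 'k scat" where
  "ord_cat n = mk_cat {Num i |i. i \<le> n} {Tup (Num i) (Num j) |i j. i \<le> j \<and> j \<le> n}
    ufst usnd (\<lambda>x. Tup x x) (\<lambda>g f. Tup (ufst f) (usnd g))"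

definition ord_fun :: "nat \<Rightarrow> nat \<Rightarrow> (nat \<Rightarrow> nat) \<Rightarrow> 'k sfun" where
  "ord_fun m n f = mk_fun (ord_cat m) (ord_cat n)
    (\<lambda>x. Num (f (unum x)))
    (\<lambda>h. Tup (Num (f (unum (ufst h)))) (Num (f (unum (usnd h)))))"

abbreviation one_cat :: "'k scat" where
  "one_cat \<equiv> ord_cat 0"

definition empty_cat :: "'k scat" where
  "empty_cat = mk_cat {} {} ufst usnd (\<lambda>x. x) (\<lambda>g f. f)"

definition to_one :: "'k scat \<Rightarrow> 'k sfun" where
  "to_one A = mk_fun A one_cat (\<lambda>_. Num 0) (\<lambda>_. Tup (Num 0) (Num 0))"

definition pt :: "'k scat \<Rightarrow> 'k uni \<Rightarrow> 'k sfun" where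
  "pt A a = mk_fun one_cat A (\<lambda>_. a) (\<lambda>_. Id A a)"

text \<open>The 2-cell between points given by an arrow of \<open>A\<close>.\<close>

definition pt_nat :: "'k scat \<Rightarrow> 'k uni \<Rightarrow> 'k snat" where
  "pt_nat A f = mk_nat (pt A (Dom A f)) (pt A (Cod A f)) (\<lambda>_. f)"

definition prod_cat :: "'k scat \<Rightarrow> 'k scat \<Rightarrow> 'k scat" (infixr "\<times>\<^sub>C" 75) where
  "A \<times>\<^sub>C B = mk_cat
    {Tup a b |a b. a \<in> Obj A \<and> b \<in> Obj B}
    {Tup f g |f g. f \<in> Arr A \<and> g \<in> Arr B}
    (\<lambda>h. Tup (Dom A (ufst h)) (Dom B (usnd h)))
    (\<lambda>h. Tup (Cod A (ufst h)) (Cod B (usnd h)))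
    (\<lambda>x. Tup (Id A (ufst x)) (Id B (usnd x)))
    (\<lambda>k h. Tup (ufst k \<cdot>\<^bsub>A\<^esub> ufst h) (usnd k \<cdot>\<^bsub>B\<^esub> usnd h))"

definition prod_fun :: "'k sfun \<Rightarrow> 'k sfun \<Rightarrow> 'k sfun" (infixr "\<otimes>\<^sub>F" 75) where
  "u \<otimes>\<^sub>F v = mk_fun (Fdom u \<times>\<^sub>C Fdom v) (Fcod u \<times>\<^sub>C Fcod v)
    (\<lambda>x. Tup (Fobj u (ufst x)) (Fobj v (usnd x)))
    (\<lambda>h. Tup (Farr u (ufst h)) (Farr v (usnd h)))"

text \<open>\<open>A \<times> \<alpha>\<close>, a natural transformation \<open>A \<times> u \<rightarrow> A \<times> v\<close> for \<open>\<alpha>: u \<rightarrow> v\<close>.\<close>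

definition id_prod_nat :: "'k scat \<Rightarrow> 'k snat \<Rightarrow> 'k snat" where
  "id_prod_nat A \<alpha> = mk_nat (idF A \<otimes>\<^sub>F Nsrc \<alpha>) (idF A \<otimes>\<^sub>F Ntgt \<alpha>)
    (\<lambda>x. Tup (Id A (ufst x)) (Ncomp \<alpha> (usnd x)))"

definition proj1 :: "'k scat \<Rightarrow> 'k scat \<Rightarrow> 'k sfun" where
  "proj1 A B = mk_fun (A \<times>\<^sub>C B) A ufst ufst"

text \<open>\<open>a \<mapsto> (a, j)\<close>, and the 2-cell \<open>(a, j) \<rightarrow> (a, j')\<close> for \<open>f: j \<rightarrow> j'\<close>.\<close>

definition slice_at :: "'k scat \<Rightarrow> 'k scat \<Rightarrow> 'k uni \<Rightarrow> 'k sfun" where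
  "slice_at A J j = mk_fun A (A \<times>\<^sub>C J) (\<lambda>a. Tup a j) (\<lambda>h. Tup h (Id J j))"

definition slice_nat :: "'k scat \<Rightarrow> 'k scat \<Rightarrow> 'k uni \<Rightarrow> 'k snat" where
  "slice_nat A J f = mk_nat (slice_at A J (Dom J f)) (slice_at A J (Cod J f)) (\<lambda>a. Tup (Id A a) f)"

definition coprod_cat :: "'k uni set \<Rightarrow> ('k uni \<Rightarrow> 'k scat) \<Rightarrow> 'k scat" where
  "coprod_cat I A = mk_cat
    {Tup i a |i a. i \<in> I \<and> a \<in> Obj (A i)}
    {Tup i f |i f. i \<in> I \<and> f \<in> Arr (A i)}
    (\<lambda>h. Tup (ufst h) (Dom (A (ufst h)) (usnd h)))
    (\<lambda>h. Tup (ufst h) (Cod (A (ufst h)) (usnd h)))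
    (\<lambda>x. Tup (ufst x) (Id (A (ufst x)) (usnd x)))
    (\<lambda>k h. Tup (ufst h) (usnd k \<cdot>\<^bsub>A (ufst h)\<^esub> usnd h))"

definition coprod_inj :: "'k uni set \<Rightarrow> ('k uni \<Rightarrow> 'k scat) \<Rightarrow> 'k uni \<Rightarrow> 'k sfun" where
  "coprod_inj I A i = mk_fun (A i) (coprod_cat I A) (Tup i) (Tup i)"

definition full_sub :: "'k scat \<Rightarrow> 'k uni set \<Rightarrow> 'k scat" where
  "full_sub A S = mk_cat (Obj A \<inter> S) {f \<in> Arr A. Dom A f \<in> S \<and> Cod A f \<in> S}
    (Dom A) (Cod A) (Id A) (Comp A)"

definition incl :: "'k scat \<Rightarrow> 'k uni set \<Rightarrow> 'k sfun" where
  "incl A S = mk_fun (full_sub A S) A (\<lambda>x. x) (\<lambda>f. f)"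

text \<open>The slice category \<open>(u/b)\<close>: objects \<open>(a, f: u a \<rightarrow> b)\<close>; an arrow is encoded as
  \<open>((source, target), g)\<close>. Dually \<open>(b/u)\<close> has objects \<open>(a, f: b \<rightarrow> u a)\<close>.\<close>

definition over_cat :: "'k sfun \<Rightarrow> 'k uni \<Rightarrow> 'k scat" where
  "over_cat u b = (let A = Fdom u; B = Fcod u in mk_cat
    {Tup a f |a f. a \<in> Obj A \<and> f \<in> Hom B (Fobj u a) b}
    {Tup (Tup (Tup a f) (Tup a' f')) g |a f a' f' g.
      a \<in> Obj A \<and> f \<in> Hom B (Fobj u a) b \<and> a' \<in> Obj A \<and> f' \<in> Hom B (Fobj u a') b \<and>
      g \<in> Hom A a a' \<and> f' \<cdot>\<^bsub>B\<^esub> Farr u g = f}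
    (\<lambda>h. ufst (ufst h)) (\<lambda>h. usnd (ufst h))
    (\<lambda>x. Tup (Tup x x) (Id A (ufst x)))
    (\<lambda>k h. Tup (Tup (ufst (ufst h)) (usnd (ufst k))) (usnd k \<cdot>\<^bsub>A\<^esub> usnd h)))"

definition under_cat :: "'k uni \<Rightarrow> 'k sfun \<Rightarrow> 'k scat" where
  "under_cat b u = (let A = Fdom u; B = Fcod u in mk_cat
    {Tup a f |a f. a \<in> Obj A \<and> f \<in> Hom B b (Fobj u a)}
    {Tup (Tup (Tup a f) (Tup a' f')) g |a f a' f' g.
      a \<in> Obj A \<and> f \<in> Hom B b (Fobj u a) \<and> a' \<in> Obj A \<and> f' \<in> Hom B b (Fobj u a') \<and>
      g \<in> Hom A a a' \<and> Farr u g \<cdot>\<^bsub>B\<^esub> f = f'}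
    (\<lambda>h. ufst (ufst h)) (\<lambda>h. usnd (ufst h))
    (\<lambda>x. Tup (Tup x x) (Id A (ufst x)))
    (\<lambda>k h. Tup (Tup (ufst (ufst h)) (usnd (ufst k))) (usnd k \<cdot>\<^bsub>A\<^esub> usnd h)))"

definition over_proj :: "'k sfun \<Rightarrow> 'k uni \<Rightarrow> 'k sfun" where
  "over_proj u b = mk_fun (over_cat u b) (Fdom u) ufst usnd"

definition under_proj :: "'k uni \<Rightarrow> 'k sfun \<Rightarrow> 'k sfun" where
  "under_proj b u = mk_fun (under_cat b u) (Fdom u) ufst usnd"

text \<open>The canonical 2-cells \<open>u p \<rightarrow> b \<pi>\<close> and \<open>b \<pi> \<rightarrow> u q\<close>.\<close>

definition over_nat :: "'k sfun \<Rightarrow> 'k uni \<Rightarrow> 'k snat" where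
  "over_nat u b = mk_nat (u \<circ>\<^sub>F over_proj u b) (pt (Fcod u) b \<circ>\<^sub>F to_one (over_cat u b)) usnd"

definition under_nat :: "'k uni \<Rightarrow> 'k sfun \<Rightarrow> 'k snat" where
  "under_nat b u = mk_nat (pt (Fcod u) b \<circ>\<^sub>F to_one (under_cat b u)) (u \<circ>\<^sub>F under_proj b u) usnd"

definition square :: "'k scat" where
  "square = ord_cat 1 \<times>\<^sub>C ord_cat 1"

abbreviation pos :: "nat \<Rightarrow> nat \<Rightarrow> 'k uni" where
  "pos i j \<equiv> Tup (Num i) (Num j)"

text \<open>The unique arrow \<open>(i, j) \<rightarrow> (i', j')\<close> of \<open>[m] \<times> [n]\<close>.\<close>

abbreviation step :: "nat \<Rightarrow> nat \<Rightarrow> nat \<Rightarrow> nat \<Rightarrow> 'k uni" where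
  "step i j i' j' \<equiv> Tup (Tup (Num i) (Num i')) (Tup (Num j) (Num j'))"

definition ul :: "'k scat" where
  "ul = full_sub square (- {pos 1 1})"

definition lr :: "'k scat" where
  "lr = full_sub square (- {pos 0 0})"

definition i_ul :: "'k sfun" where
  "i_ul = incl square (- {pos 1 1})"

definition i_lr :: "'k sfun" where
  "i_lr = incl square (- {pos 0 0})"


section \<open>Derivators\<close>

text \<open>A prederivator sends small categories, functors and natural transformations to categories,
  functors and natural transformations; the values, which need not be small, have objects in
  \<open>'o\<close> and arrows in \<open>'m\<close>.\<close>

record ('k, 'o, 'm) prederivator =
  dcat :: "'k scat \<Rightarrow> ('o, 'm) cat"
  dfun :: "'k sfun \<Rightarrow> ('o, 'm, 'o, 'm) funct"
  dnat :: "'k snat \<Rightarrow> ('o, 'm, 'o, 'm) ntrans"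

definition is_prederivator :: "('k, 'o, 'm, 'z) prederivator_scheme \<Rightarrow> bool" where
  "is_prederivator D \<longleftrightarrow>
    (\<forall>A. small_cat A \<longrightarrow> category (dcat D A)) \<and>
    (\<forall>u. small_fun u \<longrightarrow>
      is_functor (dfun D u) \<and> Fdom (dfun D u) = dcat D (Fcod u) \<and> Fcod (dfun D u) = dcat D (Fdom u)) \<and>
    (\<forall>\<alpha>. small_nat \<alpha> \<longrightarrow>
      is_ntrans (dnat D \<alpha>) \<and> Nsrc (dnat D \<alpha>) = dfun D (Nsrc \<alpha>) \<and> Ntgt (dnat D \<alpha>) = dfun D (Ntgt \<alpha>)) \<and>
    (\<forall>A. small_cat A \<longrightarrow> dfun D (idF A) = idF (dcat D A)) \<and>
    (\<forall>u v. small_fun u \<longrightarrow> small_fun v \<longrightarrow> Fcod u = Fdom v \<longrightarrow>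
      dfun D (v \<circ>\<^sub>F u) = dfun D u \<circ>\<^sub>F dfun D v) \<and>
    (\<forall>u. small_fun u \<longrightarrow> dnat D (idN u) = idN (dfun D u)) \<and>
    (\<forall>\<alpha> \<beta>. small_nat \<alpha> \<longrightarrow> small_nat \<beta> \<longrightarrow> Ntgt \<alpha> = Nsrc \<beta> \<longrightarrow>
      dnat D (\<beta> \<cdot>\<^sub>N \<alpha>) = dnat D \<beta> \<cdot>\<^sub>N dnat D \<alpha>) \<and>
    (\<forall>w \<alpha>. small_fun w \<longrightarrow> small_nat \<alpha> \<longrightarrow> Fcod (Nsrc \<alpha>) = Fdom w \<longrightarrow>
      dnat D (w \<circ>\<^sub>L \<alpha>) = dnat D \<alpha> \<circ>\<^sub>R dfun D w) \<and>
    (\<forall>\<alpha> w. small_nat \<alpha> \<longrightarrow> small_fun w \<longrightarrow> Fcod w = Fdom (Nsrc \<alpha>) \<longrightarrow>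
      dnat D (\<alpha> \<circ>\<^sub>R w) = dfun D w \<circ>\<^sub>L dnat D \<alpha>)"

text \<open>A derivator comes with a choice of the Kan extensions \<open>u\<^sub>!\<close> (\<open>lan\<close>) and \<open>u\<^sub>*\<close> (\<open>ran\<close>) and of
  the units and counits of the adjunctions. The choice is arbitrary.\<close>

record ('k, 'o, 'm) derivator = "('k, 'o, 'm) prederivator" +
  lan :: "'k sfun \<Rightarrow> ('o, 'm, 'o, 'm) funct"
  lan_unit :: "'k sfun \<Rightarrow> ('o, 'm, 'o, 'm) ntrans"
  lan_counit :: "'k sfun \<Rightarrow> ('o, 'm, 'o, 'm) ntrans"
  ran :: "'k sfun \<Rightarrow> ('o, 'm, 'o, 'm) funct"
  ran_unit :: "'k sfun \<Rightarrow> ('o, 'm, 'o, 'm) ntrans"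
  ran_counit :: "'k sfun \<Rightarrow> ('o, 'm, 'o, 'm) ntrans"

definition to_prod ::
  "('k, 'o, 'm, 'z) prederivator_scheme \<Rightarrow> 'k uni set \<Rightarrow> ('k uni \<Rightarrow> 'k scat) \<Rightarrow>
   ('o, 'm, 'k uni \<Rightarrow> 'o, 'k uni \<Rightarrow> 'm) funct" where
  "to_prod D I A = mk_fun (dcat D (coprod_cat I A)) (prod_family I (\<lambda>i. dcat D (A i)))
    (\<lambda>X. \<lambda>i\<in>I. Fobj (dfun D (coprod_inj I A i)) X)
    (\<lambda>f. \<lambda>i\<in>I. Farr (dfun D (coprod_inj I A i)) f)"

text \<open>Sending coproducts to products is understood up to equivalence of categories.\<close>

definition Der1 :: "('k, 'o, 'm, 'z) prederivator_scheme \<Rightarrow> bool" where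
  "Der1 D \<longleftrightarrow> (\<forall>I A. small I \<longrightarrow> (\<forall>i\<in>I. small_cat (A i)) \<longrightarrow> equivalence (to_prod D I A))"

definition Der2 :: "('k, 'o, 'm, 'z) prederivator_scheme \<Rightarrow> bool" where
  "Der2 D \<longleftrightarrow> (\<forall>A. small_cat A \<longrightarrow> (\<forall>f\<in>Arr (dcat D A).
    iso_arr (dcat D A) f \<longleftrightarrow> (\<forall>a\<in>Obj A. iso_arr (dcat D one_cat) (Farr (dfun D (pt A a)) f))))"

definition Der3 :: "('k, 'o, 'm) derivator \<Rightarrow> bool" where
  "Der3 D \<longleftrightarrow> (\<forall>u. small_fun u \<longrightarrow>
    adjunction (lan D u) (dfun D u) (lan_unit D u) (lan_counit D u) \<and>
    adjunction (dfun D u) (ran D u) (ran_unit D u) (ran_counit D u))"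

text \<open>The mates \<open>\<pi>\<^sub>! p\<^sup>* X \<rightarrow> \<pi>\<^sub>! p\<^sup>* u\<^sup>* u\<^sub>! X \<rightarrow> \<pi>\<^sub>! \<pi>\<^sup>* b\<^sup>* u\<^sub>! X \<rightarrow> b\<^sup>* u\<^sub>! X\<close> and
  \<open>b\<^sup>* u\<^sub>* X \<rightarrow> \<pi>\<^sub>* \<pi>\<^sup>* b\<^sup>* u\<^sub>* X \<rightarrow> \<pi>\<^sub>* q\<^sup>* u\<^sup>* u\<^sub>* X \<rightarrow> \<pi>\<^sub>* q\<^sup>* X\<close>.\<close>

definition bc_lan :: "('k, 'o, 'm) derivator \<Rightarrow> 'k sfun \<Rightarrow> 'k uni \<Rightarrow> 'o \<Rightarrow> 'm" where
  "bc_lan D u b X =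
    (let \<pi> = to_one (over_cat u b); p = over_proj u b; uX = Fobj (lan D u) X in
      Ncomp (lan_counit D \<pi>) (Fobj (dfun D (pt (Fcod u) b)) uX)
      \<cdot>\<^bsub>dcat D one_cat\<^esub> Farr (lan D \<pi>) (Ncomp (dnat D (over_nat u b)) uX)
      \<cdot>\<^bsub>dcat D one_cat\<^esub> Farr (lan D \<pi>) (Farr (dfun D p) (Ncomp (lan_unit D u) X)))"

definition bc_ran :: "('k, 'o, 'm) derivator \<Rightarrow> 'k sfun \<Rightarrow> 'k uni \<Rightarrow> 'o \<Rightarrow> 'm" where
  "bc_ran D u b X =
    (let \<pi> = to_one (under_cat b u); q = under_proj b u; uX = Fobj (ran D u) X in
      Farr (ran D \<pi>) (Farr (dfun D q) (Ncomp (ran_counit D u) X))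
      \<cdot>\<^bsub>dcat D one_cat\<^esub> Farr (ran D \<pi>) (Ncomp (dnat D (under_nat b u)) uX)
      \<cdot>\<^bsub>dcat D one_cat\<^esub> Ncomp (ran_unit D \<pi>) (Fobj (dfun D (pt (Fcod u) b)) uX))"

definition Der4 :: "('k, 'o, 'm) derivator \<Rightarrow> bool" where
  "Der4 D \<longleftrightarrow> (\<forall>u. small_fun u \<longrightarrow> (\<forall>b\<in>Obj (Fcod u). \<forall>X\<in>Obj (dcat D (Fdom u)).
    iso_arr (dcat D one_cat) (bc_lan D u b X) \<and> iso_arr (dcat D one_cat) (bc_ran D u b X)))"

definition is_derivator :: "('k, 'o, 'm) derivator \<Rightarrow> bool" where
  "is_derivator D \<longleftrightarrow> is_prederivator D \<and> Der1 D \<and> Der2 D \<and> Der3 D \<and> Der4 D"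

text \<open>The shifted derivator \<open>D\<^sup>B(A) = D(B \<times> A)\<close>.\<close>

definition shift :: "('k, 'o, 'm) derivator \<Rightarrow> 'k scat \<Rightarrow> ('k, 'o, 'm) derivator" where
  "shift D B =
    \<lparr>dcat = (\<lambda>A. dcat D (B \<times>\<^sub>C A)), dfun = (\<lambda>u. dfun D (idF B \<otimes>\<^sub>F u)),
     dnat = (\<lambda>\<alpha>. dnat D (id_prod_nat B \<alpha>)),
     lan = (\<lambda>u. lan D (idF B \<otimes>\<^sub>F u)),
     lan_unit = (\<lambda>u. lan_unit D (idF B \<otimes>\<^sub>F u)),
     lan_counit = (\<lambda>u. lan_counit D (idF B \<otimes>\<^sub>F u)),
     ran = (\<lambda>u. ran D (idF B \<otimes>\<^sub>F u)),
     ran_unit = (\<lambda>u. ran_unit D (idF B \<otimes>\<^sub>F u)),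
     ran_counit = (\<lambda>u. ran_counit D (idF B \<otimes>\<^sub>F u))\<rparr>"

text \<open>The underlying diagram functor \<open>D(A \<times> J) \<rightarrow> D(A)\<^sup>J\<close>.\<close>

definition dia ::
  "('k, 'o, 'm, 'z) prederivator_scheme \<Rightarrow> 'k scat \<Rightarrow> 'k scat \<Rightarrow>
   ('o, 'm, ('k uni, 'k uni, 'o, 'm) funct, ('k uni, 'k uni, 'o, 'm) ntrans) funct" where
  "dia D A J =
    (let ob = (\<lambda>X. mk_fun J (dcat D A) (\<lambda>j. Fobj (dfun D (slice_at A J j)) X)
                                         (\<lambda>f. Ncomp (dnat D (slice_nat A J f)) X));
         C = dcat D (A \<times>\<^sub>C J)
     in mk_fun C (func_cat J (dcat D A)) ob
          (\<lambda>h. mk_nat (ob (Dom C h)) (ob (Cod C h)) (\<lambda>j. Farr (dfun D (slice_at A J j)) h)))"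

definition strong_derivator :: "('k, 'o, 'm) derivator \<Rightarrow> bool" where
  "strong_derivator D \<longleftrightarrow> (\<forall>A. small_cat A \<longrightarrow> full (dia D A (ord_cat 1)) \<and> ess_surj (dia D A (ord_cat 1)))"

definition pointed :: "('k, 'o, 'm) derivator \<Rightarrow> bool" where
  "pointed D \<longleftrightarrow> is_derivator D \<and> (\<exists>z. zero_obj (dcat D one_cat) z)"

definition cocartesian :: "('k, 'o, 'm) derivator \<Rightarrow> 'o \<Rightarrow> bool" where
  "cocartesian D X \<longleftrightarrow> X \<in> Obj (dcat D square) \<and>
    (\<exists>Y\<in>Obj (dcat D ul). iso_objs (dcat D square) (Fobj (lan D i_ul) Y) X)"

definition cartesian :: "('k, 'o, 'm) derivator \<Rightarrow> 'o \<Rightarrow> bool" where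
  "cartesian D X \<longleftrightarrow> X \<in> Obj (dcat D square) \<and>
    (\<exists>Y\<in>Obj (dcat D lr). iso_objs (dcat D square) (Fobj (ran D i_lr) Y) X)"

definition stable_derivator :: "('k, 'o, 'm) derivator \<Rightarrow> bool" where
  "stable_derivator D \<longleftrightarrow> pointed D \<and> (\<forall>X\<in>Obj (dcat D square). cartesian D X \<longleftrightarrow> cocartesian D X)"


section \<open>Morphisms of derivators\<close>

text \<open>The component of \<open>mgam F u\<close> at \<open>X\<close> is \<open>\<gamma>\<^sub>u: u\<^sup>* F\<^sub>B X \<rightarrow> F\<^sub>A u\<^sup>* X\<close>, for \<open>u: A \<rightarrow> B\<close>.\<close>

record ('k, 'o, 'm, 'p, 'n) dmorphism =
  mfun :: "'k scat \<Rightarrow> ('o, 'm, 'p, 'n) funct"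
  mgam :: "'k sfun \<Rightarrow> ('o, 'm, 'p, 'n) ntrans"

definition is_dmorphism ::
  "('k, 'o, 'm, 'z) prederivator_scheme \<Rightarrow> ('k, 'p, 'n, 'y) prederivator_scheme \<Rightarrow>
   ('k, 'o, 'm, 'p, 'n) dmorphism \<Rightarrow> bool" where
  "is_dmorphism D E F \<longleftrightarrow>
    (\<forall>A. small_cat A \<longrightarrow>
      is_functor (mfun F A) \<and> Fdom (mfun F A) = dcat D A \<and> Fcod (mfun F A) = dcat E A) \<and>
    (\<forall>u. small_fun u \<longrightarrow>
      nat_iso (mgam F u) \<and>
      Nsrc (mgam F u) = dfun E u \<circ>\<^sub>F mfun F (Fcod u) \<and>
      Ntgt (mgam F u) = mfun F (Fdom u) \<circ>\<^sub>F dfun D u) \<and>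
    (\<forall>A. small_cat A \<longrightarrow> mgam F (idF A) = idN (mfun F A)) \<and>
    (\<forall>u v. small_fun u \<longrightarrow> small_fun v \<longrightarrow> Fcod u = Fdom v \<longrightarrow>
      mgam F (v \<circ>\<^sub>F u) = (mgam F u \<circ>\<^sub>R dfun D v) \<cdot>\<^sub>N (dfun E u \<circ>\<^sub>L mgam F v)) \<and>
    (\<forall>\<alpha>. small_nat \<alpha> \<longrightarrow>
      (mfun F (Fdom (Nsrc \<alpha>)) \<circ>\<^sub>L dnat D \<alpha>) \<cdot>\<^sub>N mgam F (Nsrc \<alpha>) =
      mgam F (Ntgt \<alpha>) \<cdot>\<^sub>N (dnat E \<alpha> \<circ>\<^sub>R mfun F (Fcod (Nsrc \<alpha>))))"

definition mshift :: "('k, 'o, 'm, 'p, 'n) dmorphism \<Rightarrow> 'k scat \<Rightarrow> ('k, 'o, 'm, 'p, 'n) dmorphism" where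
  "mshift F B = \<lparr>mfun = (\<lambda>A. mfun F (B \<times>\<^sub>C A)), mgam = (\<lambda>u. mgam F (idF B \<otimes>\<^sub>F u))\<rparr>"

text \<open>The mates \<open>u\<^sub>! F\<^sub>A X \<rightarrow> F\<^sub>B u\<^sub>! X\<close> and \<open>F\<^sub>B u\<^sub>* X \<rightarrow> u\<^sub>* F\<^sub>A X\<close>.\<close>

definition lan_mate ::
  "('k, 'o, 'm) derivator \<Rightarrow> ('k, 'p, 'n) derivator \<Rightarrow> ('k, 'o, 'm, 'p, 'n) dmorphism \<Rightarrow>
   'k sfun \<Rightarrow> 'o \<Rightarrow> 'n" where
  "lan_mate D E F u X = (let A = Fdom u; B = Fcod u; uX = Fobj (lan D u) X in
      Ncomp (lan_counit E u) (Fobj (mfun F B) uX)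
      \<cdot>\<^bsub>dcat E B\<^esub> Farr (lan E u) (inv_arr (dcat E A) (Ncomp (mgam F u) uX))
      \<cdot>\<^bsub>dcat E B\<^esub> Farr (lan E u) (Farr (mfun F A) (Ncomp (lan_unit D u) X)))"

definition ran_mate ::
  "('k, 'o, 'm) derivator \<Rightarrow> ('k, 'p, 'n) derivator \<Rightarrow> ('k, 'o, 'm, 'p, 'n) dmorphism \<Rightarrow>
   'k sfun \<Rightarrow> 'o \<Rightarrow> 'n" where
  "ran_mate D E F u X = (let A = Fdom u; B = Fcod u; uX = Fobj (ran D u) X in
      Farr (ran E u) (Farr (mfun F A) (Ncomp (ran_counit D u) X))
      \<cdot>\<^bsub>dcat E B\<^esub> Farr (ran E u) (Ncomp (mgam F u) uX)
      \<cdot>\<^bsub>dcat E B\<^esub> Ncomp (ran_unit E u) (Fobj (mfun F B) uX))"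

definition preserves_lan ::
  "('k, 'o, 'm) derivator \<Rightarrow> ('k, 'p, 'n) derivator \<Rightarrow> ('k, 'o, 'm, 'p, 'n) dmorphism \<Rightarrow>
   'k sfun \<Rightarrow> bool" where
  "preserves_lan D E F u \<longleftrightarrow> (\<forall>X\<in>Obj (dcat D (Fdom u)). iso_arr (dcat E (Fcod u)) (lan_mate D E F u X))"

definition preserves_ran ::
  "('k, 'o, 'm) derivator \<Rightarrow> ('k, 'p, 'n) derivator \<Rightarrow> ('k, 'o, 'm, 'p, 'n) dmorphism \<Rightarrow>
   'k sfun \<Rightarrow> bool" where
  "preserves_ran D E F u \<longleftrightarrow> (\<forall>X\<in>Obj (dcat D (Fdom u)). iso_arr (dcat E (Fcod u)) (ran_mate D E F u X))"

definition right_exact ::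
  "('k, 'o, 'm) derivator \<Rightarrow> ('k, 'p, 'n) derivator \<Rightarrow> ('k, 'o, 'm, 'p, 'n) dmorphism \<Rightarrow> bool" where
  "right_exact D E F \<longleftrightarrow> preserves_lan D E F (to_one empty_cat) \<and> preserves_lan D E F (to_one ul)"

definition left_exact ::
  "('k, 'o, 'm) derivator \<Rightarrow> ('k, 'p, 'n) derivator \<Rightarrow> ('k, 'o, 'm, 'p, 'n) dmorphism \<Rightarrow> bool" where
  "left_exact D E F \<longleftrightarrow> preserves_ran D E F (to_one empty_cat) \<and> preserves_ran D E F (to_one lr)"

definition exact_dmorphism ::
  "('k, 'o, 'm) derivator \<Rightarrow> ('k, 'p, 'n) derivator \<Rightarrow> ('k, 'o, 'm, 'p, 'n) dmorphism \<Rightarrow> bool" where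
  "exact_dmorphism D E F \<longleftrightarrow> is_dmorphism D E F \<and> left_exact D E F \<and> right_exact D E F"


section \<open>Suspension and the comparison map\<close>

definition i_00 :: "'k sfun" where
  "i_00 = pt ul (pos 0 0)"

definition Susp :: "('k, 'o, 'm) derivator \<Rightarrow> ('o, 'm, 'o, 'm) funct" where
  "Susp D = dfun D (pt square (pos 1 1)) \<circ>\<^sub>F lan D i_ul \<circ>\<^sub>F ran D i_00"

definition psi ::
  "('k, 'o, 'm) derivator \<Rightarrow> ('k, 'p, 'n) derivator \<Rightarrow> ('k, 'o, 'm, 'p, 'n) dmorphism \<Rightarrow>
   ('o, 'm, 'p, 'n) ntrans" where
  "psi D E F = mk_nat (Susp E \<circ>\<^sub>F mfun F one_cat) (mfun F one_cat \<circ>\<^sub>F Susp D)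
    (\<lambda>X. let e = dfun E (pt square (pos 1 1)); iX = Fobj (ran D i_00) X in
      Ncomp (mgam F (pt square (pos 1 1))) (Fobj (lan D i_ul) iX)
      \<cdot>\<^bsub>dcat E one_cat\<^esub> Farr e (lan_mate D E F i_ul iX)
      \<cdot>\<^bsub>dcat E one_cat\<^esub> Farr e (Farr (lan E i_ul) (inv_arr (dcat E ul) (ran_mate D E F i_00 X))))"

text \<open>\<open>D(A)\<close> and \<open>D\<^sup>A(1) = D(A \<times> 1)\<close> are identified by restriction along the mutually inverse
  isomorphisms \<open>to_A1 A: A \<rightarrow> A \<times> 1\<close> and \<open>from_A1 A: A \<times> 1 \<rightarrow> A\<close>; correspondingly \<open>F\<^sub>A\<close> and \<open>(F\<^sup>A)\<^sub>1\<close>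
  are identified by the structure isomorphisms \<open>\<gamma>\<close> of \<open>F\<close> at these two functors.\<close>

abbreviation to_A1 :: "'k scat \<Rightarrow> 'k sfun" where
  "to_A1 A \<equiv> slice_at A one_cat (Num 0)"

abbreviation from_A1 :: "'k scat \<Rightarrow> 'k sfun" where
  "from_A1 A \<equiv> proj1 A one_cat"

definition Susp_at :: "('k, 'o, 'm) derivator \<Rightarrow> 'k scat \<Rightarrow> ('o, 'm, 'o, 'm) funct" where
  "Susp_at D A = dfun D (to_A1 A) \<circ>\<^sub>F Susp (shift D A) \<circ>\<^sub>F dfun D (from_A1 A)"

definition psi_at ::
  "('k, 'o, 'm) derivator \<Rightarrow> ('k, 'p, 'n) derivator \<Rightarrow> ('k, 'o, 'm, 'p, 'n) dmorphism \<Rightarrow>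
   'k scat \<Rightarrow> ('o, 'm, 'p, 'n) ntrans" where
  "psi_at D E F A =
    (mgam F (to_A1 A) \<circ>\<^sub>R (Susp (shift D A) \<circ>\<^sub>F dfun D (from_A1 A)))
    \<cdot>\<^sub>N (dfun E (to_A1 A) \<circ>\<^sub>L psi (shift D A) (shift E A) (mshift F A) \<circ>\<^sub>R dfun D (from_A1 A))
    \<cdot>\<^sub>N ((dfun E (to_A1 A) \<circ>\<^sub>F Susp (shift E A)) \<circ>\<^sub>L mgam F (from_A1 A))"

definition sigma_at ::
  "('k, 'o, 'm) derivator \<Rightarrow> ('k, 'p, 'n) derivator \<Rightarrow> ('k, 'o, 'm, 'p, 'n) dmorphism \<Rightarrow>
   'k scat \<Rightarrow> ('o, 'm, 'p, 'n) ntrans" where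
  "sigma_at D E F A = inv_nat (psi_at D E F A)"


section \<open>Canonical triangulations\<close>

text \<open>A category with an endofunctor and a class of triangles, i.e. of triples \<open>(f, g, h)\<close>
  with \<open>f: X \<rightarrow> Y\<close>, \<open>g: Y \<rightarrow> Z\<close>, \<open>h: Z \<rightarrow> \<Sigma> X\<close>. The axioms of a triangulated category are not
  part of the record.\<close>

record ('o, 'm) triang =
  tcat :: "('o, 'm) cat"
  tsusp :: "('o, 'm, 'o, 'm) funct"
  tdist :: "('m \<times> 'm \<times> 'm) set"

definition triangles :: "('o, 'm) cat \<Rightarrow> ('o, 'm, 'o, 'm) funct \<Rightarrow> ('m \<times> 'm \<times> 'm) set" where
  "triangles C S = {(f, g, h). f \<in> Arr C \<and> g \<in> Arr C \<and> h \<in> Arr C \<and>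
    Cod C f = Dom C g \<and> Cod C g = Dom C h \<and> Cod C h = Fobj S (Dom C f)}"

definition tri_iso ::
  "('o, 'm) cat \<Rightarrow> ('o, 'm, 'o, 'm) funct \<Rightarrow> 'm \<times> 'm \<times> 'm \<Rightarrow> 'm \<times> 'm \<times> 'm \<Rightarrow> bool" where
  "tri_iso C S = (\<lambda>(f, g, h) (f', g', h'). \<exists>a b c.
    a \<in> Hom C (Dom C f) (Dom C f') \<and> iso_arr C a \<and>
    b \<in> Hom C (Dom C g) (Dom C g') \<and> iso_arr C b \<and>
    c \<in> Hom C (Dom C h) (Dom C h') \<and> iso_arr C c \<and>
    b \<cdot>\<^bsub>C\<^esub> f = f' \<cdot>\<^bsub>C\<^esub> a \<and> c \<cdot>\<^bsub>C\<^esub> g = g' \<cdot>\<^bsub>C\<^esub> b \<and> Farr S a \<cdot>\<^bsub>C\<^esub> h = h' \<cdot>\<^bsub>C\<^esub> c)"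

text \<open>\<open>\<phi>: \<Sigma>(X\<^sub>0\<^sub>0) \<rightarrow> X\<^sub>1\<^sub>1\<close> for \<open>X\<close> in \<open>D(\<box>)\<close> with \<open>X\<^sub>1\<^sub>0\<close> and \<open>X\<^sub>0\<^sub>1\<close> zero. Its source is \<open>\<Sigma>(X\<^sub>0\<^sub>0)\<close> on
  the nose since \<open>i\<^sup>* i_ul\<^sup>* = (0,0)\<^sup>*\<close>.\<close>

definition phi :: "('k, 'o, 'm) derivator \<Rightarrow> 'o \<Rightarrow> 'm" where
  "phi D X = (let Y = Fobj (dfun D i_ul) X in
    Farr (dfun D (pt square (pos 1 1)))
      (Ncomp (lan_counit D i_ul) X
       \<cdot>\<^bsub>dcat D square\<^esub> Farr (lan D i_ul) (inv_arr (dcat D ul) (Ncomp (ran_unit D i_00) Y))))"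

abbreviation two_one :: "'k scat" where
  "two_one \<equiv> ord_cat 2 \<times>\<^sub>C ord_cat 1"

text \<open>The inclusion of \<open>{a, b} \<times> [1]\<close> in \<open>[2] \<times> [1]\<close>, for \<open>a < b\<close>.\<close>

definition sub_square :: "nat \<Rightarrow> nat \<Rightarrow> 'k sfun" where
  "sub_square a b = ord_fun 1 2 (\<lambda>i. if i = 0 then a else b) \<otimes>\<^sub>F idF (ord_cat 1)"

definition cof_seq :: "('k, 'o, 'm) derivator \<Rightarrow> 'o \<Rightarrow> bool" where
  "cof_seq D Q \<longleftrightarrow> Q \<in> Obj (dcat D two_one) \<and>
    zero_obj (dcat D one_cat) (Fobj (dfun D (pt two_one (pos 2 0))) Q) \<and>
    zero_obj (dcat D one_cat) (Fobj (dfun D (pt two_one (pos 0 1))) Q) \<and>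
    cocartesian D (Fobj (dfun D (sub_square 0 1)) Q) \<and>
    cocartesian D (Fobj (dfun D (sub_square 1 2)) Q)"

definition std_tri :: "('k, 'o, 'm) derivator \<Rightarrow> 'o \<Rightarrow> 'm \<times> 'm \<times> 'm" where
  "std_tri D Q = (let C = dcat D one_cat; ev = (\<lambda>f. Ncomp (dnat D (pt_nat two_one f)) Q) in
    (ev (step 0 0 1 0), ev (step 1 0 1 1),
     inv_arr C (phi D (Fobj (dfun D (sub_square 0 2)) Q)) \<cdot>\<^bsub>C\<^esub> ev (step 1 1 2 1)))"

definition canon_tri_one :: "('k, 'o, 'm) derivator \<Rightarrow> ('o, 'm) triang" where
  "canon_tri_one D = \<lparr>tcat = dcat D one_cat, tsusp = Susp D,
    tdist = {t \<in> triangles (dcat D one_cat) (Susp D).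
      \<exists>Q. cof_seq D Q \<and> tri_iso (dcat D one_cat) (Susp D) t (std_tri D Q)}\<rparr>"

text \<open>The triangulation of \<open>D\<^sup>A(1)\<close>, transported to \<open>D(A)\<close>.\<close>

definition canon_tri :: "('k, 'o, 'm) derivator \<Rightarrow> 'k scat \<Rightarrow> ('o, 'm) triang" where
  "canon_tri D A = \<lparr>tcat = dcat D A, tsusp = Susp_at D A,
    tdist = {(f, g, h) \<in> triangles (dcat D A) (Susp_at D A).
      (Farr (dfun D (from_A1 A)) f, Farr (dfun D (from_A1 A)) g, Farr (dfun D (from_A1 A)) h)
        \<in> tdist (canon_tri_one (shift D A))}\<rparr>"


section \<open>Exact functors\<close>

definition zero_arr :: "('o, 'm) cat \<Rightarrow> 'm \<Rightarrow> bool" where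
  "zero_arr C f \<longleftrightarrow> f \<in> Arr C \<and>
    (\<exists>z g h. zero_obj C z \<and> g \<in> Hom C (Dom C f) z \<and> h \<in> Hom C z (Cod C f) \<and> f = h \<cdot>\<^bsub>C\<^esub> g)"

definition biproduct ::
  "('o, 'm) cat \<Rightarrow> 'o \<Rightarrow> 'o \<Rightarrow> 'o \<Rightarrow> 'm \<Rightarrow> 'm \<Rightarrow> 'm \<Rightarrow> 'm \<Rightarrow> bool" where
  "biproduct C x y b i j p q \<longleftrightarrow>
    i \<in> Hom C x b \<and> j \<in> Hom C y b \<and> p \<in> Hom C b x \<and> q \<in> Hom C b y \<and>
    p \<cdot>\<^bsub>C\<^esub> i = Id C x \<and> q \<cdot>\<^bsub>C\<^esub> j = Id C y \<and> zero_arr C (q \<cdot>\<^bsub>C\<^esub> i) \<and> zero_arr C (p \<cdot>\<^bsub>C\<^esub> j) \<and>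
    (\<forall>z\<in>Obj C. \<forall>f\<in>Hom C x z. \<forall>g\<in>Hom C y z. \<exists>!h. h \<in> Hom C b z \<and> h \<cdot>\<^bsub>C\<^esub> i = f \<and> h \<cdot>\<^bsub>C\<^esub> j = g) \<and>
    (\<forall>z\<in>Obj C. \<forall>f\<in>Hom C z x. \<forall>g\<in>Hom C z y. \<exists>!h. h \<in> Hom C z b \<and> p \<cdot>\<^bsub>C\<^esub> h = f \<and> q \<cdot>\<^bsub>C\<^esub> h = g)"

text \<open>The addition of morphisms of an additive category is determined by the category: \<open>f + g\<close> is
  \<open>\<nabla> \<circ> (f, g): X \<rightarrow> Y \<oplus> Y \<rightarrow> Y\<close>. Lemma \<open>is_sum_iff\<close> below shows that this is the addition of any
  additive structure.\<close>

definition is_sum :: "('o, 'm) cat \<Rightarrow> 'm \<Rightarrow> 'm \<Rightarrow> 'm \<Rightarrow> bool" where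
  "is_sum C f g h \<longleftrightarrow> f \<in> Arr C \<and> g \<in> Hom C (Dom C f) (Cod C f) \<and>
    (\<exists>b i j p q d t. biproduct C (Cod C f) (Cod C f) b i j p q \<and>
      t \<in> Hom C (Dom C f) b \<and> p \<cdot>\<^bsub>C\<^esub> t = f \<and> q \<cdot>\<^bsub>C\<^esub> t = g \<and>
      d \<in> Hom C b (Cod C f) \<and> d \<cdot>\<^bsub>C\<^esub> i = Id C (Cod C f) \<and> d \<cdot>\<^bsub>C\<^esub> j = Id C (Cod C f) \<and>
      h = d \<cdot>\<^bsub>C\<^esub> t)"

definition additive_functor :: "('o, 'm, 'p, 'n) funct \<Rightarrow> bool" where
  "additive_functor F \<longleftrightarrow> is_functor F \<and>
    (\<forall>f g h. is_sum (Fdom F) f g h \<longrightarrow> is_sum (Fcod F) (Farr F f) (Farr F g) (Farr F h))"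

definition additive_structure :: "('o, 'm) cat \<Rightarrow> ('m \<Rightarrow> 'm \<Rightarrow> 'm) \<Rightarrow> bool" where
  "additive_structure C add \<longleftrightarrow> category C \<and> (\<exists>z. zero_obj C z) \<and>
    (\<forall>x\<in>Obj C. \<forall>y\<in>Obj C. \<exists>b i j p q. biproduct C x y b i j p q) \<and>
    (\<forall>x\<in>Obj C. \<forall>y\<in>Obj C.
      (\<forall>f\<in>Hom C x y. \<forall>g\<in>Hom C x y. add f g \<in> Hom C x y \<and> add f g = add g f) \<and>
      (\<forall>f\<in>Hom C x y. \<forall>g\<in>Hom C x y. \<forall>h\<in>Hom C x y. add (add f g) h = add f (add g h)) \<and>
      (\<exists>n\<in>Hom C x y. \<forall>f\<in>Hom C x y. add n f = f \<and> (\<exists>g\<in>Hom C x y. add f g = n))) \<and>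
    (\<forall>x\<in>Obj C. \<forall>y\<in>Obj C. \<forall>z\<in>Obj C.
      (\<forall>f\<in>Hom C x y. \<forall>g\<in>Hom C x y. \<forall>h\<in>Hom C y z. h \<cdot>\<^bsub>C\<^esub> add f g = add (h \<cdot>\<^bsub>C\<^esub> f) (h \<cdot>\<^bsub>C\<^esub> g)) \<and>
      (\<forall>f\<in>Hom C x y. \<forall>g\<in>Hom C y z. \<forall>h\<in>Hom C y z. add g h \<cdot>\<^bsub>C\<^esub> f = add (g \<cdot>\<^bsub>C\<^esub> f) (h \<cdot>\<^bsub>C\<^esub> f)))"

lemma is_sum_iff:
  assumes "additive_structure C add" and f: "f \<in> Hom C x y" and g: "g \<in> Hom C x y"
  shows "is_sum C f g h \<longleftrightarrow> h = add f g"
proof -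
  have C: "category C" and bip: "\<And>x y. x \<in> Obj C \<Longrightarrow> y \<in> Obj C \<Longrightarrow> \<exists>b i j p q. biproduct C x y b i j p q"
    and cl: "\<And>x y f g. x \<in> Obj C \<Longrightarrow> y \<in> Obj C \<Longrightarrow> f \<in> Hom C x y \<Longrightarrow> g \<in> Hom C x y \<Longrightarrow> add f g \<in> Hom C x y"
    and grp: "\<And>x y. x \<in> Obj C \<Longrightarrow> y \<in> Obj C \<Longrightarrow>
        (\<forall>f\<in>Hom C x y. \<forall>g\<in>Hom C x y. add f g \<in> Hom C x y \<and> add f g = add g f) \<and>
        (\<forall>f\<in>Hom C x y. \<forall>g\<in>Hom C x y. \<forall>h\<in>Hom C x y. add (add f g) h = add f (add g h)) \<and>
        (\<exists>n\<in>Hom C x y. \<forall>f\<in>Hom C x y. add n f = f \<and> (\<exists>g\<in>Hom C x y. add f g = n))"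
    and dl: "\<And>x y z f g h. x \<in> Obj C \<Longrightarrow> y \<in> Obj C \<Longrightarrow> z \<in> Obj C \<Longrightarrow> f \<in> Hom C x y \<Longrightarrow> g \<in> Hom C x y \<Longrightarrow>
        h \<in> Hom C y z \<Longrightarrow> h \<cdot>\<^bsub>C\<^esub> add f g = add (h \<cdot>\<^bsub>C\<^esub> f) (h \<cdot>\<^bsub>C\<^esub> g)"
    and dr: "\<And>x y z f g h. x \<in> Obj C \<Longrightarrow> y \<in> Obj C \<Longrightarrow> z \<in> Obj C \<Longrightarrow> f \<in> Hom C x y \<Longrightarrow> g \<in> Hom C y z \<Longrightarrow>
        h \<in> Hom C y z \<Longrightarrow> add g h \<cdot>\<^bsub>C\<^esub> f = add (g \<cdot>\<^bsub>C\<^esub> f) (h \<cdot>\<^bsub>C\<^esub> f)"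
    using assms(1) unfolding additive_structure_def by (blast+)
  have cmp: "b \<cdot>\<^bsub>C\<^esub> a \<in> Hom C u w" if "a \<in> Hom C u v" "b \<in> Hom C v w" for a b u v w
    using C that unfolding category_def Hom_def by auto
  have assoc: "(c \<cdot>\<^bsub>C\<^esub> b) \<cdot>\<^bsub>C\<^esub> a = c \<cdot>\<^bsub>C\<^esub> (b \<cdot>\<^bsub>C\<^esub> a)"
    if "a \<in> Hom C u v" "b \<in> Hom C v w" "c \<in> Hom C w w'" for a b c u v w w'
    using C that unfolding category_def Hom_def by auto
  have unit: "a \<cdot>\<^bsub>C\<^esub> Id C u = a" "Id C v \<cdot>\<^bsub>C\<^esub> a = a" if "a \<in> Hom C u v" for a u v
    using C that unfolding category_def Hom_def by auto
  have ob: "u \<in> Obj C \<and> v \<in> Obj C" if "a \<in> Hom C u v" for a u v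
    using C that unfolding category_def Hom_def by auto
  have neutral: "add n a = a" "add a n = a" if n: "zero_arr C n" "n \<in> Hom C u v" and a: "a \<in> Hom C u v" for n a u v
  proof -
    obtain z k l where z: "zero_obj C z" and k: "k \<in> Hom C u z" and l: "l \<in> Hom C z v" and nl: "n = l \<cdot>\<^bsub>C\<^esub> k"
      using n unfolding zero_arr_def Hom_def by auto
    have ou: "u \<in> Obj C" "v \<in> Obj C" "z \<in> Obj C" using ob n(2) k by auto
    have "add k k = k"
      using z ou(1) k cl[OF ou(1,3) k k] unfolding zero_obj_def terminal_obj_def by blast
    then have nn: "add n n = n" using dl[OF ou(1,3,2) k k l] nl by simp
    obtain e where e: "e \<in> Hom C u v" "\<And>f. f \<in> Hom C u v \<Longrightarrow> add e f = f \<and> (\<exists>g\<in>Hom C u v. add f g = e)"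
      using grp[OF ou(1,2)] by blast
    obtain m where m: "m \<in> Hom C u v" "add n m = e" using e(2)[OF n(2)] by blast
    have "e = add (add n n) m" using nn m by simp
    also have "\<dots> = add n (add n m)" using grp[OF ou(1,2)] n(2) m(1) by blast
    also have "\<dots> = add e n" using m grp[OF ou(1,2)] n(2) e(1) by force
    also have "\<dots> = n" using e(2)[OF n(2)] by blast
    finally have "e = n" .
    then show "add n a = a" "add a n = a" using e(2)[OF a] grp[OF ou(1,2)] a n(2) by auto
  qed
  have xy: "x \<in> Obj C" "y \<in> Obj C" using ob f by auto
  have fC: "f \<in> Arr C" "Dom C f = x" "Cod C f = y" using f unfolding Hom_def by auto
  have key: "d \<cdot>\<^bsub>C\<^esub> t = add f g"
    if B: "biproduct C y y b i j p q" and t: "t \<in> Hom C x b" "p \<cdot>\<^bsub>C\<^esub> t = f" "q \<cdot>\<^bsub>C\<^esub> t = g"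
      and d: "d \<in> Hom C b y" "d \<cdot>\<^bsub>C\<^esub> i = Id C y" "d \<cdot>\<^bsub>C\<^esub> j = Id C y" for b i j p q d t
  proof -
    have i: "i \<in> Hom C y b" and j: "j \<in> Hom C y b" and p: "p \<in> Hom C b y" and q: "q \<in> Hom C b y"
      and e: "p \<cdot>\<^bsub>C\<^esub> i = Id C y" "q \<cdot>\<^bsub>C\<^esub> j = Id C y" "zero_arr C (q \<cdot>\<^bsub>C\<^esub> i)" "zero_arr C (p \<cdot>\<^bsub>C\<^esub> j)"
      and cop: "\<And>k l. k \<in> Hom C y y \<Longrightarrow> l \<in> Hom C y y \<Longrightarrow> \<exists>!h. h \<in> Hom C b y \<and> h \<cdot>\<^bsub>C\<^esub> i = k \<and> h \<cdot>\<^bsub>C\<^esub> j = l"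
      using B xy unfolding biproduct_def by blast+
    have b: "b \<in> Obj C" using ob i by auto
    have I: "Id C y \<in> Hom C y y" using C xy unfolding category_def by blast
    have 1: "add p q \<cdot>\<^bsub>C\<^esub> i = Id C y"
      using dr[OF xy(2) b xy(2) i p q] e neutral(2)[OF e(3) cmp[OF i q] I] by simp
    have 2: "add p q \<cdot>\<^bsub>C\<^esub> j = Id C y"
      using dr[OF xy(2) b xy(2) j p q] e neutral(1)[OF e(4) cmp[OF j p] I] by simp
    have "d = add p q" using cop[OF I I] d 1 2 cl[OF b xy(2) p q] by blast
    then show ?thesis using dr[OF xy(1) b xy(2) t(1) p q] t by simp
  qed
  show ?thesis
  proof
    assume "is_sum C f g h"
    then show "h = add f g" unfolding is_sum_def fC using key by blast
  next
    assume h: "h = add f g"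
    obtain b i j p q where B: "biproduct C y y b i j p q" using bip xy by blast
    have I: "Id C y \<in> Hom C y y" using C xy unfolding category_def by blast
    obtain t where t: "t \<in> Hom C x b" "p \<cdot>\<^bsub>C\<^esub> t = f" "q \<cdot>\<^bsub>C\<^esub> t = g"
      using B xy f g unfolding biproduct_def by blast
    obtain d where d: "d \<in> Hom C b y" "d \<cdot>\<^bsub>C\<^esub> i = Id C y" "d \<cdot>\<^bsub>C\<^esub> j = Id C y"
      using B xy I unfolding biproduct_def by blast
    have "h = d \<cdot>\<^bsub>C\<^esub> t" using h key[OF B t d] by simp
    then show "is_sum C f g h" unfolding is_sum_def fC(2,3)
      using fC(1) g B t d by blast
  qed
qed

definition exact_functor ::
  "('o, 'm) triang \<Rightarrow> ('p, 'n) triang \<Rightarrow> ('o, 'm, 'p, 'n) funct \<Rightarrow> ('o, 'm, 'p, 'n) ntrans \<Rightarrow> bool" where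
  "exact_functor T T' F \<sigma> \<longleftrightarrow>
    additive_functor F \<and> Fdom F = tcat T \<and> Fcod F = tcat T' \<and>
    is_ntrans \<sigma> \<and> Nsrc \<sigma> = F \<circ>\<^sub>F tsusp T \<and> Ntgt \<sigma> = tsusp T' \<circ>\<^sub>F F \<and>
    (\<forall>f g h. (f, g, h) \<in> tdist T \<longrightarrow>
      (Farr F f, Farr F g, Ncomp \<sigma> (Dom (tcat T) f) \<cdot>\<^bsub>tcat T'\<^esub> Farr F h) \<in> tdist T')"

end

theory Submission imports Defs
begin

text \<open>
The functor \<open>F\<^sub>A\<close> is exact because \<open>F\<close> maps a coherent cofiber sequence \<open>Q\<close> to one, and the standard triangle of
\<open>F Q\<close> is, up to the structure isomorphisms \<open>\<gamma>\<close>, the image of that of \<open>Q\<close> with \<open>\<psi>\<inverse>\<close> inserted at the end.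

Kan extensions are handled as universal arrows: \<open>univ (dfun D u) X Y f\<close> says that \<open>f: X \<rightarrow> u\<^sup>* Y\<close> exhibits \<open>Y\<close> as
\<open>u\<^sub>! X\<close>. A morphism preserves left Kan extensions along \<open>u\<close>, in the sense of mates, iff it preserves these universal
arrows (\<open>preserves_lan_iff\<close>). By Der2 and Der4 universality is a condition on the colimit cocones over the slices
\<open>(u/b)\<close> (\<open>univ_restr\<close>, \<open>univ_pointwise\<close>), and \<open>(u/b)\<close> may be replaced by any \<open>J\<close> with a right adjoint
functor to it (\<open>final_cocone\<close>). For the functors used here \<open>J\<close> is empty, a point or the corner of a pushout, so a
right exact \<open>F\<close> preserves the Kan extensions that define cocartesian squares, initial objects and coproducts, with any
parameter category \<open>A\<close>. The statements on right Kan extensions, terminal objects and products are those on left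
ones for the opposite derivators and the opposite morphism (\<open>left_derivator_op\<close>, \<open>preserves_ran_iff\<close>).
Preserving biproducts, \<open>F\<^sub>A\<close> is additive (\<open>mfun_additive\<close>).

Pushout squares paste (\<open>pushout_pasting\<close>), so the outer square of a cofiber sequence is cocartesian and its
\<open>\<phi>\<close> is invertible (\<open>shift_cof_seq\<close>). Both \<open>\<phi>\<close> and the components of \<open>\<psi>\<close> are values at the corner \<open>(1,1)\<close> of
a map determined by the universal property of \<open>(i_ul)\<^sub>! i\<^sub>*\<close>; the predicate \<open>susp_map\<close> describes this common
situation. Its naturality and its behaviour under \<open>F\<close> give the naturality of \<open>\<psi>\<close> and the equation relating \<open>\<phi>\<close> for
\<open>F S\<close>, \<open>F \<phi>\<close> and \<open>\<psi>\<close> (\<open>phi_compat\<close>), hence the claim on triangles for \<open>D(1)\<close> (\<open>canon_tri_one_image\<close>). The case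
of \<open>A\<close> is this one for the shifted derivators, transported along \<open>A \<cong> A \<times> 1\<close>.
\<close>

text \<open>Short forms for composition in \<open>C\<close>, composition of functors, products, and the functors and transformations that a
prederivator or a morphism assigns to \<open>u\<close>.\<close>

abbreviation comp_in :: "'m \<Rightarrow> ('o, 'm) cat \<Rightarrow> 'm \<Rightarrow> 'm" ("_ *[_]/ _" [71, 0, 70] 70) where
 "g *[C] f \<equiv> Comp C g f"
notation compF (infixr "*." 70)
abbreviation id_times :: "'k scat \<Rightarrow> 'k sfun \<Rightarrow> 'k sfun" (infixr "**" 75) where "A ** u \<equiv> prod_fun (idF A) u"
abbreviation "dob D u \<equiv> Fobj (dfun D u)"
abbreviation "dar D u \<equiv> Farr (dfun D u)"
abbreviation "dnt D \<alpha> \<equiv> Ncomp (dnat D \<alpha>)"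
abbreviation "gam F u \<equiv> Ncomp (mgam F u)"
abbreviation "mob F A \<equiv> Fobj (mfun F A)"
abbreviation "mar F A \<equiv> Farr (mfun F A)"

notation prod_cat (infixr "><" 75)
notation vcomp (infixr "*N" 70)
notation whiskL (infixr "*L" 75)
notation whiskR (infixr "*R" 75)
abbreviation "dhom D A \<equiv> Hom (dcat D A)"
abbreviation "dobj D A \<equiv> Obj (dcat D A)"

section \<open>Categories, functors and transformations as records\<close>

lemma mk_cat_simps [simp]:
 "Obj (mk_cat Ob Ar d c i m) = Ob"
 "Arr (mk_cat Ob Ar d c i m) = Ar"
 "f : Ar ==> Dom (mk_cat Ob Ar d c i m) f = d f"
 "f : Ar ==> Cod (mk_cat Ob Ar d c i m) f = c f"
 "x : Ob ==> Id (mk_cat Ob Ar d c i m) x = i x"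
 "g : Ar ==> f : Ar ==> c f = d g ==> g *[mk_cat Ob Ar d c i m] f = m g f"
 by (auto simp: mk_cat_def)

lemma Hom_mk_cat: "h : Hom (mk_cat Ob Ar d c i m) x y \<longleftrightarrow> h : Ar & d h = x & c h = y"
 by (auto simp: Hom_def)

lemma category_mk_cat:
 assumes "\<And>f. f : Ar ==> d f : Ob" "\<And>f. f : Ar ==> c f : Ob"
  and "\<And>x. x : Ob ==> i x : Ar & d (i x) = x & c (i x) = x"
  and "\<And>g f. g : Ar ==> f : Ar ==> c f = d g ==> m g f : Ar & d (m g f) = d f & c (m g f) = c g"
  and "\<And>f. f : Ar ==> m f (i (d f)) = f" "\<And>f. f : Ar ==> m (i (c f)) f = f"
  and "\<And>h g f. h : Ar ==> g : Ar ==> f : Ar ==> c f = d g ==> c g = d h ==>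
   m (m h g) f = m h (m g f)"
 shows "category (mk_cat Ob Ar d c i m)"
 unfolding category_def Hom_def
 by (auto simp: assms mk_cat_def)

lemma cat_ob: "category C ==> f : Hom C x y ==> x : Obj C" "category C ==> f : Hom C x y ==> y : Obj C"
 unfolding category_def Hom_def by auto

lemma cat_id: "category C ==> x : Obj C ==> Id C x : Hom C x x"
 unfolding category_def by auto

lemma cat_comp: "category C ==> g : Hom C y z ==> f : Hom C x y ==> g *[C] f : Hom C x z"
 unfolding category_def Hom_def by auto

lemma cat_assoc: "category C ==> h : Hom C z w ==> g : Hom C y z ==> f : Hom C x y ==>
  (h *[C] g) *[C] f = h *[C] (g *[C] f)"
 unfolding category_def Hom_def by auto

lemma cat_idl: "category C ==> f : Hom C x y ==> Id C y *[C] f = f"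
 and cat_idr: "category C ==> f : Hom C x y ==> f *[C] Id C x = f"
 unfolding category_def Hom_def by auto

lemma cat_dom: "category C ==> f : Arr C ==> Dom C f : Obj C"
 and cat_cod: "category C ==> f : Arr C ==> Cod C f : Obj C"
 unfolding category_def by auto

lemma HomI: "f : Arr C ==> f : Hom C (Dom C f) (Cod C f)"
 by (simp add: Hom_def)

lemma HomD: "f : Hom C x y ==> f : Arr C" "f : Hom C x y ==> Dom C f = x" "f : Hom C x y ==> Cod C f = y"
 by (auto simp: Hom_def)

text \<open>Two arrows compose to equal ones if they do so in a larger composite; these rules rewrite
 inside composites that are associated to the right.\<close>

lemma cat_comp_eq:
 assumes "category C" "g *[C] f = g' *[C] f'" "f : Hom C x y" "g : Hom C y z"
  "f' : Hom C x y'" "g' : Hom C y' z" "e : Hom C w x"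
 shows "g *[C] (f *[C] e) = g' *[C] (f' *[C] e)"
 using cat_assoc[OF assms(1,4,3,7)] cat_assoc[OF assms(1,6,5,7)] assms(2) by simp

lemma inverse_arrs_unique:
 assumes "category C" "inverse_arrs C f g" "inverse_arrs C f g'"
 shows "g = g'"
proof -
 let ?x = "Dom C f" and ?y = "Cod C f"
 have f: "f : Hom C ?x ?y" and g: "g : Hom C ?y ?x" and g': "g' : Hom C ?y ?x"
  using assms by (auto simp: inverse_arrs_def Hom_def)
 have "g = (g' *[C] f) *[C] g"
  using assms g cat_idl[OF assms(1) g] by (simp add: inverse_arrs_def)
 also have "\<dots> = g' *[C] (f *[C] g)" using cat_assoc[OF assms(1) g' f g] .
 also have "\<dots> = g'" using assms cat_idr[OF assms(1) g'] by (simp add: inverse_arrs_def)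
 finally show ?thesis .
qed

lemma inv_arr_eq: "category C ==> inverse_arrs C f g ==> inv_arr C f = g"
 unfolding inv_arr_def by (blast intro: inverse_arrs_unique)

lemma iso_arrI:
 assumes "category C" "f : Hom C x y" "g : Hom C y x" "g *[C] f = Id C x" "f *[C] g = Id C y"
 shows "iso_arr C f" "inv_arr C f = g"
proof -
 have "inverse_arrs C f g" using assms by (auto simp: inverse_arrs_def Hom_def)
 then show "iso_arr C f" "inv_arr C f = g" using assms(1) inv_arr_eq by (auto simp: iso_arr_def)
qed

lemma inv_arr:
 assumes "category C" "f : Hom C x y" "iso_arr C f"
 shows "inv_arr C f : Hom C y x" "inv_arr C f *[C] f = Id C x" "f *[C] inv_arr C f = Id C y"
  "iso_arr C (inv_arr C f)" "inv_arr C (inv_arr C f) = f"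
proof -
 obtain g where g: "inverse_arrs C f g" using assms by (auto simp: iso_arr_def)
 then have [simp]: "inv_arr C f = g" by (rule inv_arr_eq[OF assms(1)])
 show *: "inv_arr C f : Hom C y x" "inv_arr C f *[C] f = Id C x" "f *[C] inv_arr C f = Id C y"
  using g assms(2) by (auto simp: inverse_arrs_def Hom_def)
 show "iso_arr C (inv_arr C f)" "inv_arr C (inv_arr C f) = f"
  using iso_arrI[OF assms(1) *(1) assms(2) *(3,2)] by auto
qed

lemma iso_id: "category C ==> x : Obj C ==> iso_arr C (Id C x)"
 and inv_id: "category C ==> x : Obj C ==> inv_arr C (Id C x) = Id C x"
 by (simp_all add: iso_arrI[OF _ cat_id cat_id] cat_idl[OF _ cat_id])

lemma iso_comp:
 assumes C: "category C" and g: "g : Hom C y z" and f: "f : Hom C x y"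
  and i: "iso_arr C g" "iso_arr C f"
 shows "iso_arr C (g *[C] f)" "inv_arr C (g *[C] f) = inv_arr C f *[C] inv_arr C g"
proof -
 note G = inv_arr[OF C g i(1)] and F = inv_arr[OF C f i(2)]
 have "(inv_arr C f *[C] inv_arr C g) *[C] (g *[C] f) = inv_arr C f *[C] ((inv_arr C g *[C] g) *[C] f)"
  using cat_assoc[OF C F(1) G(1) cat_comp[OF C g f]] cat_assoc[OF C G(1) g f] by simp
 then have 1: "(inv_arr C f *[C] inv_arr C g) *[C] (g *[C] f) = Id C x" using F G cat_idl[OF C f] by simp
 have "(g *[C] f) *[C] (inv_arr C f *[C] inv_arr C g) = g *[C] ((f *[C] inv_arr C f) *[C] inv_arr C g)"
  using cat_assoc[OF C g f cat_comp[OF C F(1) G(1)]] cat_assoc[OF C f F(1) G(1)] by simp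
 then have 2: "(g *[C] f) *[C] (inv_arr C f *[C] inv_arr C g) = Id C z" using F G cat_idl[OF C G(1)] by simp
 show "iso_arr C (g *[C] f)" "inv_arr C (g *[C] f) = inv_arr C f *[C] inv_arr C g"
  using iso_arrI[OF C cat_comp[OF C g f] cat_comp[OF C F(1) G(1)] 1 2] by auto
qed

lemma inv_cancel:
 assumes "category C" "g : Hom C y z" "iso_arr C g"
 shows "f : Hom C x y ==> inv_arr C g *[C] (g *[C] f) = f"
  "f : Hom C x z ==> g *[C] (inv_arr C g *[C] f) = f"
  "h : Hom C z w ==> (h *[C] g) *[C] inv_arr C g = h"
  "h : Hom C y w ==> (h *[C] inv_arr C g) *[C] g = h"
proof -
 note i = inv_arr[OF assms]
 show "inv_arr C g *[C] (g *[C] f) = f" if "f : Hom C x y"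
  using cat_assoc[OF assms(1) i(1) assms(2) that] i(2) cat_idl[OF assms(1) that] by simp
 show "g *[C] (inv_arr C g *[C] f) = f" if "f : Hom C x z"
  using cat_assoc[OF assms(1,2) i(1) that] i(3) cat_idl[OF assms(1) that] by simp
 show "(h *[C] g) *[C] inv_arr C g = h" if "h : Hom C z w"
  using cat_assoc[OF assms(1) that assms(2) i(1)] i(3) cat_idr[OF assms(1) that] by simp
 show "(h *[C] inv_arr C g) *[C] g = h" if "h : Hom C y w"
  using cat_assoc[OF assms(1) that i(1) assms(2)] i(2) cat_idr[OF assms(1) that] by simp
qed

lemma is_functorD:
 assumes "is_functor F" "Fdom F = C" "Fcod F = C'"
 shows "category C" "category C'" "x : Obj C ==> Fobj F x : Obj C'"
  "f : Hom C x y ==> Farr F f : Hom C' (Fobj F x) (Fobj F y)"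
  "x : Obj C ==> Farr F (Id C x) = Id C' (Fobj F x)"
  "g : Hom C y z ==> f : Hom C x y ==> Farr F (g *[C] f) = Farr F g *[C'] Farr F f"
 using assms unfolding is_functor_def Let_def Hom_def by auto

lemma functor_iso:
 assumes F: "is_functor F" "Fdom F = C" "Fcod F = C'" and f: "f : Hom C x y" "iso_arr C f"
 shows "iso_arr C' (Farr F f)" "inv_arr C' (Farr F f) = Farr F (inv_arr C f)"
proof -
 note Fs = is_functorD[OF F] and i = inv_arr[OF Fs(1) f]
 have 1: "Farr F (inv_arr C f) *[C'] Farr F f = Id C' (Fobj F x)"
  using Fs(6)[OF i(1) f(1)] i(2) Fs(5) cat_ob[OF Fs(1) f(1)] by simp
 have 2: "Farr F f *[C'] Farr F (inv_arr C f) = Id C' (Fobj F y)"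
  using Fs(6)[OF f(1) i(1)] i(3) Fs(5) cat_ob[OF Fs(1) f(1)] by simp
 show "iso_arr C' (Farr F f)" "inv_arr C' (Farr F f) = Farr F (inv_arr C f)"
  using iso_arrI[OF Fs(2) Fs(4)[OF f(1)] Fs(4)[OF i(1)] 1 2] by auto
qed

lemma mk_fun_simps [simp]:
 "Fdom (mk_fun C C' o' m') = C" "Fcod (mk_fun C C' o' m') = C'"
 "x : Obj C ==> Fobj (mk_fun C C' o' m') x = o' x"
 "f : Arr C ==> Farr (mk_fun C C' o' m') f = m' f"
 by (auto simp: mk_fun_def)

lemma is_functor_mk_fun:
 assumes "category C" "category C'" "\<And>x. x : Obj C ==> o' x : Obj C'"
  "\<And>f x y. f : Hom C x y ==> m' f : Hom C' (o' x) (o' y)"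
  "\<And>x. x : Obj C ==> m' (Id C x) = Id C' (o' x)"
  "\<And>g f x y z. g : Hom C y z ==> f : Hom C x y ==> m' (g *[C] f) = m' g *[C'] m' f"
 shows "is_functor (mk_fun C C' o' m')"
proof -
 have 1: "f : Arr C ==> m' f : Hom C' (o' (Dom C f)) (o' (Cod C f))" for f
  using assms(4)[OF HomI] .
 have 2: "x : Obj C ==> Id C x : Arr C" for x using cat_id[OF assms(1)] HomD by metis
 have 3: "f : Arr C ==> Dom C f : Obj C" "f : Arr C ==> Cod C f : Obj C" for f
  using assms(1) cat_dom cat_cod by metis+
 have 4: "g : Arr C ==> f : Arr C ==> Cod C f = Dom C g ==> g *[C] f : Arr C" for g f
  using cat_comp[OF assms(1), of g "Dom C g" "Cod C g" f "Dom C f"] by (auto simp: Hom_def)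
 have 5: "g : Arr C ==> f : Arr C ==> Cod C f = Dom C g ==> m' (g *[C] f) = m' g *[C'] m' f" for g f
  using assms(6)[of g "Dom C g" "Cod C g" f "Dom C f"] by (auto simp: Hom_def)
 show ?thesis
  unfolding is_functor_def Let_def using assms(1,2) 
  by (auto simp: assms(3,5) 1 2 3 4 5 mk_fun_def)
qed

lemma funct_eqI:
 assumes "is_functor F" "is_functor G" "Fdom F = Fdom G" "Fcod F = Fcod G"
  "\<And>x. x : Obj (Fdom F) ==> Fobj F x = Fobj G x" "\<And>f. f : Arr (Fdom F) ==> Farr F f = Farr G f"
 shows "F = (G :: ('o, 'm, 'p, 'n) funct)"
proof -
 have "Fobj F = Fobj G"
  using assms by (intro extensionalityI[of _ "Obj (Fdom F)"]) (auto simp: is_functor_def Let_def PiE_def)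
 moreover have "Farr F = Farr G"
  using assms by (intro extensionalityI[of _ "Arr (Fdom F)"]) (auto simp: is_functor_def Let_def)
 ultimately show ?thesis using assms(3,4) by simp
qed

lemma idF_simps [simp]:
 "Fdom (idF C) = C" "Fcod (idF C) = C" "x : Obj C ==> Fobj (idF C) x = x" "f : Arr C ==> Farr (idF C) f = f"
 by (auto simp: idF_def)

lemma is_functor_idF: "category C ==> is_functor (idF C)"
 unfolding idF_def by (rule is_functor_mk_fun) auto

lemma compF_simps [simp]:
 "Fdom (G *. F) = Fdom F" "Fcod (G *. F) = Fcod G"
 "x : Obj (Fdom F) ==> Fobj (G *. F) x = Fobj G (Fobj F x)"
 "f : Arr (Fdom F) ==> Farr (G *. F) f = Farr G (Farr F f)"
 by (auto simp: compF_def)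

lemma is_functor_compF:
 assumes "is_functor F" "is_functor G" "Fcod F = Fdom G"
 shows "is_functor (G *. F)"
 using is_functorD[OF assms(1) refl assms(3)] is_functorD[OF assms(2) refl refl]
 unfolding compF_def by (intro is_functor_mk_fun) (simp_all, (metis+)?)

lemma compF_assoc:
 assumes "is_functor F" "is_functor G" "is_functor H" "Fcod F = Fdom G" "Fcod G = Fdom H"
 shows "(H *. G) *. F = H *. (G *. F)"
proof (rule funct_eqI)
 fix f assume f: "f : Arr (Fdom ((H *. G) *. F))"
 then have "Farr F f : Arr (Fdom G)" using is_functorD(4)[OF assms(1) refl assms(4) HomI] HomD by fastforce
 then show "Farr ((H *. G) *. F) f = Farr (H *. (G *. F)) f" using f by simp
qed (use assms is_functorD(3)[OF assms(1) refl assms(4)] in \<open>auto intro!: is_functor_compF\<close>)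

lemma compF_idF: "is_functor F ==> Fdom F = C ==> F *. idF C = F"
 using is_functorD(1)[of F, OF _ refl refl]
 by (intro funct_eqI) (auto intro!: is_functor_compF is_functor_idF)

lemma idF_compF:
 assumes "is_functor F" "Fcod F = C"
 shows "idF C *. F = F"
proof -
 have "f : Arr (Fdom F) ==> Farr F f : Arr C" for f
  using is_functorD(4)[OF assms(1) refl assms(2) HomI] HomD by fast
 then show "idF C *. F = F" using is_functorD(2,3)[OF assms(1) refl assms(2)] assms
  by (intro funct_eqI) (auto intro!: is_functor_compF is_functor_idF)
qed

subsection \<open>Natural transformations\<close>

lemma ntD:
 assumes "is_ntrans t" "Nsrc t = F" "Ntgt t = G" "Fdom F = C" "Fcod F = C'"
 shows "is_functor F" "is_functor G" "Fdom G = C" "Fcod G = C'"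
  "x : Obj C ==> Ncomp t x : Hom C' (Fobj F x) (Fobj G x)"
  "f : Hom C x y ==> Ncomp t y *[C'] Farr F f = Farr G f *[C'] Ncomp t x"
 using assms unfolding is_ntrans_def Let_def Hom_def by auto

lemma mk_nat_simps [simp]:
 "Nsrc (mk_nat F G t) = F" "Ntgt (mk_nat F G t) = G"
 "x : Obj (Fdom F) ==> Ncomp (mk_nat F G t) x = t x"
 by (auto simp: mk_nat_def)

lemma is_ntrans_mk_nat:
 assumes "is_functor F" "is_functor G" "Fdom G = Fdom F" "Fcod G = Fcod F"
  "\<And>x. x : Obj (Fdom F) ==> t x : Hom (Fcod F) (Fobj F x) (Fobj G x)"
  "\<And>f x y. f : Hom (Fdom F) x y ==> t y *[Fcod F] Farr F f = Farr G f *[Fcod F] t x"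
 shows "is_ntrans (mk_nat F G t)"
 unfolding is_ntrans_def Let_def using assms(1-4) is_functorD(1)[OF assms(1) refl refl]
 by (auto simp: assms(6)[OF HomI] assms(5) cat_dom cat_cod mk_nat_def)

lemma ntrans_eqI:
 assumes "is_ntrans s" "is_ntrans t" "Nsrc s = Nsrc t" "Ntgt s = Ntgt t"
  "\<And>x. x : Obj (Fdom (Nsrc s)) ==> Ncomp s x = Ncomp t x"
 shows "s = (t :: ('o, 'm, 'p, 'n) ntrans)"
proof -
 have "Ncomp s = Ncomp t"
  using assms by (intro extensionalityI[of _ "Obj (Fdom (Nsrc s))"]) (auto simp: is_ntrans_def Let_def)
 then show ?thesis using assms(3,4) by simp
qed

lemma idN_simps [simp]:
 "Nsrc (idN F) = F" "Ntgt (idN F) = F" "x : Obj (Fdom F) ==> Ncomp (idN F) x = Id (Fcod F) (Fobj F x)"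
 by (auto simp: idN_def)

lemma vcomp_simps [simp]:
 "Nsrc (s *N t) = Nsrc t" "Ntgt (s *N t) = Ntgt s"
 "x : Obj (Fdom (Nsrc t)) ==> Ncomp (s *N t) x = Ncomp s x *[Fcod (Nsrc t)] Ncomp t x"
 by (auto simp: vcomp_def)

lemma whiskL_simps [simp]:
 "Nsrc (G *L t) = G *. Nsrc t" "Ntgt (G *L t) = G *. Ntgt t"
 "x : Obj (Fdom (Nsrc t)) ==> Ncomp (G *L t) x = Farr G (Ncomp t x)"
 by (auto simp: whiskL_def)

lemma whiskR_simps [simp]:
 "Nsrc (t *R F) = Nsrc t *. F" "Ntgt (t *R F) = Ntgt t *. F"
 "x : Obj (Fdom F) ==> Ncomp (t *R F) x = Ncomp t (Fobj F x)"
 by (auto simp: whiskR_def)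

lemma inv_nat_simps [simp]:
 "Nsrc (inv_nat t) = Ntgt t" "Ntgt (inv_nat t) = Nsrc t"
 "x : Obj (Fdom (Ntgt t)) ==> Ncomp (inv_nat t) x = inv_arr (Fcod (Nsrc t)) (Ncomp t x)"
 by (auto simp: inv_nat_def)

lemma is_ntrans_idN: "is_functor F ==> is_ntrans (idN F)"
 unfolding idN_def
 by (rule is_ntrans_mk_nat)
  (auto intro!: cat_id dest: is_functorD[OF _ refl refl] simp: cat_idl cat_idr,
   metis cat_idl cat_idr is_functorD(2,4))

lemma is_ntrans_vcomp:
 assumes "is_ntrans s" "is_ntrans t" "Ntgt t = Nsrc s"
 shows "is_ntrans (s *N t)"
proof -
 let ?F = "Nsrc t" and ?G = "Nsrc s" and ?H = "Ntgt s" and ?C = "Fdom (Nsrc t)" and ?D = "Fcod (Nsrc t)"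
 note t = ntD[OF assms(2) refl assms(3) refl refl]
 note s = ntD[OF assms(1) refl refl t(3,4)]
 have D: "category ?D" using is_functorD(2)[OF t(1) refl refl] .
 show ?thesis unfolding vcomp_def
 proof (rule is_ntrans_mk_nat)
  fix f x y assume f: "f : Hom ?C x y"
  have xy: "x : Obj ?C" "y : Obj ?C" using cat_ob[OF is_functorD(1)[OF t(1) refl refl] f] by auto
  note [simp] = cat_assoc[OF D]
  have "(Ncomp s y *[?D] Ncomp t y) *[?D] Farr ?F f = Ncomp s y *[?D] (Ncomp t y *[?D] Farr ?F f)"
   using cat_assoc[OF D s(5) t(5) is_functorD(4)[OF t(1) refl refl f]] xy by simp
  also have "\<dots> = (Ncomp s y *[?D] Farr ?G f) *[?D] Ncomp t x"
   using cat_assoc[OF D s(5) is_functorD(4)[OF t(2-4) f] t(5)] t(6)[OF f] xy by simp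
  also have "\<dots> = Farr ?H f *[?D] (Ncomp s x *[?D] Ncomp t x)"
   using cat_assoc[OF D is_functorD(4)[OF s(2-4) f] s(5) t(5)] s(6)[OF f] xy by simp
  finally show "(Ncomp s y *[?D] Ncomp t y) *[?D] Farr ?F f = Farr ?H f *[?D] (Ncomp s x *[?D] Ncomp t x)" .
 next
  fix x assume "x : Obj ?C"
  then show "Ncomp s x *[?D] Ncomp t x : Hom ?D (Fobj ?F x) (Fobj ?H x)"
   using cat_comp[OF D s(5) t(5)] by simp
 qed (use s t in auto)
qed

lemma is_ntrans_whiskL:
 assumes "is_ntrans t" "is_functor G" "Fcod (Nsrc t) = Fdom G"
 shows "is_ntrans (G *L t)"
proof -
 note t = ntD[OF assms(1) refl refl refl assms(3)] and G = is_functorD[OF assms(2) refl refl]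
 have C: "category (Fdom (Nsrc t))" using is_functorD(1)[OF t(1) refl refl] .
 show ?thesis unfolding whiskL_def
 proof (rule is_ntrans_mk_nat)
  fix f x y assume f: "f : Hom (Fdom (G *. Nsrc t)) x y"
  then have f: "f : Hom (Fdom (Nsrc t)) x y" by simp
  note xy = cat_ob[OF C f] and Ff = is_functorD(4)[OF t(1) refl assms(3) f] and Gf = is_functorD(4)[OF t(2-4) f]
  have "f : Arr (Fdom (Nsrc t))" "f : Arr (Fdom (Ntgt t))" using f t(3) HomD by auto
  then show "Farr G (Ncomp t y) *[Fcod (G *. Nsrc t)] Farr (G *. Nsrc t) f = Farr (G *. Ntgt t) f *[Fcod (G *. Nsrc t)] Farr G (Ncomp t x)"
   using G(6)[OF t(5)[OF xy(2)] Ff] G(6)[OF Gf t(5)[OF xy(1)]] t(6)[OF f] by simp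
 qed (use t G assms in \<open>auto intro!: is_functor_compF\<close>)
qed

lemma is_ntrans_whiskR:
 assumes "is_ntrans t" "is_functor F" "Fcod F = Fdom (Nsrc t)"
 shows "is_ntrans (t *R F)"
proof -
 note t = ntD[OF assms(1) refl refl refl refl] and F = is_functorD[OF assms(2) refl assms(3)]
 show ?thesis unfolding whiskR_def
 proof (rule is_ntrans_mk_nat)
  fix f x y assume f: "f : Hom (Fdom (Nsrc t *. F)) x y"
  then have "f : Arr (Fdom F)" using HomD by auto
  then show "Ncomp t (Fobj F y) *[Fcod (Nsrc t *. F)] Farr (Nsrc t *. F) f = Farr (Ntgt t *. F) f *[Fcod (Nsrc t *. F)] Ncomp t (Fobj F x)"
   using t(6)[OF F(4)] f by simp
 qed (use t F assms in \<open>auto intro!: is_functor_compF\<close>)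
qed

lemma is_ntrans_inv_nat:
 assumes "nat_iso t"
 shows "is_ntrans (inv_nat t)"
proof -
 have t0: "is_ntrans t" and i: "\<And>x. x : Obj (Fdom (Nsrc t)) ==> iso_arr (Fcod (Nsrc t)) (Ncomp t x)"
  using assms by (auto simp: nat_iso_def)
 note t = ntD[OF t0 refl refl refl refl]
 let ?C = "Fdom (Nsrc t)" and ?D = "Fcod (Nsrc t)"
 have C: "category ?C" and D: "category ?D" using is_functorD(1,2)[OF t(1) refl refl] .
 show ?thesis unfolding inv_nat_def
 proof (rule is_ntrans_mk_nat)
  fix x assume "x : Obj (Fdom (Ntgt t))"
  then show "inv_arr ?D (Ncomp t x) : Hom (Fcod (Ntgt t)) (Fobj (Ntgt t) x) (Fobj (Nsrc t) x)"
   using inv_arr(1)[OF D t(5) i] t(3,4) by simp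
 next
  fix f x y assume "f : Hom (Fdom (Ntgt t)) x y"
  then have f: "f : Hom ?C x y" by (simp add: t)
  note xy = cat_ob[OF C f] and Ff = is_functorD(4)[OF t(1) refl refl f] and Gf = is_functorD(4)[OF t(2-4) f]
  note X = t(5)[OF xy(1)] and Y = t(5)[OF xy(2)]
  note X' = inv_arr[OF D X i[OF xy(1)]] and Y' = inv_arr[OF D Y i[OF xy(2)]]
  have "inv_arr ?D (Ncomp t y) *[?D] Farr (Ntgt t) f
    = inv_arr ?D (Ncomp t y) *[?D] ((Farr (Ntgt t) f *[?D] Ncomp t x) *[?D] inv_arr ?D (Ncomp t x))"
   using inv_cancel(3)[OF D X i[OF xy(1)] Gf] by simp
  also have "\<dots> = (inv_arr ?D (Ncomp t y) *[?D] (Ncomp t y *[?D] Farr (Nsrc t) f)) *[?D] inv_arr ?D (Ncomp t x)"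
   using cat_assoc[OF D Y'(1) cat_comp[OF D Y Ff] X'(1)] t(6)[OF f] by simp
  also have "\<dots> = Farr (Nsrc t) f *[?D] inv_arr ?D (Ncomp t x)"
   using inv_cancel(1)[OF D Y i[OF xy(2)] Ff] by simp
  finally show "inv_arr ?D (Ncomp t y) *[Fcod (Ntgt t)] Farr (Ntgt t) f
    = Farr (Nsrc t) f *[Fcod (Ntgt t)] inv_arr ?D (Ncomp t x)" by (simp add: t)
 qed (use t in auto)
qed

section \<open>Universal arrows\<close>

definition is_fun :: "('o, 'm, 'p, 'n) funct => ('o, 'm) cat => ('p, 'n) cat => bool" where
 "is_fun F C C' \<longleftrightarrow> is_functor F & Fdom F = C & Fcod F = C'"

lemma funD:
 assumes "is_fun F C C'"
 shows "is_functor F" "Fdom F = C" "Fcod F = C'" "category C" "category C'"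
 using assms is_functorD(1,2)[OF _ refl refl, of F] unfolding is_fun_def by auto

lemma fobj: "is_fun F C C' ==> x : Obj C ==> Fobj F x : Obj C'"
 and fhom: "is_fun F C C' ==> f : Hom C x y ==> Farr F f : Hom C' (Fobj F x) (Fobj F y)"
 and fident: "is_fun F C C' ==> x : Obj C ==> Farr F (Id C x) = Id C' (Fobj F x)"
 and fcomp: "is_fun F C C' ==> g : Hom C y z ==> f : Hom C x y ==> Farr F (g *[C] f) = Farr F g *[C'] Farr F f"
 and fiso: "is_fun F C C' ==> f : Hom C x y ==> iso_arr C f ==> iso_arr C' (Farr F f)"
 and finv: "is_fun F C C' ==> f : Hom C x y ==> iso_arr C f ==> inv_arr C' (Farr F f) = Farr F (inv_arr C f)"
 unfolding is_fun_def using is_functorD functor_iso by metis+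

lemma comp_fun: "is_fun F C C' ==> is_fun G C' C'' ==> is_fun (G *. F) C C''"
 unfolding is_fun_def by (auto intro: is_functor_compF)

lemma is_fun_idF: "category C ==> is_fun (idF C) C C"
 unfolding is_fun_def using is_functor_idF by auto

lemma compF_obj: "is_fun F C C' ==> x : Obj C ==> Fobj (G *. F) x = Fobj G (Fobj F x)"
 and compF_arr: "is_fun F C C' ==> f : Hom C x y ==> Farr (G *. F) f = Farr G (Farr F f)"
 by (auto simp: is_fun_def Hom_def)

text \<open>In the notation of comma categories: \<open>(Y, f)\<close> is initial in \<open>(X/R)\<close>; \<open>couniv\<close> is the dual notion.\<close>

definition univ :: "('p, 'n, 'o, 'm) funct => 'o => 'p => 'm => bool" where
 "univ R X Y f \<longleftrightarrow> Y : Obj (Fdom R) & f : Hom (Fcod R) X (Fobj R Y) &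
  (\<forall>Z\<in>Obj (Fdom R). \<forall>g\<in>Hom (Fcod R) X (Fobj R Z).
   \<exists>!h. h : Hom (Fdom R) Y Z & Farr R h *[Fcod R] f = g)"

definition couniv :: "('p, 'n, 'o, 'm) funct => 'o => 'p => 'm => bool" where
 "couniv L Y X f \<longleftrightarrow> X : Obj (Fdom L) & f : Hom (Fcod L) (Fobj L X) Y &
  (\<forall>Z\<in>Obj (Fdom L). \<forall>g\<in>Hom (Fcod L) (Fobj L Z) Y.
   \<exists>!h. h : Hom (Fdom L) Z X & f *[Fcod L] Farr L h = g)"

subsection \<open>Universal arrows to a functor\<close>

context
 fixes R :: "('p, 'n, 'o, 'm) funct" and C' C
 assumes R: "is_fun R C' C"
begin

lemma univD:
 assumes "univ R X Y f"
 shows "Y : Obj C'" "f : Hom C X (Fobj R Y)" "X : Obj C"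
  "g : Hom C X (Fobj R Z) ==> Z : Obj C' ==> \<exists>h. h : Hom C' Y Z & Farr R h *[C] f = g"
  "h : Hom C' Y Z ==> h' : Hom C' Y Z ==> Farr R h *[C] f = Farr R h' *[C] f ==> h = h'"
proof -
 show 1: "Y : Obj C'" "f : Hom C X (Fobj R Y)"
  and "g : Hom C X (Fobj R Z) ==> Z : Obj C' ==> \<exists>h. h : Hom C' Y Z & Farr R h *[C] f = g"
  using assms R unfolding univ_def is_fun_def by blast+
 show "X : Obj C" using cat_ob[OF funD(5)[OF R] 1(2)] by simp
 assume h: "h : Hom C' Y Z" "h' : Hom C' Y Z" "Farr R h *[C] f = Farr R h' *[C] f"
 have "Z : Obj C'" using cat_ob[OF funD(4)[OF R] h(1)] by simp
 moreover have "Farr R h *[C] f : Hom C X (Fobj R Z)"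
  using cat_comp[OF funD(5)[OF R] fhom[OF R h(1)] 1(2)] .
 ultimately have "\<exists>!k. k : Hom C' Y Z & Farr R k *[C] f = Farr R h *[C] f"
  using assms R unfolding univ_def is_fun_def by blast
 then show "h = h'" using h by metis
qed

lemma univI:
 assumes "Y : Obj C'" "f : Hom C X (Fobj R Y)"
  "\<And>Z g. Z : Obj C' ==> g : Hom C X (Fobj R Z) ==> \<exists>h. h : Hom C' Y Z & Farr R h *[C] f = g"
  "\<And>Z h h'. h : Hom C' Y Z ==> h' : Hom C' Y Z ==> Farr R h *[C] f = Farr R h' *[C] f ==> h = h'"
 shows "univ R X Y f"
 using assms R unfolding univ_def is_fun_def by blast

text \<open>Universal arrows from the same object are uniquely isomorphic.\<close>

lemma univ_factor_iso:
 assumes f: "univ R X Y f" and g: "univ R X Y' g"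
  and h: "h : Hom C' Y Y'" "Farr R h *[C] f = g"
 shows "iso_arr C' h"
proof -
 note C' = funD(4)[OF R] and C = funD(5)[OF R]
 note F = univD[OF f] and G = univD[OF g]
 obtain k where k: "k : Hom C' Y' Y" "Farr R k *[C] g = f" using G(4)[OF F(2,1)] by auto
 have "Farr R (k *[C'] h) *[C] f = Farr R (Id C' Y) *[C] f"
  using cat_assoc[OF C fhom[OF R k(1)] fhom[OF R h(1)] F(2)] h(2) k(2)
   fcomp[OF R k(1) h(1)] fident[OF R F(1)] cat_idl[OF C F(2)] by simp
 then have 1: "k *[C'] h = Id C' Y" using F(5)[OF cat_comp[OF C' k(1) h(1)] cat_id[OF C' F(1)]] by simp
 have "Farr R (h *[C'] k) *[C] g = Farr R (Id C' Y') *[C] g"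
  using cat_assoc[OF C fhom[OF R h(1)] fhom[OF R k(1)] G(2)] h(2) k(2)
   fcomp[OF R h(1) k(1)] fident[OF R G(1)] cat_idl[OF C G(2)] by simp
 then have 2: "h *[C'] k = Id C' Y'" using G(5)[OF cat_comp[OF C' h(1) k(1)] cat_id[OF C' G(1)]] by simp
 show ?thesis using iso_arrI(1)[OF C' h(1) k(1) 1 2] .
qed

lemma univ_postcomp_iso:
 assumes f: "univ R X Y f" and h: "h : Hom C' Y Y'" "iso_arr C' h"
 shows "univ R X Y' (Farr R h *[C] f)"
proof (rule univI)
 note C' = funD(4)[OF R] and C = funD(5)[OF R] and F = univD[OF f] and i = inv_arr[OF funD(4)[OF R] h]
 note Rh = fhom[OF R h(1)]
 have as: "Farr R k *[C] (Farr R h *[C] f) = Farr R (k *[C'] h) *[C] f" if "k : Hom C' Y' Z" for k Z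
  using cat_assoc[OF C fhom[OF R that] Rh F(2)] fcomp[OF R that h(1)] by simp
 show "Y' : Obj C'" "Farr R h *[C] f : Hom C X (Fobj R Y')"
  using cat_ob[OF C' h(1)] cat_comp[OF C Rh F(2)] by auto
 fix Z g assume "Z : Obj C'" "g : Hom C X (Fobj R Z)"
 then obtain k where k: "k : Hom C' Y Z" "Farr R k *[C] f = g" using F(4) by blast
 have "k *[C'] inv_arr C' h : Hom C' Y' Z" using cat_comp[OF C' k(1) i(1)] .
 then show "\<exists>k. k : Hom C' Y' Z & Farr R k *[C] (Farr R h *[C] f) = g"
  using as[OF cat_comp[OF C' k(1) i(1)]] k inv_cancel(4)[OF C' h k(1)] by (intro exI[of _ "k *[C'] inv_arr C' h"]) simp
next
 note C' = funD(4)[OF R] and C = funD(5)[OF R] and F = univD[OF f] and Rh = fhom[OF R h(1)]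
 fix Z k k' assume k: "k : Hom C' Y' Z" "k' : Hom C' Y' Z"
  "Farr R k *[C] (Farr R h *[C] f) = Farr R k' *[C] (Farr R h *[C] f)"
 have "k *[C'] h = k' *[C'] h"
  using F(5)[OF cat_comp[OF C' k(1) h(1)] cat_comp[OF C' k(2) h(1)]] k(3)
   cat_assoc[OF C fhom[OF R k(1)] Rh F(2)] fcomp[OF R k(1) h(1)]
   cat_assoc[OF C fhom[OF R k(2)] Rh F(2)] fcomp[OF R k(2) h(1)] by simp
 then show "k = k'" using inv_cancel(3)[OF C' h k(1)] inv_cancel(3)[OF C' h k(2)] by metis
qed

lemma univ_precomp_iso:
 assumes f: "univ R X Y f" and e: "e : Hom C X' X" "iso_arr C e"
 shows "univ R X' Y (f *[C] e)"
proof (rule univI)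
 note C' = funD(4)[OF R] and C = funD(5)[OF R] and F = univD[OF f]
 note i = inv_arr[OF C e]
 show "Y : Obj C'" "f *[C] e : Hom C X' (Fobj R Y)" using F cat_comp[OF C F(2) e(1)] by auto
 have as: "Farr R k *[C] (f *[C] e) = (Farr R k *[C] f) *[C] e" if "k : Hom C' Y Z" for k Z
  using cat_assoc[OF C fhom[OF R that] F(2) e(1)] by simp
 { fix Z g assume Z: "Z : Obj C'" and g: "g : Hom C X' (Fobj R Z)"
  obtain h where "h : Hom C' Y Z" "Farr R h *[C] f = g *[C] inv_arr C e"
   using F(4)[OF cat_comp[OF C g i(1)] Z] by auto
  then show "\<exists>h. h : Hom C' Y Z & Farr R h *[C] (f *[C] e) = g"
   using as inv_cancel(4)[OF C e g] by auto }
 fix Z h h' assume h: "h : Hom C' Y Z" "h' : Hom C' Y Z" "Farr R h *[C] (f *[C] e) = Farr R h' *[C] (f *[C] e)"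
 then have "((Farr R h *[C] f) *[C] e) *[C] inv_arr C e = ((Farr R h' *[C] f) *[C] e) *[C] inv_arr C e"
  using as by simp
 then have "Farr R h *[C] f = Farr R h' *[C] f"
  using inv_cancel(3)[OF C e cat_comp[OF C fhom[OF R h(1)] F(2)]]
   inv_cancel(3)[OF C e cat_comp[OF C fhom[OF R h(2)] F(2)]] by simp
 then show "h = h'" using F(5) h by blast
qed

lemma univ_postcomp_iso_iff:
 assumes f: "f : Hom C X (Fobj R Y)" and h: "h : Hom C' Y Y'" "iso_arr C' h"
 shows "univ R X Y' (Farr R h *[C] f) \<longleftrightarrow> univ R X Y f"
proof
 note C' = funD(4)[OF R]
 assume "univ R X Y' (Farr R h *[C] f)"
 from univ_postcomp_iso[OF this inv_arr(1,4)[OF C' h]]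
 show "univ R X Y f"
  using inv_cancel(1)[OF funD(5)[OF R] fhom[OF R h(1)] fiso[OF R h] f]
   finv[OF R h] by simp
qed (rule univ_postcomp_iso[OF _ h])

text \<open>Composing with the universal arrow to the intermediate object, which corresponds to \<open>(S R)\<^sub>! = S\<^sub>! R\<^sub>!\<close>
for left adjoints.\<close>

lemma univ_comp_iff:
 assumes f: "univ R X Y f" and S: "is_fun S C'' C'" and Z: "Z : Obj C''" and g: "g : Hom C' Y (Fobj S Z)"
 shows "univ (R *. S) X Z (Farr R g *[C] f) \<longleftrightarrow> univ S Y Z g"
proof -
 note C' = funD(4)[OF R] and C = funD(5)[OF R] and F = univD[OF f] and C'' = funD(4)[OF S]
 note T = comp_fun[OF S R]
 have gf: "Farr R g *[C] f : Hom C X (Fobj (R *. S) Z)"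
  using cat_comp[OF C fhom[OF R g] F(2)] by (simp add: compF_obj[OF S Z])
 have as: "Farr (R *. S) h *[C] (Farr R g *[C] f) = Farr R (Farr S h *[C'] g) *[C] f"
  "Farr S h *[C'] g : Hom C' Y (Fobj S W)" if h: "h : Hom C'' Z W" for h W
  using cat_assoc[OF C fhom[OF R fhom[OF S h]] fhom[OF R g] F(2)]
   fcomp[OF R fhom[OF S h] g] cat_comp[OF C' fhom[OF S h] g] by (auto simp: compF_arr[OF S h])
 note [simp] = funD(2,3)[OF S] funD(2,3)[OF R]
 show ?thesis
 proof
  assume u: "univ S Y Z g"
  have U: "\<And>k W. W : Obj C'' ==> k : Hom C' Y (Fobj S W) ==> \<exists>!h. h : Hom C'' Z W & Farr S h *[C'] g = k"
   using u unfolding univ_def by simp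
  show "univ (R *. S) X Z (Farr R g *[C] f)" unfolding univ_def
  proof (intro conjI ballI)
   fix W k assume W: "W : Obj (Fdom (R *. S))" and k: "k : Hom (Fcod (R *. S)) X (Fobj (R *. S) W)"
   have W': "W : Obj C''" using W by simp
   have k': "k : Hom C X (Fobj R (Fobj S W))" using k by (simp add: compF_obj[OF S W'])
   obtain l where l: "l : Hom C' Y (Fobj S W)" "Farr R l *[C] f = k"
    using F(4)[OF k' fobj[OF S W']] by auto
   have "(h : Hom C'' Z W & Farr (R *. S) h *[C] (Farr R g *[C] f) = k) \<longleftrightarrow> (h : Hom C'' Z W & Farr S h *[C'] g = l)" for h
    using as(1)[of h W] as(2)[of h W] F(5)[OF _ l(1)] l(2) by metis
   then show "\<exists>!h. h : Hom (Fdom (R *. S)) Z W & Farr (R *. S) h *[Fcod (R *. S)] (Farr R g *[C] f) = k"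
    using U[OF W' l(1)] by simp
  qed (use gf Z in auto)
 next
  assume u: "univ (R *. S) X Z (Farr R g *[C] f)"
  have U: "\<And>k W. W : Obj C'' ==> k : Hom C X (Fobj R (Fobj S W)) ==> \<exists>!h. h : Hom C'' Z W & Farr (R *. S) h *[C] (Farr R g *[C] f) = k"
   using u unfolding univ_def by simp
  show "univ S Y Z g" unfolding univ_def
  proof (intro conjI ballI)
   fix W l assume W: "W : Obj (Fdom S)" and l: "l : Hom (Fcod S) Y (Fobj S W)"
   have W': "W : Obj C''" and l': "l : Hom C' Y (Fobj S W)" using W l by auto
   have k: "Farr R l *[C] f : Hom C X (Fobj R (Fobj S W))" using cat_comp[OF C fhom[OF R l'] F(2)] .
   have "(h : Hom C'' Z W & Farr (R *. S) h *[C] (Farr R g *[C] f) = Farr R l *[C] f) \<longleftrightarrow> (h : Hom C'' Z W & Farr S h *[C'] g = l)" for h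
    using as(1)[of h W] as(2)[of h W] F(5)[OF _ l'] by metis
   then show "\<exists>!h. h : Hom (Fdom S) Z W & Farr S h *[Fcod S] g = l"
    using U[OF W' k] by simp
  qed (use g Z in auto)
 qed
qed

end

lemma univ_idF:
 assumes C: "category C" and f: "f : Hom C X Y"
 shows "univ (idF C) X Y f \<longleftrightarrow> iso_arr C f"
proof -
 note I = is_fun_idF[OF C] and XY = cat_ob[OF C f]
 have u: "univ (idF C) X X (Id C X)"
 proof (rule univI[OF I])
  show "Id C X : Hom C X (Fobj (idF C) X)" using cat_id[OF C XY(1)] XY by simp
  fix Z g assume Z: "Z : Obj C" "g : Hom C X (Fobj (idF C) Z)"
  then show "\<exists>h. h : Hom C X Z & Farr (idF C) h *[C] Id C X = g"
   using cat_idr[OF C, of g X Z] HomD(1)[of g C] by (intro exI[of _ g]) auto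
 next
  fix Z h h' assume "h : Hom C X Z" "h' : Hom C X Z" "Farr (idF C) h *[C] Id C X = Farr (idF C) h' *[C] Id C X"
  then show "h = h'" using cat_idr[OF C, of _ X Z] HomD(1) by (metis idF_simps(4))
 qed (use XY in auto)
 have e: "Farr (idF C) f *[C] Id C X = f" using f HomD(1)[OF f] cat_idr[OF C f] by simp
 show ?thesis
  using univ_factor_iso[OF I u _ f e] univ_postcomp_iso[OF I u f] e by auto
qed

subsection \<open>Adjunctions and universal arrows\<close>

lemma adjD:
 assumes a: "adjunction L R \<eta> \<epsilon>" and L: "is_fun L C C'"
 shows "is_fun R C' C"
  "x : Obj C ==> Ncomp \<eta> x : Hom C x (Fobj R (Fobj L x))"
  "y : Obj C' ==> Ncomp \<epsilon> y : Hom C' (Fobj L (Fobj R y)) y"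
  "f : Hom C x x' ==> Farr R (Farr L f) *[C] Ncomp \<eta> x = Ncomp \<eta> x' *[C] f"
  "g : Hom C' y y' ==> Ncomp \<epsilon> y' *[C'] Farr L (Farr R g) = g *[C'] Ncomp \<epsilon> y"
  "x : Obj C ==> Ncomp \<epsilon> (Fobj L x) *[C'] Farr L (Ncomp \<eta> x) = Id C' (Fobj L x)"
  "y : Obj C' ==> Farr R (Ncomp \<epsilon> y) *[C] Ncomp \<eta> (Fobj R y) = Id C (Fobj R y)"
proof -
 note Ls = funD[OF L]
 show R: "is_fun R C' C" using a Ls unfolding adjunction_def is_fun_def by auto
 note Rs = funD[OF R]
 have e: "is_ntrans \<eta>" "Nsrc \<eta> = idF C" "Ntgt \<eta> = R *. L" "is_ntrans \<epsilon>" "Nsrc \<epsilon> = L *. R" "Ntgt \<epsilon> = idF C'"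
  and t: "(\<epsilon> *R L) *N (L *L \<eta>) = idN L" "(R *L \<epsilon>) *N (\<eta> *R R) = idN R"
  using a Ls Rs unfolding adjunction_def by auto
 note E = ntD[OF e(1,2,3), simplified, OF refl refl] and E' = ntD[OF e(4,5,6), simplified, OF Rs(2) Ls(3)]
 show "x : Obj C ==> Ncomp \<eta> x : Hom C x (Fobj R (Fobj L x))" using E(5)[of x] Ls by simp
 show "y : Obj C' ==> Ncomp \<epsilon> y : Hom C' (Fobj L (Fobj R y)) y" using E'(5)[of y] Rs by simp
 show "f : Hom C x x' ==> Farr R (Farr L f) *[C] Ncomp \<eta> x = Ncomp \<eta> x' *[C] f"
  using E(6)[of f x x'] Ls HomD(1)[of f C] by simp
 show "g : Hom C' y y' ==> Ncomp \<epsilon> y' *[C'] Farr L (Farr R g) = g *[C'] Ncomp \<epsilon> y"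
  using E'(6)[of g y y'] Rs HomD(1)[of g C'] by simp
 show "x : Obj C ==> Ncomp \<epsilon> (Fobj L x) *[C'] Farr L (Ncomp \<eta> x) = Id C' (Fobj L x)"
  using arg_cong[OF t(1), of "\<lambda>t. Ncomp t x"] e Ls by simp
 show "y : Obj C' ==> Farr R (Ncomp \<epsilon> y) *[C] Ncomp \<eta> (Fobj R y) = Id C (Fobj R y)"
  using arg_cong[OF t(2), of "\<lambda>t. Ncomp t y"] e Rs fobj[OF R] by simp
qed

lemma adj_univ:
 assumes a: "adjunction L R \<eta> \<epsilon>" and L: "is_fun L C C'" and x: "x : Obj C"
 shows "univ R x (Fobj L x) (Ncomp \<eta> x)"
proof (rule univI[OF adjD(1)[OF a L]])
 note A = adjD[OF a L]
 note R = A(1) and C = funD(4)[OF L] and C' = funD(5)[OF L]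
 show "Fobj L x : Obj C'" "Ncomp \<eta> x : Hom C x (Fobj R (Fobj L x))"
  using A(2)[OF x] fobj[OF L x] by auto
 { fix Z g assume Z: "Z : Obj C'" and g: "g : Hom C x (Fobj R Z)"
  note Lg = fhom[OF L g]
  have "Farr R (Ncomp \<epsilon> Z *[C'] Farr L g) *[C] Ncomp \<eta> x = g"
   using fcomp[OF R A(3)[OF Z] Lg] cat_assoc[OF C fhom[OF R A(3)[OF Z]] fhom[OF R Lg] A(2)[OF x]]
    A(4)[OF g] cat_assoc[OF C fhom[OF R A(3)[OF Z]] A(2)[OF fobj[OF R Z]] g] A(7)[OF Z] cat_idl[OF C g]
   by simp
  then show "\<exists>h. h : Hom C' (Fobj L x) Z & Farr R h *[C] Ncomp \<eta> x = g"
   using cat_comp[OF C' A(3)[OF Z] Lg] by blast }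
 have *: "h = Ncomp \<epsilon> Z *[C'] Farr L (Farr R h *[C] Ncomp \<eta> x)" if h: "h : Hom C' (Fobj L x) Z" for h Z
 proof -
  note Z = cat_ob(2)[OF C' h] and Rh = fhom[OF R h]
  show ?thesis
   using fcomp[OF L Rh A(2)[OF x]] cat_assoc[OF C' A(3)[OF Z] fhom[OF L Rh] fhom[OF L A(2)[OF x]]]
    A(5)[OF h] cat_assoc[OF C' h A(3)[OF fobj[OF L x]] fhom[OF L A(2)[OF x]]] A(6)[OF x] cat_idr[OF C' h]
   by simp
 qed
 fix Z h h' assume "h : Hom C' (Fobj L x) Z" "h' : Hom C' (Fobj L x) Z" "Farr R h *[C] Ncomp \<eta> x = Farr R h' *[C] Ncomp \<eta> x"
 then show "h = h'" using * by metis
qed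

text \<open>The transpose of \<open>f\<close> is the comparison with the unit.\<close>

lemma adjunction_transpose:
 assumes a: "adjunction L R \<eta> \<epsilon>" and L: "is_fun L C C'" and f: "f : Hom C x (Fobj R y)" and y: "y : Obj C'"
 shows "Ncomp \<epsilon> y *[C'] Farr L f : Hom C' (Fobj L x) y"
  "Farr R (Ncomp \<epsilon> y *[C'] Farr L f) *[C] Ncomp \<eta> x = f"
  "univ R x y f \<longleftrightarrow> iso_arr C' (Ncomp \<epsilon> y *[C'] Farr L f)"
proof -
 note A = adjD[OF a L]
 note R = A(1) and C = funD(4)[OF L] and C' = funD(5)[OF L] and x = cat_ob(1)[OF funD(4)[OF L] f]
 note Lf = fhom[OF L f]
 show 1: "Ncomp \<epsilon> y *[C'] Farr L f : Hom C' (Fobj L x) y" using cat_comp[OF C' A(3)[OF y] Lf] .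
 show 2: "Farr R (Ncomp \<epsilon> y *[C'] Farr L f) *[C] Ncomp \<eta> x = f"
  using fcomp[OF R A(3)[OF y] Lf] cat_assoc[OF C fhom[OF R A(3)[OF y]] fhom[OF R Lf] A(2)[OF x]]
   A(4)[OF f] cat_assoc[OF C fhom[OF R A(3)[OF y]] A(2)[OF fobj[OF R y]] f] A(7)[OF y] cat_idl[OF C f]
  by simp
 note u = adj_univ[OF a L x]
 show "univ R x y f \<longleftrightarrow> iso_arr C' (Ncomp \<epsilon> y *[C'] Farr L f)"
  using univ_factor_iso[OF R u _ 1 2] univ_postcomp_iso[OF R u 1] 2 by auto
qed

lemma adjunctionI:
 assumes L: "is_fun L C C'" and R: "is_fun R C' C"
  and e: "is_ntrans \<eta>" "Nsrc \<eta> = idF C" "Ntgt \<eta> = R *. L" 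
  and e': "is_ntrans \<epsilon>" "Nsrc \<epsilon> = L *. R" "Ntgt \<epsilon> = idF C'"
  and t1: "\<And>x. x : Obj C ==> Ncomp \<epsilon> (Fobj L x) *[C'] Farr L (Ncomp \<eta> x) = Id C' (Fobj L x)"
  and t2: "\<And>y. y : Obj C' ==> Farr R (Ncomp \<epsilon> y) *[C] Ncomp \<eta> (Fobj R y) = Id C (Fobj R y)"
 shows "adjunction L R \<eta> \<epsilon>"
proof -
 note Ls = funD[OF L] and Rs = funD[OF R]
 note [simp] = e e' Ls(1-3) Rs(1-3)
 have w: "is_ntrans (\<epsilon> *R L)" "is_ntrans (L *L \<eta>)" "is_ntrans (R *L \<epsilon>)" "is_ntrans (\<eta> *R R)"
  by (auto intro!: is_ntrans_whiskL is_ntrans_whiskR)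
 have as: "(L *. R) *. L = L *. (R *. L)" "(R *. L) *. R = R *. (L *. R)"
  by (rule compF_assoc; simp)+
 note [simp] = compF_idF idF_compF fobj[OF L] fobj[OF R]
 have 1: "(\<epsilon> *R L) *N (L *L \<eta>) = idN L"
  by (rule ntrans_eqI) (use w as t1 in \<open>auto intro!: is_ntrans_vcomp is_ntrans_idN\<close>)
 have 2: "(R *L \<epsilon>) *N (\<eta> *R R) = idN R"
  by (rule ntrans_eqI) (use w as t2 in \<open>auto intro!: is_ntrans_vcomp is_ntrans_idN\<close>)
 show ?thesis unfolding adjunction_def using 1 2 by simp
qed

text \<open>A functor to which every object has a universal arrow has a left adjoint.\<close>

lemma left_adjoint_exists:
 assumes R: "is_fun R C' C" and ex: "\<And>x. x : Obj C ==> \<exists>y f. univ R x y f"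
 obtains L \<eta> \<epsilon> where "is_fun L C C'" "adjunction L R \<eta> \<epsilon>"
proof -
 note C' = funD(4)[OF R] and C = funD(5)[OF R]
 obtain l e where u: "\<And>x. x : Obj C ==> univ R x (l x) (e x)" using ex by metis
 note U = univD[OF R u]
 define m where "m f = (SOME h. h : Hom C' (l (Dom C f)) (l (Cod C f)) & Farr R h *[C] e (Dom C f) = e (Cod C f) *[C] f)" for f
 have m: "m f : Hom C' (l x) (l y)" "Farr R (m f) *[C] e x = e y *[C] f" if f: "f : Hom C x y" for f x y
 proof -
  note xy = cat_ob[OF C f]
  have "\<exists>h. h : Hom C' (l x) (l y) & Farr R h *[C] e x = e y *[C] f"
   using U(4)[OF xy(1) cat_comp[OF C U(2)[OF xy(2)] f] U(1)[OF xy(2)]] .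
  from someI_ex[OF this] show "m f : Hom C' (l x) (l y)" "Farr R (m f) *[C] e x = e y *[C] f"
   unfolding m_def HomD[OF f] by auto
 qed
 define L where "L = mk_fun C C' l m"
 have Lf: "is_functor L" unfolding L_def
 proof (rule is_functor_mk_fun[OF C C' U(1)])
  fix x assume x: "x : Obj C"
  show "m (Id C x) = Id C' (l x)"
   using U(5)[OF x m(1)[OF cat_id[OF C x]] cat_id[OF C' U(1)[OF x]]] m(2)[OF cat_id[OF C x]]
    cat_idr[OF C U(2)[OF x]] cat_idl[OF C U(2)[OF x]] fident[OF R U(1)[OF x]] by simp
 next
  fix g f x y z assume g: "g : Hom C y z" and f: "f : Hom C x y"
  note x = cat_ob(1)[OF C f] and y = cat_ob(1)[OF C g] and z = cat_ob(2)[OF C g]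
  note gf = cat_comp[OF C g f] and mm = fcomp[OF R m(1)[OF g] m(1)[OF f]]
  have "Farr R (m (g *[C] f)) *[C] e x = Farr R (m g *[C'] m f) *[C] e x"
   using m(2)[OF gf] m(2)[OF f] m(2)[OF g] mm
    cat_assoc[OF C fhom[OF R m(1)[OF g]] fhom[OF R m(1)[OF f]] U(2)[OF x]]
    cat_assoc[OF C fhom[OF R m(1)[OF g]] U(2)[OF y] f] cat_assoc[OF C U(2)[OF z] g f] by simp
  then show "m (g *[C] f) = m g *[C'] m f"
   using U(5)[OF x m(1)[OF gf] cat_comp[OF C' m(1)[OF g] m(1)[OF f]]] by simp
 qed (use m in auto)
 then have L: "is_fun L C C'" unfolding is_fun_def L_def by simp
 have [simp]: "Fdom L = C" "Fcod L = C'" "Fdom R = C'" "Fcod R = C" "is_functor L" "is_functor R"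
  using funD[OF L] funD[OF R] by auto
 have Lo: "x : Obj C ==> Fobj L x = l x" for x by (simp add: L_def)
 have La: "f : Hom C x y ==> Farr L f = m f" for f x y using HomD(1) by (fastforce simp: L_def)
 define \<eta> where "\<eta> = mk_nat (idF C) (R *. L) e"
 have \<eta>: "is_ntrans \<eta>" "Nsrc \<eta> = idF C" "Ntgt \<eta> = R *. L" "\<And>x. x : Obj C ==> Ncomp \<eta> x = e x"
  unfolding \<eta>_def
 proof (rule is_ntrans_mk_nat)
  fix f x y assume "f : Hom (Fdom (idF C)) x y"
  then have f: "f : Hom C x y" by simp
  then show "e y *[Fcod (idF C)] Farr (idF C) f = Farr (R *. L) f *[Fcod (idF C)] e x"
   using m(2)[OF f] La[OF f] HomD(1)[OF f] by simp
 qed (use C U Lo in \<open>auto intro!: is_functor_idF is_functor_compF\<close>)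
 define c where "c y = (SOME h. h : Hom C' (l (Fobj R y)) y & Farr R h *[C] e (Fobj R y) = Id C (Fobj R y))" for y
 have c: "c y : Hom C' (l (Fobj R y)) y" "Farr R (c y) *[C] e (Fobj R y) = Id C (Fobj R y)" if y: "y : Obj C'" for y
 proof -
  note Ry = fobj[OF R y]
  have "\<exists>h. h : Hom C' (l (Fobj R y)) y & Farr R h *[C] e (Fobj R y) = Id C (Fobj R y)"
   using U(4)[OF Ry cat_id[OF C Ry] y] .
  from someI_ex[OF this] show "c y : Hom C' (l (Fobj R y)) y" "Farr R (c y) *[C] e (Fobj R y) = Id C (Fobj R y)"
   unfolding c_def by auto
 qed
 define \<epsilon> where "\<epsilon> = mk_nat (L *. R) (idF C') c"
 have \<epsilon>: "is_ntrans \<epsilon>" "Nsrc \<epsilon> = L *. R" "Ntgt \<epsilon> = idF C'" "\<And>y. y : Obj C' ==> Ncomp \<epsilon> y = c y"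
  unfolding \<epsilon>_def
 proof (rule is_ntrans_mk_nat)
  fix f x y assume "f : Hom (Fdom (L *. R)) x y"
  then have f: "f : Hom C' x y" by simp
  note x = cat_ob(1)[OF C' f] and y = cat_ob(2)[OF C' f] and Rf = fhom[OF R f]
  note Rx = fobj[OF R x] and Ry = fobj[OF R y]
  have "c y *[C'] m (Farr R f) = f *[C'] c x"
  proof (rule U(5)[OF Rx cat_comp[OF C' c(1)[OF y] m(1)[OF Rf]] cat_comp[OF C' f c(1)[OF x]]])
   have "Farr R (c y *[C'] m (Farr R f)) *[C] e (Fobj R x) = Farr R f"
    using fcomp[OF R c(1)[OF y] m(1)[OF Rf]] m(2)[OF Rf] c(2)[OF y] cat_idl[OF C Rf]
     cat_assoc[OF C fhom[OF R c(1)[OF y]] fhom[OF R m(1)[OF Rf]] U(2)[OF Rx]]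
     cat_assoc[OF C fhom[OF R c(1)[OF y]] U(2)[OF Ry] Rf] by simp
   moreover have "Farr R (f *[C'] c x) *[C] e (Fobj R x) = Farr R f"
    using fcomp[OF R f c(1)[OF x]] c(2)[OF x] cat_idr[OF C Rf]
     cat_assoc[OF C Rf fhom[OF R c(1)[OF x]] U(2)[OF Rx]] by simp
   ultimately show "Farr R (c y *[C'] m (Farr R f)) *[C] e (Fobj R x) = Farr R (f *[C'] c x) *[C] e (Fobj R x)" by simp
  qed
  then show "c y *[Fcod (L *. R)] Farr (L *. R) f = Farr (idF C') f *[Fcod (L *. R)] c x"
   using La[OF Rf] HomD(1)[OF f] by simp
 qed (use C' c Lo fobj[OF R] in \<open>auto intro!: is_functor_idF is_functor_compF\<close>)
 have "adjunction L R \<eta> \<epsilon>"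
 proof (rule adjunctionI[OF L R \<eta>(1-3) \<epsilon>(1-3)])
  fix y assume "y : Obj C'"
  then show "Farr R (Ncomp \<epsilon> y) *[C] Ncomp \<eta> (Fobj R y) = Id C (Fobj R y)"
   using c(2) \<eta>(4) \<epsilon>(4) fobj[OF R] by simp
 next
  fix x assume x: "x : Obj C"
  note y = U(1)[OF x] and Rl = fobj[OF R U(1)[OF x]]
  note me = m[OF U(2)[OF x]]
  have "c (l x) *[C'] m (e x) = Id C' (l x)"
   using U(5)[OF x cat_comp[OF C' c(1)[OF y] me(1)] cat_id[OF C' y]]
    fcomp[OF R c(1)[OF y] me(1)] me(2) c(2)[OF y] cat_idl[OF C U(2)[OF x]] fident[OF R y]
    cat_assoc[OF C fhom[OF R c(1)[OF y]] fhom[OF R me(1)] U(2)[OF x]]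
    cat_assoc[OF C fhom[OF R c(1)[OF y]] U(2)[OF Rl] U(2)[OF x]] by simp
  then show "Ncomp \<epsilon> (Fobj L x) *[C'] Farr L (Ncomp \<eta> x) = Id C' (Fobj L x)"
   using \<eta>(4)[OF x] \<epsilon>(4)[OF y] Lo[OF x] La[OF U(2)[OF x]] by simp
 qed
 then show ?thesis using that L by blast
qed



section \<open>Opposites\<close>

text \<open>The explicit record makes \<open>opc (opc C) = C\<close> an equality for categories, since composites of arrows that do not
match are undefined in both.\<close>

definition opc :: "('o, 'm) cat => ('o, 'm) cat" where
 "opc C = mk_cat (Obj C) (Arr C) (Cod C) (Dom C) (Id C) (\<lambda>g f. f *[C] g)"

definition opF :: "('o, 'm, 'p, 'n) funct => ('o, 'm, 'p, 'n) funct" where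
 "opF F = \<lparr>Fdom = opc (Fdom F), Fcod = opc (Fcod F), Fobj = Fobj F, Farr = Farr F\<rparr>"

definition opN :: "('o, 'm, 'p, 'n) ntrans => ('o, 'm, 'p, 'n) ntrans" where
 "opN t = \<lparr>Nsrc = opF (Ntgt t), Ntgt = opF (Nsrc t), Ncomp = Ncomp t\<rparr>"

lemma opc_simps [simp]: "Obj (opc C) = Obj C" "Arr (opc C) = Arr C" "Hom (opc C) x y = Hom C y x"
 "f : Arr C ==> Dom (opc C) f = Cod C f" "f : Arr C ==> Cod (opc C) f = Dom C f" "x : Obj C ==> Id (opc C) x = Id C x"
 by (auto simp: opc_def mk_cat_def Hom_def)

lemma opc_comp: "f : Hom C y z ==> g : Hom C x y ==> g *[opc C] f = f *[C] g"
 by (auto simp: opc_def mk_cat_def Hom_def)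

lemma category_op:
 assumes C: "category C"
 shows "category (opc C)"
 unfolding opc_def
proof (rule category_mk_cat)
 note a = cat_comp[OF C, unfolded Hom_def, simplified]
 show "h : Arr C ==> g : Arr C ==> f : Arr C ==> Dom C f = Cod C g ==> Dom C g = Cod C h ==> f *[C] (g *[C] h) = (f *[C] g) *[C] h" for f g h
  using cat_assoc[OF C, unfolded Hom_def, simplified] by simp
qed (auto simp: cat_dom[OF C] cat_cod[OF C] HomD[OF cat_id[OF C]] cat_comp[OF C, unfolded Hom_def, simplified] cat_idl[OF C HomI] cat_idr[OF C HomI])

lemma cat_eqI:
 assumes C: "category C" and D: "category D" and "Obj C = Obj D" and h: "\<And>x y. Hom C x y = Hom D x y"
  and i: "\<And>x. x : Obj C ==> Id C x = Id D x" and c: "\<And>f g x y z. g : Hom C y z ==> f : Hom C x y ==> g *[C] f = g *[D] f"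
 shows "C = (D :: ('o, 'm) cat)"
proof (rule cat.equality)
 have e: "f : Arr D & Dom D f = Dom C f & Cod D f = Cod C f" if "f : Arr C" for f
  using HomD[OF HomI[OF that, unfolded h]] by blast
 have e': "f : Arr C" if "f : Arr D" for f
  using HomD(1)[OF HomI[OF that, folded h]] .
 have a: "f : Arr C \<longleftrightarrow> f : Arr D" and d: "f : Arr C ==> Dom C f = Dom D f" "f : Arr C ==> Cod C f = Cod D f" for f
  using e e' by auto
 show A: "Arr C = Arr D" using a by blast
 have x: "Dom C : extensional (Arr C)" "Dom D : extensional (Arr C)" "Cod C : extensional (Arr C)" "Cod D : extensional (Arr C)"
  "Id C : extensional (Obj C)" "Id D : extensional (Obj C)"
  using C[unfolded category_def] D[unfolded category_def, folded A assms(3)] by (simp_all only: PiE_def Int_iff)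
 show "Dom C = Dom D" "Cod C = Cod D" by (rule extensionalityI[OF x(1,2) d(1)], assumption, rule extensionalityI[OF x(3,4) d(2)])
 show "Id C = Id D" by (rule extensionalityI[OF x(5,6) i])
 have u: "\<not> (g : Arr B & f : Arr B & Cod B f = Dom B g) ==> g *[B] f = undefined" if "category B" for B :: "('o, 'm) cat" and g f
  by (rule that[unfolded category_def, THEN conjunct2, THEN conjunct2, THEN conjunct2, THEN conjunct1, THEN spec, THEN spec, THEN mp])
 have "g *[C] f = g *[D] f" for g f
 proof (cases "g : Arr C & f : Arr C & Cod C f = Dom C g")
  case True
  then have "g : Hom C (Cod C f) (Cod C g)" "f : Hom C (Dom C f) (Cod C f)" by (simp_all add: Hom_def)
  then show ?thesis by (rule c)
 next
  case False
  moreover have "\<not> (g : Arr D & f : Arr D & Cod D f = Dom D g)"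
  proof
   assume g: "g : Arr D & f : Arr D & Cod D f = Dom D g"
   then have "g : Arr C" "f : Arr C" using a by auto
   from False this d(1)[OF this(1)] d(2)[OF this(2)] g show False by simp
  qed
  ultimately show ?thesis using u[OF C] u[OF D] by simp
 qed
 then show "Comp C = Comp D" by blast
qed (use assms(3) in simp_all)

lemma opc_opc:
 assumes C: "category C"
 shows "opc (opc C) = C"
 by (rule cat_eqI[OF category_op[OF category_op[OF C]] C]) (simp_all add: opc_comp[of _ "opc C"] opc_comp[of _ C])

lemma iso_op:
 assumes C: "category C" and f: "f : Hom C x y"
 shows "iso_arr (opc C) f \<longleftrightarrow> iso_arr C f" "iso_arr C f ==> inv_arr (opc C) f = inv_arr C f"
proof -
 have 1: "iso_arr (opc C) f & inv_arr (opc C) f = inv_arr C f" if i: "iso_arr C f" and C: "category C" and f: "f : Hom C x y" for C :: "('a, 'b) cat" and f x y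
 proof -
  note v = inv_arr[OF C f i] and o = cat_ob[OF C f]
  have h: "f : Hom (opc C) y x" "inv_arr C f : Hom (opc C) x y" using f v(1) by simp_all
  from iso_arrI[OF category_op[OF C] h] show ?thesis using opc_comp[OF f v(1)] opc_comp[OF v(1) f] v(2,3) o by simp
 qed
 show "iso_arr (opc C) f \<longleftrightarrow> iso_arr C f" using 1[OF _ C f] 1[OF _ category_op[OF C], of f y x] f opc_opc[OF C] by auto
 show "iso_arr C f ==> inv_arr (opc C) f = inv_arr C f" using 1[OF _ C f] by simp
qed

lemma opF_simps [simp]: "Fdom (opF F) = opc (Fdom F)" "Fcod (opF F) = opc (Fcod F)" "Fobj (opF F) = Fobj F" "Farr (opF F) = Farr F"
 and opN_simps [simp]: "Nsrc (opN t) = opF (Ntgt t)" "Ntgt (opN t) = opF (Nsrc t)" "Ncomp (opN t) = Ncomp t"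
 by (simp_all add: opF_def opN_def)

lemma is_fun_op:
 assumes F: "is_fun F C C'"
 shows "is_fun (opF F) (opc C) (opc C')"
proof -
 note f = funD[OF F]
 have "is_functor (opF F)" unfolding is_functor_def Let_def opF_simps f(2,3)
 proof (intro conjI ballI impI)
  show "category (opc C)" "category (opc C')" using category_op f(4,5) by auto
  show "Fobj F : Obj (opc C) \<rightarrow>\<^sub>E Obj (opc C')" "Farr F : extensional (Arr (opc C))"
   using f(1) f(2,3) unfolding is_functor_def Let_def by auto
 next
  fix h assume "h : Arr (opc C)"
  then show "Farr F h : Hom (opc C') (Fobj F (Dom (opc C) h)) (Fobj F (Cod (opc C) h))" using fhom[OF F HomI[of h C]] by simp
 next
  fix x assume "x : Obj (opc C)"
  then show "Farr F (Id (opc C) x) = Id (opc C') (Fobj F x)" using fident[OF F] fobj[OF F] by simp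
 next
  fix h k assume h: "h : Arr (opc C)" and k: "k : Arr (opc C)" and e: "Cod (opc C) k = Dom (opc C) h"
  have h': "h : Hom C (Dom C h) (Cod C h)" and k': "k : Hom C (Cod C h) (Cod C k)" using h k e by (auto simp: Hom_def)
  show "Farr F (h *[opc C] k) = Farr F h *[opc C'] Farr F k"
   unfolding opc_comp[OF k' h'] opc_comp[OF fhom[OF F k'] fhom[OF F h']] by (rule fcomp[OF F k' h'])
 qed
 then show ?thesis using f by (simp add: is_fun_def)
qed

lemma opF_opF: "is_fun F C C' ==> opF (opF F) = F"
 using funD[of F C C'] by (simp add: opF_def opc_opc)

lemma opF_compF: "opF (G *. F) = opF G *. opF F" and opF_idF: "opF (idF C) = idF (opc C)"
 by (simp_all add: opF_def compF_def idF_def mk_fun_def)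

lemma is_ntrans_op:
 assumes t: "is_ntrans t"
 shows "is_ntrans (opN t)"
proof -
 note T = ntD[OF t refl refl refl refl]
 let ?C = "Fdom (Nsrc t)" and ?D = "Fcod (Nsrc t)"
 have f: "is_fun (Nsrc t) ?C ?D" "is_fun (Ntgt t) ?C ?D" using T by (auto simp: is_fun_def)
 note fo = funD[OF is_fun_op[OF f(1)]] and fo' = funD[OF is_fun_op[OF f(2)]]
 show ?thesis unfolding is_ntrans_def Let_def opN_simps opF_simps
 proof (intro conjI ballI fo(1) fo'(1))
  show "opc (Fdom (Nsrc t)) = opc (Fdom (Ntgt t))" "opc (Fcod (Nsrc t)) = opc (Fcod (Ntgt t))" using T(3,4) by auto
  show "Ncomp t : extensional (Obj (opc (Fdom (Ntgt t))))" using t T(3) unfolding is_ntrans_def Let_def by auto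
 next
  fix x assume "x : Obj (opc (Fdom (Ntgt t)))"
  then show "Ncomp t x : Hom (opc (Fcod (Ntgt t))) (Fobj (Ntgt t) x) (Fobj (Nsrc t) x)" using T(3,4,5) by auto
 next
  fix h assume "h : Arr (opc (Fdom (Ntgt t)))"
  then have h: "h : Hom ?C (Dom ?C h) (Cod ?C h)" and a: "h : Arr ?C" using T(3) by (auto simp: Hom_def)
  note o = cat_ob[OF funD(4)[OF f(1)] h]
  show "Ncomp t (Cod (opc (Fdom (Ntgt t))) h) *[opc (Fcod (Ntgt t))] Farr (Ntgt t) h =
   Farr (Nsrc t) h *[opc (Fcod (Ntgt t))] Ncomp t (Dom (opc (Fdom (Ntgt t))) h)"
   unfolding T(3,4) opc_simps(4)[OF a] opc_simps(5)[OF a] opc_comp[OF fhom[OF f(2) h] T(5)[OF o(1)]]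
    opc_comp[OF T(5)[OF o(2)] fhom[OF f(1) h]] by (rule T(6)[OF h, symmetric])
 qed
qed

lemma opN_opN: "is_ntrans t ==> opN (opN t) = t"
 using opF_opF[of "Nsrc t"] opF_opF[of "Ntgt t"] ntD[of t, OF _ refl refl refl refl]
 by (simp add: opN_def is_fun_def)

lemma opN_idN:
 assumes F: "is_fun F C C'"
 shows "opN (idN F) = idN (opF F)"
 using fobj[OF F] funD(2,3)[OF F] by (auto simp: opN_def idN_def mk_nat_def restrict_def fun_eq_iff)

lemma opN_vcomp:
 assumes s: "is_ntrans s" and t: "is_ntrans t" and e: "Ntgt t = Nsrc s"
 shows "opN (s *N t) = opN t *N opN s"
proof -
 note T = ntD[OF t refl e refl refl] note S = ntD[OF s refl refl T(3,4)]
 have "Ncomp t x *[opc (Fcod (Ntgt s))] Ncomp s x = Ncomp s x *[Fcod (Nsrc t)] Ncomp t x" if "x : Obj (Fdom (Nsrc t))" for x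
  using opc_comp[OF S(5)[OF that] T(5)[OF that]] S(4) by simp
 then show ?thesis using S(3) by (auto simp: opN_def vcomp_def mk_nat_def restrict_def fun_eq_iff)
qed

lemma opN_whisk:
 assumes t: "is_ntrans t" 
 shows "opN (G *L t) = opF G *L opN t" "opN (t *R F) = opN t *R opF F"
 using ntD(3)[OF t refl refl refl refl] by (auto simp: opN_def whiskL_def whiskR_def mk_nat_def opF_compF)

lemma adjunction_op:
 assumes a: "adjunction L R \<eta> \<epsilon>"
 shows "adjunction (opF R) (opF L) (opN \<epsilon>) (opN \<eta>)"
proof -
 have L: "is_fun L (Fdom L) (Fcod L)" and R: "is_fun R (Fcod L) (Fdom L)"
  and n: "is_ntrans \<eta>" "Nsrc \<eta> = idF (Fdom L)" "Ntgt \<eta> = R *. L" and e: "is_ntrans \<epsilon>" "Nsrc \<epsilon> = L *. R" "Ntgt \<epsilon> = idF (Fdom R)"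
  and t: "(\<epsilon> *R L) *N (L *L \<eta>) = idN L" "(R *L \<epsilon>) *N (\<eta> *R R) = idN R"
  using a unfolding adjunction_def is_fun_def by auto
 note Ls = funD[OF L] and Rs = funD[OF R]
 note as = compF_assoc[OF Ls(1) Rs(1) Ls(1) _ Rs(3)] compF_assoc[OF Rs(1) Ls(1) Rs(1) Rs(3)]
 have w: "is_ntrans (\<epsilon> *R L)" "is_ntrans (L *L \<eta>)" "is_ntrans (R *L \<epsilon>)" "is_ntrans (\<eta> *R R)"
  using n e Ls Rs by (auto intro!: is_ntrans_whiskL is_ntrans_whiskR)
 have m: "Ntgt (L *L \<eta>) = Nsrc (\<epsilon> *R L)" "Ntgt (\<eta> *R R) = Nsrc (R *L \<epsilon>)" using n e as Ls Rs by simp_all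
 have "(opN \<eta> *R opF R) *N (opF R *L opN \<epsilon>) = idN (opF R)" "(opF L *L opN \<eta>) *N (opN \<epsilon> *R opF L) = idN (opF L)"
  using arg_cong[OF t(2), of opN] arg_cong[OF t(1), of opN]
  unfolding opN_vcomp[OF w(3,4) m(2)] opN_vcomp[OF w(1,2) m(1)] opN_whisk[OF n(1)] opN_whisk[OF e(1)] opN_idN[OF L] opN_idN[OF R] .
 then show ?thesis unfolding adjunction_def
  using funD(1)[OF is_fun_op[OF L]] funD(1)[OF is_fun_op[OF R]] is_ntrans_op[OF n(1)] is_ntrans_op[OF e(1)] n e Ls Rs
  by (simp add: opF_compF opF_idF)
qed

lemma couniv_op:
 assumes L: "is_fun L C' C"
 shows "couniv L Y X f \<longleftrightarrow> univ (opF L) Y X f"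
proof -
 note l = funD[OF L]
 have "(f *[C] Farr L h = g) \<longleftrightarrow> (Farr L h *[opc C] f = g)" if "f : Hom C (Fobj L X) Y" "h : Hom C' Z X" for h g Z
  using opc_comp[OF that(1) fhom[OF L that(2)]] by simp
 then show ?thesis unfolding couniv_def univ_def opF_simps l(2,3) opc_simps by (auto cong: conj_cong)
qed

lemma counivD:
 assumes L: "is_fun L C' C" and c: "couniv L Y X f"
 shows "X : Obj C'" "f : Hom C (Fobj L X) Y" "Y : Obj C"
  "g : Hom C (Fobj L Z) Y ==> Z : Obj C' ==> \<exists>h. h : Hom C' Z X & f *[C] Farr L h = g"
  "h : Hom C' Z X ==> h' : Hom C' Z X ==> f *[C] Farr L h = f *[C] Farr L h' ==> h = h'"
proof -
 show 1: "X : Obj C'" "f : Hom C (Fobj L X) Y"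
  and "g : Hom C (Fobj L Z) Y ==> Z : Obj C' ==> \<exists>h. h : Hom C' Z X & f *[C] Farr L h = g"
  using c L unfolding couniv_def is_fun_def by blast+
 show "Y : Obj C" using cat_ob[OF funD(5)[OF L] 1(2)] by simp
 assume h: "h : Hom C' Z X" "h' : Hom C' Z X" "f *[C] Farr L h = f *[C] Farr L h'"
 have "Z : Obj C'" using cat_ob[OF funD(4)[OF L] h(1)] by simp
 moreover have "f *[C] Farr L h : Hom C (Fobj L Z) Y"
  using cat_comp[OF funD(5)[OF L] 1(2) fhom[OF L h(1)]] .
 ultimately have "\<exists>!k. k : Hom C' Z X & f *[C] Farr L k = f *[C] Farr L h"
  using c L unfolding couniv_def is_fun_def by blast
 then show "h = h'" using h by metis
qed

lemma adjunction_couniv: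
 assumes a: "adjunction L R \<eta> \<epsilon>" and L: "is_fun L C C'" and y: "y : Obj C'"
 shows "couniv L y (Fobj R y) (Ncomp \<epsilon> y)"
 using adj_univ[OF adjunction_op[OF a] is_fun_op[OF adjD(1)[OF a L]]] y by (simp add: couniv_op[OF L])

lemma adjunction_cotranspose:
 assumes a: "adjunction L R \<eta> \<epsilon>" and L: "is_fun L C C'" and f: "f : Hom C' (Fobj L x) y" and x: "x : Obj C"
 shows "Farr R f *[C] Ncomp \<eta> x : Hom C x (Fobj R y)"
  "Ncomp \<epsilon> y *[C'] Farr L (Farr R f *[C] Ncomp \<eta> x) = f"
  "couniv L y x f \<longleftrightarrow> iso_arr C (Farr R f *[C] Ncomp \<eta> x)"
proof -
 note R = adjD(1)[OF a L] and n = adjD(2)[OF a L x] and C = funD(4)[OF L] and y = cat_ob(2)[OF funD(5)[OF L] f]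
 note k = adjD(3)[OF a L y]
 have f': "f : Hom (opc C') y (Fobj (opF L) x)" and x': "x : Obj (opc C)" using f x by simp_all
 note T = adjunction_transpose[OF adjunction_op[OF a] is_fun_op[OF R] f' x', unfolded opF_simps opN_simps opc_comp[OF fhom[OF R f] n] opc_simps]
 show h: "Farr R f *[C] Ncomp \<eta> x : Hom C x (Fobj R y)" by (rule T(1))
 show "Ncomp \<epsilon> y *[C'] Farr L (Farr R f *[C] Ncomp \<eta> x) = f"
  using T(2) unfolding opc_comp[OF k fhom[OF L h]] .
 show "couniv L y x f \<longleftrightarrow> iso_arr C (Farr R f *[C] Ncomp \<eta> x)"
  unfolding couniv_op[OF L] T(3) by (rule iso_op(1)[OF C h])
qed

section \<open>Small categories\<close>

lemma small_finite:
 assumes "infinite (UNIV :: 'k set)" "finite (S :: 'k uni set)"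
 shows "small S"
proof (rule ccontr)
 assume "\<not> small S"
 then have "|UNIV :: 'k set| \<le>o |S|"
  unfolding small_def by (simp add: not_ordLess_iff_ordLeq[OF card_of_Well_order card_of_Well_order])
 then show False using assms card_of_ordLeq_finite[of "UNIV :: 'k set" S] by simp
qed

lemma small_subset: "small T ==> S \<subseteq> T ==> small S"
 unfolding small_def using ordLeq_ordLess_trans[OF card_of_mono1] .

lemma small_image2:
 fixes S T :: "'k uni set" and h :: "'k uni => 'k uni => 'k uni"
 assumes "infinite (UNIV :: 'k set)" "small S" "small T"
 shows "small {h a b |a b. a : S & b : T}"
proof -
 have *: "|A \<times> B| <o |UNIV :: 'k set| & |B \<times> A| <o |UNIV :: 'k set|"
  if A: "small A" and B: "small B" "|B| \<le>o |A|" for A B :: "'k uni set"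
 proof (cases "finite A \<or> B = {}")
  case True
  then have "finite (A \<times> B)" "finite (B \<times> A)" using B(2) card_of_ordLeq_finite by auto
  moreover have "|X| <o |UNIV :: 'k set|" if "finite X" for X :: "('k uni \<times> 'k uni) set"
   using assms(1) that card_of_ordLeq_finite[of "UNIV :: 'k set" X]
    not_ordLess_iff_ordLeq[OF card_of_Well_order card_of_Well_order, of X "UNIV :: 'k set"] by blast
  ultimately show ?thesis by blast
 next
  case False
  then have e: "|A \<times> B| =o |A|" "|B \<times> A| =o |A|" using card_of_Times_infinite[OF _ _ B(2)] by auto
  show ?thesis using ordIso_ordLess_trans[OF e(1) A[unfolded small_def]] ordIso_ordLess_trans[OF e(2) A[unfolded small_def]] ..
 qed
 have "|S| \<le>o |T| \<or> |T| \<le>o |S|" using ordLeq_total[OF card_of_Well_order card_of_Well_order] .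
 then have "|S \<times> T| <o |UNIV :: 'k set|"
  using *[OF assms(2,3)] *[OF assms(3,2)] by (elim disjE) simp_all
 then have "|(\<lambda>(a, b). h a b) ` (S \<times> T)| <o |UNIV :: 'k set|"
  by (rule ordLeq_ordLess_trans[OF card_of_image])
 moreover have "{h a b |a b. a : S & b : T} = (\<lambda>(a, b). h a b) ` (S \<times> T)" by auto
 ultimately show ?thesis unfolding small_def by simp
qed

text \<open>The predicates \<open>sfun\<close> and \<open>ncell\<close> give the 1-cells and 2-cells of small categories with their boundary.\<close>

definition sfun :: "'k sfun => 'k scat => 'k scat => bool" where
 "sfun u A B \<longleftrightarrow> small_cat A & small_cat B & is_fun u A B"

definition ncell :: "'k snat => 'k sfun => 'k sfun => 'k scat => 'k scat => bool" where
 "ncell \<alpha> u v A B \<longleftrightarrow> sfun u A B & sfun v A B & is_ntrans \<alpha> & Nsrc \<alpha> = u & Ntgt \<alpha> = v"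

lemma sfunD:
 assumes "sfun u A B"
 shows "small_fun u" "Fdom u = A" "Fcod u = B" "small_cat A" "small_cat B" "is_fun u A B"
  "category A" "category B" "is_functor u"
 using assms unfolding sfun_def is_fun_def small_fun_def small_cat_def by auto

lemma small_fun_sfun: "small_fun u ==> sfun u (Fdom u) (Fcod u)"
 unfolding sfun_def is_fun_def small_fun_def by auto

lemma sfun_mk_fun:
 assumes "small_cat C" "small_cat C'" "\<And>x. x : Obj C ==> o' x : Obj C'"
  "\<And>f x y. f : Hom C x y ==> m' f : Hom C' (o' x) (o' y)"
  "\<And>x. x : Obj C ==> m' (Id C x) = Id C' (o' x)"
  "\<And>g f x y z. g : Hom C y z ==> f : Hom C x y ==> m' (g *[C] f) = m' g *[C'] m' f"
 shows "sfun (mk_fun C C' o' m') C C'"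
 unfolding sfun_def is_fun_def using assms by (auto intro!: is_functor_mk_fun simp: small_cat_def)

lemma sfun_comp: "sfun u A B ==> sfun v B C ==> sfun (v *. u) A C"
 unfolding sfun_def by (auto intro: comp_fun)

lemma sfun_id: "small_cat A ==> sfun (idF A) A A"
 unfolding sfun_def using is_fun_idF by (auto simp: small_cat_def)

lemma sfun_eqI:
 assumes u: "sfun u A B" and v: "sfun v A B" and "\<And>x. x : Obj A ==> Fobj u x = Fobj v x"
  and "\<And>f x y. f : Hom A x y ==> Farr u f = Farr v f"
 shows "u = v"
 by (rule funct_eqI) (use sfunD[OF u] sfunD[OF v] assms(3) assms(4)[OF HomI] in auto)

lemma ncellD:
 assumes "ncell \<alpha> u v A B"
 shows "small_nat \<alpha>" "Nsrc \<alpha> = u" "Ntgt \<alpha> = v" "is_ntrans \<alpha>" "sfun u A B" "sfun v A B"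
  "x : Obj A ==> Ncomp \<alpha> x : Hom B (Fobj u x) (Fobj v x)"
  "f : Hom A x y ==> Ncomp \<alpha> y *[B] Farr u f = Farr v f *[B] Ncomp \<alpha> x"
 using assms ntD[of \<alpha> u v A B] sfunD[of u A B] sfunD[of v A B] unfolding ncell_def small_nat_def by auto

lemma ncell_mk_nat:
 assumes u: "sfun u A B" and v: "sfun v A B"
  and t: "\<And>x. x : Obj A ==> t x : Hom B (Fobj u x) (Fobj v x)"
  and n: "\<And>f x y. f : Hom A x y ==> t y *[B] Farr u f = Farr v f *[B] t x"
 shows "ncell (mk_nat u v t) u v A B"
 unfolding ncell_def using u v sfunD[OF u] sfunD[OF v] t n
 by (auto intro!: is_ntrans_mk_nat)

lemma ncell_eqI:
 assumes "ncell \<alpha> u v A B" "ncell \<beta> u v A B" "\<And>x. x : Obj A ==> Ncomp \<alpha> x = Ncomp \<beta> x"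
 shows "\<alpha> = \<beta>"
 by (rule ntrans_eqI) (use assms in \<open>auto simp: ncell_def dest: sfunD\<close>)

lemma ncell_id: "sfun u A B ==> ncell (idN u) u u A B"
 unfolding ncell_def by (auto dest: sfunD intro: is_ntrans_idN)

lemma ncell_vcomp: "ncell \<alpha> u v A B ==> ncell \<beta> v w A B ==> ncell (\<beta> *N \<alpha>) u w A B"
 unfolding ncell_def by (auto intro: is_ntrans_vcomp)

lemma ncell_whiskL: "ncell \<alpha> u v A B ==> sfun w B C ==> ncell (w *L \<alpha>) (w *. u) (w *. v) A C"
 unfolding ncell_def using sfunD[of w B C] sfunD[of u A B]
 by (auto intro!: is_ntrans_whiskL sfun_comp)

lemma ncell_whiskR: "ncell \<alpha> u v A B ==> sfun w A' A ==> ncell (\<alpha> *R w) (u *. w) (v *. w) A' B"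
 unfolding ncell_def using sfunD[of w A' A] sfunD[of u A B]
 by (auto intro!: is_ntrans_whiskR sfun_comp)

subsection \<open>Ordinals, points and slices\<close>

lemma ord_cat_simps [simp]:
 "Obj (ord_cat n) = {Num i |i. i \<le> n}"
 "Arr (ord_cat n) = {Tup (Num i) (Num j) |i j. i \<le> j & j \<le> n}"
 by (auto simp: ord_cat_def)

lemma Hom_ord_cat [simp]:
 "f : Hom (ord_cat n) x y \<longleftrightarrow> (\<exists>i j. i \<le> j & j \<le> n & x = Num i & y = Num j & f = Tup (Num i) (Num j))"
 by (auto simp: Hom_def ord_cat_def)

lemma ord_cat_id [simp]: "i \<le> n ==> Id (ord_cat n) (Num i) = Tup (Num i) (Num i)"
 by (auto simp: ord_cat_def)

lemma ord_cat_comp [simp]: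
 "i \<le> j ==> j \<le> l ==> l \<le> n ==> Tup (Num j) (Num l) *[ord_cat n] Tup (Num i) (Num j) = Tup (Num i) (Num l)"
 by (auto simp: ord_cat_def)

lemma small_ord:
 assumes "infinite (UNIV :: 'k set)"
 shows "small_cat (ord_cat n :: 'k scat)"
proof -
 have 1: "finite {Num i :: 'k uni |i. i \<le> n}" by simp
 have "{Tup (Num i) (Num j) :: 'k uni |i j. i \<le> j & j \<le> n} \<subseteq> (\<lambda>(i, j). Tup (Num i) (Num j)) ` ({..n} \<times> {..n})"
  by auto
 then have 2: "finite {Tup (Num i) (Num j) :: 'k uni |i j. i \<le> j & j \<le> n}"
  using finite_subset by blast
 have "category (ord_cat n :: 'k scat)" unfolding ord_cat_def by (rule category_mk_cat) auto
 then show ?thesis using small_finite[OF assms] 1 2 by (simp add: small_cat_def)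
qed

lemma category_ord_cat: "category (ord_cat n :: 'k scat)"
 unfolding ord_cat_def by (rule category_mk_cat) auto

lemma sfun_pt:
 assumes "infinite (UNIV :: 'k set)" "small_cat (A :: 'k scat)" "a : Obj A"
 shows "sfun (pt A a) one_cat A"
 unfolding pt_def using assms cat_id[of A a] cat_idl[of A "Id A a" a a]
 by (intro sfun_mk_fun small_ord) (auto simp: small_cat_def)

lemma s_one:
 assumes "infinite (UNIV :: 'k set)" "small_cat (A :: 'k scat)"
 shows "sfun (to_one A) A one_cat"
 unfolding to_one_def using assms
 by (intro sfun_mk_fun small_ord) auto

lemma to_one_unique:
 assumes "sfun u A one_cat" 
 shows "u = to_one A"
proof -
 have "is_functor (to_one A)" unfolding to_one_def
  by (rule is_functor_mk_fun) (use sfunD[OF assms] in auto)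
 moreover have "x : Obj A ==> Fobj u x = Num 0" for x using fobj[OF sfunD(6)[OF assms]] by fastforce
 moreover have "f : Arr A ==> Farr u f = Tup (Num 0) (Num 0)" for f
  using fhom[OF sfunD(6)[OF assms] HomI, of f] by auto
 ultimately show ?thesis using sfunD[OF assms] by (intro funct_eqI) (auto simp: to_one_def)
qed

lemma ncell_one_unique:
 assumes "ncell \<alpha> u v A one_cat"
 shows "\<alpha> = idN (to_one A)"
proof -
 have u: "u = to_one A" "v = to_one A" using to_one_unique ncellD[OF assms] by auto
 show ?thesis
 proof (rule ncell_eqI[OF assms[unfolded u] ncell_id])
  show t: "sfun (to_one A) A one_cat" using ncellD(5)[OF assms] u by simp
  fix x assume "x : Obj A"
  then have "Ncomp \<alpha> x = Tup (Num 0) (Num 0)" "Ncomp (idN (to_one A)) x = Tup (Num 0) (Num 0)"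
   using ncellD(7)[OF assms, of x] ncellD(7)[OF ncell_id[OF t], of x] by auto
  then show "Ncomp \<alpha> x = Ncomp (idN (to_one A)) x" by simp
 qed
qed

lemma pt_to_one_simps [simp]:
 "x : Obj J ==> Fobj (pt B b *. to_one J) x = b"
 "f : Arr J ==> Farr (pt B b *. to_one J) f = Id B b"
 by (auto simp: pt_def to_one_def)

lemma sfun_const:
 "infinite (UNIV :: 'k set) ==> small_cat (J :: 'k scat) ==> small_cat B ==> b : Obj B ==> sfun (pt B b *. to_one J) J B"
 using sfun_pt s_one sfun_comp by metis

lemma over_cat_simps:
 assumes u: "sfun u A B"
 shows "Obj (over_cat u b) = {Tup a f |a f. a : Obj A & f : Hom B (Fobj u a) b}" 
  "h : Hom (over_cat u b) x y \<longleftrightarrow> (\<exists>a f a' f' g. x = Tup a f & y = Tup a' f' & h = Tup (Tup x y) g &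
    f : Hom B (Fobj u a) b & f' : Hom B (Fobj u a') b & g : Hom A a a' & f' *[B] Farr u g = f)"
  "x : Obj (over_cat u b) ==> Id (over_cat u b) x = Tup (Tup x x) (Id A (ufst x))"
  "Tup (Tup y z) k : Hom (over_cat u b) y z ==> Tup (Tup x y) h : Hom (over_cat u b) x y ==>
   Tup (Tup y z) k *[over_cat u b] Tup (Tup x y) h = Tup (Tup x z) (k *[A] h)"
 unfolding over_cat_def Let_def sfunD(2,3)[OF u]
 by (auto simp: Hom_mk_cat dest: cat_ob[OF sfunD(7)[OF u]])

lemma under_cat_simps:
 assumes u: "sfun u A B"
 shows "Obj (under_cat b u) = {Tup a f |a f. a : Obj A & f : Hom B b (Fobj u a)}" 
  "h : Hom (under_cat b u) x y \<longleftrightarrow> (\<exists>a f a' f' g. x = Tup a f & y = Tup a' f' & h = Tup (Tup x y) g &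
    f : Hom B b (Fobj u a) & f' : Hom B b (Fobj u a') & g : Hom A a a' & Farr u g *[B] f = f')"
  "x : Obj (under_cat b u) ==> Id (under_cat b u) x = Tup (Tup x x) (Id A (ufst x))"
  "Tup (Tup y z) k : Hom (under_cat b u) y z ==> Tup (Tup x y) h : Hom (under_cat b u) x y ==>
   Tup (Tup y z) k *[under_cat b u] Tup (Tup x y) h = Tup (Tup x z) (k *[A] h)"
 unfolding under_cat_def Let_def sfunD(2,3)[OF u]
 by (auto simp: Hom_mk_cat dest: cat_ob[OF sfunD(7)[OF u]])

lemma small_over_cat:
 fixes u :: "'k sfun"
 assumes inf: "infinite (UNIV :: 'k set)" and u: "sfun u A B"
 shows "small_cat (over_cat u b)"
proof -
 note us = sfunD[OF u]
 let ?Ob = "{Tup a f |a f. a : Obj A & f : Hom B (Fobj u a) b}"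
 let ?Ar = "{Tup (Tup (Tup a f) (Tup a' f')) g |a f a' f' g. a : Obj A & f : Hom B (Fobj u a) b &
  a' : Obj A & f' : Hom B (Fobj u a') b & g : Hom A a a' & f' *[B] Farr u g = f}"
 have 1: "category (over_cat u b)"
  unfolding over_cat_def Let_def us(2,3)
 proof (rule category_mk_cat)
  fix x assume "x : ?Ob"
  then obtain a f where x: "x = Tup a f" "a : Obj A" "f : Hom B (Fobj u a) b" by blast
  then show "Tup (Tup x x) (Id A (ufst x)) : ?Ar & ufst (ufst (Tup (Tup x x) (Id A (ufst x)))) = x &
   usnd (ufst (Tup (Tup x x) (Id A (ufst x)))) = x"
   using cat_id[OF us(7) x(2)] fident[OF us(6) x(2)] cat_idr[OF us(8), OF x(3)] by simp
 next
  fix k h assume k: "k : ?Ar" and h: "h : ?Ar" and kh: "usnd (ufst h) = ufst (ufst k)"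
  obtain a f a' f' g where h: "h = Tup (Tup (Tup a f) (Tup a' f')) g" "a : Obj A" "f : Hom B (Fobj u a) b" "a' : Obj A"
   "f' : Hom B (Fobj u a') b" and g1: "g : Hom A a a'" "f' *[B] Farr u g = f" using h by blast
  obtain a'' f'' g' where k: "k = Tup (Tup (Tup a' f') (Tup a'' f'')) g'" "a'' : Obj A"
   "f'' : Hom B (Fobj u a'') b" and g2: "g' : Hom A a' a''" "f'' *[B] Farr u g' = f'" using k kh h(1) by auto
  note g = g1(1) g2(1)
  have "f'' *[B] Farr u (g' *[A] g) = f" using fcomp[OF us(6) g(2,1)] cat_assoc[OF us(8) k(3) fhom[OF us(6) g(2)] fhom[OF us(6) g(1)], symmetric] g1(2) g2(2) k(3) h(3) by simp
  then show "Tup (Tup (ufst (ufst h)) (usnd (ufst k))) (usnd k *[A] usnd h) : ?Ar &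
   ufst (ufst (Tup (Tup (ufst (ufst h)) (usnd (ufst k))) (usnd k *[A] usnd h))) = ufst (ufst h) &
   usnd (ufst (Tup (Tup (ufst (ufst h)) (usnd (ufst k))) (usnd k *[A] usnd h))) = usnd (ufst k)"
   using h k cat_comp[OF us(7) g(2,1)] by simp
 qed (auto simp: cat_idl[OF us(7)] cat_idr[OF us(7)] cat_assoc[OF us(7)])
 have O: "small (Obj (over_cat u b))"
  by (rule small_subset[OF small_image2[OF inf, of "Obj A" "Arr B" Tup]])
   (use us in \<open>auto simp: over_cat_simps[OF u] small_cat_def Hom_def\<close>)
 have "small {Tup x y |x y. x : Obj (over_cat u b) & y : Obj (over_cat u b)}"
  by (rule small_image2[OF inf O O])
 from small_image2[OF inf this, of "Arr A" Tup]
 have 2: "small {Tup a y |a y. a : {Tup x y |x y. x : Obj (over_cat u b) & y : Obj (over_cat u b)} & y : Arr A}"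
  using us by (simp add: small_cat_def)
 have "small (Arr (over_cat u b))"
  by (rule small_subset[OF 2]) (use us in \<open>auto simp: over_cat_def Let_def Hom_def\<close>)
 then show ?thesis using 1 O by (simp add: small_cat_def)
qed

lemma small_under_cat:
 fixes u :: "'k sfun"
 assumes inf: "infinite (UNIV :: 'k set)" and u: "sfun u A B"
 shows "small_cat (under_cat b u)"
proof -
 note us = sfunD[OF u]
 let ?Ob = "{Tup a f |a f. a : Obj A & f : Hom B b (Fobj u a)}"
 let ?Ar = "{Tup (Tup (Tup a f) (Tup a' f')) g |a f a' f' g. a : Obj A & f : Hom B b (Fobj u a) &
  a' : Obj A & f' : Hom B b (Fobj u a') & g : Hom A a a' & Farr u g *[B] f = f'}"
 have 1: "category (under_cat b u)"
  unfolding under_cat_def Let_def us(2,3)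
 proof (rule category_mk_cat)
  fix x assume "x : ?Ob"
  then obtain a f where x: "x = Tup a f" "a : Obj A" "f : Hom B b (Fobj u a)" by blast
  then show "Tup (Tup x x) (Id A (ufst x)) : ?Ar & ufst (ufst (Tup (Tup x x) (Id A (ufst x)))) = x &
   usnd (ufst (Tup (Tup x x) (Id A (ufst x)))) = x"
   using cat_id[OF us(7) x(2)] fident[OF us(6) x(2)] cat_idl[OF us(8),  OF x(3)] by simp
 next
  fix k h assume k: "k : ?Ar" and h: "h : ?Ar" and kh: "usnd (ufst h) = ufst (ufst k)"
  obtain a f a' f' g where h: "h = Tup (Tup (Tup a f) (Tup a' f')) g" "a : Obj A" "f : Hom B b (Fobj u a)" "a' : Obj A"
   "f' : Hom B b (Fobj u a')" and g1: "g : Hom A a a'" "Farr u g *[B] f = f'" using h by blast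
  obtain a'' f'' g' where k: "k = Tup (Tup (Tup a' f') (Tup a'' f'')) g'" "a'' : Obj A"
   "f'' : Hom B b (Fobj u a'')" and g2: "g' : Hom A a' a''" "Farr u g' *[B] f' = f''" using k kh h(1) by auto
  note g = g1(1) g2(1)
  have "Farr u (g' *[A] g) *[B] f = f''" using fcomp[OF us(6) g(2,1)] cat_assoc[OF us(8) fhom[OF us(6) g(2)] fhom[OF us(6) g(1)]] g1(2) g2(2) k(3) h(3) by simp
  then show "Tup (Tup (ufst (ufst h)) (usnd (ufst k))) (usnd k *[A] usnd h) : ?Ar &
   ufst (ufst (Tup (Tup (ufst (ufst h)) (usnd (ufst k))) (usnd k *[A] usnd h))) = ufst (ufst h) &
   usnd (ufst (Tup (Tup (ufst (ufst h)) (usnd (ufst k))) (usnd k *[A] usnd h))) = usnd (ufst k)"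
   using h k cat_comp[OF us(7) g(2,1)] by simp
 qed (auto simp: cat_idl[OF us(7)] cat_idr[OF us(7)] cat_assoc[OF us(7)])
 have O: "small (Obj (under_cat b u))"
  by (rule small_subset[OF small_image2[OF inf, of "Obj A" "Arr B" Tup]])
   (use us in \<open>auto simp: under_cat_simps[OF u] small_cat_def Hom_def\<close>)
 have "small {Tup x y |x y. x : Obj (under_cat b u) & y : Obj (under_cat b u)}"
  by (rule small_image2[OF inf O O])
 from small_image2[OF inf this, of "Arr A" Tup]
 have 2: "small {Tup a y |a y. a : {Tup x y |x y. x : Obj (under_cat b u) & y : Obj (under_cat b u)} & y : Arr A}"
  using us by (simp add: small_cat_def)
 have "small (Arr (under_cat b u))"
  by (rule small_subset[OF 2]) (use us in \<open>auto simp: under_cat_def Let_def Hom_def\<close>)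
 then show ?thesis using 1 O by (simp add: small_cat_def)
qed


lemma small_nat_ncell: "small_nat \<alpha> ==> ncell \<alpha> (Nsrc \<alpha>) (Ntgt \<alpha>) (Fdom (Nsrc \<alpha>)) (Fcod (Nsrc \<alpha>))"
 using small_fun_sfun unfolding small_nat_def ncell_def sfun_def is_fun_def is_ntrans_def Let_def small_fun_def by metis

section \<open>Prederivators\<close>

context
 fixes D :: "('k, 'o, 'm, 'z) prederivator_scheme"
 assumes P: "is_prederivator D"
begin

lemma D_cat: "small_cat A ==> category (dcat D A)"
 using P unfolding is_prederivator_def by blast

lemma D_fun: "sfun u A B ==> is_fun (dfun D u) (dcat D B) (dcat D A)"
 using P sfunD[of u A B] unfolding is_prederivator_def is_fun_def by metis

lemma D_idF: "small_cat A ==> dfun D (idF A) = idF (dcat D A)"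
 using P unfolding is_prederivator_def by blast

lemma D_compF: "sfun u A B ==> sfun v B C ==> dfun D (v *. u) = dfun D u *. dfun D v"
 using P sfunD[of u A B] sfunD[of v B C] unfolding is_prederivator_def by metis

lemma D_cob: "sfun u A B ==> sfun v B C ==> X : dobj D C ==>
  dob D (v *. u) X = dob D u (dob D v X)"
 using compF_obj[OF D_fun[of v B C]] by (simp add: D_compF)

lemma D_car: "sfun u A B ==> sfun v B C ==> f : dhom D C X Y ==>
  dar D (v *. u) f = dar D u (dar D v f)"
 using compF_arr[OF D_fun[of v B C]] by (simp add: D_compF)

lemma D_nat: "ncell \<alpha> u v A B ==> is_ntrans (dnat D \<alpha>) & Nsrc (dnat D \<alpha>) = dfun D u & Ntgt (dnat D \<alpha>) = dfun D v"
 using P ncellD[of \<alpha> u v A B] unfolding is_prederivator_def by metis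

lemma D_nat_hom: "ncell \<alpha> u v A B ==> X : dobj D B ==>
  dnt D \<alpha> X : dhom D A (dob D u X) (dob D v X)"
 using ntD(5)[of "dnat D \<alpha>"] D_nat[of \<alpha> u v A B] funD[OF D_fun[of u A B]] ncellD(5) by metis

lemma D_nat_natural: "ncell \<alpha> u v A B ==> f : dhom D B X Y ==>
  dnt D \<alpha> Y *[dcat D A] dar D u f = dar D v f *[dcat D A] dnt D \<alpha> X"
 using ntD(6)[of "dnat D \<alpha>"] D_nat[of \<alpha> u v A B] funD[OF D_fun[of u A B]] ncellD(5) by metis

lemma D_idN: "sfun u A B ==> X : dobj D B ==> dnt D (idN u) X = Id (dcat D A) (dob D u X)"
proof -
 assume u: "sfun u A B" and X: "X : dobj D B"
 have "dnat D (idN u) = idN (dfun D u)" using P sfunD(1)[OF u] unfolding is_prederivator_def by blast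
 then show ?thesis using funD[OF D_fun[OF u]] X by simp
qed

lemma D_vcomp:
 assumes a: "ncell \<alpha> u v A B" and b: "ncell \<beta> v w A B" and X: "X : dobj D B"
 shows "dnt D (\<beta> *N \<alpha>) X = dnt D \<beta> X *[dcat D A] dnt D \<alpha> X"
proof -
 have "dnat D (\<beta> *N \<alpha>) = dnat D \<beta> *N dnat D \<alpha>"
  using P ncellD[OF a] ncellD[OF b] unfolding is_prederivator_def by metis
 then show ?thesis using X D_nat[OF a] funD[OF D_fun[OF ncellD(5)[OF a]]] by simp
qed

lemma D_whiskL:
 assumes a: "ncell \<alpha> u v A B" and w: "sfun w B C" and X: "X : dobj D C"
 shows "dnt D (w *L \<alpha>) X = dnt D \<alpha> (dob D w X)"
proof -
 have "dnat D (w *L \<alpha>) = dnat D \<alpha> *R dfun D w"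
  using P ncellD(1,2)[OF a] sfunD(1,2)[OF w] sfunD(3)[OF ncellD(5)[OF a]] unfolding is_prederivator_def by metis
 then show ?thesis using X funD[OF D_fun[OF w]] by simp
qed

lemma D_whiskR:
 assumes a: "ncell \<alpha> u v A B" and w: "sfun w A' A" and X: "X : dobj D B"
 shows "dnt D (\<alpha> *R w) X = dar D w (dnt D \<alpha> X)"
proof -
 have "dnat D (\<alpha> *R w) = dfun D w *L dnat D \<alpha>"
  using P ncellD(1,2)[OF a] sfunD(1,3)[OF w] sfunD(2)[OF ncellD(5)[OF a]] unfolding is_prederivator_def by metis
 then show ?thesis using X D_nat[OF a] funD[OF D_fun[OF ncellD(5)[OF a]]] by simp
qed

text \<open>A prederivator reverses functors but not transformations, hence turns a left adjoint into a
 right adjoint.\<close>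

lemma D_adjunction:
 assumes a: "adjunction l r \<eta> \<epsilon>" and l: "sfun l A B" and r: "sfun r B A"
 shows "adjunction (dfun D r) (dfun D l) (dnat D \<eta>) (dnat D \<epsilon>)"
proof (rule adjunctionI[OF D_fun[OF r] D_fun[OF l]])
 have e: "ncell \<eta> (idF A) (r *. l) A A" "ncell \<epsilon> (l *. r) (idF B) B B"
  and t: "(\<epsilon> *R l) *N (l *L \<eta>) = idN l" "(r *L \<epsilon>) *N (\<eta> *R r) = idN r"
  using a sfunD[OF l] sfunD[OF r] sfun_comp[OF l r] sfun_comp[OF r l] sfun_id
  unfolding adjunction_def ncell_def by auto
 note A = sfunD(4)[OF l] and B = sfunD(5)[OF l]
 show "is_ntrans (dnat D \<eta>)" "Nsrc (dnat D \<eta>) = idF (dcat D A)" "Ntgt (dnat D \<eta>) = dfun D l *. dfun D r"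
  "is_ntrans (dnat D \<epsilon>)" "Nsrc (dnat D \<epsilon>) = dfun D r *. dfun D l" "Ntgt (dnat D \<epsilon>) = idF (dcat D B)"
  using D_nat[OF e(1)] D_nat[OF e(2)] D_idF[OF A] D_idF[OF B] D_compF[OF l r] D_compF[OF r l] by auto
 have as: "r *. (l *. r) = (r *. l) *. r" "(l *. r) *. l = l *. (r *. l)"
  using compF_assoc[of r l r] compF_assoc[of l r l] sfunD[OF l] sfunD[OF r] by auto
 have i: "idF A *. r = r" "r *. idF B = r" "idF B *. l = l" "l *. idF A = l"
  using sfunD[OF l] sfunD[OF r] by (auto intro: compF_idF idF_compF)
 { fix X assume X: "X : dobj D A"
  show "dnt D \<epsilon> (dob D r X) *[dcat D B] dar D r (dnt D \<eta> X) = Id (dcat D B) (dob D r X)"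
   using D_vcomp[OF ncell_whiskR[OF e(1) r] ncell_whiskL[OF e(2) r, unfolded as i] X]
    D_whiskR[OF e(1) r X] D_whiskL[OF e(2) r X] D_idN[OF r X] t(2) i by simp }
 fix Y assume Y: "Y : dobj D B"
 show "dar D l (dnt D \<epsilon> Y) *[dcat D A] dnt D \<eta> (dob D l Y) = Id (dcat D A) (dob D l Y)"
  using D_vcomp[OF ncell_whiskL[OF e(1) l] ncell_whiskR[OF e(2) l, unfolded as i] Y]
   D_whiskR[OF e(2) l Y] D_whiskL[OF e(1) l Y] D_idN[OF l Y] t(1) i by simp
qed

text \<open>Restriction along a right adjoint \<open>r\<close> does not change colimit cocones: \<open>r\<^sup>*\<close> is left adjoint to \<open>l\<^sup>*\<close>,
 thus \<open>X \<rightarrow> l\<^sup>* r\<^sup>* X\<close> is universal, and universal arrows compose.\<close>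

lemma univ_right_adjoint:
 assumes a: "adjunction l r \<eta> \<epsilon>" and l: "sfun l A B" and r: "sfun r B A"
  and o: "sfun (to_one B) B one_cat"
  and X: "X : dobj D A" and Z: "Z : dobj D one_cat"
  and f: "f : dhom D A X (dob D (to_one A) Z)"
 shows "univ (dfun D (to_one A)) X Z f \<longleftrightarrow> univ (dfun D (to_one B)) (dob D r X) Z (dar D r f)"
proof -
 let ?p = "to_one A" and ?q = "to_one B"
 have tp: "to_one A = to_one B *. l" using to_one_unique[OF sfun_comp[OF l o]] by simp
 have p: "sfun ?p A one_cat" using sfun_comp[OF l o] tp by simp
 have tq: "to_one B = to_one A *. r" using to_one_unique[OF sfun_comp[OF r p]] by simp
 note da = D_adjunction[OF a l r] and L = D_fun[OF r] and R = D_fun[OF l]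
 have f': "f : dhom D A X (dob D l (dob D ?q Z))"
  using f D_cob[OF l o Z] tp by simp
 have qZ: "dob D ?q Z : dobj D B" using fobj[OF D_fun[OF o] Z] .
 note T = adjunction_transpose[OF da L f' qZ]
 have e: "ncell \<epsilon> (l *. r) (idF B) B B"
  using a sfunD[OF l] sfunD[OF r] sfun_comp[OF r l] sfun_id unfolding adjunction_def ncell_def by auto
 have "to_one B *L \<epsilon> = idN (to_one B)" using ncell_one_unique[OF ncell_whiskL[OF e o]] .
 then have e1: "dnt D \<epsilon> (dob D ?q Z) = Id (dcat D B) (dob D ?q Z)"
  using D_whiskL[OF e o Z] D_idN[OF o Z] by simp
 have rf: "dar D r f : dhom D B (dob D r X) (dob D ?q Z)"
  using fhom[OF L f] D_cob[OF r p Z] tq by simp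
 have f1: "dnt D \<epsilon> (dob D ?q Z) *[dcat D B] dar D r f = dar D r f"
  using cat_idl[OF funD(5)[OF L] rf] e1 by simp
 have "univ (dfun D l *. dfun D ?q) X Z (dar D l (dar D r f) *[dcat D A] dnt D \<eta> X)
  \<longleftrightarrow> univ (dfun D ?q) (dob D r X) Z (dar D r f)"
  using univ_comp_iff[OF R adj_univ[OF da L X] D_fun[OF o] Z rf] .
 then show ?thesis using T(2) f1 D_compF[OF l o] tp by simp
qed

end

section \<open>The pointwise criterion for left Kan extensions\<close>

text \<open>The data of a cocone under \<open>u k\<close> with vertex \<open>b\<close>, i.e. of a functor from \<open>J\<close> to the slice \<open>(u/b)\<close>.\<close>

definition cocone :: "'k sfun => 'k scat => 'k scat => 'k uni => 'k sfun => 'k scat => 'k snat => bool" where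
 "cocone u A B b k J \<kappa> \<longleftrightarrow> sfun u A B & b : Obj B & sfun k J A &
  sfun (to_one J) J one_cat & sfun (pt B b) one_cat B &
  ncell \<kappa> (u *. k) (pt B b *. to_one J) J B"

text \<open>The functor from \<open>J\<close> to \<open>(u/b)\<close> is a right adjoint, spelled out: every object \<open>(x, f)\<close> of the slice has a
universal arrow to it. Right adjoints are final, so colimits over \<open>(u/b)\<close> may be computed over \<open>J\<close>.\<close>

definition final_cocone :: "'k sfun => 'k scat => 'k scat => 'k uni => 'k sfun => 'k scat => 'k snat => bool" where
 "final_cocone u A B b k J \<kappa> \<longleftrightarrow> cocone u A B b k J \<kappa> &
  (\<forall>x\<in>Obj A. \<forall>f\<in>Hom B (Fobj u x) b. \<exists>j\<in>Obj J. \<exists>g\<in>Hom A x (Fobj k j).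
   Ncomp \<kappa> j *[B] Farr u g = f &
   (\<forall>j'\<in>Obj J. \<forall>g'\<in>Hom A x (Fobj k j'). Ncomp \<kappa> j' *[B] Farr u g' = f \<longrightarrow>
    (\<exists>!h. h : Hom J j j' & Farr k h *[A] g = g')))"

text \<open>For \<open>f: X \<rightarrow> u\<^sup>* Y\<close> this is the cocone on \<open>k\<^sup>* X\<close> with vertex \<open>Y\<^sub>b\<close> obtained by restricting to \<open>J\<close> and moving
along \<open>\<kappa>\<close>.\<close>

definition restr :: "('k, 'o, 'm, 'z) prederivator_scheme => 'k scat => 'k sfun => 'k snat => 'o => 'm => 'm" where
 "restr D J k \<kappa> Y f = dnt D \<kappa> Y *[dcat D J] dar D k f"

lemma coconeD:
 assumes "cocone u A B b k J \<kappa>"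
 shows "sfun u A B" "b : Obj B" "sfun k J A" "ncell \<kappa> (u *. k) (pt B b *. to_one J) J B"
  "sfun (to_one J) J one_cat" "sfun (pt B b) one_cat B"
  "j : Obj J ==> Ncomp \<kappa> j : Hom B (Fobj u (Fobj k j)) b"
  "h : Hom J i j ==> Ncomp \<kappa> j *[B] Farr u (Farr k h) = Ncomp \<kappa> i"
proof -
 show 1: "sfun u A B" "b : Obj B" "sfun k J A" "ncell \<kappa> (u *. k) (pt B b *. to_one J) J B"
  "sfun (to_one J) J one_cat" "sfun (pt B b) one_cat B"
  using assms by (auto simp: cocone_def)
 show *: "Ncomp \<kappa> j : Hom B (Fobj u (Fobj k j)) b" if "j : Obj J" for j
  using ncellD(7)[OF 1(4) that] that by (simp add: compF_obj[OF sfunD(6)[OF 1(3)]])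
 show "Ncomp \<kappa> j *[B] Farr u (Farr k h) = Ncomp \<kappa> i" if h: "h : Hom J i j"
  using ncellD(8)[OF 1(4) h] HomD(1)[OF h] cat_idl[OF sfunD(8)[OF 1(1)] *] cat_ob[OF sfunD(7)[OF 1(3)] h]
  by (simp add: compF_arr[OF sfunD(6)[OF 1(3)] h])
qed

lemma over_cocone:
 fixes u :: "'k sfun"
 assumes inf: "infinite (UNIV :: 'k set)" and u: "sfun u A B" and b: "b : Obj B"
 shows "cocone u A B b (over_proj u b) (over_cat u b) (over_nat u b)"
proof -
 note us = sfunD[OF u] and O = small_over_cat[OF inf u, of b] and S = over_cat_simps[OF u]
 have p: "sfun (over_proj u b) (over_cat u b) A"
  unfolding over_proj_def us(2)
 proof (rule sfun_mk_fun[OF O us(4)])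
  fix g f x y z assume "g : Hom (over_cat u b) y z" "f : Hom (over_cat u b) x y"
  then show "usnd (g *[over_cat u b] f) = usnd g *[A] usnd f"
   using S(4)[of y z "usnd g" b x "usnd f"] by (auto simp: S(2))
 qed (auto simp: S(1-3))
 have po: "x : Obj (over_cat u b) ==> Fobj (over_proj u b) x = ufst x"
  "f : Hom (over_cat u b) x y ==> Farr (over_proj u b) f = usnd f" for x y f
  using HomD(1)[of f "over_cat u b"] by (auto simp: over_proj_def)
 have "ncell (over_nat u b) (u *. over_proj u b) (pt B b *. to_one (over_cat u b)) (over_cat u b) B"
  unfolding over_nat_def us(3)
 proof (rule ncell_mk_nat)
  fix x assume "x : Obj (over_cat u b)"
  then show "usnd x : Hom B (Fobj (u *. over_proj u b) x) (Fobj (pt B b *. to_one (over_cat u b)) x)"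
   using po(1) by (auto simp: compF_obj[OF sfunD(6)[OF p]] S(1))
 next
  fix f x y assume f: "f : Hom (over_cat u b) x y"
  then show "usnd y *[B] Farr (u *. over_proj u b) f = Farr (pt B b *. to_one (over_cat u b)) f *[B] usnd x"
   using HomD(1)[OF f] cat_idl[OF us(8)] by (auto simp: compF_arr[OF sfunD(6)[OF p] f] po(2)[OF f] S(2))
 qed (use p u O b inf sfun_const[OF inf O us(5) b] in \<open>auto intro: sfun_comp\<close>)
 then show ?thesis
  unfolding cocone_def using u b p s_one[OF inf O] sfun_pt[OF inf us(5) b] by simp
qed

lemma cocone_slice_functor:
 fixes u :: "'k sfun"
 assumes inf: "infinite (UNIV :: 'k set)" and c: "cocone u A B b k J \<kappa>"
 obtains r where "sfun r J (over_cat u b)" "over_proj u b *. r = k" "over_nat u b *R r = \<kappa>"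
  "\<And>j. j : Obj J ==> Fobj r j = Tup (Fobj k j) (Ncomp \<kappa> j)"
  "\<And>h i j. h : Hom J i j ==> Farr r h = Tup (Tup (Fobj r i) (Fobj r j)) (Farr k h)"
proof -
 note C = coconeD[OF c]
 note us = sfunD[OF C(1)] and ks = sfunD[OF C(3)] and S = over_cat_simps[OF C(1)]
 note O = over_cocone[OF inf C(1,2)]
 note o = coconeD[OF O]
 let ?ob = "\<lambda>j. Tup (Fobj k j) (Ncomp \<kappa> j)"
 let ?ar = "\<lambda>h. Tup (Tup (?ob (Dom J h)) (?ob (Cod J h))) (Farr k h)"
 define r where "r = mk_fun J (over_cat u b) ?ob ?ar"
 have h: "?ar h : Hom (over_cat u b) (?ob i) (?ob j)" if "h : Hom J i j" for h i j
  using HomD(2,3)[OF that] fhom[OF ks(6) that] C(8)[OF that] C(7) cat_ob[OF ks(7) that] by (auto simp: S(2))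
 have ob: "j : Obj J ==> ?ob j : Obj (over_cat u b)" for j
  using C(7) fobj[OF ks(6)] by (auto simp: S(1))
 have r: "sfun r J (over_cat u b)" unfolding r_def
 proof (rule sfun_mk_fun[OF ks(4) sfunD(4)[OF o(3)] ob h])
  fix j assume j: "j : Obj J"
  show "?ar (Id J j) = Id (over_cat u b) (?ob j)"
   using S(3)[OF ob[OF j]] HomD[OF cat_id[OF ks(7) j]] fident[OF ks(6) j] by simp
 next
  fix g f i j l assume gf: "g : Hom J j l" "f : Hom J i j"
  show "?ar (g *[J] f) = ?ar g *[over_cat u b] ?ar f"
   using S(4) h[OF gf(1)] h[OF gf(2)] HomD[OF gf(1)] HomD[OF gf(2)] HomD[OF cat_comp[OF ks(7) gf]]
    fcomp[OF ks(6) gf] by simp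
 qed
 have ro: "\<And>j. j : Obj J ==> Fobj r j = Tup (Fobj k j) (Ncomp \<kappa> j)" unfolding r_def by simp
 have ra: "Farr r h = Tup (Tup (Fobj r i) (Fobj r j)) (Farr k h)" if "h : Hom J i j" for h i j
  using HomD[OF that] cat_ob[OF ks(7) that] by (auto simp: r_def)
 have "over_proj u b *. r = k"
 proof (rule sfun_eqI[OF sfun_comp[OF r o(3)] C(3)])
  fix j assume j: "j : Obj J"
  show "Fobj (over_proj u b *. r) j = Fobj k j"
   using ro[OF j] ob[OF j] by (simp add: compF_obj[OF sfunD(6)[OF r] j] over_proj_def)
 next
  fix h i j assume h': "h : Hom J i j"
  show "Farr (over_proj u b *. r) h = Farr k h"
   using HomD(1)[OF fhom[OF sfunD(6)[OF r] h']] ra[OF h']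
   by (simp add: compF_arr[OF sfunD(6)[OF r] h'] over_proj_def)
 qed
 moreover have "over_nat u b *R r = \<kappa>"
 proof (rule ncell_eqI)
  have 1: "(u *. over_proj u b) *. r = u *. k"
   using calculation compF_assoc[of r "over_proj u b" u] sfunD[OF r] sfunD[OF o(3)] us by simp
  have "to_one (over_cat u b) *. r = to_one J" using to_one_unique[OF sfun_comp[OF r o(5)]] by simp
  then have 2: "(pt B b *. to_one (over_cat u b)) *. r = pt B b *. to_one J"
   using compF_assoc[of r "to_one (over_cat u b)" "pt B b"] sfunD[OF r] sfunD[OF o(5)] sfunD[OF o(6)] by simp
  show "ncell (over_nat u b *R r) (u *. k) (pt B b *. to_one J) J B"
   using ncell_whiskR[OF o(4) r] 1 2 by simp
  show "ncell \<kappa> (u *. k) (pt B b *. to_one J) J B" by (rule C(4))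
  fix j assume j: "j : Obj J"
  then show "Ncomp (over_nat u b *R r) j = Ncomp \<kappa> j"
   using sfunD(2)[OF r] ro[OF j] sfunD(2)[OF o(3)] ob[OF j] by (simp add: over_nat_def)
 qed
 ultimately show ?thesis using that r ro ra by blast
qed

lemma final_slice_univ:
 fixes u :: "'k sfun"
 assumes c: "final_cocone u A B b k J \<kappa>" and r: "sfun r J (over_cat u b)"
  and ro: "\<And>j. j : Obj J ==> Fobj r j = Tup (Fobj k j) (Ncomp \<kappa> j)"
  and ra: "\<And>h i j. h : Hom J i j ==> Farr r h = Tup (Tup (Fobj r i) (Fobj r j)) (Farr k h)"
  and w: "w : Obj (over_cat u b)"
 shows "\<exists>j g. univ r w j g"
proof -
 have c': "cocone u A B b k J \<kappa>" using c by (simp add: final_cocone_def)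
 note C = coconeD[OF c'] and S = over_cat_simps[OF coconeD(1)[OF c']] and rf = sfunD(6)[OF r]
 obtain x f where w': "w = Tup x f" and x: "x : Obj A" and f: "f : Hom B (Fobj u x) b"
  using w by (auto simp: S(1))
 obtain j g where j: "j : Obj J" and g: "g : Hom A x (Fobj k j)" "Ncomp \<kappa> j *[B] Farr u g = f"
  and gu: "\<And>j' g'. j' : Obj J ==> g' : Hom A x (Fobj k j') ==> Ncomp \<kappa> j' *[B] Farr u g' = f ==>
    \<exists>!h. h : Hom J j j' & Farr k h *[A] g = g'"
  using bspec[OF bspec[OF conjunct2[OF c[unfolded final_cocone_def]] x] f] by blast
 let ?g = "Tup (Tup w (Fobj r j)) g"
 have gh: "?g : Hom (over_cat u b) w (Fobj r j)" using g f C(7)[OF j] ro[OF j] w' by (auto simp: S(2))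
 have comp: "Farr r h *[over_cat u b] ?g = Tup (Tup w (Fobj r j')) (Farr k h *[A] g)" if "h : Hom J j j'" for h j'
  using S(4)[OF _ gh] fhom[OF rf that] ra[OF that] by simp
 have "univ r w j ?g"
 proof (rule univI[OF rf j gh])
  fix j' g' assume j': "j' : Obj J" and "g' : Hom (over_cat u b) w (Fobj r j')"
  then obtain g'' where g'': "g' = Tup (Tup w (Fobj r j')) g''" "g'' : Hom A x (Fobj k j')" "Ncomp \<kappa> j' *[B] Farr u g'' = f"
   using ro[OF j'] w' by (auto simp: S(2))
  then show "\<exists>h. h : Hom J j j' & Farr r h *[over_cat u b] ?g = g'"
   using ex1_implies_ex[OF gu[OF j' g''(2,3)]] comp[of _ j'] g''(1) by metis
 next
  fix j' h h' assume h: "h : Hom J j j'" "h' : Hom J j j'" "Farr r h *[over_cat u b] ?g = Farr r h' *[over_cat u b] ?g"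
  note j' = cat_ob(2)[OF sfunD(7)[OF r] h(1)]
  have e: "Farr k h *[A] g = Farr k h' *[A] g" using h comp by simp
  note hk = fhom[OF sfunD(6)[OF C(3)] h(1)]
  have "Ncomp \<kappa> j' *[B] Farr u (Farr k h *[A] g) = f"
   using fcomp[OF sfunD(6)[OF C(1)] hk g(1)] C(8)[OF h(1)] g(2)
    cat_assoc[OF sfunD(8)[OF C(1)] C(7)[OF j'] fhom[OF sfunD(6)[OF C(1)] hk] fhom[OF sfunD(6)[OF C(1)] g(1)]]
   by simp
  from gu[OF j' cat_comp[OF sfunD(7)[OF C(1)] hk g(1)] this] show "h = h'" using h(1,2) e by metis
 qed
 then show ?thesis by blast
qed

lemma restr_hom:
 assumes P: "is_prederivator D" and c: "cocone u A B b k J \<kappa>"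
  and Y: "Y : dobj D B" and f: "f : dhom D A X (dob D u Y)"
 shows "restr D J k \<kappa> Y f : dhom D J (dob D k X) (dob D (to_one J) (dob D (pt B b) Y))"
 unfolding restr_def
proof (rule cat_comp[OF D_cat[OF P]])
 note C = coconeD[OF c]
 show "small_cat J" using sfunD[OF C(3)] by simp
 show "dnt D \<kappa> Y : dhom D J (dob D k (dob D u Y)) (dob D (to_one J) (dob D (pt B b) Y))"
  using D_nat_hom[OF P C(4) Y] D_cob[OF P C(3,1) Y] D_cob[OF P C(5,6) Y] by simp
 show "dar D k f : dhom D J (dob D k X) (dob D k (dob D u Y))"
  using fhom[OF D_fun[OF P C(3)] f] .
qed

lemma restr_comp:
 assumes P: "is_prederivator D" and c: "cocone u A B b k J \<kappa>"
  and f: "f : dhom D A X (dob D u Y)" and h: "h : dhom D B Y Z"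
 shows "restr D J k \<kappa> Z (dar D u h *[dcat D A] f) =
  dar D (to_one J) (dar D (pt B b) h) *[dcat D J] restr D J k \<kappa> Y f"
proof -
 note C = coconeD[OF c]
 note YZ = cat_ob[OF D_cat[OF P sfunD(5)[OF C(1)]] h]
 note J = D_cat[OF P sfunD(4)[OF C(3)]] and uh = fhom[OF D_fun[OF P C(1)] h] and kf = fhom[OF D_fun[OF P C(3)] f]
 note kuh = fhom[OF D_fun[OF P C(3)] uh]
 have n: "\<And>Y. Y : dobj D B ==> dnt D \<kappa> Y : dhom D J (dob D k (dob D u Y)) (dob D (to_one J) (dob D (pt B b) Y))"
  using D_nat_hom[OF P C(4)] D_cob[OF P C(3,1)] D_cob[OF P C(5,6)] by simp
 have "dnt D \<kappa> Z *[dcat D J] dar D k (dar D u h) = dar D (to_one J) (dar D (pt B b) h) *[dcat D J] dnt D \<kappa> Y"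
  using D_nat_natural[OF P C(4) h] D_car[OF P C(3,1) h] D_car[OF P C(5,6) h] by simp
 then show ?thesis
  unfolding restr_def fcomp[OF D_fun[OF P C(3)] uh f]
  using cat_assoc[OF J n[OF YZ(2)] kuh kf]
   cat_assoc[OF J fhom[OF D_fun[OF P C(5)] fhom[OF D_fun[OF P C(6)] h]] n[OF YZ(1)] kf] by simp
qed

text \<open>The functor from \<open>J\<close> to the slice has a left adjoint, so \<open>univ_right_adjoint\<close> applies.\<close>

lemma restr_final_iff:
 fixes u :: "'k sfun"
 assumes inf: "infinite (UNIV :: 'k set)" and P: "is_prederivator D"
  and c: "final_cocone u A B b k J \<kappa>"
  and Y: "Y : dobj D B" and f: "f : dhom D A X (dob D u Y)"
 shows "univ (dfun D (to_one (over_cat u b))) (dob D (over_proj u b) X) (dob D (pt B b) Y)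
   (restr D (over_cat u b) (over_proj u b) (over_nat u b) Y f) \<longleftrightarrow>
  univ (dfun D (to_one J)) (dob D k X) (dob D (pt B b) Y) (restr D J k \<kappa> Y f)"
proof -
 have c': "cocone u A B b k J \<kappa>" using c by (simp add: final_cocone_def)
 note C = coconeD[OF c'] and O' = over_cocone[OF inf coconeD(1,2)[OF c']]
 note O = coconeD[OF O']
 obtain r where r: "sfun r J (over_cat u b)" "over_proj u b *. r = k" "over_nat u b *R r = \<kappa>"
  "\<And>j. j : Obj J ==> Fobj r j = Tup (Fobj k j) (Ncomp \<kappa> j)"
  "\<And>h i j. h : Hom J i j ==> Farr r h = Tup (Tup (Fobj r i) (Fobj r j)) (Farr k h)"
  using cocone_slice_functor[OF inf c'] by blast
 obtain l \<eta> \<epsilon> where l: "is_fun l (over_cat u b) J" and a: "adjunction l r \<eta> \<epsilon>"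
  using left_adjoint_exists[OF sfunD(6)[OF r(1)] final_slice_univ[OF c r(1,4,5)]] by blast
 have l: "sfun l (over_cat u b) J" using l sfunD(4,5)[OF r(1)] by (simp add: sfun_def)
 note X = cat_ob(1)[OF D_cat[OF P sfunD(4)[OF C(1)]] f]
 have pX: "dob D (over_proj u b) X : dobj D (over_cat u b)"
  using fobj[OF D_fun[OF P O(3)] X] .
 have bY: "dob D (pt B b) Y : dobj D one_cat" using fobj[OF D_fun[OF P C(6)] Y] .
 have 1: "dob D r (dob D (over_proj u b) X) = dob D k X"
  using D_cob[OF P r(1) O(3) X] r(2) by simp
 have n: "dnt D (over_nat u b) Y : dhom D (over_cat u b) (dob D (over_proj u b) (dob D u Y)) (dob D (to_one (over_cat u b)) (dob D (pt B b) Y))"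
  using D_nat_hom[OF P O(4) Y] D_cob[OF P O(3,1) Y] D_cob[OF P O(5,6) Y] by simp
 have 2: "dar D r (restr D (over_cat u b) (over_proj u b) (over_nat u b) Y f) = restr D J k \<kappa> Y f"
  unfolding restr_def
  using fcomp[OF D_fun[OF P r(1)] n fhom[OF D_fun[OF P O(3)] f]]
   D_whiskR[OF P O(4) r(1) Y] r(2,3) D_car[OF P r(1) O(3) f] by simp
 show ?thesis using univ_right_adjoint[OF P a l r(1) C(5) pX bY restr_hom[OF P O' Y f]] 1 2 by simp
qed

lemma lan_adj:
 assumes "Der3 D" and P: "is_prederivator D" and u: "sfun u A B"
 shows "adjunction (lan D u) (dfun D u) (lan_unit D u) (lan_counit D u)" "is_fun (lan D u) (dcat D A) (dcat D B)"
proof -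
 show a: "adjunction (lan D u) (dfun D u) (lan_unit D u) (lan_counit D u)"
  using assms sfunD[OF u] unfolding Der3_def by blast
 show "is_fun (lan D u) (dcat D A) (dcat D B)"
  using a funD[OF D_fun[OF P u]] unfolding adjunction_def is_fun_def by auto
qed

lemma derD: "is_derivator D ==> is_prederivator D" "is_derivator D ==> Der1 D" "is_derivator D ==> Der2 D"
  "is_derivator D ==> Der3 D" "is_derivator D ==> Der4 D"
 by (auto simp: is_derivator_def)

text \<open>Der4 in terms of universal arrows: the mate in Der4 is the transpose of the restricted unit.\<close>

lemma over_univ:
 fixes u :: "'k sfun"
 assumes inf: "infinite (UNIV :: 'k set)" and D: "is_derivator D" and u: "sfun u A B" and b: "b : Obj B"
  and X: "X : dobj D A"
 shows "univ (dfun D (to_one (over_cat u b))) (dob D (over_proj u b) X) (dob D (pt B b) (Fobj (lan D u) X))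
   (restr D (over_cat u b) (over_proj u b) (over_nat u b) (Fobj (lan D u) X) (Ncomp (lan_unit D u) X))"
proof -
 note P = derD(1)[OF D] and L = lan_adj[OF derD(4)[OF D] derD(1)[OF D]]
 note O' = over_cocone[OF inf u b]
 note O = coconeD[OF O'] and Lu = L[OF u]
 note Lp = L[OF O(5)]
 let ?uX = "Fobj (lan D u) X" and ?p = "to_one (over_cat u b)"
 note uX = fobj[OF Lu(2) X] and e = adjD(2)[OF Lu X]
 note h = restr_hom[OF P O' uX e] and bY = fobj[OF D_fun[OF P O(6)] uX]
 have n: "dnt D (over_nat u b) ?uX : dhom D (over_cat u b) (dob D (over_proj u b) (dob D u ?uX)) (dob D ?p (dob D (pt B b) ?uX))"
  using D_nat_hom[OF P O(4) uX] D_cob[OF P O(3,1) uX] D_cob[OF P O(5,6) uX] by simp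
 have "bc_lan D u b X = Ncomp (lan_counit D ?p) (dob D (pt B b) ?uX) *[dcat D one_cat]
   Farr (lan D ?p) (restr D (over_cat u b) (over_proj u b) (over_nat u b) ?uX (Ncomp (lan_unit D u) X))"
  unfolding bc_lan_def restr_def Let_def
  using fcomp[OF Lp(2) n fhom[OF D_fun[OF P O(3)] e]] sfunD(3)[OF u] by simp
 moreover have "iso_arr (dcat D one_cat) (bc_lan D u b X)"
  using derD(5)[OF D] sfunD[OF u] b X unfolding Der4_def by blast
 ultimately show ?thesis using adjunction_transpose(3)[OF Lp h bY] by simp
qed

lemma ran_adj:
 assumes "Der3 D" and P: "is_prederivator D" and u: "sfun u A B"
 shows "adjunction (dfun D u) (ran D u) (ran_unit D u) (ran_counit D u)" "is_fun (ran D u) (dcat D A) (dcat D B)"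
proof -
 show a: "adjunction (dfun D u) (ran D u) (ran_unit D u) (ran_counit D u)"
  using assms sfunD[OF u] unfolding Der3_def by blast
 show "is_fun (ran D u) (dcat D A) (dcat D B)"
  using a funD[OF D_fun[OF P u]] unfolding adjunction_def is_fun_def by auto
qed

text \<open>The part of the axioms that concerns left Kan extensions, with Der4 in the form of \<open>over_univ\<close>. Its purpose is
that both \<open>D\<close> and its opposite satisfy it, so that every result proved from it has a dual.\<close>

definition left_derivator :: "('k, 'o, 'm) derivator => bool" where
 "left_derivator D \<longleftrightarrow> is_prederivator D & Der1 D & Der2 D & Der3 D &
  (\<forall>u b X. small_fun u \<longrightarrow> b : Obj (Fcod u) \<longrightarrow> X : dobj D (Fdom u) \<longrightarrow>
   univ (dfun D (to_one (over_cat u b))) (dob D (over_proj u b) X) (dob D (pt (Fcod u) b) (Fobj (lan D u) X))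
    (restr D (over_cat u b) (over_proj u b) (over_nat u b) (Fobj (lan D u) X) (Ncomp (lan_unit D u) X)))"

lemma lderD:
 "left_derivator D ==> is_prederivator D" "left_derivator D ==> Der1 D" "left_derivator D ==> Der2 D" "left_derivator D ==> Der3 D"
 "left_derivator D ==> sfun u A B ==> b : Obj B ==> X : dobj D A ==>
  univ (dfun D (to_one (over_cat u b))) (dob D (over_proj u b) X) (dob D (pt B b) (Fobj (lan D u) X))
   (restr D (over_cat u b) (over_proj u b) (over_nat u b) (Fobj (lan D u) X) (Ncomp (lan_unit D u) X))"
 unfolding left_derivator_def using sfunD(1,2,3)[of u A B] by metis+

lemma derivator_left:
 fixes D :: "('k, 'o, 'm) derivator"
 assumes inf: "infinite (UNIV :: 'k set)" and D: "is_derivator D"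
 shows "left_derivator D"
 unfolding left_derivator_def
 using derD[OF D] over_univ[OF inf D small_fun_sfun] by blast

lemma Der2_iso:
 assumes D: "Der2 D" "small_cat A" "f : dhom D A X Y"
  and "\<And>a. a : Obj A ==> iso_arr (dcat D one_cat) (dar D (pt A a) f)"
 shows "iso_arr (dcat D A) f"
 using assms HomD(1)[OF D(3)] unfolding Der2_def by blast

text \<open>Compare \<open>f\<close> with the unit of \<open>u\<^sub>!\<close>: the two differ by an isomorphism, which restriction preserves.\<close>

lemma univ_restr:
 fixes u :: "'k sfun"
 assumes inf: "infinite (UNIV :: 'k set)" and D: "left_derivator D" and c: "final_cocone u A B b k J \<kappa>"
  and f: "univ (dfun D u) X Y f"
 shows "univ (dfun D (to_one J)) (dob D k X) (dob D (pt B b) Y) (restr D J k \<kappa> Y f)"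
proof -
 note P = lderD(1)[OF D]
 have c': "cocone u A B b k J \<kappa>" using c by (simp add: final_cocone_def)
 note C = coconeD[OF c'] and O' = over_cocone[OF inf coconeD(1,2)[OF c']]
 note O = coconeD[OF O'] and U = D_fun[OF P C(1)] and F = univD[OF D_fun[OF P C(1)] f]
 note L = lan_adj[OF lderD(4)[OF D] lderD(1)[OF D] C(1)]
 note u = adj_univ[OF L F(3)] and e = adjD(2)[OF L F(3)]
 obtain h where h: "h : dhom D B (Fobj (lan D u) X) Y" "dar D u h *[dcat D A] Ncomp (lan_unit D u) X = f"
  using univD(4)[OF U u F(2,1)] by blast
 have i: "iso_arr (dcat D B) h" by (rule univ_factor_iso[OF U u f h])
 note bh = fhom[OF D_fun[OF P C(6)] h(1)] fiso[OF D_fun[OF P C(6)] h(1) i]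
 have "univ (dfun D (to_one (over_cat u b))) (dob D (over_proj u b) X) (dob D (pt B b) Y)
   (restr D (over_cat u b) (over_proj u b) (over_nat u b) Y f)"
  using univ_postcomp_iso[OF D_fun[OF P O(5)] lderD(5)[OF D C(1,2) F(3)] bh] restr_comp[OF P O' e h(1)] h(2) by simp
 then show ?thesis using restr_final_iff[OF inf P c F(1,2)] by simp
qed

text \<open>Der2 reduces the invertibility of the comparison \<open>u\<^sub>! X \<rightarrow> Y\<close> to its values at the objects \<open>b\<close>, and there it compares
two universal arrows over the slice.\<close>

lemma univ_pointwise:
 fixes u :: "'k sfun"
 assumes inf: "infinite (UNIV :: 'k set)" and D: "left_derivator D" and u: "sfun u A B"
  and f: "f : dhom D A X (dob D u Y)" and Y: "Y : dobj D B"
  and ex: "\<And>b. b : Obj B ==> \<exists>k J \<kappa>. final_cocone u A B b k J \<kappa> &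
   univ (dfun D (to_one J)) (dob D k X) (dob D (pt B b) Y) (restr D J k \<kappa> Y f)"
 shows "univ (dfun D u) X Y f"
proof -
 note P = lderD(1)[OF D]
 note U = D_fun[OF P u] and X = cat_ob(1)[OF D_cat[OF P sfunD(4)[OF u]] f]
 note L = lan_adj[OF lderD(4)[OF D] lderD(1)[OF D] u]
 note lu = adj_univ[OF L X] and e = adjD(2)[OF L X]
 obtain h where h: "h : dhom D B (Fobj (lan D u) X) Y" "dar D u h *[dcat D A] Ncomp (lan_unit D u) X = f"
  using univD(4)[OF U lu f Y] by blast
 have "iso_arr (dcat D B) h"
 proof (rule Der2_iso[OF lderD(3)[OF D] sfunD(5)[OF u] h(1)])
  fix b assume b: "b : Obj B"
  note O' = over_cocone[OF inf u b]
  note O = coconeD[OF O']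
  obtain k J \<kappa> where "final_cocone u A B b k J \<kappa>"
   "univ (dfun D (to_one J)) (dob D k X) (dob D (pt B b) Y) (restr D J k \<kappa> Y f)" using ex[OF b] by blast
  then have "univ (dfun D (to_one (over_cat u b))) (dob D (over_proj u b) X) (dob D (pt B b) Y)
   (restr D (over_cat u b) (over_proj u b) (over_nat u b) Y f)" using restr_final_iff[OF inf P _ Y f] by blast
  from univ_factor_iso[OF D_fun[OF P O(5)] lderD(5)[OF D u b X] this fhom[OF D_fun[OF P O(6)] h(1)]]
  show "iso_arr (dcat D one_cat) (dar D (pt B b) h)" using restr_comp[OF P O' e h(1)] h(2) by simp
 qed
 then show ?thesis using univ_postcomp_iso[OF U lu h(1)] h(2) by simp
qed

section \<open>Morphisms of derivators and Kan extensions\<close>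

text \<open>The image under \<open>F\<close> of \<open>f: X \<rightarrow> u\<^sup>* Y\<close>, corrected by \<open>\<gamma>\<^sub>u\<close> so that its target is \<open>u\<^sup>* F Y\<close> again; \<open>mcoimg\<close> is the
analogue for \<open>f: u\<^sup>* Y \<rightarrow> X\<close>.\<close>

definition mimg :: "('k, 'p, 'n, 'y) prederivator_scheme => ('k, 'o, 'm, 'p, 'n) dmorphism => 'k sfun => 'o => 'm => 'n" where
 "mimg E F u Y f = inv_arr (dcat E (Fdom u)) (gam F u Y) *[dcat E (Fdom u)] mar F (Fdom u) f"

definition mcoimg :: "('k, 'p, 'n, 'y) prederivator_scheme => ('k, 'o, 'm, 'p, 'n) dmorphism => 'k sfun => 'o => 'm => 'n" where
 "mcoimg E F u Y f = mar F (Fdom u) f *[dcat E (Fdom u)] gam F u Y"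

definition pres_univ :: "('k, 'o, 'm, 'z) prederivator_scheme => ('k, 'p, 'n, 'y) prederivator_scheme => ('k, 'o, 'm, 'p, 'n) dmorphism => 'k sfun => bool" where
 "pres_univ D E F u \<longleftrightarrow> (\<forall>X Y f. univ (dfun D u) X Y f \<longrightarrow>
  univ (dfun E u) (mob F (Fdom u) X) (mob F (Fcod u) Y) (mimg E F u Y f))"

context
 fixes D :: "('k, 'o, 'm, 'z) prederivator_scheme" and E :: "('k, 'p, 'n, 'y) prederivator_scheme"
  and F :: "('k, 'o, 'm, 'p, 'n) dmorphism"
 assumes PD: "is_prederivator D" and PE: "is_prederivator E" and M: "is_dmorphism D E F"
begin

lemma M_fun: "small_cat A ==> is_fun (mfun F A) (dcat D A) (dcat E A)"
 using M unfolding is_dmorphism_def is_fun_def by blast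

lemma M_gam: "sfun u A B ==> nat_iso (mgam F u) & Nsrc (mgam F u) = dfun E u *. mfun F B & Ntgt (mgam F u) = mfun F A *. dfun D u"
 using M sfunD(1-3)[of u A B] unfolding is_dmorphism_def by metis

lemma gam_hom: 
 assumes u: "sfun u A B" and X: "X : dobj D B"
 shows "gam F u X : dhom E A (dob E u (mob F B X)) (mob F A (dob D u X))"
  "iso_arr (dcat E A) (gam F u X)"
proof -
 note us = sfunD[OF u]
 note FA = M_fun[OF us(4)] and FB = M_fun[OF us(5)] and Du = D_fun[OF PD u] and Eu = D_fun[OF PE u]
 have n: "is_ntrans (mgam F u)" "Nsrc (mgam F u) = dfun E u *. mfun F B" "Ntgt (mgam F u) = mfun F A *. dfun D u"
  and i: "\<And>x. x : Obj (Fdom (Nsrc (mgam F u))) ==> iso_arr (Fcod (Nsrc (mgam F u))) (gam F u x)"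
  using M_gam[OF u] by (auto simp: nat_iso_def)
 note s = funD[OF comp_fun[OF FB Eu]]
 show "gam F u X : dhom E A (dob E u (mob F B X)) (mob F A (dob D u X))"
  using ntD(5)[OF n s(2,3) X] by (simp add: compF_obj[OF FB X] compF_obj[OF Du X])
 show "iso_arr (dcat E A) (gam F u X)" using i[of X] n(2) s X by simp
qed

lemma gam_natural:
 assumes u: "sfun u A B" and f: "f : dhom D B X Y"
 shows "gam F u Y *[dcat E A] dar E u (mar F B f) =
  mar F A (dar D u f) *[dcat E A] gam F u X"
proof -
 note us = sfunD[OF u]
 note FA = M_fun[OF us(4)] and FB = M_fun[OF us(5)] and Du = D_fun[OF PD u] and Eu = D_fun[OF PE u]
 have n: "is_ntrans (mgam F u)" "Nsrc (mgam F u) = dfun E u *. mfun F B" "Ntgt (mgam F u) = mfun F A *. dfun D u"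
  using M_gam[OF u] by (auto simp: nat_iso_def)
 note s = funD[OF comp_fun[OF FB Eu]]
 show ?thesis using ntD(6)[OF n s(2,3) f] by (simp add: compF_arr[OF FB f] compF_arr[OF Du f])
qed

lemma gam_idF: "small_cat A ==> X : dobj D A ==> gam F (idF A) X = Id (dcat E A) (mob F A X)"
proof -
 assume A: "small_cat A" and X: "X : dobj D A"
 have "mgam F (idF A) = idN (mfun F A)" using M A unfolding is_dmorphism_def by blast
 then show ?thesis using X funD[OF M_fun[OF A]] by simp
qed

lemma gam_comp:
 assumes u: "sfun u A B" and v: "sfun v B C" and X: "X : dobj D C"
 shows "gam F (v *. u) X = gam F u (dob D v X) *[dcat E A] dar E u (gam F v X)"
proof -
 note us = sfunD[OF u] and vs = sfunD[OF v]
 have "mgam F (v *. u) = (mgam F u *R dfun D v) *N (dfun E u *L mgam F v)"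
  using M us(1-3) vs(1-3) unfolding is_dmorphism_def by metis
 moreover have "Fdom (Nsrc (mgam F v)) = dcat D C" "Fcod (dfun E u) = dcat E A"
  using M_gam[OF v] funD[OF comp_fun[OF M_fun[OF vs(5)] D_fun[OF PE v]]] funD[OF D_fun[OF PE u]] by auto
 moreover have "Fdom (dfun D v) = dcat D C" using funD[OF D_fun[OF PD v]] by simp
 ultimately show ?thesis using X by simp
qed

lemma gam_2cell:
 assumes a: "ncell \<alpha> u v A B" and X: "X : dobj D B"
 shows "mar F A (dnt D \<alpha> X) *[dcat E A] gam F u X =
  gam F v X *[dcat E A] dnt E \<alpha> (mob F B X)"
proof -
 note al = ncellD[OF a]
 note us = sfunD[OF al(5)] and vs = sfunD[OF al(6)]
 note FB = M_fun[OF us(5)]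
 have "(mfun F A *L dnat D \<alpha>) *N mgam F u = mgam F v *N (dnat E \<alpha> *R mfun F B)"
  using M al(1-3) us(2,3) unfolding is_dmorphism_def by metis
 from arg_cong[OF this, of "\<lambda>t. Ncomp t X"] show ?thesis
  using X M_gam[OF al(5)] D_nat[OF PD a] D_nat[OF PE a] funD[OF comp_fun[OF FB D_fun[OF PE al(5)]]]
   funD[OF FB] funD[OF D_fun[OF PD al(5)]] funD[OF D_fun[OF PE al(5)]]
  by (simp add: compF_obj[OF FB])
qed

lemma mimg_hom:
 assumes u: "sfun u A B" and Y: "Y : dobj D B" and f: "f : dhom D A X (dob D u Y)"
 shows "mimg E F u Y f : dhom E A (mob F A X) (dob E u (mob F B Y))"
  "gam F u Y *[dcat E A] mimg E F u Y f = mar F A f"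
proof -
 note us = sfunD[OF u] and g = gam_hom[OF u Y] and EA = D_cat[OF PE sfunD(4)[OF u]]
 note Ff = fhom[OF M_fun[OF us(4)] f]
 show "mimg E F u Y f : dhom E A (mob F A X) (dob E u (mob F B Y))"
  unfolding mimg_def us(2) using cat_comp[OF EA inv_arr(1)[OF EA g] Ff] .
 show "gam F u Y *[dcat E A] mimg E F u Y f = mar F A f"
  unfolding mimg_def us(2) using inv_cancel(2)[OF EA g Ff] .
qed

lemma mimg_eqI:
 assumes u: "sfun u A B" and Y: "Y : dobj D B" 
  and g: "g : dhom E A W (dob E u (mob F B Y))"
  and e: "gam F u Y *[dcat E A] g = mar F A f"
 shows "g = mimg E F u Y f"
 unfolding mimg_def sfunD(2)[OF u] e[symmetric]
 using inv_cancel(1)[OF D_cat[OF PE sfunD(4)[OF u]] gam_hom[OF u Y] g] by simp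

lemma mimg_comp:
 assumes u: "sfun u A B" and f: "f : dhom D A X (dob D u Y)" and h: "h : dhom D B Y Z"
 shows "mimg E F u Z (dar D u h *[dcat D A] f) = dar E u (mar F B h) *[dcat E A] mimg E F u Y f"
proof (rule mimg_eqI[symmetric, OF u])
 note us = sfunD[OF u] and EA = D_cat[OF PE sfunD(4)[OF u]]
 note YZ = cat_ob[OF D_cat[OF PD us(5)] h] and uh = fhom[OF D_fun[OF PD u] h]
 note i = mimg_hom[OF u YZ(1) f] and Fh = fhom[OF D_fun[OF PE u] fhom[OF M_fun[OF us(5)] h]]
 note gY = gam_hom(1)[OF u YZ(1)] and gZ = gam_hom(1)[OF u YZ(2)]
 show "Z : dobj D B" by (rule YZ)
 show "dar E u (mar F B h) *[dcat E A] mimg E F u Y f : dhom E A (mob F A X) (dob E u (mob F B Z))"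
  using cat_comp[OF EA Fh i(1)] .
 show "gam F u Z *[dcat E A] (dar E u (mar F B h) *[dcat E A] mimg E F u Y f)
   = mar F A (dar D u h *[dcat D A] f)"
  using cat_comp_eq[OF EA gam_natural[OF u h] Fh gZ gY fhom[OF M_fun[OF us(4)] uh] i(1)] i(2)
   fcomp[OF M_fun[OF us(4)] uh f] by simp
qed

lemma mimg_compF:
 assumes u: "sfun u A B" and v: "sfun v B C" and Y: "Y : dobj D B" and Z: "Z : dobj D C"
  and f: "f : dhom D A X (dob D u Y)" and g: "g : dhom D B Y (dob D v Z)"
 shows "mimg E F (v *. u) Z (dar D u g *[dcat D A] f) = dar E u (mimg E F v Z g) *[dcat E A] mimg E F u Y f"
proof (rule mimg_eqI[symmetric, OF sfun_comp[OF u v] Z])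
 note us = sfunD[OF u] and vs = sfunD[OF v] and EA = D_cat[OF PE sfunD(4)[OF u]]
 note i = mimg_hom[OF u Y f] and j = mimg_hom[OF v Z g] and uj = fhom[OF D_fun[OF PE u] mimg_hom(1)[OF v Z g]]
 note vZ = fobj[OF D_fun[OF PD v] Z] and ug = fhom[OF D_fun[OF PD u] g]
 note gv = fhom[OF D_fun[OF PE u] gam_hom(1)[OF v Z]] and gu = gam_hom(1)[OF u vZ]
 show "dar E u (mimg E F v Z g) *[dcat E A] mimg E F u Y f : dhom E A (mob F A X) (dob E (v *. u) (mob F C Z))"
  using cat_comp[OF EA uj i(1)] D_cob[OF PE u v fobj[OF M_fun[OF vs(5)] Z]] by simp
 have "gam F (v *. u) Z *[dcat E A] (dar E u (mimg E F v Z g) *[dcat E A] mimg E F u Y f)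
  = gam F u (dob D v Z) *[dcat E A] (dar E u (gam F v Z) *[dcat E A] (dar E u (mimg E F v Z g) *[dcat E A] mimg E F u Y f))"
  unfolding gam_comp[OF u v Z] using cat_assoc[OF EA gu gv cat_comp[OF EA uj i(1)]] .
 also have "\<dots> = gam F u (dob D v Z) *[dcat E A] (dar E u (mar F B g) *[dcat E A] mimg E F u Y f)"
  using cat_assoc[OF EA gv uj i(1)] fcomp[OF D_fun[OF PE u] gam_hom(1)[OF v Z] j(1)] j(2) by simp
 also have "\<dots> = mar F A (dar D u g) *[dcat E A] (gam F u Y *[dcat E A] mimg E F u Y f)"
  using cat_comp_eq[OF EA gam_natural[OF u g] fhom[OF D_fun[OF PE u] fhom[OF M_fun[OF us(5)] g]] gu
    gam_hom(1)[OF u Y] fhom[OF M_fun[OF us(4)] ug] i(1)] .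
 also have "\<dots> = mar F A (dar D u g *[dcat D A] f)"
  using i(2) fcomp[OF M_fun[OF us(4)] ug f] by simp
 finally show "gam F (v *. u) Z *[dcat E A] (dar E u (mimg E F v Z g) *[dcat E A] mimg E F u Y f)
  = mar F A (dar D u g *[dcat D A] f)" .
qed

text \<open>Passing to a slice commutes with applying \<open>F\<close>, by the compatibility of \<open>\<gamma>\<close> with composition and 2-cells.\<close>

lemma mimg_restr:
 assumes c: "cocone u A B b k J \<kappa>" and Y: "Y : dobj D B" and f: "f : dhom D A X (dob D u Y)"
 shows "dar E (to_one J) (gam F (pt B b) Y) *[dcat E J] restr E J k \<kappa> (mob F B Y) (mimg E F u Y f)
  = mimg E F (to_one J) (dob D (pt B b) Y) (restr D J k \<kappa> Y f) *[dcat E J] gam F k X"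
proof -
 note C = coconeD[OF c]
 let ?G = "mob F B Y" and ?bY = "dob D (pt B b) Y" and ?p = "to_one J"
 note B = sfunD(5)[OF C(1)] and A = sfunD(4)[OF C(1)] and J = sfunD(4)[OF C(3)]
 note EJ = D_cat[OF PE J] and DA = D_cat[OF PD A]
 note X = cat_ob(1)[OF DA f] and FB = M_fun[OF B] and FA = M_fun[OF A] and FJ = M_fun[OF J]
 note G = fobj[OF FB Y] and bY = fobj[OF D_fun[OF PD C(6)] Y] and uY = fobj[OF D_fun[OF PD C(1)] Y]
 note i = mimg_hom[OF C(1) Y f]
 note rD = restr_hom[OF PD c Y f] and rE = restr_hom[OF PE c G i(1)]
 note kX = fobj[OF D_fun[OF PD C(3)] X]
 note ki = fhom[OF D_fun[OF PE C(3)] i(1)] and kf = fhom[OF D_fun[OF PD C(3)] f]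
 note gb = fhom[OF D_fun[OF PE C(5)] gam_hom(1)[OF C(6) Y]]
 note gp = gam_hom(1)[OF C(5) bY] and gk = gam_hom(1)[OF C(3) X] and gku = gam_hom(1)[OF C(3) uY]
 note gu = fhom[OF D_fun[OF PE C(3)] gam_hom(1)[OF C(1) Y]]
 note j = mimg_hom[OF C(5) bY rD]
 have nE: "dnt E \<kappa> ?G : dhom E J (dob E k (dob E u ?G)) (dob E ?p (dob E (pt B b) ?G))"
  using D_nat_hom[OF PE C(4) G] D_cob[OF PE C(3,1) G] D_cob[OF PE C(5,6) G] by simp
 have nD: "dnt D \<kappa> Y : dhom D J (dob D k (dob D u Y)) (dob D ?p ?bY)"
  using D_nat_hom[OF PD C(4) Y] D_cob[OF PD C(3,1) Y] D_cob[OF PD C(5,6) Y] by simp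
 note FnD = fhom[OF FJ nD]
 have two: "mar F J (dnt D \<kappa> Y) *[dcat E J] (gam F k (dob D u Y) *[dcat E J] dar E k (gam F u Y))
  = (gam F ?p ?bY *[dcat E J] dar E ?p (gam F (pt B b) Y)) *[dcat E J] dnt E \<kappa> ?G"
  using gam_2cell[OF C(4) Y] gam_comp[OF C(3,1) Y] gam_comp[OF C(5,6) Y] by simp
 have kgu: "dar E k (gam F u Y) *[dcat E J] dar E k (mimg E F u Y f) = dar E k (mar F A f)"
  using fcomp[OF D_fun[OF PE C(3)] gam_hom(1)[OF C(1) Y] i(1), symmetric] i(2) by simp
 have "gam F ?p ?bY *[dcat E J] (dar E ?p (gam F (pt B b) Y) *[dcat E J] restr E J k \<kappa> ?G (mimg E F u Y f))
  = ((gam F ?p ?bY *[dcat E J] dar E ?p (gam F (pt B b) Y)) *[dcat E J] dnt E \<kappa> ?G) *[dcat E J] dar E k (mimg E F u Y f)"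
  using cat_assoc[OF EJ gp gb rE] cat_assoc[OF EJ cat_comp[OF EJ gp gb] nE ki] unfolding restr_def by simp
 also have "\<dots> = mar F J (dnt D \<kappa> Y) *[dcat E J] (gam F k (dob D u Y) *[dcat E J] dar E k (mar F A f))"
  using two[symmetric] cat_assoc[OF EJ FnD cat_comp[OF EJ gku gu] ki] cat_assoc[OF EJ gku gu ki] kgu by simp
 also have "\<dots> = mar F J (restr D J k \<kappa> Y f) *[dcat E J] gam F k X"
  unfolding gam_natural[OF C(3) f] restr_def fcomp[OF FJ nD kf]
  using cat_assoc[OF EJ FnD fhom[OF FJ kf] gk] by simp
 also have "\<dots> = gam F ?p ?bY *[dcat E J] (mimg E F ?p ?bY (restr D J k \<kappa> Y f) *[dcat E J] gam F k X)"
  using cat_assoc[OF EJ gp j(1) gk] j(2) by simp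
 finally have e: "gam F ?p ?bY *[dcat E J] (dar E ?p (gam F (pt B b) Y) *[dcat E J] restr E J k \<kappa> ?G (mimg E F u Y f))
  = gam F ?p ?bY *[dcat E J] (mimg E F ?p ?bY (restr D J k \<kappa> Y f) *[dcat E J] gam F k X)" .
 show ?thesis
  using inv_cancel(1)[OF EJ gam_hom[OF C(5) bY] cat_comp[OF EJ gb rE]]
   inv_cancel(1)[OF EJ gam_hom[OF C(5) bY] cat_comp[OF EJ j(1) gk]] unfolding e by metis
qed

lemma mcoimg_hom:
 assumes u: "sfun u A B" and Y: "Y : dobj D B" and f: "f : dhom D A (dob D u Y) X"
 shows "mcoimg E F u Y f : dhom E A (dob E u (mob F B Y)) (mob F A X)"
 unfolding mcoimg_def sfunD(2)[OF u]
 using cat_comp[OF D_cat[OF PE sfunD(4)[OF u]] fhom[OF M_fun[OF sfunD(4)[OF u]] f] gam_hom(1)[OF u Y]] .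

lemma mcoimg_comp:
 assumes u: "sfun u A B" and f: "f : dhom D A (dob D u Y) X" and h: "h : dhom D B Z Y"
 shows "mcoimg E F u Z (f *[dcat D A] dar D u h) = mcoimg E F u Y f *[dcat E A] dar E u (mar F B h)"
proof -
 note us = sfunD[OF u] and EA = D_cat[OF PE sfunD(4)[OF u]]
 note ZY = cat_ob[OF D_cat[OF PD us(5)] h] and uh = fhom[OF D_fun[OF PD u] h] and FA = M_fun[OF us(4)]
 note Fh = fhom[OF D_fun[OF PE u] fhom[OF M_fun[OF us(5)] h]]
 show ?thesis
  unfolding mcoimg_def us(2) fcomp[OF FA f uh]
  using cat_assoc[OF EA fhom[OF FA f] fhom[OF FA uh] gam_hom(1)[OF u ZY(1)]] gam_natural[OF u h]
   cat_assoc[OF EA fhom[OF FA f] gam_hom(1)[OF u ZY(2)] Fh] by simp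
qed

end


text \<open>Restrict a universal arrow to the slices by \<open>univ_restr\<close>, apply \<open>F\<close> there, and reassemble by
\<open>univ_pointwise\<close>.\<close>

lemma pres_univ_pointwise:
 fixes u :: "'k sfun"
 assumes inf: "infinite (UNIV :: 'k set)" and D: "left_derivator D" and E: "left_derivator E" and M: "is_dmorphism D E F"
  and u: "sfun u A B"
  and ex: "\<And>b. b : Obj B ==> \<exists>k J \<kappa>. final_cocone u A B b k J \<kappa> & pres_univ D E F (to_one J)"
 shows "pres_univ D E F u"
 unfolding pres_univ_def
proof (intro allI impI)
 note PD = lderD(1)[OF D] and PE = lderD(1)[OF E]
 note us = sfunD[OF u] and FA = M_fun[OF PD PE M sfunD(4)[OF u]] and FB = M_fun[OF PD PE M sfunD(5)[OF u]]
 fix X Y f assume f: "univ (dfun D u) X Y f"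
 note F = univD[OF D_fun[OF PD u] f]
 note i = mimg_hom(1)[OF PD PE M u F(1,2)] and FY = fobj[OF FB F(1)]
 have "univ (dfun E u) (mob F A X) (mob F B Y) (mimg E F u Y f)"
 proof (rule univ_pointwise[OF inf E u i FY])
  fix b assume "b : Obj B"
  then obtain k J \<kappa> where c: "final_cocone u A B b k J \<kappa>" and p: "pres_univ D E F (to_one J)" using ex by blast
  have c': "cocone u A B b k J \<kappa>" using c by (simp add: final_cocone_def)
  note C = coconeD[OF c']
  note EJ = D_fun[OF PE C(5)] and gk = gam_hom[OF PD PE M C(3) F(3)] and gb = gam_hom[OF PD PE M C(6) F(1)]
  have "univ (dfun E (to_one J)) (mob F J (dob D k X)) (mob F one_cat (dob D (pt B b) Y))
   (mimg E F (to_one J) (dob D (pt B b) Y) (restr D J k \<kappa> Y f))"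
   using univ_restr[OF inf D c f] p sfunD(2,3)[OF C(5)] unfolding pres_univ_def by auto
  from univ_precomp_iso[OF EJ this gk]
  have "univ (dfun E (to_one J)) (dob E k (mob F A X)) (dob E (pt B b) (mob F B Y))
   (restr E J k \<kappa> (mob F B Y) (mimg E F u Y f))"
   using mimg_restr[OF PD PE M c' F(1,2)] univ_postcomp_iso_iff[OF EJ restr_hom[OF PE c' FY i] gb] by simp
  then show "\<exists>k J \<kappa>. final_cocone u A B b k J \<kappa> & univ (dfun E (to_one J)) (dob E k (mob F A X)) (dob E (pt B b) (mob F B Y))
   (restr E J k \<kappa> (mob F B Y) (mimg E F u Y f))" using c by blast
 qed
 then show "univ (dfun E u) (mob F (Fdom u) X) (mob F (Fcod u) Y) (mimg E F u Y f)"
  using us by simp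
qed

context
 fixes D :: "('k, 'o, 'm) derivator" and E :: "('k, 'p, 'n) derivator" and F :: "('k, 'o, 'm, 'p, 'n) dmorphism"
 assumes PD: "is_prederivator D" and PE: "is_prederivator E" and M: "is_dmorphism D E F"
  and D3: "Der3 D" and E3: "Der3 E"
begin

lemma pres_univ_compF:
 assumes u: "sfun u A B" and v: "sfun v B C" and pu: "pres_univ D E F u" and pv: "pres_univ D E F v"
 shows "pres_univ D E F (v *. u)"
 unfolding pres_univ_def
proof (intro allI impI)
 note us = sfunD[OF u] and vs = sfunD[OF v] and Du = D_fun[OF PD u] and Dv = D_fun[OF PD v]
 fix X Z f assume f: "univ (dfun D (v *. u)) X Z f"
 note F = univD[OF D_fun[OF PD sfun_comp[OF u v]] f]
 note L = lan_adj[OF D3 PD u]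
 let ?Y = "Fobj (lan D u) X"
 note e = adj_univ[OF L F(3)] and Y = fobj[OF L(2) F(3)] and vZ = fobj[OF Dv F(1)]
 note eh = adjD(2)[OF L F(3)]
 obtain g where g: "g : dhom D B ?Y (dob D v Z)" "dar D u g *[dcat D A] Ncomp (lan_unit D u) X = f"
  using univD(4)[OF Du e _ vZ] F(2) D_cob[OF PD u v F(1)] by auto
 have "univ (dfun D v) ?Y Z g" using univ_comp_iff[OF Du e Dv F(1) g(1)] f g(2) D_compF[OF PD u v] by simp
 then have 1: "univ (dfun E v) (mob F B ?Y) (mob F C Z) (mimg E F v Z g)"
  using pv vs unfolding pres_univ_def by auto
 have 2: "univ (dfun E u) (mob F A X) (mob F B ?Y) (mimg E F u ?Y (Ncomp (lan_unit D u) X))"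
  using pu us e unfolding pres_univ_def by auto
 have "univ (dfun E (v *. u)) (mob F A X) (mob F C Z) (mimg E F (v *. u) Z f)"
  using univ_comp_iff[OF D_fun[OF PE u] 2 D_fun[OF PE v] univD(1)[OF D_fun[OF PE v] 1] mimg_hom(1)[OF PD PE M v F(1) g(1)]] 1
   mimg_compF[OF PD PE M u v Y F(1) eh g(1)] g(2) D_compF[OF PE u v] by simp
 then show "univ (dfun E (v *. u)) (mob F (Fdom (v *. u)) X) (mob F (Fcod (v *. u)) Z) (mimg E F (v *. u) Z f)"
  using us vs by simp
qed

text \<open>The mate is the transpose of the image of the unit, hence invertible iff that image is universal.\<close>

lemma lan_mate_univ:
 assumes u: "sfun u A B" and X: "X : dobj D A"
 shows "lan_mate D E F u X : dhom E B (Fobj (lan E u) (mob F A X)) (mob F B (Fobj (lan D u) X))"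
  "dar E u (lan_mate D E F u X) *[dcat E A] Ncomp (lan_unit E u) (mob F A X)
   = mimg E F u (Fobj (lan D u) X) (Ncomp (lan_unit D u) X)"
  "iso_arr (dcat E B) (lan_mate D E F u X) \<longleftrightarrow>
   univ (dfun E u) (mob F A X) (mob F B (Fobj (lan D u) X)) (mimg E F u (Fobj (lan D u) X) (Ncomp (lan_unit D u) X))"
proof -
 note us = sfunD[OF u] and L = lan_adj[OF D3 PD u] and LE = lan_adj[OF E3 PE u]
 note uX = fobj[OF L(2) X] and e = adjD(2)[OF L X]
 note i = mimg_hom(1)[OF PD PE M u uX e] and FuX = fobj[OF M_fun[OF PD PE M us(5)] fobj[OF L(2) X]]
 note EA = D_cat[OF PE us(4)]
 have "lan_mate D E F u X = Ncomp (lan_counit E u) (mob F B (Fobj (lan D u) X)) *[dcat E B] Farr (lan E u) (mimg E F u (Fobj (lan D u) X) (Ncomp (lan_unit D u) X))"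
  unfolding lan_mate_def mimg_def Let_def us(2,3)
  using fcomp[OF LE(2) inv_arr(1)[OF EA gam_hom[OF PD PE M u uX]] fhom[OF M_fun[OF PD PE M us(4)] e]] by simp
 then show "lan_mate D E F u X : dhom E B (Fobj (lan E u) (mob F A X)) (mob F B (Fobj (lan D u) X))"
  "dar E u (lan_mate D E F u X) *[dcat E A] Ncomp (lan_unit E u) (mob F A X)
   = mimg E F u (Fobj (lan D u) X) (Ncomp (lan_unit D u) X)"
  "iso_arr (dcat E B) (lan_mate D E F u X) \<longleftrightarrow>
   univ (dfun E u) (mob F A X) (mob F B (Fobj (lan D u) X)) (mimg E F u (Fobj (lan D u) X) (Ncomp (lan_unit D u) X))"
  using adjunction_transpose[OF LE i FuX] by simp_all
qed

lemma ran_mate_couniv: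
 assumes u: "sfun u A B" and X: "X : dobj D A"
 shows "ran_mate D E F u X : dhom E B (mob F B (Fobj (ran D u) X)) (Fobj (ran E u) (mob F A X))"
  "Ncomp (ran_counit E u) (mob F A X) *[dcat E A] dar E u (ran_mate D E F u X)
   = mcoimg E F u (Fobj (ran D u) X) (Ncomp (ran_counit D u) X)"
  "iso_arr (dcat E B) (ran_mate D E F u X) \<longleftrightarrow>
   couniv (dfun E u) (mob F A X) (mob F B (Fobj (ran D u) X)) (mcoimg E F u (Fobj (ran D u) X) (Ncomp (ran_counit D u) X))"
proof -
 note us = sfunD[OF u] and L = ran_adj[OF D3 PD u] and LE = ran_adj[OF E3 PE u]
 note Du = D_fun[OF PD u] and Eu = D_fun[OF PE u]
 note uX = fobj[OF L(2) X] and e = adjD(3)[OF L(1) Du X]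
 note i = mcoimg_hom[OF PD PE M u uX e] and FuX = fobj[OF M_fun[OF PD PE M us(5)] fobj[OF L(2) X]]
 note Fe = fhom[OF M_fun[OF PD PE M us(4)] e] and g = gam_hom(1)[OF PD PE M u uX]
 have "ran_mate D E F u X = Farr (ran E u) (mcoimg E F u (Fobj (ran D u) X) (Ncomp (ran_counit D u) X)) *[dcat E B] Ncomp (ran_unit E u) (mob F B (Fobj (ran D u) X))"
  unfolding ran_mate_def mcoimg_def Let_def us(2,3)
  using fcomp[OF LE(2) Fe g] cat_assoc[OF funD(5)[OF LE(2)] fhom[OF LE(2) Fe] fhom[OF LE(2) g] adjD(2)[OF LE(1) Eu FuX]] by simp
 then show "ran_mate D E F u X : dhom E B (mob F B (Fobj (ran D u) X)) (Fobj (ran E u) (mob F A X))"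
  "Ncomp (ran_counit E u) (mob F A X) *[dcat E A] dar E u (ran_mate D E F u X)
   = mcoimg E F u (Fobj (ran D u) X) (Ncomp (ran_counit D u) X)"
  "iso_arr (dcat E B) (ran_mate D E F u X) \<longleftrightarrow>
   couniv (dfun E u) (mob F A X) (mob F B (Fobj (ran D u) X)) (mcoimg E F u (Fobj (ran D u) X) (Ncomp (ran_counit D u) X))"
  using adjunction_cotranspose[OF LE(1) Eu i FuX] by simp_all
qed

text \<open>Any universal arrow differs from the unit by an isomorphism, so it suffices to look at units.\<close>

lemma preserves_lan_iff:
 assumes u: "sfun u A B"
 shows "preserves_lan D E F u \<longleftrightarrow> pres_univ D E F u"
proof
 note us = sfunD[OF u] and L = lan_adj[OF D3 PD u] and FA = M_fun[OF PD PE M sfunD(4)[OF u]] and FB = M_fun[OF PD PE M sfunD(5)[OF u]]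
 show "pres_univ D E F u ==> preserves_lan D E F u"
  unfolding preserves_lan_def us(2,3) using lan_mate_univ(3)[OF u] adj_univ[OF L] us(2,3)
  unfolding pres_univ_def by auto
 assume p: "preserves_lan D E F u"
 show "pres_univ D E F u" unfolding pres_univ_def us(2,3)
 proof (intro allI impI)
  fix X Y f assume f: "univ (dfun D u) X Y f"
  note F = univD[OF D_fun[OF PD u] f]
  note e = adj_univ[OF L F(3)] and eh = adjD(2)[OF L F(3)]
  obtain h where h: "h : dhom D B (Fobj (lan D u) X) Y" "dar D u h *[dcat D A] Ncomp (lan_unit D u) X = f"
   using univD(4)[OF D_fun[OF PD u] e F(2,1)] by blast
  note i = univ_factor_iso[OF D_fun[OF PD u] e f h]
  have "univ (dfun E u) (mob F A X) (mob F B (Fobj (lan D u) X)) (mimg E F u (Fobj (lan D u) X) (Ncomp (lan_unit D u) X))"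
   using p lan_mate_univ(3)[OF u F(3)] F(3) us(2,3) unfolding preserves_lan_def by auto
  from univ_postcomp_iso[OF D_fun[OF PE u] this fhom[OF FB h(1)] fiso[OF FB h(1) i]]
  show "univ (dfun E u) (mob F A X) (mob F B Y) (mimg E F u Y f)"
   using mimg_comp[OF PD PE M u eh h(1)] h(2) by simp
 qed
qed

lemma to_one_one: "infinite (UNIV :: 'k set) ==> to_one one_cat = (idF one_cat :: 'k sfun)"
 by (rule to_one_unique[OF sfun_id[OF small_ord], symmetric])

lemma pres_one:
 assumes inf: "infinite (UNIV :: 'k set)"
 shows "pres_univ D E F (to_one one_cat)"
proof -
 let ?I = "idF one_cat :: 'k sfun"
 have o: "small_cat (one_cat :: 'k scat)" using small_ord[OF inf] .
 note t = to_one_one[OF inf] and Fo = M_fun[OF PD PE M o] and EO = D_cat[OF PE o] and DO = D_cat[OF PD o] and id = sfun_id[OF o]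
 have 1: "univ (dfun E ?I) (mob F one_cat X) (mob F one_cat Y) (mimg E F ?I Y f)"
  if "univ (dfun D ?I) X Y f" for X Y f
 proof -
  note f = univD[OF D_fun[OF PD id] that]
  have fh: "f : dhom D one_cat X Y" using f(1,2) D_idF[OF PD o] by simp
  have i: "iso_arr (dcat D one_cat) f" using that univ_idF[OF DO fh] D_idF[OF PD o] by simp
  note Ff = fhom[OF Fo fh]
  have "mimg E F ?I Y f = mar F one_cat f"
   unfolding mimg_def using gam_idF[OF PD PE M o f(1)] inv_id[OF EO fobj[OF Fo f(1)]] cat_idl[OF EO Ff] by simp
  then show ?thesis using univ_idF[OF EO Ff] D_idF[OF PE o] fiso[OF Fo fh i] by simp
 qed
 show "pres_univ D E F (to_one one_cat)" unfolding t pres_univ_def using 1 by auto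
qed

end

section \<open>Products, full subcategories and coproducts of small categories\<close>

lemma prod_simps:
 "x : Obj (A >< B) \<longleftrightarrow> (\<exists>a b. x = Tup a b & a : Obj A & b : Obj B)"
 "h : Hom (A >< B) x y \<longleftrightarrow> (\<exists>a b a' b' f g. x = Tup a b & y = Tup a' b' & h = Tup f g & f : Hom A a a' & g : Hom B b b')"
 "a : Obj A ==> b : Obj B ==> Id (A >< B) (Tup a b) = Tup (Id A a) (Id B b)"
 "f' : Hom A a' a'' ==> g' : Hom B b' b'' ==> f : Hom A a a' ==> g : Hom B b b' ==>
  Tup f' g' *[A >< B] Tup f g = Tup (f' *[A] f) (g' *[B] g)"
 by (auto simp: prod_cat_def Hom_mk_cat Hom_def)

lemma category_prod:
 assumes A: "category A" and B: "category B"
 shows "category (A >< B)"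
proof -
 have a: "\<And>g f. g : Arr A ==> f : Arr A ==> Cod A f = Dom A g ==> g *[A] f : Arr A & Dom A (g *[A] f) = Dom A f & Cod A (g *[A] f) = Cod A g"
  using cat_comp[OF A, unfolded Hom_def] by auto
 have b: "\<And>g f. g : Arr B ==> f : Arr B ==> Cod B f = Dom B g ==> g *[B] f : Arr B & Dom B (g *[B] f) = Dom B f & Cod B (g *[B] f) = Cod B g"
  using cat_comp[OF B, unfolded Hom_def] by auto
 show ?thesis unfolding prod_cat_def
  by (rule category_mk_cat)
   (auto simp: cat_dom[OF A] cat_dom[OF B] cat_cod[OF A] cat_cod[OF B] HomD[OF cat_id[OF A]] HomD[OF cat_id[OF B]] a b
    cat_idl[OF A HomI] cat_idl[OF B HomI] cat_idr[OF A HomI] cat_idr[OF B HomI]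
    cat_assoc[OF A, unfolded Hom_def, simplified] cat_assoc[OF B, unfolded Hom_def, simplified])
qed

lemma small_prod:
 fixes A B :: "'k scat"
 assumes inf: "infinite (UNIV :: 'k set)" and A: "small_cat A" and B: "small_cat B"
 shows "small_cat (A >< B)"
 using category_prod small_image2[OF inf, of _ _ Tup] A B unfolding small_cat_def by (auto simp: prod_cat_def)

lemma sfun_prod:
 fixes A :: "'k scat"
 assumes inf: "infinite (UNIV :: 'k set)" and A: "small_cat A" and u: "sfun u J K"
 shows "sfun (A ** u) (A >< J) (A >< K)"
  "a : Obj A ==> j : Obj J ==> Fobj (A ** u) (Tup a j) = Tup a (Fobj u j)"
  "f : Hom A a a' ==> g : Hom J j j' ==> Farr (A ** u) (Tup f g) = Tup f (Farr u g)"
proof -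
 note us = sfunD[OF u]
 have cA: "category A" using A by (simp add: small_cat_def)
 have id: "f : Hom A a a' ==> Farr (idF A) f = f" for f a a' using HomD(1)[of f A] by simp
 note P = prod_simps
 have o: "\<And>a j. a : Obj A ==> j : Obj J ==> Tup a j : Obj (A >< J)" by (simp add: P)
 have h: "\<And>a j a' j' f g. f : Hom A a a' ==> g : Hom J j j' ==> Tup f g : Arr (A >< J)"
  using HomD(1) by (fastforce simp: prod_cat_def)
 show "sfun (A ** u) (A >< J) (A >< K)"
  unfolding prod_fun_def us(2,3) idF_simps
 proof (rule sfun_mk_fun[OF small_prod[OF inf A us(4)] small_prod[OF inf A us(5)]])
  fix x assume "x : Obj (A >< J)"
  then obtain a j where x: "x = Tup a j" "a : Obj A" "j : Obj J" by (auto simp: P)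
  then show "Tup (Fobj (idF A) (ufst x)) (Fobj u (usnd x)) : Obj (A >< K)"
   using fobj[OF us(6) x(3)] by (simp add: P)
  show "Tup (Farr (idF A) (ufst (Id (A >< J) x))) (Farr u (usnd (Id (A >< J) x))) = Id (A >< K) (Tup (Fobj (idF A) (ufst x)) (Fobj u (usnd x)))"
   using x fobj[OF us(6) x(3)] fident[OF us(6) x(3)] id[OF cat_id[OF cA x(2)]] by (simp add: P(3))
 next
  fix f x y assume "f : Hom (A >< J) x y"
  then obtain a b a' b' f' g' where f: "x = Tup a b" "y = Tup a' b'" "f = Tup f' g'" "f' : Hom A a a'" "g' : Hom J b b'" by (auto simp: P)
  then show "Tup (Farr (idF A) (ufst f)) (Farr u (usnd f)) : Hom (A >< K) (Tup (Fobj (idF A) (ufst x)) (Fobj u (usnd x))) (Tup (Fobj (idF A) (ufst y)) (Fobj u (usnd y)))"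
   using fhom[OF us(6) f(5)] id[OF f(4)] cat_ob[OF cA f(4)] by (simp add: P)
 next
  fix g f x y z assume "g : Hom (A >< J) y z" "f : Hom (A >< J) x y"
  then obtain a b a' b' f1 f2 a'' b'' g1 g2 where f: "x = Tup a b" "y = Tup a' b'" "f = Tup f1 f2" "f1 : Hom A a a'" "f2 : Hom J b b'"
   and g: "z = Tup a'' b''" "g = Tup g1 g2" "g1 : Hom A a' a''" "g2 : Hom J b' b''" by (auto simp: P)
  show "Tup (Farr (idF A) (ufst (g *[A >< J] f))) (Farr u (usnd (g *[A >< J] f)))
   = Tup (Farr (idF A) (ufst g)) (Farr u (usnd g)) *[A >< K] Tup (Farr (idF A) (ufst f)) (Farr u (usnd f))"
   using f(3) g(2) P(4)[OF g(3,4) f(4,5)] P(4)[OF g(3) fhom[OF us(6) g(4)] f(4) fhom[OF us(6) f(5)]]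
    id[OF f(4)] id[OF g(3)] id[OF cat_comp[OF cA g(3) f(4)]] fcomp[OF us(6) g(4) f(5)] by simp
 qed
 show "a : Obj A ==> j : Obj J ==> Fobj (A ** u) (Tup a j) = Tup a (Fobj u j)"
  using o us(2) by (simp add: prod_fun_def)
 show "f : Hom A a a' ==> g : Hom J j j' ==> Farr (A ** u) (Tup f g) = Tup f (Farr u g)"
  using h us(2) id by (simp add: prod_fun_def)
qed

lemma full_sub_simps:
 "Obj (full_sub A S) = Obj A \<inter> S"
 "h : Hom (full_sub A S) x y \<longleftrightarrow> h : Hom A x y & x : S & y : S"
 "x : Obj A ==> x : S ==> Id (full_sub A S) x = Id A x"
 "g : Hom (full_sub A S) y z ==> f : Hom (full_sub A S) x y ==> g *[full_sub A S] f = g *[A] f"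
 by (auto simp: full_sub_def Hom_mk_cat Hom_def)

lemma small_full_sub:
 assumes A: "small_cat A"
 shows "small_cat (full_sub A S)"
proof -
 have cA: "category A" using A by (simp add: small_cat_def)
 have a: "\<And>g f. g : Arr A ==> f : Arr A ==> Cod A f = Dom A g ==> g *[A] f : Arr A & Dom A (g *[A] f) = Dom A f & Cod A (g *[A] f) = Cod A g"
  using cat_comp[OF cA, unfolded Hom_def] by auto
 have "category (full_sub A S)" unfolding full_sub_def
  by (rule category_mk_cat)
   (auto simp: cat_dom[OF cA] cat_cod[OF cA] HomD[OF cat_id[OF cA]] a
    cat_idl[OF cA HomI] cat_idr[OF cA HomI] cat_assoc[OF cA, unfolded Hom_def, simplified])
 moreover have "Obj (full_sub A S) \<subseteq> Obj A" "Arr (full_sub A S) \<subseteq> Arr A" by (auto simp: full_sub_def)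
 ultimately show ?thesis using A small_subset unfolding small_cat_def by blast
qed

lemma sfun_incl:
 assumes A: "small_cat A"
 shows "sfun (incl A S) (full_sub A S) A" "x : Obj A ==> x : S ==> Fobj (incl A S) x = x"
  "f : Hom (full_sub A S) x y ==> Farr (incl A S) f = f"
proof -
 show "sfun (incl A S) (full_sub A S) A" unfolding incl_def
  by (rule sfun_mk_fun[OF small_full_sub[OF A] A])
   (auto simp: full_sub_simps)
 show "x : Obj A ==> x : S ==> Fobj (incl A S) x = x" "f : Hom (full_sub A S) x y ==> Farr (incl A S) f = f"
  using HomD(1)[of f "full_sub A S"] by (auto simp: incl_def full_sub_simps(1))
qed

lemma small_empty: "small_cat (empty_cat :: 'k scat)"
proof -
 have "|{} :: 'k uni set| <o |UNIV :: 'k set|" by (simp add: card_of_ordLess2[symmetric, of UNIV "{}"])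
 then show ?thesis unfolding small_cat_def small_def empty_cat_def
  by (auto intro: category_mk_cat)
qed

lemma empty_cat_simps [simp]: "Obj empty_cat = {}" "Hom empty_cat x y = {}"
 by (auto simp: empty_cat_def Hom_mk_cat)

lemma sfun_from_empty: "small_cat A ==> sfun (mk_fun empty_cat A (\<lambda>x. x) (\<lambda>f. f)) empty_cat A"
 by (rule sfun_mk_fun[OF small_empty]) auto

section \<open>Final cocones\<close>

lemma pt_comp:
 fixes u :: "'k sfun"
 assumes inf: "infinite (UNIV :: 'k set)" and u: "sfun u A B" and a: "a : Obj A"
 shows "u *. pt A a = pt B (Fobj u a)"
proof (rule sfun_eqI)
 note us = sfunD[OF u]
 note p = sfun_pt[OF inf us(4) a] and q = sfun_pt[OF inf us(5) fobj[OF us(6) a]]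
 show "sfun (u *. pt A a) one_cat B" "sfun (pt B (Fobj u a)) one_cat B" using sfun_comp[OF p u] q by auto
 show "x : Obj one_cat ==> Fobj (u *. pt A a) x = Fobj (pt B (Fobj u a)) x" for x
  by (simp add: compF_obj[OF sfunD(6)[OF p]] pt_def)
 show "f : Hom one_cat x y ==> Farr (u *. pt A a) f = Farr (pt B (Fobj u a)) f" for f x y
  using HomD(1)[of f one_cat] by (simp add: compF_arr[OF sfunD(6)[OF p]] pt_def fident[OF us(6) a])
qed

lemma pt_to_one_one:
 fixes B :: "'k scat"
 assumes inf: "infinite (UNIV :: 'k set)" and B: "small_cat B" and b: "b : Obj B"
 shows "pt B b *. to_one one_cat = pt B b"
 using to_one_unique[OF sfun_id[OF small_ord[OF inf]]] compF_idF[of "pt B b" one_cat] sfunD[OF sfun_pt[OF inf B b]] by simp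

text \<open>If arrows into \<open>u a\<close> lift uniquely to arrows into \<open>a\<close>, then \<open>(a, 1)\<close> is terminal in the slice.\<close>

lemma final_cocone_pt:
 fixes u :: "'k sfun"
 assumes inf: "infinite (UNIV :: 'k set)" and u: "sfun u A B" and a: "a : Obj A"
  and lift: "\<And>x f. x : Obj A ==> f : Hom B (Fobj u x) (Fobj u a) ==> \<exists>!g. g : Hom A x a & Farr u g = f"
 shows "final_cocone u A B (Fobj u a) (pt A a) one_cat (idN (pt B (Fobj u a)))"
proof -
 note us = sfunD[OF u]
 note ua = fobj[OF us(6) a]
 note p = sfun_pt[OF inf us(4) a] and q = sfun_pt[OF inf us(5) ua]
 have c: "cocone u A B (Fobj u a) (pt A a) one_cat (idN (pt B (Fobj u a)))"
  unfolding cocone_def pt_comp[OF inf u a] pt_to_one_one[OF inf us(5) ua]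
  using u ua p q s_one[OF inf small_ord[OF inf]] ncell_id[OF q] by auto
 have k: "Ncomp (idN (pt B (Fobj u a))) (Num 0) = Id B (Fobj u a)" by (simp add: pt_def)
 have pa: "Fobj (pt A a) (Num 0) = a" "Farr (pt A a) (Tup (Num 0) (Num 0)) = Id A a" by (simp_all add: pt_def)
 show ?thesis unfolding final_cocone_def
 proof (intro conjI ballI c)
  fix x f assume x: "x : Obj A" and f: "f : Hom B (Fobj u x) (Fobj u a)"
  obtain g where g: "g : Hom A x a" "Farr u g = f" and gu: "\<And>g'. g' : Hom A x a ==> Farr u g' = f ==> g' = g"
   using lift[OF x f] by blast
  show "\<exists>j\<in>Obj one_cat. \<exists>g\<in>Hom A x (Fobj (pt A a) j). Ncomp (idN (pt B (Fobj u a))) j *[B] Farr u g = f &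
    (\<forall>j'\<in>Obj one_cat. \<forall>g'\<in>Hom A x (Fobj (pt A a) j'). Ncomp (idN (pt B (Fobj u a))) j' *[B] Farr u g' = f \<longrightarrow>
     (\<exists>!h. h : Hom one_cat j j' & Farr (pt A a) h *[A] g = g'))"
  proof (rule bexI[of _ "Num 0"], rule bexI[of _ g], intro conjI ballI impI)
   show "Ncomp (idN (pt B (Fobj u a))) (Num 0) *[B] Farr u g = f"
    using k cat_idl[OF us(8) f] g(2) by simp
   fix j' g' assume j': "j' : Obj one_cat" and g': "g' : Hom A x (Fobj (pt A a) j')"
    and e: "Ncomp (idN (pt B (Fobj u a))) j' *[B] Farr u g' = f"
   have [simp]: "j' = Num 0" using j' by simp
   have "g' : Hom A x a" using g' pa by simp
   then have "g' = g" using gu e k cat_idl[OF us(8) fhom[OF us(6) \<open>g' : Hom A x a\<close>]] by simp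
   then show "\<exists>!h. h : Hom one_cat (Num 0) j' & Farr (pt A a) h *[A] g = g'"
    using pa cat_idl[OF us(7) g(1)] by (intro ex1I[of _ "Tup (Num 0) (Num 0)"]) auto
  qed (use g pa in auto)
 qed
qed

lemma final_cocone_empty:
 fixes u :: "'k sfun"
 assumes inf: "infinite (UNIV :: 'k set)" and u: "sfun u A B" and b: "b : Obj B"
 defines "k \<equiv> mk_fun empty_cat A (\<lambda>x. x) (\<lambda>f. f)"
 shows "(\<And>x. x : Obj A ==> Hom B (Fobj u x) b = {}) ==>
   final_cocone u A B b k empty_cat (mk_nat (u *. k) (pt B b *. to_one empty_cat) (\<lambda>x. x))"
proof -
 note us = sfunD[OF u]
 have k: "sfun k empty_cat A" unfolding k_def by (rule sfun_from_empty[OF us(4)])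
 note t = s_one[OF inf small_empty] and q = sfun_pt[OF inf us(5) b] and c = sfun_const[OF inf small_empty us(5) b]
 have 1: "ncell (mk_nat (u *. k) (pt B b *. to_one empty_cat) (\<lambda>x. x)) (u *. k) (pt B b *. to_one empty_cat) empty_cat B"
  by (rule ncell_mk_nat[OF sfun_comp[OF k u] c]) auto
 show "(\<And>x. x : Obj A ==> Hom B (Fobj u x) b = {}) ==>
   final_cocone u A B b k empty_cat (mk_nat (u *. k) (pt B b *. to_one empty_cat) (\<lambda>x. x))"
  unfolding final_cocone_def cocone_def using u b k t q 1 by blast
qed

definition at_left :: "'k scat => 'k scat => 'k uni => 'k sfun" where
 "at_left A J a = mk_fun J (A >< J) (Tup a) (Tup (Id A a))"

lemma sfun_at_left:
 fixes A :: "'k scat"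
 assumes inf: "infinite (UNIV :: 'k set)" and A: "small_cat A" and J: "small_cat J" and a: "a : Obj A"
 shows "sfun (at_left A J a) J (A >< J)" "j : Obj J ==> Fobj (at_left A J a) j = Tup a j"
  "h : Hom J i j ==> Farr (at_left A J a) h = Tup (Id A a) h"
proof -
 have cA: "category A" using A by (simp add: small_cat_def)
 note i = cat_id[OF cA a]
 show "sfun (at_left A J a) J (A >< J)" unfolding at_left_def
  by (rule sfun_mk_fun[OF J small_prod[OF inf A J]])
   (auto simp: prod_simps a i prod_simps(4)[OF i _ i] cat_idl[OF cA i])
 show "j : Obj J ==> Fobj (at_left A J a) j = Tup a j" "h : Hom J i j ==> Farr (at_left A J a) h = Tup (Id A a) h"
  using HomD(1)[of h J] by (auto simp: at_left_def)
qed

text \<open>If the slice of \<open>A \<times> J\<close> over \<open>b\<close> is \<open>(A/a) \<times> J\<close>, then the fibre over the terminal object of \<open>(A/a)\<close>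
computes colimits.\<close>

lemma final_cocone_slice:
 fixes u :: "'k sfun"
 assumes inf: "infinite (UNIV :: 'k set)" and A: "small_cat A" and J: "small_cat J"
  and u: "sfun u (A >< J) B" and a: "a : Obj A" and b: "b : Obj B"
  and c: "\<And>j. j : Obj J ==> c j : Hom B (Fobj u (Tup a j)) b"
  and nat: "\<And>h i j. h : Hom J i j ==> c j *[B] Farr u (Tup (Id A a) h) = c i"
  and bij: "\<And>x j f. x : Obj A ==> j : Obj J ==> f : Hom B (Fobj u (Tup x j)) b ==>
   \<exists>!g. g : Hom A x a & c j *[B] Farr u (Tup g (Id J j)) = f"
 shows "final_cocone u (A >< J) B b (at_left A J a) J (mk_nat (u *. at_left A J a) (pt B b *. to_one J) c)"
  (is "final_cocone u ?AJ B b ?k J ?\<kappa>")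
proof -
 note us = sfunD[OF u] and k = sfun_at_left[OF inf A J a] and S = prod_simps
 have cA: "category A" and cJ: "category J" using A J by (simp_all add: small_cat_def)
 note q = sfun_pt[OF inf us(5) b] and cs = sfun_const[OF inf J us(5) b] and i = cat_id[OF cA a]
 have "ncell ?\<kappa> (u *. ?k) (pt B b *. to_one J) J B"
 proof (rule ncell_mk_nat[OF sfun_comp[OF k(1) u] cs])
  fix j assume j: "j : Obj J"
  then show "c j : Hom B (Fobj (u *. ?k) j) (Fobj (pt B b *. to_one J) j)"
   using c[OF j] k(2)[OF j] by (simp add: compF_obj[OF sfunD(6)[OF k(1)]])
 next
  fix h x y assume h: "h : Hom J x y"
  then show "c y *[B] Farr (u *. ?k) h = Farr (pt B b *. to_one J) h *[B] c x"
   using nat[OF h] k(3)[OF h] HomD(1)[OF h] cat_idl[OF us(8) c] cat_ob[OF cJ h] by (simp add: compF_arr[OF sfunD(6)[OF k(1)] h])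
 qed
 then have cc: "cocone u ?AJ B b ?k J ?\<kappa>" unfolding cocone_def using u b k(1) s_one[OF inf J] q by simp
 have kc: "j : Obj J ==> Ncomp ?\<kappa> j = c j" for j using sfunD(2)[OF k(1)] by simp
 show ?thesis unfolding final_cocone_def
 proof (intro conjI ballI cc)
  fix x f assume "x : Obj ?AJ" and f: "f : Hom B (Fobj u x) b"
  then obtain x' j where x: "x = Tup x' j" "x' : Obj A" and j: "j : Obj J" by (auto simp: S)
  note ij = cat_id[OF cJ j]
  obtain g where g: "g : Hom A x' a" "c j *[B] Farr u (Tup g (Id J j)) = f"
   and gu: "\<And>g'. g' : Hom A x' a ==> c j *[B] Farr u (Tup g' (Id J j)) = f ==> g' = g"
   using bij[OF x(2) j f[unfolded x(1)]] by blast
  let ?g = "Tup g (Id J j)"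
  have gh: "?g : Hom ?AJ x (Fobj ?k j)" using g(1) j x ij k(2)[OF j] by (simp add: S)
  show "\<exists>j\<in>Obj J. \<exists>g\<in>Hom ?AJ x (Fobj ?k j). Ncomp ?\<kappa> j *[B] Farr u g = f &
    (\<forall>j'\<in>Obj J. \<forall>g'\<in>Hom ?AJ x (Fobj ?k j'). Ncomp ?\<kappa> j' *[B] Farr u g' = f \<longrightarrow>
     (\<exists>!h. h : Hom J j j' & Farr ?k h *[?AJ] g = g'))"
  proof (intro bexI[OF _ j] bexI[OF _ gh] conjI ballI impI)
   show "Ncomp ?\<kappa> j *[B] Farr u ?g = f" using kc[OF j] g(2) by simp
   fix j' g' assume j': "j' : Obj J" and "g' : Hom ?AJ x (Fobj ?k j')" and e: "Ncomp ?\<kappa> j' *[B] Farr u g' = f"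
   then obtain g1 g2 where g': "g' = Tup g1 g2" "g1 : Hom A x' a" "g2 : Hom J j j'" using k(2)[OF j'] x by (auto simp: S)
   have "g' = Tup (Id A a) g2 *[?AJ] Tup g1 (Id J j)"
    using g' S(4)[OF i g'(3) g'(2) ij] cat_idl[OF cA g'(2)] cat_idr[OF cJ g'(3)] by simp
   moreover have h1: "Tup (Id A a) g2 : Hom ?AJ (Tup a j) (Tup a j')" and h2: "Tup g1 (Id J j) : Hom ?AJ x (Tup a j)"
    using i g' ij x by (auto simp: S)
   ultimately have "c j *[B] Farr u (Tup g1 (Id J j)) = f"
    using e kc[OF j'] fcomp[OF us(6) h1 h2] nat[OF g'(3)]
     cat_assoc[OF us(8) c[OF j'] fhom[OF us(6) h1] fhom[OF us(6) h2]] by simp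
   then have g1: "g1 = g" using gu[OF g'(2)] by simp
   have "Farr ?k h *[?AJ] ?g = Tup g h" if "h : Hom J j j'" for h
    using k(3)[OF that] S(4)[OF i that g(1) ij] cat_idl[OF cA g(1)] cat_idr[OF cJ that] by simp
   then show "\<exists>!h. h : Hom J j j' & Farr ?k h *[?AJ] ?g = g'" using g' g1 by auto
  qed
 qed
qed

section \<open>The opposite derivator\<close>

lemma small_op: "small_cat A ==> small_cat (opc A)"
 by (simp add: small_cat_def category_op)

lemma sfun_op: "sfun u A B ==> sfun (opF u) (opc A) (opc B)"
 unfolding sfun_def using is_fun_op small_op by blast

lemma sfun_op_op: "sfun u A B ==> opF (opF u) = u" using opF_opF sfunD(6) by blast

lemma ncell_op: "ncell \<alpha> u v A B ==> ncell (opN \<alpha>) (opF v) (opF u) (opc A) (opc B)"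
 unfolding ncell_def using is_ntrans_op sfun_op by auto

lemma op_one: "opc one_cat = (one_cat :: 'k scat)"
 by (rule cat_eqI[OF category_op[OF category_ord_cat] category_ord_cat]) (auto simp: opc_comp[of _ _ "Num 0" "Num 0" _ "Num 0"])

lemma op_empty: "opc empty_cat = (empty_cat :: 'k scat)"
 using small_empty[where 'k='k] by (intro cat_eqI) (auto simp: small_cat_def intro: category_op)

lemma op_to_one:
 fixes A :: "'k scat"
 assumes inf: "infinite (UNIV :: 'k set)" and A: "small_cat A"
 shows "opF (to_one A) = to_one (opc A)"
 using to_one_unique[OF sfun_op[OF s_one[OF inf A], unfolded op_one]] .

lemma op_pt:
 fixes A :: "'k scat"
 assumes inf: "infinite (UNIV :: 'k set)" and A: "small_cat A" and a: "a : Obj A"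
 shows "opF (pt A a) = pt (opc A) a"
 by (rule sfun_eqI[OF sfun_op[OF sfun_pt[OF inf A a], unfolded op_one] sfun_pt[OF inf small_op[OF A]]]) (use a in \<open>auto simp: pt_def\<close>)

lemma op_prod:
 fixes A B :: "'k scat"
 assumes A: "category A" and B: "category B"
 shows "opc (A >< B) = opc A >< opc B"
proof (rule cat_eqI[OF category_op[OF category_prod[OF A B]] category_prod[OF category_op[OF A] category_op[OF B]]])
 fix x :: "'k uni" assume "x : Obj (opc (A >< B))"
 then obtain a b where "x = Tup a b" "a : Obj A" "b : Obj B" by (auto simp: prod_simps(1))
 then show "Id (opc (A >< B)) x = Id (opc A >< opc B) x" by (simp add: prod_simps(1,3))
next
 fix f g x y z :: "'k uni" assume "g : Hom (opc (A >< B)) y z" "f : Hom (opc (A >< B)) x y"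
 then obtain a b a' b' a'' b'' g1 g2 f1 f2 where *: "g = Tup g1 g2" "f = Tup f1 f2" "z = Tup a b" "y = Tup a' b'" "x = Tup a'' b''"
  and g: "g1 : Hom A a a'" "g2 : Hom B b b'" and f: "f1 : Hom A a' a''" "f2 : Hom B b' b''" by (auto simp: prod_simps(2))
 have h: "Tup g1 g2 : Hom (A >< B) z y" "Tup f1 f2 : Hom (A >< B) y x" using * g f by (simp_all add: prod_simps(2))
 have o: "g1 : Hom (opc A) a' a" "g2 : Hom (opc B) b' b" "f1 : Hom (opc A) a'' a'" "f2 : Hom (opc B) b'' b'" using f g by simp_all
 show "g *[opc (A >< B)] f = g *[opc A >< opc B] f"
  unfolding *(1,2) opc_comp[OF h(2,1)] prod_simps(4)[OF f g] prod_simps(4)[OF o] opc_comp[OF f(1) g(1)] opc_comp[OF f(2) g(2)] ..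
qed (auto simp: prod_simps(1,2))

lemma op_id_prod:
 fixes A :: "'k scat"
 assumes inf: "infinite (UNIV :: 'k set)" and A: "small_cat A" and u: "sfun u J K"
 shows "opF (A ** u) = (opc A) ** opF u"
proof -
 note p = sfun_prod[OF inf A u] and q = sfun_prod[OF inf small_op[OF A] sfun_op[OF u]] and us = sfunD[OF u]
 have cA: "category A" using A by (simp add: small_cat_def)
 show ?thesis
 proof (rule sfun_eqI[OF sfun_op[OF p(1), unfolded op_prod[OF cA us(7)] op_prod[OF cA us(8)]] q(1)])
  fix x :: "'k uni" assume "x : Obj (opc A >< opc J)"
  then obtain a j where "x = Tup a j" "a : Obj A" "j : Obj J" by (auto simp: prod_simps(1))
  then show "Fobj (opF (A ** u)) x = Fobj ((opc A) ** opF u) x" using p(2) q(2) by simp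
 next
  fix h x y :: "'k uni" assume "h : Hom (opc A >< opc J) x y"
  then obtain f g a a' j j' where "h = Tup f g" "f : Hom A a a'" "g : Hom J j j'" by (auto simp: prod_simps(2))
  then show "Farr (opF (A ** u)) h = Farr ((opc A) ** opF u) h" using p(3) q(3)[of f a' a g j' j] by simp
 qed
qed

text \<open>The opposite derivator \<open>A \<mapsto> D(A\<^sup>o\<^sup>p)\<^sup>o\<^sup>p\<close>. Passing to opposites reverses functors and 2-cells, which exchanges the two Kan
extensions, and units with counits.\<close>

definition opD :: "('k, 'o, 'm) derivator => ('k, 'o, 'm) derivator" where
 "opD D = \<lparr>dcat = (\<lambda>A. opc (dcat D (opc A))), dfun = (\<lambda>u. opF (dfun D (opF u))), dnat = (\<lambda>\<alpha>. opN (dnat D (opN \<alpha>))),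
  lan = (\<lambda>u. opF (ran D (opF u))), lan_unit = (\<lambda>u. opN (ran_counit D (opF u))), lan_counit = (\<lambda>u. opN (ran_unit D (opF u))),
  ran = (\<lambda>u. opF (lan D (opF u))), ran_unit = (\<lambda>u. opN (lan_counit D (opF u))), ran_counit = (\<lambda>u. opN (lan_unit D (opF u)))\<rparr>"

lemma opD_simps [simp]:
 "dcat (opD D) A = opc (dcat D (opc A))" "dfun (opD D) u = opF (dfun D (opF u))" "dnat (opD D) \<alpha> = opN (dnat D (opN \<alpha>))"
 "lan (opD D) u = opF (ran D (opF u))" "lan_unit (opD D) u = opN (ran_counit D (opF u))" "lan_counit (opD D) u = opN (ran_unit D (opF u))"
 by (simp_all add: opD_def)

lemma is_prederivator_op:
 fixes D :: "('k, 'o, 'm) derivator"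
 assumes P: "is_prederivator D"
 shows "is_prederivator (opD D)"
proof -
 have nf: "Fdom (Ntgt \<alpha>) = Fdom (Nsrc \<alpha>)" "Fcod (Ntgt \<alpha>) = Fcod (Nsrc \<alpha>)" if "small_nat \<alpha>" for \<alpha> :: "'k snat"
  using that unfolding small_nat_def is_ntrans_def Let_def by auto
 note PP = P[unfolded is_prederivator_def]
 show ?thesis unfolding is_prederivator_def opD_simps
 proof (intro conjI allI impI)
  fix B :: "'k scat" assume B: "small_cat B"
  show "category (opc (dcat D (opc B)))" by (rule category_op[OF D_cat[OF P small_op[OF B]]])
  show "opF (dfun D (opF (idF B))) = idF (opc (dcat D (opc B)))" unfolding opF_idF D_idF[OF P small_op[OF B]] ..
 next
  fix u :: "'k sfun" assume u: "small_fun u"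
  note D = D_fun[OF P sfun_op[OF small_fun_sfun[OF u]]]
  show "is_functor (opF (dfun D (opF u)))" "Fdom (opF (dfun D (opF u))) = opc (dcat D (opc (Fcod u)))"
   "Fcod (opF (dfun D (opF u))) = opc (dcat D (opc (Fdom u)))" using funD(1,2,3)[OF is_fun_op[OF D]] .
  have "dnat D (idN (opF u)) = idN (dfun D (opF u))" using PP sfunD(1)[OF sfun_op[OF small_fun_sfun[OF u]]] by blast
  then show "opN (dnat D (opN (idN u))) = idN (opF (dfun D (opF u)))"
   unfolding opN_idN[OF sfunD(6)[OF small_fun_sfun[OF u]]] using opN_idN[OF D] by simp
 next
  fix \<alpha> :: "'k snat" assume a: "small_nat \<alpha>"
  note D = D_nat[OF P ncell_op[OF small_nat_ncell[OF a]]]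
  show "is_ntrans (opN (dnat D (opN \<alpha>)))" "Nsrc (opN (dnat D (opN \<alpha>))) = opF (dfun D (opF (Nsrc \<alpha>)))"
   "Ntgt (opN (dnat D (opN \<alpha>))) = opF (dfun D (opF (Ntgt \<alpha>)))" using D is_ntrans_op by auto
 next
  fix u v :: "'k sfun" assume u: "small_fun u" and v: "small_fun v" and uv: "Fcod u = Fdom v"
  show "opF (dfun D (opF (v *. u))) = opF (dfun D (opF u)) *. opF (dfun D (opF v))"
   unfolding opF_compF D_compF[OF P sfun_op[OF small_fun_sfun[OF u]] sfun_op[OF small_fun_sfun[OF v, folded uv]]] ..
 next
  fix \<alpha> \<beta> :: "'k snat" assume a: "small_nat \<alpha>" and b: "small_nat \<beta>" and ab: "Ntgt \<alpha> = Nsrc \<beta>"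
  note na = ncell_op[OF small_nat_ncell[OF a]]
  have nb: "ncell (opN \<beta>) (opF (Ntgt \<beta>)) (opF (Ntgt \<alpha>)) (opc (Fdom (Nsrc \<alpha>))) (opc (Fcod (Nsrc \<alpha>)))"
   using ncell_op[OF small_nat_ncell[OF b]] nf[OF a] unfolding ab[symmetric] by simp
  note t = ncellD(4)[OF small_nat_ncell[OF a]] ncellD(4)[OF small_nat_ncell[OF b]]
  have "dnat D (opN \<alpha> *N opN \<beta>) = dnat D (opN \<alpha>) *N dnat D (opN \<beta>)" using PP ncellD(1-3)[OF na] ncellD(1-3)[OF nb] by simp
  then show "opN (dnat D (opN (\<beta> *N \<alpha>))) = opN (dnat D (opN \<beta>)) *N opN (dnat D (opN \<alpha>))"
   unfolding opN_vcomp[OF t(2,1) ab] using opN_vcomp[of "dnat D (opN \<alpha>)" "dnat D (opN \<beta>)"] D_nat[OF P na] D_nat[OF P nb] by simp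
 next
  fix w :: "'k sfun" and \<alpha> :: "'k snat" assume w: "small_fun w" and a: "small_nat \<alpha>" and e: "Fcod (Nsrc \<alpha>) = Fdom w"
  note na = ncell_op[OF small_nat_ncell[OF a]] and sw = sfun_op[OF small_fun_sfun[OF w, folded e]] and t = ncellD(4)[OF small_nat_ncell[OF a]]
  have "dnat D (opF w *L opN \<alpha>) = dnat D (opN \<alpha>) *R dfun D (opF w)"
   using PP ncellD(1,2)[OF na] sfunD(1,2)[OF sw] sfunD(3)[OF ncellD(5)[OF na]] by simp
  then show "opN (dnat D (opN (w *L \<alpha>))) = opN (dnat D (opN \<alpha>)) *R opF (dfun D (opF w))"
   unfolding opN_whisk(1)[OF t] using opN_whisk(2)[of "dnat D (opN \<alpha>)"] D_nat[OF P na] by simp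
 next
  fix w :: "'k sfun" and \<alpha> :: "'k snat" assume a: "small_nat \<alpha>" and w: "small_fun w" and e: "Fcod w = Fdom (Nsrc \<alpha>)"
  note na = ncell_op[OF small_nat_ncell[OF a]] and sw = sfun_op[OF small_fun_sfun[OF w, unfolded e]] and t = ncellD(4)[OF small_nat_ncell[OF a]]
  have "dnat D (opN \<alpha> *R opF w) = dfun D (opF w) *L dnat D (opN \<alpha>)"
   using PP ncellD(1,2)[OF na] sfunD(1,3)[OF sw] sfunD(2)[OF ncellD(5)[OF na]] by simp
  then show "opN (dnat D (opN (\<alpha> *R w))) = opF (dfun D (opF w)) *L opN (dnat D (opN \<alpha>))"
   unfolding opN_whisk(2)[OF t] using opN_whisk(1)[of "dnat D (opN \<alpha>)"] D_nat[OF P na] by simp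
 qed
qed

lemma equivalence_op:
 assumes F: "equivalence F"
 shows "equivalence (opF F)"
proof -
 have f: "is_fun F (Fdom F) (Fcod F)" using F by (simp add: equivalence_def is_fun_def)
 have "iso_objs (opc (Fcod F)) x y" if i: "iso_objs (Fcod F) x y" for x y
 proof -
  obtain k where k: "k : Hom (Fcod F) x y" "iso_arr (Fcod F) k" using i unfolding iso_objs_def by blast
  note v = inv_arr[OF funD(5)[OF f] k]
  show ?thesis unfolding iso_objs_def using v(1,4) iso_op(1)[OF funD(5)[OF f] v(1)] by auto
 qed
 then have "ess_surj (opF F)" using F unfolding equivalence_def ess_surj_def opF_simps opc_simps by blast
 then show ?thesis using F funD(1)[OF is_fun_op[OF f]] unfolding equivalence_def full_def faithful_def opF_simps opc_simps by blast
qed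

lemma mk_cat_cong:
 assumes "Ob = Ob'" "Ar = Ar'" "\<And>f. f : Ar' ==> d f = d' f" "\<And>f. f : Ar' ==> c f = c' f" "\<And>x. x : Ob' ==> i x = i' x"
  "\<And>g f. g : Ar' ==> f : Ar' ==> c' f = d' g ==> m g f = m' g f"
 shows "mk_cat Ob Ar d c i m = mk_cat Ob' Ar' d' c' i' m'"
 using assms by (auto simp: mk_cat_def restrict_def fun_eq_iff)

lemma opc_mk_cat: "opc (mk_cat Ob Ar d c i m) = mk_cat Ob Ar c d i (\<lambda>g f. m f g)"
 unfolding opc_def by (rule mk_cat_cong) auto

lemma opF_mk_fun: "opF (mk_fun C C' o' m') = mk_fun (opc C) (opc C') o' m'"
 by (simp add: opF_def mk_fun_def)

lemma opc_comp_arr: "f : Arr C ==> g : Arr C ==> Cod C g = Dom C f ==> g *[opc C] f = f *[C] g"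
 by (rule opc_comp) (auto simp: Hom_def)

lemma Der1_op:
 fixes D :: "('k, 'o, 'm) derivator"
 assumes inf: "infinite (UNIV :: 'k set)" and P: "is_prederivator D" and D1: "Der1 D"
 shows "Der1 (opD D)"
 unfolding Der1_def
proof (intro allI impI)
 fix I and A :: "'k uni => 'k scat" assume I: "small I" and A: "\<forall>i\<in>I. small_cat (A i)"
 let ?A = "\<lambda>i. opc (A i)"
 have c: "opc (coprod_cat I A) = coprod_cat I ?A"
  unfolding coprod_cat_def opc_mk_cat by (rule mk_cat_cong) (auto simp: opc_comp_arr)
 have j: "opF (coprod_inj I A i) = coprod_inj I ?A i" for i unfolding coprod_inj_def opF_mk_fun c ..
 have p: "opc (prod_family I (\<lambda>i. dcat D (?A i))) = prod_family I (\<lambda>i. opc (dcat D (?A i)))"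
  unfolding prod_family_def opc_mk_cat
 proof (rule mk_cat_cong)
  fix g f assume gf: "g : (\<Pi>\<^sub>E i\<in>I. Arr (opc (dcat D (?A i))))" "f : (\<Pi>\<^sub>E i\<in>I. Arr (opc (dcat D (?A i))))"
   and e: "(\<lambda>i\<in>I. Cod (opc (dcat D (?A i))) (f i)) = (\<lambda>i\<in>I. Dom (opc (dcat D (?A i))) (g i))"
  show "(\<lambda>i\<in>I. f i *[dcat D (?A i)] g i) = (\<lambda>i\<in>I. g i *[opc (dcat D (?A i))] f i)"
  proof (rule restrict_ext)
   fix i assume i: "i : I"
   show "f i *[dcat D (?A i)] g i = g i *[opc (dcat D (?A i))] f i"
    using PiE_mem[OF gf(1) i] PiE_mem[OF gf(2) i] fun_cong[OF e, of i] i by (simp add: opc_comp_arr)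
  qed
 next
  fix f assume f: "f : (\<Pi>\<^sub>E i\<in>I. Arr (opc (dcat D (?A i))))"
  show "(\<lambda>i\<in>I. Cod (dcat D (?A i)) (f i)) = (\<lambda>i\<in>I. Dom (opc (dcat D (?A i))) (f i))"
   "(\<lambda>i\<in>I. Dom (dcat D (?A i)) (f i)) = (\<lambda>i\<in>I. Cod (opc (dcat D (?A i))) (f i))"
   by (rule restrict_ext, use PiE_mem[OF f] in simp)+
 next
  fix x assume x: "x : (\<Pi>\<^sub>E i\<in>I. Obj (opc (dcat D (?A i))))"
  show "(\<lambda>i\<in>I. Id (dcat D (?A i)) (x i)) = (\<lambda>i\<in>I. Id (opc (dcat D (?A i))) (x i))"
   by (rule restrict_ext) (use PiE_mem[OF x] in simp)
 qed simp_all
 have "to_prod (opD D) I A = opF (to_prod D I ?A)"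
  unfolding to_prod_def opF_mk_fun opD_simps opF_simps c j p ..
 moreover have "equivalence (to_prod D I ?A)" by (rule D1[unfolded Der1_def, rule_format, OF I], rule small_op, use A in blast)
 ultimately show "equivalence (to_prod (opD D) I A)" using equivalence_op by simp
qed

lemma under_cone:
 fixes u :: "'k sfun"
 assumes inf: "infinite (UNIV :: 'k set)" and u: "sfun u A B" and b: "b : Obj B"
 shows "sfun (under_proj b u) (under_cat b u) A" "ncell (under_nat b u) (pt B b *. to_one (under_cat b u)) (u *. under_proj b u) (under_cat b u) B"
  "x : Obj (under_cat b u) ==> Fobj (under_proj b u) x = ufst x" "f : Hom (under_cat b u) x y ==> Farr (under_proj b u) f = usnd f"
proof -
 note us = sfunD[OF u] and O = small_under_cat[OF inf u, of b] and S = under_cat_simps[OF u]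
 show p: "sfun (under_proj b u) (under_cat b u) A"
  unfolding under_proj_def us(2)
 proof (rule sfun_mk_fun[OF O us(4)])
  fix g f x y z assume "g : Hom (under_cat b u) y z" "f : Hom (under_cat b u) x y"
  then show "usnd (g *[under_cat b u] f) = usnd g *[A] usnd f"
   using S(4)[of y z "usnd g" b x "usnd f"] by (auto simp: S(2))
 qed (auto simp: S(1-3))
 show po: "x : Obj (under_cat b u) ==> Fobj (under_proj b u) x = ufst x"
  "f : Hom (under_cat b u) x y ==> Farr (under_proj b u) f = usnd f" for x y f
  using HomD(1)[of f "under_cat b u"] by (auto simp: under_proj_def)
 show "ncell (under_nat b u) (pt B b *. to_one (under_cat b u)) (u *. under_proj b u) (under_cat b u) B"
  unfolding under_nat_def us(3)
 proof (rule ncell_mk_nat)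
  fix x assume "x : Obj (under_cat b u)"
  then show "usnd x : Hom B (Fobj (pt B b *. to_one (under_cat b u)) x) (Fobj (u *. under_proj b u) x)"
   using po(1) by (auto simp: compF_obj[OF sfunD(6)[OF p]] S(1))
 next
  fix f x y assume f: "f : Hom (under_cat b u) x y"
  then show "usnd y *[B] Farr (pt B b *. to_one (under_cat b u)) f = Farr (u *. under_proj b u) f *[B] usnd x"
   using HomD(1)[OF f] cat_idr[OF us(8)] by (auto simp: compF_arr[OF sfunD(6)[OF p] f] po(2)[OF f] S(2))
 qed (use p u O b inf sfun_const[OF inf O us(5) b] in \<open>auto intro: sfun_comp\<close>)
qed

text \<open>The isomorphism between the opposite of \<open>(b/u)\<close> and the slice of the opposite functor over \<open>b\<close> is not an equality of
records; a final cocone is all that is used of it.\<close>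

lemma under_final:
 fixes u :: "'k sfun"
 assumes inf: "infinite (UNIV :: 'k set)" and u: "sfun u A B" and b: "b : Obj B"
 defines "v \<equiv> opF u"
 shows "final_cocone u A B b (opF (under_proj b v)) (opc (under_cat b v)) (opN (under_nat b v))"
proof -
 note us = sfunD[OF u] and v = sfun_op[OF u, folded v_def]
 have b': "b : Obj (opc B)" using b by simp
 note S = under_cat_simps[OF v] and U = under_cone[OF inf v b'] and p = sfun_op[OF under_cone(1)[OF inf v b'], unfolded opc_opc[OF us(7)]]
 note uo = small_under_cat[OF inf v, of b] note o = small_op[OF uo]
 have n: "ncell (opN (under_nat b v)) (u *. opF (under_proj b v)) (pt B b *. to_one (opc (under_cat b v))) (opc (under_cat b v)) B"
  using ncell_op[OF U(2)] unfolding opF_compF op_to_one[OF inf uo] op_pt[OF inf small_op[OF us(5)] b'] opc_opc[OF us(8)] sfun_op_op[OF u, folded v_def] .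
 have c: "cocone u A B b (opF (under_proj b v)) (opc (under_cat b v)) (opN (under_nat b v))"
  unfolding cocone_def using u b p n s_one[OF inf o] sfun_pt[OF inf us(5) b] by simp
 show ?thesis unfolding final_cocone_def
 proof (intro conjI ballI c)
  fix x f assume x: "x : Obj A" and f: "f : Hom B (Fobj u x) b"
  let ?w = "Tup x f"
  have w: "?w : Obj (under_cat b v)" unfolding S(1) using x f by (simp add: v_def)
  have kw: "Fobj (opF (under_proj b v)) ?w = x" using U(3)[OF w] by simp
  have at: "Ncomp (opN (under_nat b v)) j = usnd j" if "j : Obj (under_cat b v)" for j
   using that sfunD(2)[OF U(1)] sfunD(3)[OF v] by (simp add: under_nat_def to_one_def)
  show "\<exists>j\<in>Obj (opc (under_cat b v)). \<exists>g\<in>Hom A x (Fobj (opF (under_proj b v)) j). Ncomp (opN (under_nat b v)) j *[B] Farr u g = f &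
   (\<forall>j'\<in>Obj (opc (under_cat b v)). \<forall>g'\<in>Hom A x (Fobj (opF (under_proj b v)) j'). Ncomp (opN (under_nat b v)) j' *[B] Farr u g' = f \<longrightarrow>
    (\<exists>!h. h : Hom (opc (under_cat b v)) j j' & Farr (opF (under_proj b v)) h *[A] g = g'))"
  proof (rule bexI[of _ ?w], rule bexI[of _ "Id A x"], intro conjI ballI impI)
   show "?w : Obj (opc (under_cat b v))" using w by simp
   show "Id A x : Hom A x (Fobj (opF (under_proj b v)) ?w)" unfolding kw by (rule cat_id[OF us(7) x])
   show "Ncomp (opN (under_nat b v)) ?w *[B] Farr u (Id A x) = f" using at[OF w] fident[OF us(6) x] cat_idr[OF us(8) f] by simp
  next
   fix j' g' assume j': "j' : Obj (opc (under_cat b v))" and g': "g' : Hom A x (Fobj (opF (under_proj b v)) j')"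
    and e: "Ncomp (opN (under_nat b v)) j' *[B] Farr u g' = f"
   have jo: "j' : Obj (under_cat b v)" using j' by simp
   obtain x' f' where j: "j' = Tup x' f'" "x' : Obj A" "f' : Hom B (Fobj u x') b" using jo unfolding S(1) by (auto simp: v_def)
   have g: "g' : Hom A x x'" using g' U(3)[OF jo] j(1) by simp
   have e': "f' *[B] Farr u g' = f" using e at[OF jo] j(1) by simp
   have h: "h : Hom (under_cat b v) j' ?w \<longleftrightarrow> (\<exists>k\<in>Hom A x x'. h = Tup (Tup j' ?w) k & f' *[B] Farr u k = f)" for h
    unfolding S(2) using j f opc_comp[OF j(3) fhom[OF us(6)], of _ x] by (auto simp: v_def)
   have k: "Farr (opF (under_proj b v)) h *[A] Id A x = usnd h" if "h : Hom (under_cat b v) j' ?w" for h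
    using U(4)[OF that] that h[of h] cat_idr[OF us(7)] by auto
   show "\<exists>!h. h : Hom (opc (under_cat b v)) ?w j' & Farr (opF (under_proj b v)) h *[A] Id A x = g'"
   proof (rule ex1I[of _ "Tup (Tup j' ?w) g'"])
    have m: "Tup (Tup j' ?w) g' : Hom (under_cat b v) j' ?w" unfolding h using g e' by blast
    then show "Tup (Tup j' ?w) g' : Hom (opc (under_cat b v)) ?w j' & Farr (opF (under_proj b v)) (Tup (Tup j' ?w) g') *[A] Id A x = g'"
     unfolding k[OF m] by simp
    fix h' assume h': "h' : Hom (opc (under_cat b v)) ?w j' & Farr (opF (under_proj b v)) h' *[A] Id A x = g'"
    then have hh: "h' : Hom (under_cat b v) j' ?w" by simp
    have "usnd h' = g'" using h' k[OF hh] by simp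
    then show "h' = Tup (Tup j' ?w) g'" using hh unfolding h by force
   qed
  qed
 qed
qed

text \<open>The right half of Der4 for \<open>D\<close>, read in the opposite categories, is the condition on the slices for \<open>opD D\<close>.\<close>

lemma left_derivator_op:
 fixes D :: "('k, 'o, 'm) derivator"
 assumes inf: "infinite (UNIV :: 'k set)" and D: "is_derivator D"
 shows "left_derivator (opD D)"
proof -
 note P = derD(1)[OF D] and D3 = derD(4)[OF D]
 note PO = is_prederivator_op[OF P]
 have O3: "Der3 (opD D)" unfolding Der3_def
 proof (intro allI impI)
  fix u :: "'k sfun" assume u: "small_fun u"
  note v = sfun_op[OF small_fun_sfun[OF u]]
  show "adjunction (lan (opD D) u) (dfun (opD D) u) (lan_unit (opD D) u) (lan_counit (opD D) u) &
   adjunction (dfun (opD D) u) (ran (opD D) u) (ran_unit (opD D) u) (ran_counit (opD D) u)"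
   using adjunction_op[OF ran_adj(1)[OF D3 P v]] adjunction_op[OF lan_adj(1)[OF D3 P v]] by (simp add: opD_def)
 qed
 have O2: "Der2 (opD D)" unfolding Der2_def
 proof (intro allI impI ballI)
  fix A :: "'k scat" and f assume A: "small_cat A" and "f : Arr (dcat (opD D) A)"
  then have f: "f : Arr (dcat D (opc A))" by simp
  note DA = D_cat[OF P small_op[OF A]] and D1 = D_cat[OF P small_ord[OF inf, of 0]]
  have "iso_arr (dcat (opD D) one_cat) (dar (opD D) (pt A a) f) \<longleftrightarrow> iso_arr (dcat D one_cat) (dar D (pt (opc A) a) f)" if a: "a : Obj A" for a
  proof -
   have a': "a : Obj (opc A)" using a by simp
   show ?thesis unfolding opD_simps opF_simps op_pt[OF inf A a] op_one
    using iso_op(1)[OF D1 fhom[OF D_fun[OF P sfun_pt[OF inf small_op[OF A] a']] HomI[OF f]]] .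
  qed
  moreover have "iso_arr (dcat D (opc A)) f \<longleftrightarrow> (\<forall>a\<in>Obj A. iso_arr (dcat D one_cat) (dar D (pt (opc A) a) f))"
   using derD(3)[OF D] small_op[OF A] f unfolding Der2_def by simp
  ultimately show "iso_arr (dcat (opD D) A) f \<longleftrightarrow> (\<forall>a\<in>Obj A. iso_arr (dcat (opD D) one_cat) (dar (opD D) (pt A a) f))"
   using iso_op(1)[OF DA HomI[OF f]] by simp
 qed
 show ?thesis unfolding left_derivator_def
 proof (intro conjI allI impI PO Der1_op[OF inf P derD(2)[OF D]] O2 O3)
  fix w :: "'k sfun" and b X assume w: "small_fun w" and b: "b : Obj (Fcod w)" and X: "X : dobj (opD D) (Fdom w)"
  define A where "A = Fdom w" define B where "B = Fcod w"
  have u: "sfun w A B" unfolding A_def B_def by (rule small_fun_sfun[OF w])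
  have bB: "b : Obj B" and b': "b : Obj (opc B)" using b by (simp_all add: B_def)
  define v where "v = opF w"
  note v = sfun_op[OF u, folded v_def] note us = sfunD[OF u]
  have Xv: "X : dobj D (opc A)" using X by (simp add: A_def)
  note R = ran_adj[OF D3 P v] and Dv = D_fun[OF P v]
  note fc = under_final[OF inf u bB, folded v_def]
  note U = under_cone[OF inf v b'] and uo = small_under_cat[OF inf v, of b]
  let ?J = "under_cat b v" and ?p = "under_proj b v" and ?Y = "Fobj (ran D v) X" and ?e = "Ncomp (ran_counit D v) X"
  note Y = fobj[OF R(2) Xv] and e = adjD(3)[OF R(1) Dv Xv]
  note t = s_one[OF inf uo] and q = sfun_pt[OF inf small_op[OF us(5)] b']
  note Dp = D_fun[OF P U(1)] and Dt = D_fun[OF P t] and Rt = ran_adj[OF D3 P t]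
  note bY = fobj[OF D_fun[OF P q] Y] and pe = fhom[OF Dp e]
  have n: "dnt D (under_nat b v) ?Y : dhom D ?J (dob D (to_one ?J) (dob D (pt (opc B) b) ?Y)) (dob D ?p (dob D v ?Y))"
   using D_nat_hom[OF P U(2) Y] D_cob[OF P U(1) v Y] D_cob[OF P t q Y] by simp
  have h: "dar D ?p ?e *[dcat D ?J] dnt D (under_nat b v) ?Y : dhom D ?J (dob D (to_one ?J) (dob D (pt (opc B) b) ?Y)) (dob D ?p X)"
   by (rule cat_comp[OF funD(5)[OF Dp] pe n])
  have "bc_ran D v b X = Farr (ran D (to_one ?J)) (dar D ?p ?e *[dcat D ?J] dnt D (under_nat b v) ?Y)
   *[dcat D one_cat] Ncomp (ran_unit D (to_one ?J)) (dob D (pt (opc B) b) ?Y)"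
   unfolding bc_ran_def Let_def
   using fcomp[OF Rt(2) pe n] sfunD(3)[OF v]
    cat_assoc[OF funD(5)[OF Rt(2)] fhom[OF Rt(2) pe] fhom[OF Rt(2) n] adjD(2)[OF Rt(1) Dt bY]] by simp
  moreover have "iso_arr (dcat D one_cat) (bc_ran D v b X)"
   using derD(5)[OF D, unfolded Der4_def, rule_format, OF sfunD(1)[OF v], of b X] sfunD(2,3)[OF v] b' Xv by simp
  ultimately have "couniv (dfun D (to_one ?J)) (dob D ?p X) (dob D (pt (opc B) b) ?Y)
    (dar D ?p ?e *[dcat D ?J] dnt D (under_nat b v) ?Y)"
   using adjunction_cotranspose(3)[OF Rt(1) Dt h bY] by simp
  moreover have "restr (opD D) (opc ?J) (opF ?p) (opN (under_nat b v)) ?Y ?e = dar D ?p ?e *[dcat D ?J] dnt D (under_nat b v) ?Y"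
   unfolding restr_def opD_simps opN_simps opF_simps opc_opc[OF sfunD(7)[OF U(1)]] opN_opN[OF ncellD(4)[OF U(2)]] sfun_op_op[OF U(1)]
   by (rule opc_comp[OF pe n])
  ultimately have "univ (dfun (opD D) (to_one (opc ?J))) (dob (opD D) (opF ?p) X) (dob (opD D) (pt B b) ?Y)
    (restr (opD D) (opc ?J) (opF ?p) (opN (under_nat b v)) ?Y ?e)"
   using couniv_op[OF Dt] op_to_one[OF inf uo] sfun_op_op[OF t] sfun_op_op[OF U(1)] op_pt[OF inf us(5) bB] by simp
  moreover have "?Y : dobj (opD D) B" "?e : dhom (opD D) A X (dob (opD D) w ?Y)" using Y e by (simp_all add: v_def)
  ultimately show "univ (dfun (opD D) (to_one (over_cat w b))) (dob (opD D) (over_proj w b) X)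
   (dob (opD D) (pt (Fcod w) b) (Fobj (lan (opD D) w) X))
   (restr (opD D) (over_cat w b) (over_proj w b) (over_nat w b) (Fobj (lan (opD D) w) X) (Ncomp (lan_unit (opD D) w) X))"
   using restr_final_iff[OF inf PO fc] by (simp add: v_def B_def)
 qed
qed

section \<open>The opposite of a morphism\<close>

text \<open>The structure isomorphisms change direction in the opposite categories and are therefore inverted.\<close>

definition opM :: "('k, 'o, 'm, 'p, 'n) dmorphism => ('k, 'o, 'm, 'p, 'n) dmorphism" where
 "opM F = \<lparr>mfun = (\<lambda>A. opF (mfun F (opc A))), mgam = (\<lambda>u. opN (inv_nat (mgam F (opF u))))\<rparr>"

lemma opM_simps [simp]: "mfun (opM F) A = opF (mfun F (opc A))" "mgam (opM F) u = opN (inv_nat (mgam F (opF u)))"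
 by (simp_all add: opM_def)

lemma inv_nat_idN: "is_fun G C C' ==> inv_nat (idN G) = idN G"
 using funD(2,3,5)[of G C C'] fobj[of G C C'] by (auto simp: inv_nat_def idN_def mk_nat_def restrict_def fun_eq_iff inv_id)

lemma inv_nat_whisk:
 assumes t: "nat_iso t"
 shows "is_fun F C (Fdom (Nsrc t)) ==> inv_nat (t *R F) = inv_nat t *R F"
  "is_fun G (Fcod (Nsrc t)) C' ==> inv_nat (G *L t) = G *L inv_nat t"
proof -
 have t0: "is_ntrans t" and i: "\<And>x. x : Obj (Fdom (Nsrc t)) ==> iso_arr (Fcod (Nsrc t)) (Ncomp t x)" using t by (auto simp: nat_iso_def)
 note T = ntD[OF t0 refl refl refl refl]
 show "inv_nat (t *R F) = inv_nat t *R F" if "is_fun F C (Fdom (Nsrc t))"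
  using funD(2)[OF that] fobj[OF that] T(3) by (auto simp: inv_nat_def whiskR_def mk_nat_def restrict_def fun_eq_iff compF_def mk_fun_def)
 show "inv_nat (G *L t) = G *L inv_nat t" if G: "is_fun G (Fcod (Nsrc t)) C'"
  using funD(3)[OF G] T(3) finv[OF G T(5) i] by (auto simp: inv_nat_def whiskL_def mk_nat_def restrict_def fun_eq_iff compF_def mk_fun_def)
qed

lemma nat_iso_whisk:
 assumes t: "nat_iso t"
 shows "is_fun F C (Fdom (Nsrc t)) ==> nat_iso (t *R F)" "is_fun G (Fcod (Nsrc t)) C' ==> nat_iso (G *L t)"
proof -
 have t0: "is_ntrans t" and i: "\<And>x. x : Obj (Fdom (Nsrc t)) ==> iso_arr (Fcod (Nsrc t)) (Ncomp t x)" using t by (auto simp: nat_iso_def)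
 note T = ntD[OF t0 refl refl refl refl]
 show "nat_iso (t *R F)" if F: "is_fun F C (Fdom (Nsrc t))"
  unfolding nat_iso_def using is_ntrans_whiskR[OF t0 funD(1,3)[OF F]] i fobj[OF F] funD(2)[OF F] by (simp add: compF_def mk_fun_def)
 show "nat_iso (G *L t)" if G: "is_fun G (Fcod (Nsrc t)) C'"
  unfolding nat_iso_def using is_ntrans_whiskL[OF t0 funD(1)[OF G]] fiso[OF G T(5) i] funD(2,3)[OF G] by (simp add: compF_def mk_fun_def)
qed

lemma inv_nat_vcomp:
 assumes s: "nat_iso s" and t: "nat_iso t" and e: "Ntgt t = Nsrc s"
 shows "inv_nat (s *N t) = inv_nat t *N inv_nat s"
proof -
 have t0: "is_ntrans t" "\<And>x. x : Obj (Fdom (Nsrc t)) ==> iso_arr (Fcod (Nsrc t)) (Ncomp t x)"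
  and s0: "is_ntrans s" "\<And>x. x : Obj (Fdom (Nsrc s)) ==> iso_arr (Fcod (Nsrc s)) (Ncomp s x)" using s t by (auto simp: nat_iso_def)
 note T = ntD[OF t0(1) refl e refl refl]
 note S = ntD[OF s0(1) refl refl T(3,4)]
 have C: "category (Fcod (Nsrc t))" using is_functorD(2)[OF T(1) refl refl] .
 have "inv_arr (Fcod (Nsrc t)) (Ncomp s x *[Fcod (Nsrc t)] Ncomp t x) = inv_arr (Fcod (Nsrc t)) (Ncomp t x) *[Fcod (Nsrc t)] inv_arr (Fcod (Nsrc t)) (Ncomp s x)"
  if x: "x : Obj (Fdom (Nsrc t))" for x
  using iso_comp(2)[OF C S(5)[OF x] T(5)[OF x] _ t0(2)[OF x]] s0(2)[of x] x T(3,4) by simp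
 then show ?thesis using T(3,4) S(3,4) e by (auto simp: inv_nat_def vcomp_def mk_nat_def restrict_def fun_eq_iff)
qed

lemma inv_nat_swap:
 assumes g: "nat_iso g" and h: "nat_iso h" and p: "is_ntrans p" "Nsrc p = Ntgt g" and q: "is_ntrans q" "Ntgt q = Nsrc h"
  and e: "p *N g = h *N q"
 shows "inv_nat h *N p = q *N inv_nat g"
proof -
 have g0: "is_ntrans g" "\<And>x. x : Obj (Fdom (Nsrc g)) ==> iso_arr (Fcod (Nsrc g)) (Ncomp g x)"
  and h0: "is_ntrans h" "\<And>x. x : Obj (Fdom (Nsrc h)) ==> iso_arr (Fcod (Nsrc h)) (Ncomp h x)" using g h by (auto simp: nat_iso_def)
 have pt: "Ntgt p = Ntgt h" and qs: "Nsrc q = Nsrc g" using arg_cong[OF e, of Ntgt] arg_cong[OF e, of Nsrc] by simp_all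
 note G = ntD[OF g0(1) refl refl refl refl]
 note P = ntD[OF p(1) p(2) refl G(3,4)] and Q = ntD[OF q(1) qs refl refl refl]
 note H = ntD[OF h0(1) q(2)[symmetric] refl Q(3,4)]
 have C: "category (Fcod (Nsrc g))" using is_functorD(2)[OF G(1) refl refl] .
 show ?thesis
 proof (rule ntrans_eqI)
  show "is_ntrans (inv_nat h *N p)" by (rule is_ntrans_vcomp[OF is_ntrans_inv_nat[OF h] p(1)]) (simp add: pt)
  show "is_ntrans (q *N inv_nat g)" by (rule is_ntrans_vcomp[OF q(1) is_ntrans_inv_nat[OF g]]) (simp add: qs)
  fix x assume "x : Obj (Fdom (Nsrc (inv_nat h *N p)))"
  then have x: "x : Obj (Fdom (Nsrc g))" using p(2) G(3) by simp
  have ih: "iso_arr (Fcod (Nsrc g)) (Ncomp h x)" using h0(2)[of x] x Q(3,4) q(2) by simp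
  note hv = inv_arr[OF C H(5)[OF x] ih] and gx = G(5)[OF x] g0(2)[OF x]
  let ?c = "Comp (Fcod (Nsrc g))" and ?h = "inv_arr (Fcod (Nsrc g)) (Ncomp h x)"
  have "?c (Ncomp p x) (Ncomp g x) = ?c (Ncomp h x) (Ncomp q x)"
   using arg_cong[OF e, of "\<lambda>t. Ncomp t x"] x qs by simp
  then have "?c (?c ?h (Ncomp p x)) (Ncomp g x) = Ncomp q x"
   using cat_assoc[OF C hv(1) P(5)[OF x, unfolded pt] gx(1)] inv_cancel(1)[OF C H(5)[OF x] ih Q(5)[OF x]] q(2) by simp
  then have "?c ?h (Ncomp p x) = ?c (Ncomp q x) (inv_arr (Fcod (Nsrc g)) (Ncomp g x))"
   using inv_cancel(3)[OF C gx cat_comp[OF C hv(1) P(5)[OF x, unfolded pt]]] by simp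
  then show "Ncomp (inv_nat h *N p) x = Ncomp (q *N inv_nat g) x"
   using x p(2) G(3,4) Q(3,4) H(3,4) q(2) by simp
 qed (simp_all add: p q pt qs)
qed

context
 fixes D :: "('k, 'o, 'm) derivator" and E :: "('k, 'p, 'n) derivator" and F :: "('k, 'o, 'm, 'p, 'n) dmorphism"
 assumes PD: "is_prederivator D" and PE: "is_prederivator E" and M: "is_dmorphism D E F"
begin

lemma opM_gam:
 assumes u: "sfun u A B"
 shows "nat_iso (mgam (opM F) u)" "Nsrc (mgam (opM F) u) = dfun (opD E) u *. mfun (opM F) B" "Ntgt (mgam (opM F) u) = mfun (opM F) A *. dfun (opD D) u"
  "X : dobj D (opc B) ==> gam (opM F) u X = inv_arr (dcat E (opc A)) (gam F (opF u) X)"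
proof -
 note v = sfun_op[OF u]
 note g = M_gam[OF PD PE M v] note g0 = g[THEN conjunct1] and gs = g[THEN conjunct2, THEN conjunct1] and gt = g[THEN conjunct2, THEN conjunct2]
 note FB = M_fun[OF PD PE M sfunD(5)[OF v]] and Ev = D_fun[OF PE v] and FA = M_fun[OF PD PE M sfunD(4)[OF v]] and Dv = D_fun[OF PD v]
 note s = funD(2,3)[OF comp_fun[OF FB Ev]] and t = funD(2,3)[OF comp_fun[OF Dv FA]]
 show c: "gam (opM F) u X = inv_arr (dcat E (opc A)) (gam F (opF u) X)" if "X : dobj D (opc B)" for X
  using that gs gt s t by simp
 show "Nsrc (mgam (opM F) u) = dfun (opD E) u *. mfun (opM F) B" "Ntgt (mgam (opM F) u) = mfun (opM F) A *. dfun (opD D) u"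
  using gs gt opF_compF by simp_all
 have "iso_arr (opc (dcat E (opc A))) (gam (opM F) u X)" if X: "X : dobj D (opc B)" for X
 proof -
  note w = inv_arr[OF D_cat[OF PE sfunD(4)[OF v]] gam_hom[OF PD PE M v X]]
  show ?thesis unfolding c[OF X] using iso_op(1)[OF D_cat[OF PE sfunD(4)[OF v]] w(1)] w(4) by simp
 qed
 then show "nat_iso (mgam (opM F) u)"
  unfolding nat_iso_def using is_ntrans_op[OF is_ntrans_inv_nat[OF g0]] gs s by simp
qed

lemma is_dmorphism_op: "is_dmorphism (opD D) (opD E) (opM F)"
 unfolding is_dmorphism_def
proof (intro conjI allI impI)
 fix A :: "'k scat" assume A: "small_cat A"
 note G = M_fun[OF PD PE M small_op[OF A]]
 show "is_functor (mfun (opM F) A)" "Fdom (mfun (opM F) A) = dcat (opD D) A" "Fcod (mfun (opM F) A) = dcat (opD E) A"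
  using funD(1,2,3)[OF is_fun_op[OF G]] by simp_all
 have "mgam F (idF (opc A)) = idN (mfun F (opc A))" using M small_op[OF A] unfolding is_dmorphism_def by blast
 then show "mgam (opM F) (idF A) = idN (mfun (opM F) A)" using opN_idN[OF G] inv_nat_idN[OF G] by (simp add: opF_idF)
next
 fix u :: "'k sfun" assume u: "small_fun u"
 note g = opM_gam[OF small_fun_sfun[OF u]]
 show "nat_iso (mgam (opM F) u)" "Nsrc (mgam (opM F) u) = dfun (opD E) u *. mfun (opM F) (Fcod u)" "Ntgt (mgam (opM F) u) = mfun (opM F) (Fdom u) *. dfun (opD D) u"
  by (fact g)+
next
 fix u v :: "'k sfun" assume u: "small_fun u" and v: "small_fun v" and uv: "Fcod u = Fdom v"
 note u' = sfun_op[OF small_fun_sfun[OF u]] and v' = sfun_op[OF small_fun_sfun[OF v, folded uv]]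
 note gu = M_gam[OF PD PE M u', THEN conjunct1] M_gam[OF PD PE M u', THEN conjunct2, THEN conjunct1] M_gam[OF PD PE M u', THEN conjunct2, THEN conjunct2]
  and gv = M_gam[OF PD PE M v', THEN conjunct1] M_gam[OF PD PE M v', THEN conjunct2, THEN conjunct1] M_gam[OF PD PE M v', THEN conjunct2, THEN conjunct2]
 note Dv = D_fun[OF PD v'] and Eu = D_fun[OF PE u'] and FB = M_fun[OF PD PE M sfunD(5)[OF u']] and FC = M_fun[OF PD PE M sfunD(5)[OF v']]
  and Ev = D_fun[OF PE v']
 have dv: "is_fun (dfun D (opF v)) (dcat D (opc (Fcod v))) (Fdom (Nsrc (mgam F (opF u))))"
  using Dv funD(2)[OF comp_fun[OF FB Eu]] unfolding gu(2) by simp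
 have eu: "is_fun (dfun E (opF u)) (Fcod (Nsrc (mgam F (opF v)))) (dcat E (opc (Fdom u)))"
  using Eu funD(3)[OF comp_fun[OF FC Ev]] unfolding gv(2) by simp
 note nw = nat_iso_whisk(1)[OF gu(1) dv] nat_iso_whisk(2)[OF gv(1) eu] and iw = inv_nat_whisk(1)[OF gu(1) dv] inv_nat_whisk(2)[OF gv(1) eu]
 have j: "Ntgt (dfun E (opF u) *L mgam F (opF v)) = Nsrc (mgam F (opF u) *R dfun D (opF v))"
  unfolding whiskL_simps whiskR_simps gu(2) gv(3) using compF_assoc[of "dfun D (opF v)" "mfun F (opc (Fcod u))" "dfun E (opF u)"]
   funD(1,2,3)[OF Dv] funD(1,2,3)[OF FB] funD(1,2,3)[OF Eu] by simp
 have "mgam F (opF v *. opF u) = (mgam F (opF u) *R dfun D (opF v)) *N (dfun E (opF u) *L mgam F (opF v))"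
  using M sfunD(1)[OF u'] sfunD(1)[OF v'] uv unfolding is_dmorphism_def by simp
 then have "mgam (opM F) (v *. u) = opN ((dfun E (opF u) *L inv_nat (mgam F (opF v))) *N (inv_nat (mgam F (opF u)) *R dfun D (opF v)))"
  unfolding opM_simps opF_compF using inv_nat_vcomp[OF nw j] iw by simp
 also have "\<dots> = opN (inv_nat (mgam F (opF u)) *R dfun D (opF v)) *N opN (dfun E (opF u) *L inv_nat (mgam F (opF v)))"
  by (rule opN_vcomp[OF is_ntrans_inv_nat[OF nw(2), unfolded iw] is_ntrans_inv_nat[OF nw(1), unfolded iw]]) (use j in simp)
 also have "\<dots> = (mgam (opM F) u *R dfun (opD D) v) *N (dfun (opD E) u *L mgam (opM F) v)"
  unfolding opN_whisk(1)[OF is_ntrans_inv_nat[OF gv(1)]] opN_whisk(2)[OF is_ntrans_inv_nat[OF gu(1)]] by simp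
 finally show "mgam (opM F) (v *. u) = (mgam (opM F) u *R dfun (opD D) v) *N (dfun (opD E) u *L mgam (opM F) v)" .
next
 fix \<alpha> :: "'k snat" assume a: "small_nat \<alpha>"
 define u v A B where d: "u = Nsrc \<alpha>" "v = Ntgt \<alpha>" "A = Fdom (Nsrc \<alpha>)" "B = Fcod (Nsrc \<alpha>)"
 note al = small_nat_ncell[OF a, folded d]
 have AB: "Fdom u = A" "Fcod u = B" by (simp_all add: d)
 note a' = ncell_op[OF al]
 note n = ncellD[OF a'] note u' = n(6) and v' = n(5)
 note gu = M_gam[OF PD PE M u', THEN conjunct1] M_gam[OF PD PE M u', THEN conjunct2, THEN conjunct1] M_gam[OF PD PE M u', THEN conjunct2, THEN conjunct2]
  and gv = M_gam[OF PD PE M v', THEN conjunct1] M_gam[OF PD PE M v', THEN conjunct2, THEN conjunct1] M_gam[OF PD PE M v', THEN conjunct2, THEN conjunct2]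
 note FA = M_fun[OF PD PE M sfunD(4)[OF u']] and FB = M_fun[OF PD PE M sfunD(5)[OF u']]
 note dD = D_nat[OF PD a', THEN conjunct1] D_nat[OF PD a', THEN conjunct2, THEN conjunct1] D_nat[OF PD a', THEN conjunct2, THEN conjunct2]
  and dE = D_nat[OF PE a', THEN conjunct1] D_nat[OF PE a', THEN conjunct2, THEN conjunct1] D_nat[OF PE a', THEN conjunct2, THEN conjunct2]
 let ?p = "mfun F (opc A) *L dnat D (opN \<alpha>)" and ?q = "dnat E (opN \<alpha>) *R mfun F (opc B)"
 have p: "is_ntrans ?p" using is_ntrans_whiskL[OF dD(1) funD(1)[OF FA]] funD(2)[OF FA] funD(3)[OF D_fun[OF PD v']] dD(2) by simp
 have q: "is_ntrans ?q" using is_ntrans_whiskR[OF dE(1) funD(1)[OF FB]] funD(3)[OF FB] funD(2)[OF D_fun[OF PE v']] dE(2) by simp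
 have "?p *N mgam F (opF v) = mgam F (opF u) *N ?q"
  using M n(1-3) sfunD(2,3)[OF v'] unfolding is_dmorphism_def by metis
 from inv_nat_swap[OF gv(1) gu(1) p _ q _ this]
 have e: "inv_nat (mgam F (opF u)) *N ?p = ?q *N inv_nat (mgam F (opF v))" using dD dE gu gv by simp
 have "opN ?p *N opN (inv_nat (mgam F (opF u))) = opN (inv_nat (mgam F (opF v))) *N opN ?q"
  using arg_cong[OF e, of opN] opN_vcomp[OF is_ntrans_inv_nat[OF gu(1)] p] opN_vcomp[OF q is_ntrans_inv_nat[OF gv(1)]] dD dE gu gv by simp
 then show "(mfun (opM F) (Fdom (Nsrc \<alpha>)) *L dnat (opD D) \<alpha>) *N mgam (opM F) (Nsrc \<alpha>) =
  mgam (opM F) (Ntgt \<alpha>) *N (dnat (opD E) \<alpha> *R mfun (opM F) (Fcod (Nsrc \<alpha>)))"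
  unfolding d(1,2)[symmetric] AB opM_simps opD_simps opN_whisk(1)[OF dD(1)] opN_whisk(2)[OF dE(1)] .
qed

end

text \<open>The right mate of \<open>F\<close> is the left mate of its opposite.\<close>

lemma preserves_ran_iff:
 fixes D :: "('k, 'o, 'm) derivator"
 assumes inf: "infinite (UNIV :: 'k set)" and D: "is_derivator D" and E: "is_derivator E" and M: "is_dmorphism D E F" and v: "sfun v A B"
 shows "preserves_ran D E F v \<longleftrightarrow> pres_univ (opD D) (opD E) (opM F) (opF v)"
proof -
 note PD = derD(1)[OF D] and PE = derD(1)[OF E]
 note LD = left_derivator_op[OF inf D] and LE = left_derivator_op[OF inf E] and w = sfun_op[OF v] and vs = sfunD[OF v]
 note oo = opc_opc[OF vs(7)] opc_opc[OF vs(8)] sfun_op_op[OF v]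
 have "iso_arr (opc (dcat E B)) (lan_mate (opD D) (opD E) (opM F) (opF v) X) \<longleftrightarrow> iso_arr (dcat E B) (ran_mate D E F v X)" if X: "X : dobj D A" for X
 proof -
  note R = ran_adj[OF derD(4)[OF D] PD v] and RE = ran_adj[OF derD(4)[OF E] PE v]
  let ?Y = "Fobj (ran D v) X"
  note Y = fobj[OF R(2) X] and e = adjD(3)[OF R(1) D_fun[OF PD v] X]
  note FY = fobj[OF M_fun[OF PD PE M vs(5)] Y]
  note g = gam_hom[OF PD PE M v Y] and Fe = fhom[OF M_fun[OF PD PE M vs(4)] e]
  note eta = adjD(2)[OF RE(1) D_fun[OF PE v] FY]
  note EA = D_cat[OF PE vs(4)] and EB = D_cat[OF PE vs(5)]
  have gi: "inv_arr (opc (dcat E A)) (gam (opM F) (opF v) ?Y) = gam F v ?Y"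
   using opM_gam(4)[OF PD PE M w, of ?Y] Y iso_op(2)[OF EA inv_arr(1,4)[OF EA g]] inv_arr(5)[OF EA g] oo by simp
  note a = fhom[OF RE(2) Fe] and b = fhom[OF RE(2) g(1)]
  have "lan_mate (opD D) (opD E) (opM F) (opF v) X = ran_mate D E F v X"
   unfolding lan_mate_def ran_mate_def Let_def opD_simps opF_simps opN_simps opM_simps(1) vs(2,3) oo gi
   unfolding opc_comp[OF a b] opc_comp[OF cat_comp[OF EB a b] eta] by (rule cat_assoc[OF EB a b eta])
  then show ?thesis using iso_op(1)[OF EB cat_comp[OF EB cat_comp[OF EB a b] eta]] cat_assoc[OF EB a b eta]
   unfolding ran_mate_def Let_def vs(2,3) by simp
 qed
 then have "preserves_ran D E F v \<longleftrightarrow> preserves_lan (opD D) (opD E) (opM F) (opF v)"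
  unfolding preserves_ran_def preserves_lan_def opD_simps opF_simps vs(2,3) oo by simp
 then show ?thesis
  using preserves_lan_iff[OF lderD(1)[OF LD] lderD(1)[OF LE] is_dmorphism_op[OF PD PE M] lderD(4)[OF LD] lderD(4)[OF LE] w] by simp
qed

section \<open>The square and its corners\<close>

lemma square_simps:
 "x : Obj square \<longleftrightarrow> x = pos 0 0 \<or> x = pos 1 0 \<or> x = pos 0 1 \<or> x = pos 1 1"
 "h : Hom square x y \<longleftrightarrow> (\<exists>i j i' j'. x = pos i j & y = pos i' j' & h = step i j i' j' & i \<le> i' & i' \<le> 1 & j \<le> j' & j' \<le> 1)"
proof -
 have "x : Obj square \<longleftrightarrow> (\<exists>i j. x = pos i j & i \<le> 1 & j \<le> 1)"
  unfolding square_def prod_simps by auto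
 moreover have "(i::nat) \<le> 1 \<longleftrightarrow> i = 0 \<or> i = 1" for i by auto
 ultimately show "x : Obj square \<longleftrightarrow> x = pos 0 0 \<or> x = pos 1 0 \<or> x = pos 0 1 \<or> x = pos 1 1" by (simp, blast)
 show "h : Hom square x y \<longleftrightarrow> (\<exists>i j i' j'. x = pos i j & y = pos i' j' & h = step i j i' j' & i \<le> i' & i' \<le> 1 & j \<le> j' & j' \<le> 1)"
  unfolding square_def prod_simps by (simp, blast)
qed

lemma small_square: "infinite (UNIV :: 'k set) ==> small_cat (square :: 'k scat)"
 unfolding square_def by (intro small_prod small_ord)

lemma small_ul: "infinite (UNIV :: 'k set) ==> small_cat (ul :: 'k scat)"
 unfolding ul_def by (rule small_full_sub[OF small_square])

lemma small_lr: "infinite (UNIV :: 'k set) ==> small_cat (lr :: 'k scat)"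
 unfolding lr_def by (rule small_full_sub[OF small_square])

lemma ul_simps:
 "x : Obj ul \<longleftrightarrow> x = pos 0 0 \<or> x = pos 1 0 \<or> x = pos 0 1"
 "h : Hom ul x y \<longleftrightarrow> h : Hom square x y & y ~= pos 1 1"
 by (auto simp: ul_def full_sub_simps square_simps)

lemma lr_simps:
 "x : Obj lr \<longleftrightarrow> x = pos 1 1 \<or> x = pos 1 0 \<or> x = pos 0 1"
 "h : Hom lr x y \<longleftrightarrow> h : Hom square x y & x ~= pos 0 0"
 by (auto simp: lr_def full_sub_simps square_simps)

lemma square_thin: "h : Hom square x y ==> h' : Hom square x y ==> h = h'"
 by (auto simp: square_simps)

lemma sfun_i_ul:
 assumes inf: "infinite (UNIV :: 'k set)"
 shows "sfun (i_ul :: 'k sfun) ul square" "x : Obj ul ==> Fobj (i_ul :: 'k sfun) x = x"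
  "h : Hom ul x y ==> Farr (i_ul :: 'k sfun) h = h"
 using sfun_incl[OF small_square[OF inf], where S = "- {pos 1 1}"] unfolding i_ul_def ul_def
 by (auto simp: full_sub_simps)

lemma sfun_i_00: "infinite (UNIV :: 'k set) ==> sfun (i_00 :: 'k sfun) one_cat ul"
 unfolding i_00_def by (rule sfun_pt[OF _ small_ul]) (auto simp: ul_simps)

definition to_corner :: "'k uni => 'k uni" where
 "to_corner j = Tup (Tup (ufst j) (Num 1)) (Tup (usnd j) (Num 1))"

definition corner_cocone :: "'k scat => 'k uni => 'k snat" where
 "corner_cocone A a = mk_nat ((A ** i_ul) *. at_left A ul a) (pt (A >< square) (Tup a (pos 1 1)) *. to_one ul)
  (\<lambda>j. Tup (Id A a) (to_corner j))"

text \<open>All of the corner lies below \<open>(1,1)\<close>, so its slice is \<open>(A/a) \<times> ul\<close>.\<close>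

lemma final_corner:
 fixes A :: "'k scat"
 assumes inf: "infinite (UNIV :: 'k set)" and A: "small_cat A" and a: "a : Obj A"
 shows "final_cocone (A ** i_ul) (A >< ul) (A >< square) (Tup a (pos 1 1)) (at_left A ul a) ul (corner_cocone A a)"
 unfolding corner_cocone_def
proof (rule final_cocone_slice[OF inf A small_ul[OF inf]])
 have cA: "category A" using A by (simp add: small_cat_def)
 note S = prod_simps and i = cat_id[OF cA a] and P = sfun_prod[OF inf A sfun_i_ul(1)[OF inf]]
 note U = sfun_i_ul[OF inf]
 have cu: "category (ul :: 'k scat)" using small_ul[OF inf] by (simp add: small_cat_def)
 show "sfun (A ** i_ul) (A >< ul) (A >< square)" by (rule P(1))
 show "a : Obj A" by (rule a)
 show "Tup a (pos 1 1) : Obj (A >< square)" using a by (simp add: S square_simps)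
 have tc: "to_corner j : Hom square j (pos 1 1)" if "j : Obj ul" for j :: "'k uni"
  using that by (auto simp: ul_simps square_simps to_corner_def)
 have o: "Fobj (A ** i_ul) (Tup x j) = Tup x j" if "x : Obj A" "j : Obj ul" for x j
  using P(2)[OF that] U(2)[OF that(2)] by simp
 show c: "Tup (Id A a) (to_corner j) : Hom (A >< square) (Fobj (A ** i_ul) (Tup a j)) (Tup a (pos 1 1))" if "j : Obj ul" for j
  using o[OF a that] i tc[OF that] by (simp add: S)
 have comp: "Tup (Id A a) (to_corner j) *[A >< square] Tup g h = Tup g (to_corner i)"
  if "g : Hom A x a" "h : Hom ul i j" for g h i j x
 proof -
  have ij: "i : Obj ul" "j : Obj ul" using that(2) cat_ob[OF cu] by auto
  have h: "h : Hom square i j" using that(2) by (simp add: ul_simps)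
  have "to_corner j *[square] h : Hom square i (pos 1 1)"
   using cat_comp[OF _ tc[OF ij(2)] h] small_square[OF inf] by (simp add: small_cat_def)
  then have "to_corner j *[square] h = to_corner i" using square_thin tc[OF ij(1)] by blast
  then show ?thesis using S(4)[OF i tc[OF ij(2)] that(1) h] cat_idl[OF cA that(1)] by simp
 qed
 show "Tup (Id A a) (to_corner j) *[A >< square] Farr (A ** i_ul) (Tup (Id A a) h) = Tup (Id A a) (to_corner i)"
  if "h : Hom ul i j" for h i j using comp[OF i that] P(3)[OF i that] U(3)[OF that] by simp
 fix x j f assume x: "x : Obj A" and j: "j : Obj ul" and f: "f : Hom (A >< square) (Fobj (A ** i_ul) (Tup x j)) (Tup a (pos 1 1))"
 obtain f1 f2 where f': "f = Tup f1 f2" "f1 : Hom A x a" "f2 : Hom square j (pos 1 1)"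
  using f o[OF x j] by (auto simp: S)
 have f2: "f2 = to_corner j" using square_thin f'(3) tc[OF j] by blast
 have "Tup (Id A a) (to_corner j) *[A >< square] Farr (A ** i_ul) (Tup g (Id ul j)) = Tup g (to_corner j)" if "g : Hom A x a" for g
  using comp[OF that cat_id[OF cu j]] P(3)[OF that cat_id[OF cu j]] U(3)[OF cat_id[OF cu j]] by simp
 then show "\<exists>!g. g : Hom A x a & Tup (Id A a) (to_corner j) *[A >< square] Farr (A ** i_ul) (Tup g (Id ul j)) = f"
  using f' f2 by auto
qed

text \<open>Away from \<open>(1,1)\<close> the inclusion is a sieve, so arrows lift uniquely.\<close>

lemma final_off_corner:
 fixes A :: "'k scat"
 assumes inf: "infinite (UNIV :: 'k set)" and A: "small_cat A" and a: "a : Obj A" and p: "p : Obj ul"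
 shows "final_cocone (A ** i_ul) (A >< ul) (A >< square) (Tup a p) (pt (A >< ul) (Tup a p)) one_cat (idN (pt (A >< square) (Tup a p)))"
proof -
 note S = prod_simps and P = sfun_prod[OF inf A sfun_i_ul(1)[OF inf]] and U = sfun_i_ul[OF inf]
 have ap: "Tup a p : Obj (A >< ul)" using a p by (simp add: S)
 have e: "Fobj (A ** i_ul) (Tup x j) = Tup x j" if "x : Obj A" "j : Obj ul" for x j
  using P(2)[OF that] U(2)[OF that(2)] by simp
 have "\<exists>!g. g : Hom (A >< ul) x (Tup a p) & Farr (A ** i_ul) g = f"
  if x: "x : Obj (A >< ul)" and f: "f : Hom (A >< square) (Fobj (A ** i_ul) x) (Fobj (A ** i_ul) (Tup a p))" for x f
 proof -
  obtain a' j where x': "x = Tup a' j" "a' : Obj A" "j : Obj ul" using x by (auto simp: S)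
  have f': "f : Hom (A >< square) x (Tup a p)" using f e[OF a p] e[OF x'(2,3)] x'(1) by simp
  have h: "g : Hom (A >< ul) x (Tup a p) ==> Farr (A ** i_ul) g = g" for g
   using P(3) U(3) by (auto simp: S)
  have "f : Hom (A >< ul) x (Tup a p)" using f' x' p by (auto simp: S ul_simps)
  then show ?thesis using h by auto
 qed
 from final_cocone_pt[OF inf P(1) ap this] show ?thesis using e[OF a p] by simp
qed

text \<open>An object without arrows to other objects: the slices at it have a terminal object, and the others are empty. The
extension by zero from \<open>(0,0)\<close> to the corner is of this kind in the opposite category.\<close>

lemma final_point:
 fixes A P :: "'k scat"
 assumes inf: "infinite (UNIV :: 'k set)" and A: "small_cat A" and P: "small_cat P" and p0: "p0 : Obj P"
  and src: "\<And>p h. h : Hom P p0 p ==> p = p0 & h = Id P p0" and a: "a : Obj A"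
 shows "final_cocone (A ** pt P p0) (A >< one_cat) (A >< P) (Tup a p0) (pt (A >< one_cat) (Tup a (Num 0))) one_cat (idN (pt (A >< P) (Tup a p0)))"
  "p : Obj P ==> p ~= p0 ==> \<exists>k \<kappa>. final_cocone (A ** pt P p0) (A >< one_cat) (A >< P) (Tup a p) k empty_cat \<kappa>"
proof -
 note S = prod_simps and U = sfun_prod[OF inf A sfun_pt[OF inf P p0]]
 have i: "Fobj (pt P p0) (Num 0) = p0" "Farr (pt P p0) (Tup (Num 0) (Num 0)) = Id P p0" by (auto simp: pt_def)
 have e: "Fobj (A ** pt P p0) (Tup x (Num 0)) = Tup x p0" if "x : Obj A" for x
  using U(2)[OF that, of "Num 0"] i by simp
 have a0: "Tup a (Num 0) : Obj (A >< one_cat)" using a by (simp add: S)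
 have "\<exists>!g. g : Hom (A >< one_cat) x (Tup a (Num 0)) & Farr (A ** pt P p0) g = f"
  if x: "x : Obj (A >< one_cat)" and f: "f : Hom (A >< P) (Fobj (A ** pt P p0) x) (Fobj (A ** pt P p0) (Tup a (Num 0)))" for x f
 proof -
  obtain a' where x': "x = Tup a' (Num 0)" "a' : Obj A" using x by (auto simp: S)
  obtain f1 f2 where f2: "f = Tup f1 f2" "f1 : Hom A a' a" "f2 : Hom P p0 p0"
   using f e[OF a] e[OF x'(2)] x'(1) by (auto simp: S)
  have f': "f = Tup f1 (Id P p0)" using f2(1) src[OF f2(3)] by simp
  have h: "Farr (A ** pt P p0) (Tup g (Tup (Num 0) (Num 0))) = Tup g (Id P p0)" if "g : Hom A a' a" for g
   using U(3)[OF that, of "Tup (Num 0) (Num 0)" "Num 0" "Num 0"] i by simp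
  show ?thesis
   by (rule ex1I[of _ "Tup f1 (Tup (Num 0) (Num 0))"]) (use f' f2(2) x' h in \<open>auto simp: S\<close>)
 qed
 from final_cocone_pt[OF inf U(1) a0 this]
 show "final_cocone (A ** pt P p0) (A >< one_cat) (A >< P) (Tup a p0) (pt (A >< one_cat) (Tup a (Num 0))) one_cat (idN (pt (A >< P) (Tup a p0)))"
  using e[OF a] by simp
 assume p: "p : Obj P" "p ~= p0"
 have ap: "Tup a p : Obj (A >< P)" using a p by (simp add: S)
 have "Hom (A >< P) (Fobj (A ** pt P p0) x) (Tup a p) = {}" if x: "x : Obj (A >< one_cat)" for x
 proof -
  obtain a' where x': "x = Tup a' (Num 0)" "a' : Obj A" using x by (auto simp: S)
  show ?thesis unfolding x'(1) e[OF x'(2)] using src p(2) by (auto simp: S(2))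
 qed
 from final_cocone_empty[OF inf U(1) ap this] show "\<exists>k \<kappa>. final_cocone (A ** pt P p0) (A >< one_cat) (A >< P) (Tup a p) k empty_cat \<kappa>" by blast
qed

context
 fixes D :: "('k, 'o, 'm) derivator" and E :: "('k, 'p, 'n) derivator" and F :: "('k, 'o, 'm, 'p, 'n) dmorphism"
 assumes inf: "infinite (UNIV :: 'k set)" and D: "left_derivator D" and E: "left_derivator E" and M: "is_dmorphism D E F"
  and pe: "pres_univ D E F (to_one empty_cat)"
begin

lemma pres_point:
 fixes A P :: "'k scat"
 assumes A: "small_cat A" and P: "small_cat P" and p0: "p0 : Obj P"
  and src: "\<And>p h. h : Hom P p0 p ==> p = p0 & h = Id P p0"
 shows "pres_univ D E F (A ** pt P p0)"
proof (rule pres_univ_pointwise[OF inf D E M sfun_prod(1)[OF inf A sfun_pt[OF inf P p0]]])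
 note one = pres_one[OF lderD(1)[OF D] lderD(1)[OF E] M lderD(4)[OF D] lderD(4)[OF E] inf]
 note fp = final_point[OF inf A P p0 src]
 fix b assume "b : Obj (A >< P)"
 then obtain x p where b: "b = Tup x p" "x : Obj A" "p : Obj P" by (auto simp: prod_simps)
 show "\<exists>k J \<kappa>. final_cocone (A ** pt P p0) (A >< one_cat) (A >< P) b k J \<kappa> & pres_univ D E F (to_one J)"
 proof (cases "p = p0")
  case True
  then show ?thesis using fp(1)[OF _ b(2)] one b(1) by blast
 next
  case False
  then show ?thesis using fp(2)[OF _ b(2,3)] pe b(1) by blast
 qed
qed

lemma pres_i_ul:
 fixes A :: "'k scat"
 assumes pu: "pres_univ D E F (to_one ul)" and A: "small_cat A"
 shows "pres_univ D E F (A ** i_ul)"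
proof (rule pres_univ_pointwise[OF inf D E M sfun_prod(1)[OF inf A sfun_i_ul(1)[OF inf]]])
 note one = pres_one[OF lderD(1)[OF D] lderD(1)[OF E] M lderD(4)[OF D] lderD(4)[OF E] inf]
 fix b assume "b : Obj (A >< square)"
 then obtain x p where b: "b = Tup x p" "x : Obj A" "p : Obj square" by (auto simp: prod_simps)
 show "\<exists>k J \<kappa>. final_cocone (A ** i_ul) (A >< ul) (A >< square) b k J \<kappa> & pres_univ D E F (to_one J)"
 proof (cases "p = pos 1 1")
  case True
  then show ?thesis using final_corner[OF inf A b(2)] pu b(1) by blast
 next
  case False
  then have "p : Obj ul" using b(3) by (auto simp: ul_simps square_simps)
  then show ?thesis using final_off_corner[OF inf A b(2)] one b(1) by blast
 qed
qed

end

lemma op_point: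
 fixes A :: "'k scat"
 assumes inf: "infinite (UNIV :: 'k set)" and A: "small_cat A"
 shows "opF (A ** i_00) = (opc A) ** pt (opc ul) (pos 0 0)" "small_cat (opc ul :: 'k scat)" "(pos 0 0 :: 'k uni) : Obj (opc ul)"
  "\<And>p h :: 'k uni. h : Hom (opc ul) (pos 0 0) p ==> p = pos 0 0 & h = Id (opc ul) (pos 0 0)"
proof -
 have z: "(pos 0 0 :: 'k uni) : Obj ul" by (simp add: ul_simps)
 show "opF (A ** i_00) = (opc A) ** pt (opc ul) (pos 0 0)"
  unfolding op_id_prod[OF inf A sfun_i_00[OF inf]] unfolding i_00_def op_pt[OF inf small_ul[OF inf] z] ..
 show "small_cat (opc ul :: 'k scat)" by (rule small_op[OF small_ul[OF inf]])
 show "(pos 0 0 :: 'k uni) : Obj (opc ul)" using z by simp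
 have "(Id ul (pos 0 0) :: 'k uni) = step 0 0 0 0"
  using cat_id[of ul "pos 0 0"] small_ul[OF inf] z by (auto simp: small_cat_def ul_simps square_simps)
 then show "p = pos 0 0 & h = Id (opc ul) (pos 0 0)" if "h : Hom (opc ul) (pos 0 0) p" for p h :: "'k uni"
  using that z by (auto simp: ul_simps square_simps)
qed

lemma exact_pres:
 fixes D :: "('k, 'o, 'm) derivator"
 assumes inf: "infinite (UNIV :: 'k set)" and D: "is_derivator D" and E: "is_derivator E" and F: "exact_dmorphism D E F"
 shows "pres_univ D E F (to_one empty_cat)" "pres_univ D E F (to_one ul)"
  "pres_univ (opD D) (opD E) (opM F) (to_one empty_cat)" "pres_univ (opD D) (opD E) (opM F) (to_one (opc lr))"
proof -
 have M: "is_dmorphism D E F" using F by (simp add: exact_dmorphism_def)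
 note a = derD(1)[OF D] derD(1)[OF E] M derD(4)[OF D] derD(4)[OF E]
 note e = s_one[OF inf small_empty] and u = s_one[OF inf small_ul[OF inf]] and l = s_one[OF inf small_lr[OF inf]]
 show "pres_univ D E F (to_one empty_cat)" "pres_univ D E F (to_one ul)"
  "pres_univ (opD D) (opD E) (opM F) (to_one empty_cat)" "pres_univ (opD D) (opD E) (opM F) (to_one (opc lr))"
  using F preserves_lan_iff[OF a e] preserves_lan_iff[OF a u]
   preserves_ran_iff[OF inf D E M e, unfolded op_to_one[OF inf small_empty] op_empty]
   preserves_ran_iff[OF inf D E M l, unfolded op_to_one[OF inf small_lr[OF inf]]]
  unfolding exact_dmorphism_def right_exact_def left_exact_def by auto
qed

lemma pres_square:
 fixes D :: "('k, 'o, 'm) derivator" and A :: "'k scat"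
 assumes inf: "infinite (UNIV :: 'k set)" and D: "is_derivator D" and E: "is_derivator E" and F: "exact_dmorphism D E F"
  and A: "small_cat A"
 shows "preserves_lan D E F (A ** i_ul)" "preserves_ran D E F (A ** i_00)"
proof -
 have M: "is_dmorphism D E F" using F by (simp add: exact_dmorphism_def)
 note a = derD(1)[OF D] derD(1)[OF E] M derD(4)[OF D] derD(4)[OF E]
 note ex = exact_pres[OF inf D E F] and op = op_point[OF inf A]
 show "preserves_lan D E F (A ** i_ul)"
  unfolding preserves_lan_iff[OF a sfun_prod(1)[OF inf A sfun_i_ul(1)[OF inf]]]
  by (rule pres_i_ul[OF inf derivator_left[OF inf D] derivator_left[OF inf E] M ex(1,2) A])
 show "preserves_ran D E F (A ** i_00)"
  unfolding preserves_ran_iff[OF inf D E M sfun_prod(1)[OF inf A sfun_i_00[OF inf]]] op(1)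
  by (rule pres_point[OF inf left_derivator_op[OF inf D] left_derivator_op[OF inf E] is_dmorphism_op[OF a(1-3)] ex(3) small_op[OF A] op(2-4)])
qed

section \<open>Initial, terminal and zero objects\<close>

text \<open>Der1 for the empty family: \<open>D(\<emptyset>)\<close> is equivalent to the terminal category.\<close>

lemma D_empty_hom:
 assumes D1: "Der1 D" and P: "is_prederivator D"
 shows "\<exists>x. x : dobj D empty_cat" 
  "x : dobj D empty_cat ==> y : dobj D empty_cat ==> \<exists>!f. f : dhom D empty_cat x y"
proof -
 let ?A = "\<lambda>i :: 'a uni. empty_cat :: 'a scat"
 have s: "small ({} :: 'a uni set)" using small_empty[where 'k='a] by (simp add: small_cat_def)
 have c: "coprod_cat {} ?A = empty_cat"
  by (simp add: coprod_cat_def empty_cat_def mk_cat_def restrict_def)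
 have e: "equivalence (to_prod D {} ?A)" using D1 s unfolding Der1_def by blast
 have d: "Fdom (to_prod D {} ?A) = dcat D empty_cat" "Fcod (to_prod D {} ?A) = prod_family {} (\<lambda>i. dcat D (?A i))"
  by (simp_all add: to_prod_def c)
 have pf: "Obj (prod_family {} (\<lambda>i. dcat D (?A i))) = {\<lambda>i. undefined}" "Arr (prod_family {} (\<lambda>i. dcat D (?A i))) = {\<lambda>i. undefined}"
  by (simp_all add: prod_family_def)
 note f = is_functorD[OF _ d]
 have F: "is_functor (to_prod D {} ?A)" "full (to_prod D {} ?A)" "faithful (to_prod D {} ?A)" "ess_surj (to_prod D {} ?A)"
  using e unfolding equivalence_def by auto
 show "\<exists>x. x : dobj D empty_cat" using F(4) unfolding ess_surj_def d pf by blast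
 assume x: "x : dobj D empty_cat" and y: "y : dobj D empty_cat"
 let ?F = "to_prod D {} ?A"
 note cc = f(2)[OF F(1)]
 have Fx: "Fobj ?F x = (\<lambda>i. undefined)" "Fobj ?F y = (\<lambda>i. undefined)" using f(3)[OF F(1)] x y pf(1) by auto
 have "Hom (Fcod ?F) (Fobj ?F x) (Fobj ?F y) ~= {}"
  using cat_id[OF cc f(3)[OF F(1) x]] Fx d by auto
 then have 1: "dhom D empty_cat x y ~= {}" using F(2) x y unfolding full_def d by blast
 have "g = g'" if "g : dhom D empty_cat x y" "g' : dhom D empty_cat x y" for g g'
 proof -
  have "Farr ?F g = Farr ?F g'" using f(4)[OF F(1) that(1)] f(4)[OF F(1) that(2)] pf(2) by (auto simp: Hom_def)
  then show ?thesis using F(3) x y that unfolding faithful_def d inj_on_def by blast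
 qed
 then show "\<exists>!f. f : dhom D empty_cat x y" using 1 by blast
qed

text \<open>Arrows in \<open>D(\<emptyset>)\<close> carry no information, so universality says that \<open>Y\<close> is initial.\<close>

lemma univ_empty_iff:
 assumes D1: "Der1 D" and P: "is_prederivator D" and u: "sfun u empty_cat A"
  and Y: "Y : dobj D A" and f: "f : dhom D empty_cat X (dob D u Y)"
 shows "univ (dfun D u) X Y f \<longleftrightarrow> initial_obj (dcat D A) Y"
proof -
 note U = D_fun[OF P u]
 note h = D_empty_hom(2)[OF D1 P] and X = cat_ob(1)[OF funD(5)[OF U] f]
 have "(\<exists>!h. h : dhom D A Y Z & dar D u h *[dcat D empty_cat] f = g) \<longleftrightarrow> (\<exists>!h. h : dhom D A Y Z)"
  if Z: "Z : dobj D A" and g: "g : dhom D empty_cat X (dob D u Z)" for Z g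
 proof -
  have "dar D u h *[dcat D empty_cat] f = g" if "h : dhom D A Y Z" for h
   using h[OF X fobj[OF U Z]] g cat_comp[OF funD(5)[OF U] fhom[OF U that] f] by blast
  then show ?thesis by metis
 qed
 moreover have "\<exists>g. g : dhom D empty_cat X (dob D u Z)" if "Z : dobj D A" for Z
  using h[OF X fobj[OF U that]] by blast
 ultimately show ?thesis unfolding univ_def initial_obj_def using funD(2,3)[OF U] Y f by (auto 0 3)
qed

lemma pres_initial:
 fixes D :: "('k, 'o, 'm) derivator" and E :: "('k, 'p, 'n) derivator" and A :: "'k scat"
 assumes inf: "infinite (UNIV :: 'k set)" and D: "left_derivator D" and E: "left_derivator E" and M: "is_dmorphism D E F"
  and pe: "pres_univ D E F (to_one empty_cat)" and A: "small_cat A" and z: "initial_obj (dcat D A) z"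
 shows "initial_obj (dcat E A) (mob F A z)"
proof -
 note PD = lderD(1)[OF D] and PE = lderD(1)[OF E] and D1 = lderD(2)[OF D] and E1 = lderD(2)[OF E]
 let ?u = "mk_fun empty_cat A (\<lambda>x. x) (\<lambda>f. f)"
 have u: "sfun ?u empty_cat A" by (rule sfun_from_empty[OF A])
 have no: "x : Obj empty_cat ==> Hom A y z = {}" for x y z :: "'k uni" by simp
 have p: "pres_univ D E F ?u"
  by (rule pres_univ_pointwise[OF inf D E M u]) (use final_cocone_empty[OF inf u] no pe in blast)
 have zo: "z : dobj D A" using z by (auto simp: initial_obj_def)
 obtain X where X: "X : dobj D empty_cat" using D_empty_hom(1)[OF D1 PD] by blast
 obtain f where f: "f : dhom D empty_cat X (dob D ?u z)"
  using D_empty_hom(2)[OF D1 PD X fobj[OF D_fun[OF PD u] zo]] by blast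
 show ?thesis
  using univ_empty_iff[OF D1 PD u zo f] z p sfunD(2,3)[OF u] mimg_hom(1)[OF PD PE M u zo f]
   univ_empty_iff[OF E1 PE u fobj[OF M_fun[OF PD PE M A] zo]] unfolding pres_univ_def by metis
qed

lemma initial_op: "initial_obj (opc C) z \<longleftrightarrow> terminal_obj C z"
 by (simp add: initial_obj_def terminal_obj_def)

lemma pres_zero:
 fixes D :: "('k, 'o, 'm) derivator" and A :: "'k scat"
 assumes inf: "infinite (UNIV :: 'k set)" and D: "is_derivator D" and E: "is_derivator E" and F: "exact_dmorphism D E F"
  and A: "small_cat A" and z: "zero_obj (dcat D A) z"
 shows "zero_obj (dcat E A) (mob F A z)"
proof -
 have M: "is_dmorphism D E F" using F by (simp add: exact_dmorphism_def)
 note PD = derD(1)[OF D] and PE = derD(1)[OF E] and ex = exact_pres[OF inf D E F]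
 have "opc (opc A) = A" by (rule opc_opc) (use A in \<open>simp add: small_cat_def\<close>)
 then show ?thesis
  using pres_initial[OF inf derivator_left[OF inf D] derivator_left[OF inf E] M ex(1) A]
   pres_initial[OF inf left_derivator_op[OF inf D] left_derivator_op[OF inf E] is_dmorphism_op[OF PD PE M] ex(3) small_op[OF A]]
   z unfolding zero_obj_def opD_simps opM_simps initial_op by simp
qed

text \<open>The objects of \<open>[m] \<times> [n]\<close> are written with the numeral 1, which has to stay folded for them to match.\<close>

declare One_nat_def [simp del]

section \<open>Thin categories\<close>

definition thin :: "('o, 'm) cat => bool" where
 "thin C \<longleftrightarrow> (\<forall>x y f g. f : Hom C x y \<longrightarrow> g : Hom C x y \<longrightarrow> f = g)"

lemma thinD: "thin C ==> f : Hom C x y ==> g : Hom C x y ==> f = g"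
 unfolding thin_def by blast

lemma ncell_thin_eq: "thin B ==> ncell \<alpha> u v A B ==> ncell \<beta> u v A B ==> \<alpha> = \<beta>"
 using ncell_eqI[of \<alpha> u v A B \<beta>] ncellD(7)[of \<alpha> u v A B] ncellD(7)[of \<beta> u v A B] thinD by metis

lemma ncell_thin_exists:
 assumes t: "thin B" and u: "sfun u A B" and v: "sfun v A B"
  and ex: "\<And>x. x : Obj A ==> Hom B (Fobj u x) (Fobj v x) ~= {}"
 shows "\<exists>\<alpha>. ncell \<alpha> u v A B"
proof -
 have h: "(SOME h. h : Hom B (Fobj u x) (Fobj v x)) : Hom B (Fobj u x) (Fobj v x)" if "x : Obj A" for x
  using ex[OF that] by (simp add: some_in_eq)
 have "ncell (mk_nat u v (\<lambda>x. SOME h. h : Hom B (Fobj u x) (Fobj v x))) u v A B"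
 proof (rule ncell_mk_nat[OF u v h])
  note us = sfunD[OF u]
  fix f x y assume f: "f : Hom A x y"
  note xy = cat_ob[OF us(7) f]
  show "(SOME h. h : Hom B (Fobj u y) (Fobj v y)) *[B] Farr u f = Farr v f *[B] (SOME h. h : Hom B (Fobj u x) (Fobj v x))"
   using thinD[OF t cat_comp[OF us(8) h[OF xy(2)] fhom[OF us(6) f]] cat_comp[OF us(8) fhom[OF sfunD(6)[OF v] f] h[OF xy(1)]]] .
 qed
 then show ?thesis by blast
qed

text \<open>In posets finality means that the elements of \<open>J\<close> above any \<open>x\<close> below \<open>b\<close> have a least one.\<close>

lemma final_cocone_thin:
 assumes c: "cocone u A B b k J \<kappa>" and tA: "thin A" and tB: "thin B" and tJ: "thin J"
  and least: "\<And>x. x : Obj A ==> Hom B (Fobj u x) b ~= {} ==>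
   \<exists>j\<in>Obj J. Hom A x (Fobj k j) ~= {} & (\<forall>j'\<in>Obj J. Hom A x (Fobj k j') ~= {} \<longrightarrow> Hom J j j' ~= {})"
 shows "final_cocone u A B b k J \<kappa>"
 unfolding final_cocone_def
proof (intro conjI ballI c)
 note C = coconeD[OF c]
 note us = sfunD[OF C(1)]
 fix x f assume x: "x : Obj A" and f: "f : Hom B (Fobj u x) b"
 obtain j g where j: "j : Obj J" and g: "g : Hom A x (Fobj k j)"
  and l: "\<And>j'. j' : Obj J ==> Hom A x (Fobj k j') ~= {} ==> Hom J j j' ~= {}"
  using least[OF x] f by blast
 show "\<exists>j\<in>Obj J. \<exists>g\<in>Hom A x (Fobj k j). Ncomp \<kappa> j *[B] Farr u g = f &
   (\<forall>j'\<in>Obj J. \<forall>g'\<in>Hom A x (Fobj k j'). Ncomp \<kappa> j' *[B] Farr u g' = f \<longrightarrow>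
    (\<exists>!h. h : Hom J j j' & Farr k h *[A] g = g'))"
 proof (intro bexI[OF _ j] bexI[OF _ g] conjI ballI impI)
  show "Ncomp \<kappa> j *[B] Farr u g = f"
   using thinD[OF tB cat_comp[OF us(8) C(7)[OF j] fhom[OF us(6) g]] f] .
  fix j' g' assume j': "j' : Obj J" and g': "g' : Hom A x (Fobj k j')"
  obtain h where h: "h : Hom J j j'" using l[OF j'] g' by blast
  have "Farr k h *[A] g = g'" using thinD[OF tA cat_comp[OF us(7) fhom[OF sfunD(6)[OF C(3)] h] g] g'] .
  then show "\<exists>!h. h : Hom J j j' & Farr k h *[A] g = g'" using h thinD[OF tJ] by blast
 qed
qed

lemma thin_ord: "thin (ord_cat n :: 'k scat)"
 unfolding thin_def by auto

lemma thin_prod: "thin A ==> thin B ==> thin (A >< B)"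
 unfolding thin_def prod_simps by blast

lemma thin_full_sub: "thin A ==> thin (full_sub A S)"
 unfolding thin_def full_sub_simps by blast

lemma thin_ul: "thin (ul :: 'k scat)"
 unfolding ul_def square_def by (intro thin_full_sub thin_prod thin_ord)

lemma two_one_simps:
 "x : Obj two_one \<longleftrightarrow> (\<exists>i j. x = pos i j & i \<le> 2 & j \<le> 1)"
 "h : Hom two_one x y \<longleftrightarrow> (\<exists>i j i' j'. x = pos i j & y = pos i' j' & h = step i j i' j' & i \<le> i' & i' \<le> 2 & j \<le> j' & j' \<le> 1)"
 by (auto simp: prod_simps)

lemma small_two_one: "infinite (UNIV :: 'k set) ==> small_cat (two_one :: 'k scat)"
 by (intro small_prod small_ord)

lemma thin_two_one: "thin (two_one :: 'k scat)"
 by (intro thin_prod thin_ord)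

lemma sfun_sub_square:
 assumes inf: "infinite (UNIV :: 'k set)" and xy: "x \<le> y" "y \<le> 2"
 shows "sfun (sub_square x y :: 'k sfun) square two_one"
  "i \<le> 1 ==> j \<le> 1 ==> Fobj (sub_square x y :: 'k sfun) (pos i j) = pos (if i = 0 then x else y) j"
  "h : Hom square v w ==> Farr (sub_square x y :: 'k sfun) h : Hom two_one (Fobj (sub_square x y) v) (Fobj (sub_square x y) w)"
proof -
 let ?f = "\<lambda>i::nat. if i = 0 then x else y"
 have m: "i \<le> j ==> ?f i \<le> ?f j & ?f j \<le> 2" for i j using xy by auto
 have u: "sfun (ord_fun 1 2 ?f :: 'k sfun) (ord_cat 1) (ord_cat 2)"
  unfolding ord_fun_def
 proof (rule sfun_mk_fun[OF small_ord[OF inf] small_ord[OF inf]])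
  fix g h u v w :: "'k uni" assume "g : Hom (ord_cat 1) v w" "h : Hom (ord_cat 1) u v"
  then obtain a b c where "g = Tup (Num b) (Num c)" "h = Tup (Num a) (Num b)" "a \<le> b" "b \<le> c" "c \<le> 1" by auto
  then show "Tup (Num (?f (unum (ufst (g *[ord_cat 1] h))))) (Num (?f (unum (usnd (g *[ord_cat 1] h))))) =
   Tup (Num (?f (unum (ufst g)))) (Num (?f (unum (usnd g)))) *[ord_cat 2] Tup (Num (?f (unum (ufst h)))) (Num (?f (unum (usnd h))))"
   using m by simp
 qed (use xy in auto)
 have uo: "Fobj (ord_fun 1 2 ?f :: 'k sfun) (Num i) = Num (?f i)" if "i \<le> 1" for i using that by (simp add: ord_fun_def)
 have ua: "Farr (ord_fun 1 2 ?f :: 'k sfun) (Tup (Num i) (Num j)) = Tup (Num (?f i)) (Num (?f j))" if "i \<le> j" "j \<le> 1" for i j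
  using that by (simp add: ord_fun_def)
 have so: "Fobj (sub_square x y :: 'k sfun) (pos i j) = pos (?f i) j" if "i \<le> 1" "j \<le> 1" for i j
  using that sfunD(2)[OF u] uo by (simp add: sub_square_def prod_fun_def prod_simps)
 show "i \<le> 1 ==> j \<le> 1 ==> Fobj (sub_square x y :: 'k sfun) (pos i j) = pos (?f i) j" by (rule so)
 have sa: "Farr (sub_square x y :: 'k sfun) (step i j i' j') = step (?f i) j (?f i') j'" if "i \<le> i'" "i' \<le> 1" "j \<le> j'" "j' \<le> 1" for i j i' j'
 proof -
  have "(step i j i' j' :: 'k uni) : Arr (ord_cat 1 >< ord_cat 1)" using that by (auto simp: prod_cat_def)
  then show ?thesis using that sfunD(2)[OF u] ua by (simp add: sub_square_def prod_fun_def)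
 qed
 show hom: "h : Hom square v w ==> Farr (sub_square x y :: 'k sfun) h : Hom two_one (Fobj (sub_square x y) v) (Fobj (sub_square x y) w)" for h v w
  using so sa m xy by (auto simp: square_simps two_one_simps)
 have d: "Fdom (sub_square x y :: 'k sfun) = square" "Fcod (sub_square x y :: 'k sfun) = two_one"
  using sfunD(2,3)[OF u] by (simp_all add: sub_square_def prod_fun_def square_def)
 let ?m = "mk_fun square two_one (Fobj (sub_square x y)) (Farr (sub_square x y)) :: 'k sfun"
 have "sfun ?m square two_one"
 proof (rule sfun_mk_fun[OF small_square[OF inf] small_two_one[OF inf] _ hom])
  have cs: "category (square :: 'k scat)" and ct: "category (two_one :: 'k scat)" 
   using small_square[OF inf] small_two_one[OF inf] by (simp_all add: small_cat_def)
  show o: "v : Obj square ==> Fobj (sub_square x y) v : Obj two_one" for v :: "'k uni"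
   using so xy by (auto simp: square_simps two_one_simps)
  show "Farr (sub_square x y) (Id square v) = Id two_one (Fobj (sub_square x y) v)" if "v : Obj square" for v :: "'k uni"
   using thinD[OF thin_two_one hom[OF cat_id[OF cs that]] cat_id[OF ct o[OF that]]] .
  fix g h u v w :: "'k uni" assume g: "g : Hom square v w" and h: "h : Hom square u v"
  show "Farr (sub_square x y) (g *[square] h) = Farr (sub_square x y) g *[two_one] Farr (sub_square x y) h"
   using thinD[OF thin_two_one hom[OF cat_comp[OF cs g h]] cat_comp[OF ct hom[OF g] hom[OF h]]] .
 qed
 moreover have "?m = sub_square x y"
  unfolding sub_square_def prod_fun_def mk_fun_def using sfunD(2,3)[OF u] by (simp add: square_def)
 ultimately show "sfun (sub_square x y :: 'k sfun) square two_one" by simp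
qed

text \<open>A functor whose objects lie in \<open>S\<close> factors through the full subcategory on \<open>S\<close>.\<close>

lemma corestrict:
 assumes v: "sfun v J B" and S: "\<And>j. j : Obj J ==> Fobj v j : S"
 defines "w \<equiv> mk_fun J (full_sub B S) (Fobj v) (Farr v)"
 shows "sfun w J (full_sub B S)" "incl B S *. w = v" "j : Obj J ==> Fobj w j = Fobj v j"
proof -
 note vs = sfunD[OF v]
 have h: "Farr v h : Hom (full_sub B S) (Fobj v i) (Fobj v j)" if "h : Hom J i j" for h i j
  using fhom[OF vs(6) that] S cat_ob[OF vs(7) that] by (auto simp: full_sub_simps)
 show w: "sfun w J (full_sub B S)" unfolding w_def
 proof (rule sfun_mk_fun[OF vs(4) small_full_sub[OF vs(5)] _ h])
  show "j : Obj J ==> Fobj v j : Obj (full_sub B S)" for j using fobj[OF vs(6)] S by (simp add: full_sub_simps)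
  show "j : Obj J ==> Farr v (Id J j) = Id (full_sub B S) (Fobj v j)" for j
   using fident[OF vs(6)] fobj[OF vs(6)] S by (simp add: full_sub_simps)
  show "Farr v (g *[J] f) = Farr v g *[full_sub B S] Farr v f" if "g : Hom J y z" "f : Hom J x y" for g f x y z
   using fcomp[OF vs(6) that] full_sub_simps(4)[OF h[OF that(1)] h[OF that(2)]] by simp
 qed
 show o: "j : Obj J ==> Fobj w j = Fobj v j" for j by (simp add: w_def)
 note I = sfun_incl[OF vs(5), where S = S]
 show "incl B S *. w = v"
 proof (rule sfun_eqI[OF sfun_comp[OF w I(1)] v])
  show "j : Obj J ==> Fobj (incl B S *. w) j = Fobj v j" for j
   using o I(2) fobj[OF vs(6)] S by (simp add: compF_obj[OF sfunD(6)[OF w]])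
  fix f x y assume f: "f : Hom J x y"
  show "Farr (incl B S *. w) f = Farr v f"
   using I(3)[OF h[OF f]] HomD(1)[OF f] by (simp add: compF_arr[OF sfunD(6)[OF w] f] w_def)
 qed
qed

section \<open>Pasting of cocartesian squares\<close>

lemma restr_id:
 assumes P: "is_prederivator D" and c: "cocone u A B b k J \<kappa>" and X: "X : dobj D B"
 shows "restr D J k \<kappa> X (Id (dcat D A) (dob D u X)) = dnt D \<kappa> X"
proof -
 note C = coconeD[OF c]
 have "dnt D \<kappa> X : dhom D J (dob D k (dob D u X)) (dob D (pt B b *. to_one J) X)"
  using D_nat_hom[OF P C(4) X] D_cob[OF P C(3,1) X] by simp
 then show ?thesis unfolding restr_def
  using fident[OF D_fun[OF P C(3)] fobj[OF D_fun[OF P C(1)] X]] cat_idr[OF D_cat[OF P sfunD(4)[OF C(3)]]] by simp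
qed

lemma univ_one_iff:
 fixes D :: "('k, 'o, 'm, 'z) prederivator_scheme"
 assumes inf: "infinite (UNIV :: 'k set)" and P: "is_prederivator D" and f: "f : dhom D one_cat X Y"
 shows "univ (dfun D (to_one one_cat)) X Y f \<longleftrightarrow> iso_arr (dcat D one_cat) f"
proof -
 have "to_one one_cat = (idF one_cat :: 'k sfun)" by (rule to_one_unique[OF sfun_id[OF small_ord[OF inf]], symmetric])
 then have e: "dfun D (to_one one_cat) = idF (dcat D one_cat)" using D_idF[OF P small_ord[OF inf]] by simp
 show "univ (dfun D (to_one one_cat)) X Y f \<longleftrightarrow> iso_arr (dcat D one_cat) f"
  unfolding e using univ_idF[OF D_cat[OF P small_ord[OF inf]] f] by auto
qed

lemma restr_id_pt_univ:
 fixes D :: "('k, 'o, 'm, 'z) prederivator_scheme"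
 assumes inf: "infinite (UNIV :: 'k set)" and P: "is_prederivator D"
  and c: "cocone u A B b k one_cat (idN (pt B b))" and X: "X : dobj D B"
 shows "univ (dfun D (to_one one_cat)) (dob D k (dob D u X)) (dob D (pt B b) X)
  (restr D one_cat k (idN (pt B b)) X (Id (dcat D A) (dob D u X)))"
proof -
 note C = coconeD[OF c]
 have e: "dob D k (dob D u X) = dob D (pt B b) X"
  using D_cob[OF P C(3,1) X] ncellD(2)[OF C(4)] by simp
 note bX = fobj[OF D_fun[OF P C(6)] X] and o = D_cat[OF P small_ord[OF inf]]
 show ?thesis
  unfolding restr_id[OF P c X] D_idN[OF P C(6) X] e
  using univ_one_iff[OF inf P cat_id[OF o bX]] iso_id[OF o bX] by simp
qed

text \<open>The corner of the square \<open>{x, y} \<times> [1]\<close> in \<open>[2] \<times> [1]\<close> with its vertex \<open>(y, 1)\<close>. The target is a poset, so the cocone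
is unique.\<close>

definition edge_cocone :: "nat => nat => 'k snat" where
 "edge_cocone x y = (THE \<kappa>. ncell \<kappa> (sub_square x y *. i_ul) (pt two_one (pos y 1) *. to_one ul) ul two_one)"

lemma edge_cocone:
 assumes inf: "infinite (UNIV :: 'k set)" and xy: "x \<le> y" "y \<le> 2"
 shows "ncell (edge_cocone x y :: 'k snat) (sub_square x y *. i_ul) (pt two_one (pos y 1) *. to_one ul) ul two_one"
proof -
 note u = sfun_i_ul[OF inf] and s = sfun_sub_square[OF inf xy]
 have y: "(pos y 1 :: 'k uni) : Obj two_one" using xy by (simp add: two_one_simps)
 have "\<exists>\<kappa>. ncell (\<kappa> :: 'k snat) (sub_square x y *. i_ul) (pt two_one (pos y 1) *. to_one ul) ul two_one"
 proof (rule ncell_thin_exists[OF thin_two_one sfun_comp[OF u(1) s(1)] sfun_const[OF inf small_ul[OF inf] small_two_one[OF inf] y]])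
  fix j :: "'k uni" assume j: "j : Obj ul"
  then show "Hom two_one (Fobj (sub_square x y *. i_ul) j) (Fobj (pt two_one (pos y 1) *. to_one ul) j) ~= {}"
   using u(2)[OF j] xy s(2) by (simp add: compF_obj[OF sfunD(6)[OF u(1)] j] ex_in_conv[symmetric] two_one_simps) (auto simp: ul_simps)
 qed
 then show ?thesis unfolding edge_cocone_def using theI' ncell_thin_eq[OF thin_two_one] by metis
qed

lemma edge_obj:
 assumes inf: "infinite (UNIV :: 'k set)" and xy: "x \<le> y" "y \<le> 2"
 shows "sfun (sub_square x y *. i_ul :: 'k sfun) ul two_one"
  "Fobj (sub_square x y *. i_ul :: 'k sfun) (pos 0 0) = pos x 0"
  "Fobj (sub_square x y *. i_ul :: 'k sfun) (pos 1 0) = pos y 0"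
  "Fobj (sub_square x y *. i_ul :: 'k sfun) (pos 0 1) = pos x 1"
proof -
 note u = sfun_i_ul[OF inf] and s = sfun_sub_square[OF inf xy]
 show "sfun (sub_square x y *. i_ul :: 'k sfun) ul two_one" using sfun_comp[OF u(1) s(1)] .
 have z: "(pos 0 0 :: 'k uni) : Obj ul" "(pos 1 0 :: 'k uni) : Obj ul" "(pos 0 1 :: 'k uni) : Obj ul"
  by (auto simp: ul_simps)
 show "Fobj (sub_square x y *. i_ul :: 'k sfun) (pos 0 0) = pos x 0"
  "Fobj (sub_square x y *. i_ul :: 'k sfun) (pos 1 0) = pos y 0"
  "Fobj (sub_square x y *. i_ul :: 'k sfun) (pos 0 1) = pos x 1"
  using z u(2) s(2) by (auto simp: compF_obj[OF sfunD(6)[OF u(1)]])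
qed

lemma Hom_two_one_pos:
 "(Hom (two_one :: 'k scat) (pos i j) (pos i' j') ~= {}) \<longleftrightarrow> i \<le> i' & i' \<le> 2 & j \<le> j' & j' \<le> 1"
 by (simp add: ex_in_conv[symmetric] two_one_simps)

lemma Hom_ul_pos:
 "(Hom (ul :: 'k scat) (pos i j) (pos i' j') ~= {}) \<longleftrightarrow> i \<le> i' & i' \<le> 1 & j \<le> j' & j' \<le> 1 & \<not> (i' = 1 & j' = 1)"
 by (auto simp: ex_in_conv[symmetric] ul_simps square_simps)

lemma ball_ul: "(\<forall>j\<in>Obj (ul :: 'k scat). P j) \<longleftrightarrow> P (pos 0 0) & P (pos 1 0) & P (pos 0 1)"
 by (auto simp: ul_simps(1))

text \<open>Left Kan extensions compose: the first pushout makes \<open>Q\<close> a left Kan extension on an intermediate full subcategory,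
over which the second computes the colimit.\<close>

lemma pushout_pasting:
 fixes D :: "('k, 'o, 'm) derivator"
 assumes inf: "infinite (UNIV :: 'k set)" and D: "left_derivator D" and Q: "Q : dobj D two_one"
  and L: "univ (dfun D (to_one ul)) (dob D (sub_square 0 1 *. i_ul) Q) (dob D (pt two_one (pos 1 1)) Q)
   (dnt D (edge_cocone 0 1) Q)"
  and R: "univ (dfun D (to_one ul)) (dob D (sub_square 1 2 *. i_ul) Q) (dob D (pt two_one (pos 2 1)) Q)
   (dnt D (edge_cocone 1 2) Q)"
 shows "univ (dfun D (to_one ul)) (dob D (sub_square 0 2 *. i_ul) Q) (dob D (pt two_one (pos 2 1)) Q)
   (dnt D (edge_cocone 0 2) Q)"
proof -
 note P = lderD(1)[OF D]
 note B = small_two_one[OF inf] and tB = thin_two_one and U = small_ul[OF inf] and tU = thin_ul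
 define T' where "T' = full_sub (two_one :: 'k scat) (- {pos 2 1})"
 define T where "T = full_sub T' (- {pos 1 1})"
 define i' where "i' = incl (two_one :: 'k scat) (- {pos 2 1})"
 define i where "i = incl T' (- {pos 1 1})"
 have sT': "small_cat T'" and sT: "small_cat T" unfolding T_def T'_def by (intro small_full_sub B)+
 have tT': "thin T'" and tT: "thin T" unfolding T_def T'_def by (intro thin_full_sub tB)+
 note i' = sfun_incl[OF B, where S = "- {pos 2 1}", folded T'_def i'_def]
 note i = sfun_incl[OF sT', where S = "- {pos 1 1}", folded T_def i_def]
 have oT': "x : Obj T' \<longleftrightarrow> x : Obj two_one & x ~= pos 2 1" for x by (auto simp: T'_def full_sub_simps)
 have oT: "x : Obj T \<longleftrightarrow> x : Obj T' & x ~= pos 1 1" for x by (auto simp: T_def full_sub_simps)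
 have hT': "h : Hom T' x y \<longleftrightarrow> h : Hom two_one x y & x ~= pos 2 1 & y ~= pos 2 1" for h x y by (auto simp: T'_def full_sub_simps)
 have hT: "h : Hom T x y \<longleftrightarrow> h : Hom T' x y & x ~= pos 1 1 & y ~= pos 1 1" for h x y by (auto simp: T_def full_sub_simps)
 have oB: "x : Obj two_one \<longleftrightarrow> x = pos 0 0 \<or> x = pos 1 0 \<or> x = pos 2 0 \<or> x = pos 0 1 \<or> x = pos 1 1 \<or> x = pos 2 1" for x :: "'k uni"
 proof -
  have "(a::nat) \<le> 2 \<longleftrightarrow> a = 0 \<or> a = 1 \<or> a = 2" "(a::nat) \<le> 1 \<longleftrightarrow> a = 0 \<or> a = 1" for a by auto
  then show ?thesis by (auto simp: two_one_simps)
 qed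
 have nT': "(Hom T' (pos a b) (pos c d) ~= {}) \<longleftrightarrow> Hom (two_one :: 'k scat) (pos a b) (pos c d) ~= {} & \<not> (a = 2 & b = 1) & \<not> (c = 2 & d = 1)" for a b c d
  using hT' by blast
 have nT: "(Hom T (pos a b) (pos c d) ~= {}) \<longleftrightarrow> Hom T' (pos a b) (pos c d) ~= {} & \<not> (a = 1 & b = 1) & \<not> (c = 1 & d = 1)" for a b c d
  using hT by blast
 have e01: "(0::nat) \<le> 1" "(1::nat) \<le> 2" "(0::nat) \<le> 2" by auto
 have vL: "sfun (sub_square 0 1 *. i_ul :: 'k sfun) ul two_one" and vR: "sfun (sub_square 1 2 *. i_ul :: 'k sfun) ul two_one"
  and vO: "sfun (sub_square 0 2 *. i_ul :: 'k sfun) ul two_one"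
  using edge_obj(1)[OF inf] by auto
 have vLo: "Fobj (sub_square 0 1 *. i_ul :: 'k sfun) (pos 0 0) = pos 0 0" "Fobj (sub_square 0 1 *. i_ul :: 'k sfun) (pos 1 0) = pos 1 0" "Fobj (sub_square 0 1 *. i_ul :: 'k sfun) (pos 0 1) = pos 0 1"
  using edge_obj(2-4)[OF inf, of 0 1] by auto
 have vRo: "Fobj (sub_square 1 2 *. i_ul :: 'k sfun) (pos 0 0) = pos 1 0" "Fobj (sub_square 1 2 *. i_ul :: 'k sfun) (pos 1 0) = pos 2 0" "Fobj (sub_square 1 2 *. i_ul :: 'k sfun) (pos 0 1) = pos 1 1"
  using edge_obj(2-4)[OF inf, of 1 2] by auto
 have vOo: "Fobj (sub_square 0 2 *. i_ul :: 'k sfun) (pos 0 0) = pos 0 0" "Fobj (sub_square 0 2 *. i_ul :: 'k sfun) (pos 1 0) = pos 2 0" "Fobj (sub_square 0 2 *. i_ul :: 'k sfun) (pos 0 1) = pos 0 1"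
  using edge_obj(2-4)[OF inf, of 0 2] by auto
 note cor' = corestrict[where S = "- {pos 2 1}" and B = "two_one :: 'k scat", folded T'_def i'_def]
 note cor = corestrict[where S = "- {pos 1 1}" and B = T', folded T_def i_def]
 obtain l' where l': "sfun l' ul T'" "i' *. l' = sub_square 0 1 *. i_ul" "\<And>x. x : Obj ul ==> Fobj l' x = Fobj (sub_square 0 1 *. i_ul) x"
  by (rule that[OF cor'[OF vL]]) (use vLo in \<open>auto simp: ul_simps(1)\<close>)
 obtain r where r: "sfun r ul T'" "i' *. r = sub_square 1 2 *. i_ul" "\<And>x. x : Obj ul ==> Fobj r x = Fobj (sub_square 1 2 *. i_ul) x"
  by (rule that[OF cor'[OF vR]]) (use vRo in \<open>auto simp: ul_simps(1)\<close>)
 obtain o' where o': "sfun o' ul T'" "i' *. o' = sub_square 0 2 *. i_ul" "\<And>x. x : Obj ul ==> Fobj o' x = Fobj (sub_square 0 2 *. i_ul) x"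
  by (rule that[OF cor'[OF vO]]) (use vOo in \<open>auto simp: ul_simps(1)\<close>)
 obtain l where l: "sfun l ul T" "i *. l = l'" "\<And>x. x : Obj ul ==> Fobj l x = Fobj l' x"
  by (rule that[OF cor[OF l'(1)]]) (use l'(3) vLo in \<open>auto simp: ul_simps(1)\<close>)
 obtain oo where oo: "sfun oo ul T" "i *. oo = o'" "\<And>x. x : Obj ul ==> Fobj oo x = Fobj o' x"
  by (rule that[OF cor[OF o'(1)]]) (use o'(3) vOo in \<open>auto simp: ul_simps(1)\<close>)
 define Q' where "Q' = dob D i' Q"
 have Q': "Q' : dobj D T'" unfolding Q'_def using fobj[OF D_fun[OF P i'(1)] Q] .
 have tu: "sfun (to_one ul :: 'k sfun) ul one_cat" using s_one[OF inf U] .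
 have t': "sfun (to_one T') T' one_cat" using s_one[OF inf sT'] .
 have tT1: "sfun (to_one T) T one_cat" using s_one[OF inf sT] .
 have p11: "(pos 1 1 :: 'k uni) : Obj T'" "(pos 2 1 :: 'k uni) : Obj two_one" by (auto simp: oT' oB)
 have p21: "sfun (pt two_one (pos 2 1) :: 'k sfun) one_cat two_one" using sfun_pt[OF inf B p11(2)] .
 have tof: "to_one T' *. i = to_one T" "to_one T' *. r = to_one ul" "to_one T *. oo = to_one ul" "to_one T *. l = to_one ul"
  using to_one_unique sfun_comp i(1) r(1) oo(1) l(1) t' tT1 by metis+

 (* The left square shows that Q restricted to T' is a left Kan extension from T. *)
 have univ_i: "univ (dfun D i) (dob D i Q') Q' (Id (dcat D T) (dob D i Q'))"
 proof (rule univ_pointwise[OF inf D i(1) _ Q'])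
  show "Id (dcat D T) (dob D i Q') : dhom D T (dob D i Q') (dob D i Q')"
   using cat_id[OF D_cat[OF P sT] fobj[OF D_fun[OF P i(1)] Q']] .
  fix b assume b: "b : Obj T'"
  show "\<exists>k J \<kappa>. final_cocone i T T' b k J \<kappa> & univ (dfun D (to_one J)) (dob D k (dob D i Q')) (dob D (pt T' b) Q')
   (restr D J k \<kappa> Q' (Id (dcat D T) (dob D i Q')))"
  proof (cases "b = pos 1 1")
   case False
   then have bT: "b : Obj T" using b oT by simp
   have ib: "Fobj i b = b" using i(2) False b by simp
   have "\<exists>!g. g : Hom T x b & Farr i g = f" if "x : Obj T" "f : Hom T' (Fobj i x) (Fobj i b)" for x f
    using that i(2)[of x] i(3)[of _ x b] ib False oT[of x] hT[of _ x b] by auto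
   from final_cocone_pt[OF inf i(1) bT this] have c: "final_cocone i T T' b (pt T b) one_cat (idN (pt T' b))" using ib by simp
   then have "cocone i T T' b (pt T b) one_cat (idN (pt T' b))" by (simp add: final_cocone_def)
   from c restr_id_pt_univ[OF inf P this Q'] show ?thesis by blast
  next
   case True
   have p: "sfun (pt T' b) one_cat T'" using sfun_pt[OF inf sT' b] .
   have ll: "Fobj (i *. l) x = Fobj (sub_square 0 1 *. i_ul) x" if "x : Obj ul" for x using l(2) l'(3)[OF that] by simp
   have "\<exists>\<kappa>. ncell \<kappa> (i *. l) (pt T' b *. to_one ul) ul T'"
   proof (rule ncell_thin_exists[OF tT' sfun_comp[OF l(1) i(1)] sfun_comp[OF tu p]])
    fix x :: "'k uni" assume x: "x : Obj ul"
    show "Hom T' (Fobj (i *. l) x) (Fobj (pt T' b *. to_one ul) x) ~= {}"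
     using x[unfolded ul_simps(1)] ll[OF x] vLo pt_to_one_simps(1)[OF x, of T' "pos 1 1"] unfolding True
     by (elim disjE) (simp_all add: x nT' Hom_two_one_pos)
   qed
   then obtain \<kappa> where k: "ncell \<kappa> (i *. l) (pt T' b *. to_one ul) ul T'" by blast
   have c: "cocone i T T' b l ul \<kappa>" unfolding cocone_def using i(1) b l(1) tu p k by simp
   have fc: "final_cocone i T T' b l ul \<kappa>"
   proof (rule final_cocone_thin[OF c tT tT' tU])
    fix x assume x: "x : Obj T" and ne: "Hom T' (Fobj i x) b ~= {}"
    have ix: "Fobj i x = x" using i(2) x oT by simp
    have x': "x = pos 0 0 \<or> x = pos 1 0 \<or> x = pos 0 1"
     using x[unfolded oT oT' oB] ne[unfolded ix True] by (elim conjE disjE) (simp_all add: nT' Hom_two_one_pos)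
    have lo: "Fobj l (pos 0 0) = pos 0 0" "Fobj l (pos 1 0) = pos 1 0" "Fobj l (pos 0 1) = pos 0 1"
     using l(3) l'(3) vLo by (auto simp: ul_simps)
    show "\<exists>j\<in>Obj ul. Hom T x (Fobj l j) ~= {} & (\<forall>j'\<in>Obj ul. Hom T x (Fobj l j') ~= {} \<longrightarrow> Hom ul j j' ~= {})"
     using x' by (elim disjE; intro bexI[of _ x]) (simp_all add: lo ball_ul ul_simps(1) nT nT' Hom_two_one_pos Hom_ul_pos)
   qed
   have 1: "dob D l (dob D i Q') = dob D (sub_square 0 1 *. i_ul) Q"
    using D_cob[OF P l(1) i(1) Q'] D_cob[OF P l'(1) i'(1) Q] l(2) l'(2) Q'_def by simp
   have ib: "Fobj i' b = pos 1 1" using i'(2) b oT' True by simp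
   have 2: "dob D (pt T' b) Q' = dob D (pt two_one (pos 1 1)) Q"
    using D_cob[OF P p i'(1) Q] pt_comp[OF inf i'(1) b] ib Q'_def by simp
   have s: "i' *. (i *. l) = sub_square 0 1 *. i_ul" using l(2) l'(2) by simp
   have t: "i' *. (pt T' b *. to_one ul) = pt two_one (pos 1 1) *. to_one ul"
    using compF_assoc[of "to_one ul" "pt T' b" i'] sfunD[OF tu] sfunD[OF p] sfunD[OF i'(1)] pt_comp[OF inf i'(1) b] ib by simp
   have "i' *L \<kappa> = edge_cocone 0 1"
    using ncell_thin_eq[OF tB ncell_whiskL[OF k i'(1), unfolded s t] edge_cocone[OF inf e01(1,2)]] .
   then have "dnt D \<kappa> Q' = dnt D (edge_cocone 0 1) Q"
    using D_whiskL[OF P k i'(1) Q] Q'_def by simp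
   then have "univ (dfun D (to_one ul)) (dob D l (dob D i Q')) (dob D (pt T' b) Q')
    (restr D ul l \<kappa> Q' (Id (dcat D T) (dob D i Q')))"
    unfolding restr_id[OF P c Q'] 1 2 using L by simp
   then show ?thesis using fc by blast
  qed
 qed

 define Y where "Y = dob D (pt two_one (pos 2 1)) Q"
 have Y: "Y : dobj D one_cat" unfolding Y_def using fobj[OF D_fun[OF P p21] Q] .
 have o1: "small_cat (one_cat :: 'k scat)" by (rule small_ord[OF inf])
 have pi: "pt one_cat (Num 0) = (idF one_cat :: 'k sfun)"
  using to_one_unique[OF sfun_pt[OF inf o1, of "Num 0"]] to_one_unique[OF sfun_id[OF o1]] by simp
 have pY: "dob D (pt one_cat (Num 0)) Y = Y" using pi D_idF[OF P o1] Y by simp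
 have p0: "sfun (pt one_cat (Num 0) :: 'k sfun) one_cat one_cat" using pi sfun_id[OF o1] by simp
 have pt0: "pt one_cat (Num 0) *. to_one ul = (to_one ul :: 'k sfun)" using to_one_unique[OF sfun_comp[OF tu p0]] .
 have "\<exists>\<tau>. ncell \<tau> i' (pt two_one (pos 2 1) *. to_one T') T' two_one"
 proof (rule ncell_thin_exists[OF tB i'(1) sfun_comp[OF t' p21]])
  fix x assume x: "x : Obj T'"
  then have "Fobj i' x = x" using i'(2) oT' by simp
  then show "Hom two_one (Fobj i' x) (Fobj (pt two_one (pos 2 1) *. to_one T') x) ~= {}"
   using x[unfolded oT' oB] pt_to_one_simps(1)[OF x] by (elim conjE disjE) (simp_all add: Hom_two_one_pos)
 qed
 then obtain \<tau> where \<tau>: "ncell \<tau> i' (pt two_one (pos 2 1) *. to_one T') T' two_one" by blast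
 define g where "g = dnt D \<tau> Q"
 have g: "g : dhom D T' Q' (dob D (to_one T') Y)"
  unfolding g_def Q'_def Y_def using D_nat_hom[OF P \<tau> Q] D_cob[OF P t' p21 Q] by simp

 (* For a cocone under a category K with vertex Y, restriction along m amounts to whiskering. *)
 have restr_m: "restr D ul m (idN (to_one ul)) Y f = dar D m f"
  if m: "sfun m ul K" and tK: "to_one K *. m = to_one ul" "sfun (to_one K) K one_cat" and f: "f : dhom D K X (dob D (to_one K) Y)" for m K f X
 proof -
  have "dar D m f : dhom D ul (dob D m X) (dob D (to_one ul) Y)"
   using fhom[OF D_fun[OF P m] f] D_cob[OF P m tK(2) Y] tK(1) by simp
  then show ?thesis unfolding restr_def D_idN[OF P tu Y] using cat_idl[OF D_cat[OF P U]] by blast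
 qed
 have cK: "cocone (to_one K) K one_cat (Num 0) m ul (idN (to_one ul))"
  if m: "sfun m ul K" and tK: "to_one K *. m = to_one ul" "sfun (to_one K) K one_cat" for m :: "'k sfun" and K
  unfolding cocone_def using m tK tu p0 pt0 ncell_id[OF tu] by simp

 (* The right square: Y is the colimit over T'. *)
 have univ_g: "univ (dfun D (to_one T')) Q' Y g"
 proof (rule univ_pointwise[OF inf D t' g Y])
  fix b :: "'k uni" assume "b : Obj one_cat"
  then have b: "b = Num 0" by simp
  note c = cK[OF r(1) tof(2) t']
  have ro: "Fobj r (pos 0 0) = pos 1 0" "Fobj r (pos 1 0) = pos 2 0" "Fobj r (pos 0 1) = pos 1 1"
   using r(3) vRo by (auto simp: ul_simps)
  have fc: "final_cocone (to_one T') T' one_cat (Num 0) r ul (idN (to_one ul))"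
  proof (rule final_cocone_thin[OF c tT' thin_ord tU])
   fix x assume "x : Obj T'"
   then have x: "x = pos 0 0 \<or> x = pos 1 0 \<or> x = pos 2 0 \<or> x = pos 0 1 \<or> x = pos 1 1" unfolding oT' oB by auto
   let ?j = "if x = pos 2 0 then pos 1 0 else if x = pos 0 1 \<or> x = pos 1 1 then pos 0 1 else pos 0 0"
   show "\<exists>j\<in>Obj ul. Hom T' x (Fobj r j) ~= {} & (\<forall>j'\<in>Obj ul. Hom T' x (Fobj r j') ~= {} \<longrightarrow> Hom ul j j' ~= {})"
    using x by (elim disjE; intro bexI[of _ ?j]) (simp_all add: ro ball_ul ul_simps(1) nT' Hom_two_one_pos Hom_ul_pos)
  qed
  have s: "(pt two_one (pos 2 1) *. to_one T') *. r = pt two_one (pos 2 1) *. to_one ul"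
   using compF_assoc[of r "to_one T'" "pt two_one (pos 2 1)"] sfunD[OF r(1)] sfunD[OF t'] sfunD[OF p21] tof(2) by simp
  have "\<tau> *R r = edge_cocone 1 2"
   using ncell_thin_eq[OF tB ncell_whiskR[OF \<tau> r(1), unfolded s r(2)] edge_cocone[OF inf e01(2) order_refl]] .
  then have "dar D r g = dnt D (edge_cocone 1 2) Q" using D_whiskR[OF P \<tau> r(1) Q] g_def by simp
  moreover have "dob D r Q' = dob D (sub_square 1 2 *. i_ul) Q"
   using D_cob[OF P r(1) i'(1) Q] r(2) Q'_def by simp
  ultimately have "univ (dfun D (to_one ul)) (dob D r Q') (dob D (pt one_cat b) Y) (restr D ul r (idN (to_one ul)) Y g)"
   using R pY restr_m[OF r(1) tof(2) t' g] unfolding b Y_def by simp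
  then show "\<exists>k J \<kappa>. final_cocone (to_one T') T' one_cat b k J \<kappa> &
   univ (dfun D (to_one J)) (dob D k Q') (dob D (pt one_cat b) Y) (restr D J k \<kappa> Y g)"
   using fc unfolding b by blast
 qed

 (* Hence Y is the colimit over T, in which the corner of the outer square is final. *)
 have ig: "dar D i g : dhom D T (dob D i Q') (dob D (to_one T) Y)"
  using fhom[OF D_fun[OF P i(1)] g] D_cob[OF P i(1) t' Y] tof(1) by simp
 have "univ (dfun D (to_one T)) (dob D i Q') Y (dar D i g)"
  using univ_comp_iff[OF D_fun[OF P i(1)] univ_i D_fun[OF P t'] Y g] univ_g D_compF[OF P i(1) t'] tof(1)
   cat_idr[OF D_cat[OF P sT] ig] by simp
 note cO = cK[OF oo(1) tof(3) tT1]
 have oo': "Fobj oo (pos 0 0) = pos 0 0" "Fobj oo (pos 1 0) = pos 2 0" "Fobj oo (pos 0 1) = pos 0 1"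
  using oo(3) o'(3) vOo by (auto simp: ul_simps)
 have "final_cocone (to_one T) T one_cat (Num 0) oo ul (idN (to_one ul))"
 proof (rule final_cocone_thin[OF cO tT thin_ord tU])
  fix x assume "x : Obj T"
  then have x: "x = pos 0 0 \<or> x = pos 1 0 \<or> x = pos 2 0 \<or> x = pos 0 1" unfolding oT oT' oB by auto
  let ?j = "if x = pos 2 0 \<or> x = pos 1 0 then pos 1 0 else x"
  show "\<exists>j\<in>Obj ul. Hom T x (Fobj oo j) ~= {} & (\<forall>j'\<in>Obj ul. Hom T x (Fobj oo j') ~= {} \<longrightarrow> Hom ul j j' ~= {})"
   using x by (elim disjE; intro bexI[of _ ?j]) (simp_all add: oo' ball_ul ul_simps(1) nT nT' Hom_two_one_pos Hom_ul_pos)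
 qed
 from univ_restr[OF inf D this \<open>univ (dfun D (to_one T)) (dob D i Q') Y (dar D i g)\<close>]
 have u: "univ (dfun D (to_one ul)) (dob D oo (dob D i Q')) Y (dar D oo (dar D i g))"
  using pY restr_m[OF oo(1) tof(3) tT1 ig] by simp
 have s: "(pt two_one (pos 2 1) *. to_one T') *. o' = pt two_one (pos 2 1) *. to_one ul"
  using compF_assoc[of o' "to_one T'" "pt two_one (pos 2 1)"] sfunD[OF o'(1)] sfunD[OF t'] sfunD[OF p21]
   to_one_unique[OF sfun_comp[OF o'(1) t']] by simp
 have "\<tau> *R o' = edge_cocone 0 2"
  using ncell_thin_eq[OF tB ncell_whiskR[OF \<tau> o'(1), unfolded s o'(2)] edge_cocone[OF inf e01(3) order_refl]] .
 then have "dar D oo (dar D i g) = dnt D (edge_cocone 0 2) Q"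
  using D_whiskR[OF P \<tau> o'(1) Q] g_def D_car[OF P oo(1) i(1) g] oo(2) by simp
 moreover have "dob D oo (dob D i Q') = dob D (sub_square 0 2 *. i_ul) Q"
  using D_cob[OF P oo(1) i(1) Q'] D_cob[OF P o'(1) i'(1) Q] oo(2) o'(2) Q'_def by simp
 ultimately show ?thesis using u unfolding Y_def by simp
qed

section \<open>Cocartesian squares and the invertibility of the comparison maps\<close>

text \<open>A square with parameters in \<open>A\<close> is a left Kan extension from its corner iff it is a pushout at each \<open>a\<close>. Only the vertex
\<open>(1,1)\<close> carries a condition since the inclusion is a sieve elsewhere.\<close>

lemma univ_id_square_iff:
 fixes D :: "('k, 'o, 'm) derivator" and A :: "'k scat"
 assumes inf: "infinite (UNIV :: 'k set)" and D: "left_derivator D" and A: "small_cat A"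
  and X: "X : dobj D (A >< square)"
 shows "univ (dfun D (A ** i_ul)) (dob D (A ** i_ul) X) X
   (Id (dcat D (A >< ul)) (dob D (A ** i_ul) X)) \<longleftrightarrow>
  (\<forall>a\<in>Obj A. univ (dfun D (to_one ul)) (dob D (at_left A ul a) (dob D (A ** i_ul) X))
   (dob D (pt (A >< square) (Tup a (pos 1 1))) X) (dnt D (corner_cocone A a) X))"
  (is "univ (dfun D ?s) _ X ?id \<longleftrightarrow> (\<forall>a\<in>Obj A. ?U a)")
proof
 note P = lderD(1)[OF D]
 note s = sfun_prod(1)[OF inf A sfun_i_ul(1)[OF inf]]
 note sX = fobj[OF D_fun[OF P s] X] and S = prod_simps
 have co: "cocone ?s (A >< ul) (A >< square) (Tup a (pos 1 1)) (at_left A ul a) ul (corner_cocone A a)" if "a : Obj A" for a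
  using final_corner[OF inf A that] by (simp add: final_cocone_def)
 { assume u: "univ (dfun D ?s) (dob D ?s X) X ?id"
  show "\<forall>a\<in>Obj A. ?U a"
   using univ_restr[OF inf D final_corner[OF inf A] u] restr_id[OF P co X] by simp }
 assume U: "\<forall>a\<in>Obj A. ?U a"
 show "univ (dfun D ?s) (dob D ?s X) X ?id"
 proof (rule univ_pointwise[OF inf D s _ X])
  show "?id : dhom D (A >< ul) (dob D ?s X) (dob D ?s X)"
   using cat_id[OF funD(5)[OF D_fun[OF P s]] sX] .
  fix b assume "b : Obj (A >< square)"
  then obtain a p where b: "b = Tup a p" "a : Obj A" "p : Obj square" by (auto simp: S)
  show "\<exists>k J \<kappa>. final_cocone ?s (A >< ul) (A >< square) b k J \<kappa> &
   univ (dfun D (to_one J)) (dob D k (dob D ?s X)) (dob D (pt (A >< square) b) X) (restr D J k \<kappa> X ?id)"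
  proof (cases "p = pos 1 1")
   case True
   then show ?thesis using final_corner[OF inf A b(2)] U b restr_id[OF P co[OF b(2)] X] by fastforce
  next
   case False
   then have p: "p : Obj ul" using b(3) by (auto simp: ul_simps square_simps)
   note fc = final_off_corner[OF inf A b(2) p]
   have "cocone ?s (A >< ul) (A >< square) (Tup a p) (pt (A >< ul) (Tup a p)) one_cat (idN (pt (A >< square) (Tup a p)))"
    using fc by (simp add: final_cocone_def)
   from fc restr_id_pt_univ[OF inf P this X] show ?thesis unfolding b(1) by blast
  qed
 qed
qed

text \<open>The counit is invertible on the essential image of the fully faithful \<open>(A \<times> i_ul)\<^sub>!\<close>.\<close>

lemma cocartesian_shift_univ:
 fixes D :: "('k, 'o, 'm) derivator" and A :: "'k scat"
 assumes inf: "infinite (UNIV :: 'k set)" and D: "left_derivator D" and A: "small_cat A"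
  and c: "cocartesian (shift D A) X"
 shows "X : dobj D (A >< square)"
  "univ (dfun D (A ** i_ul)) (dob D (A ** i_ul) X) X
   (Id (dcat D (A >< ul)) (dob D (A ** i_ul) X))"
proof -
 let ?s = "A ** i_ul"
 note P = lderD(1)[OF D]
 note s = sfun_prod(1)[OF inf A sfun_i_ul(1)[OF inf]] and S = prod_simps
 note L = lan_adj[OF lderD(4)[OF D] P s] and ds = D_fun[OF P s]
 note ss = sfunD[OF s]
 obtain Y g where X: "X : dobj D (A >< square)" and Y: "Y : dobj D (A >< ul)"
  and g: "g : dhom D (A >< square) (Fobj (lan D ?s) Y) X" "iso_arr (dcat D (A >< square)) g"
  using c unfolding cocartesian_def iso_objs_def by (auto simp: shift_def)
 show "X : dobj D (A >< square)" by (rule X)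
 let ?f = "dar D ?s g *[dcat D (A >< ul)] Ncomp (lan_unit D ?s) Y"
 have u: "univ (dfun D ?s) Y X ?f" using univ_postcomp_iso[OF ds adj_univ[OF L Y] g] .
 note f = univD(2)[OF ds u] and sX = fobj[OF ds X]
 have i: "iso_arr (dcat D (A >< ul)) ?f"
 proof (rule Der2_iso[OF lderD(3)[OF D] ss(4) f])
  fix b assume b: "b : Obj (A >< ul)"
  then obtain a p where b': "b = Tup a p" "a : Obj A" "p : Obj ul" by (auto simp: S)
  note fc = final_off_corner[OF inf A b'(2,3)]
  have "cocone ?s (A >< ul) (A >< square) (Tup a p) (pt (A >< ul) (Tup a p)) one_cat (idN (pt (A >< square) (Tup a p)))"
   using fc by (simp add: final_cocone_def)
  note C = coconeD[OF this]
  let ?b = "Tup a p"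
  note U = univ_restr[OF inf D fc u]
  have e: "dob D (pt (A >< ul) ?b) (dob D ?s X) = dob D (pt (A >< square) ?b) X"
   using D_cob[OF P C(3,1) X] ncellD(2)[OF C(4)] by simp
  note bf = fhom[OF D_fun[OF P C(3)] f, unfolded e]
  have "restr D one_cat (pt (A >< ul) ?b) (idN (pt (A >< square) ?b)) X ?f = dar D (pt (A >< ul) ?b) ?f"
   unfolding restr_def D_idN[OF P C(6) X] using cat_idl[OF D_cat[OF P small_ord[OF inf]] bf] .
  then show "iso_arr (dcat D one_cat) (dar D (pt (A >< ul) b) ?f)"
   using U univ_one_iff(1)[OF inf P bf] unfolding b'(1) by simp
 qed
 note C = funD(5)[OF ds]
 show "univ (dfun D ?s) (dob D ?s X) X (Id (dcat D (A >< ul)) (dob D ?s X))"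
  using univ_precomp_iso[OF ds u inv_arr(1)[OF C f i] inv_arr(4)[OF C f i]] inv_arr(3)[OF C f i] by simp
qed

text \<open>Restricting first to a square and then to its corner at \<open>a\<close>, or first to \<open>a\<close> and then along an edge, amounts to the
same. This moves the pasting problem to a single diagram of shape \<open>[2] \<times> [1]\<close>.\<close>

lemma corner_edge:
 fixes D :: "('k, 'o, 'm) derivator" and A :: "'k scat"
 assumes inf: "infinite (UNIV :: 'k set)" and P: "is_prederivator D" and A: "small_cat A" and a: "a : Obj A"
  and xy: "x \<le> y" "y \<le> 2" and Q: "Q : dobj D (A >< two_one)"
 defines "Qa \<equiv> dob D (at_left A two_one a) Q" and "S \<equiv> dob D (A ** sub_square x y) Q"
 shows "S : dobj D (A >< square)" "Qa : dobj D two_one"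
  "dob D (at_left A ul a) (dob D (A ** i_ul) S) = dob D (sub_square x y *. i_ul) Qa"
  "dob D (pt (A >< square) (Tup a (pos 1 1))) S = dob D (pt two_one (pos y 1)) Qa"
  "dnt D (corner_cocone A a) S = dnt D (edge_cocone x y) Qa"
proof -
 note sq = small_square[OF inf] and B = small_two_one[OF inf] and U = small_ul[OF inf]
 have cA: "category A" using A by (simp add: small_cat_def)
 note ia = cat_id[OF cA a] and SS = prod_simps
 note sub = sfun_sub_square[OF inf xy] and iu = sfun_i_ul[OF inf]
 note As = sfun_prod[OF inf A sub(1)] and Au = sfun_prod[OF inf A iu(1)]
 note aB = sfun_at_left[OF inf A B a] and au = sfun_at_left[OF inf A U a]
 note v = sfun_comp[OF iu(1) sub(1)]
 show S: "S : dobj D (A >< square)" unfolding S_def using fobj[OF D_fun[OF P As(1)] Q] .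
 show Qa: "Qa : dobj D two_one" unfolding Qa_def using fobj[OF D_fun[OF P aB(1)] Q] .
 have uo: "x : Obj ul ==> x : Obj square" for x :: "'k uni" by (auto simp: ul_simps square_simps)
 have uh: "h : Hom ul i j ==> h : Hom square i j" for h i j :: "'k uni" by (auto simp: ul_simps)
 note l1 = sfun_comp[OF au(1) Au(1)]
 note l2 = sfun_comp[OF l1 As(1)]
 have e1: "(A ** sub_square x y) *. ((A ** i_ul) *. at_left A ul a) = at_left A two_one a *. (sub_square x y *. i_ul)"
 proof (rule sfun_eqI[OF l2 sfun_comp[OF v aB(1)]])
  fix j :: "'k uni" assume j: "j : Obj ul"
  show "Fobj ((A ** sub_square x y) *. ((A ** i_ul) *. at_left A ul a)) j = Fobj (at_left A two_one a *. (sub_square x y *. i_ul)) j"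
   using j fobj[OF sfunD(6)[OF sub(1)] uo[OF j]] aB(2) au(2)[OF j] As(2)[OF a uo[OF j]] Au(2)[OF a j] iu(2)[OF j]
   by (simp add: compF_obj[OF sfunD(6)[OF l1]] compF_obj[OF sfunD(6)[OF au(1)]] compF_obj[OF sfunD(6)[OF v]] compF_obj[OF sfunD(6)[OF iu(1)]])
 next
  fix h i j :: "'k uni" assume h: "h : Hom ul i j"
  note h1 = fhom[OF sfunD(6)[OF sub(1)] uh[OF h]]
  show "Farr ((A ** sub_square x y) *. ((A ** i_ul) *. at_left A ul a)) h = Farr (at_left A two_one a *. (sub_square x y *. i_ul)) h"
   using aB(3)[OF h1] au(3)[OF h] As(3)[OF ia uh[OF h]] Au(3)[OF ia h] iu(3)[OF h]
   by (simp add: compF_arr[OF sfunD(6)[OF l1] h] compF_arr[OF sfunD(6)[OF au(1)] h] compF_arr[OF sfunD(6)[OF v] h] compF_arr[OF sfunD(6)[OF iu(1)] h])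
 qed
 have c11: "(pos 1 1 :: 'k uni) : Obj square" by (simp add: square_simps)
 have b: "Tup a (pos 1 1) : Obj (A >< square)" using a c11 by (simp add: SS)
 have y1: "(pos y 1 :: 'k uni) : Obj two_one" using xy by (simp add: two_one_simps)
 have so: "Fobj (sub_square x y) (pos 1 1) = (pos y 1 :: 'k uni)" using sub(2)[of 1 1] by simp
 note pA = sfun_pt[OF inf sfunD(4)[OF As(1)] b] and pB = sfun_pt[OF inf B y1] and tu = s_one[OF inf U]
 have e2: "(A ** sub_square x y) *. pt (A >< square) (Tup a (pos 1 1)) = at_left A two_one a *. pt two_one (pos y 1)"
  using pt_comp[OF inf As(1) b] pt_comp[OF inf aB(1) y1] As(2)[OF a c11] so aB(2)[OF y1] by simp
 have e3: "(A ** sub_square x y) *. (pt (A >< square) (Tup a (pos 1 1)) *. to_one ul) = at_left A two_one a *. (pt two_one (pos y 1) *. to_one ul)"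
  using compF_assoc[of "to_one ul" "pt (A >< square) (Tup a (pos 1 1))" "A ** sub_square x y"]
   compF_assoc[of "to_one ul" "pt two_one (pos y 1)" "at_left A two_one a"] e2
   sfunD[OF tu] sfunD[OF pA] sfunD[OF pB] sfunD[OF As(1)] sfunD[OF aB(1)] by simp
 show "dob D (at_left A ul a) (dob D (A ** i_ul) S) = dob D (sub_square x y *. i_ul) Qa"
  using D_cob[OF P au(1) Au(1) S] D_cob[OF P l1 As(1) Q] D_cob[OF P v aB(1) Q] e1 S_def Qa_def by simp
 show "dob D (pt (A >< square) (Tup a (pos 1 1))) S = dob D (pt two_one (pos y 1)) Qa"
  using D_cob[OF P pA As(1) Q] D_cob[OF P pB aB(1) Q] e2 S_def Qa_def by simp
 have co: "ncell (corner_cocone A a) ((A ** i_ul) *. at_left A ul a) (pt (A >< square) (Tup a (pos 1 1)) *. to_one ul) ul (A >< square)"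
  using final_corner[OF inf A a] by (simp add: final_cocone_def cocone_def)
 note ed = edge_cocone[OF inf xy]
 have "(A ** sub_square x y) *L corner_cocone A a = at_left A two_one a *L edge_cocone x y"
 proof (rule ncell_eqI[OF ncell_whiskL[OF co As(1), unfolded e1 e3] ncell_whiskL[OF ed aB(1)]])
  fix j :: "'k uni" assume j: "j : Obj ul"
  have tc: "to_corner j : Hom square j (pos 1 1)"
   using j by (auto simp: ul_simps square_simps to_corner_def)
  have 1: "Ncomp (corner_cocone A a) j = Tup (Id A a) (to_corner j)"
   using j sfunD(2)[OF l1] by (simp add: corner_cocone_def)
  have ej: "Ncomp (edge_cocone x y) j : Hom two_one (Fobj (sub_square x y) j) (pos y 1)"
   using ncellD(7)[OF ed j] j iu(2)[OF j] by (simp add: compF_obj[OF sfunD(6)[OF iu(1)] j])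
  have 2: "Farr (sub_square x y) (to_corner j) = Ncomp (edge_cocone x y) j"
   using thinD[OF thin_two_one sub(3)[OF tc]] ej so by simp
  show "Ncomp ((A ** sub_square x y) *L corner_cocone A a) j = Ncomp (at_left A two_one a *L edge_cocone x y) j"
   using j 1 2 As(3)[OF ia tc] aB(3)[OF ej] ncellD(2)[OF co] ncellD(2)[OF ed] sfunD(2)[OF l1] sfunD(2)[OF v] by simp
 qed
 then show "dnt D (corner_cocone A a) S = dnt D (edge_cocone x y) Qa"
  using D_whiskL[OF P co As(1) Q] D_whiskL[OF P ed aB(1) Q] S_def Qa_def by simp
qed

text \<open>The composite of adjacent cocartesian squares, obtained from \<open>pushout_pasting\<close> at each \<open>a\<close>.\<close>

lemma outer_square_univ:
 fixes D :: "('k, 'o, 'm) derivator" and A :: "'k scat"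
 assumes inf: "infinite (UNIV :: 'k set)" and D: "left_derivator D" and A: "small_cat A"
  and Q: "Q : dobj D (A >< two_one)"
  and c1: "cocartesian (shift D A) (dob D (A ** sub_square 0 1) Q)"
  and c2: "cocartesian (shift D A) (dob D (A ** sub_square 1 2) Q)"
 defines "S \<equiv> dob D (A ** sub_square 0 2) Q"
 shows "univ (dfun D (A ** i_ul)) (dob D (A ** i_ul) S) S
   (Id (dcat D (A >< ul)) (dob D (A ** i_ul) S))"
proof -
 note P = lderD(1)[OF D]
 have le: "(0::nat) \<le> 1" "(1::nat) \<le> 2" "(0::nat) \<le> 2" "(2::nat) \<le> 2" by auto
 note u1 = cocartesian_shift_univ[OF inf D A c1] and u2 = cocartesian_shift_univ[OF inf D A c2]
 show ?thesis
 proof (cases "Obj A = {}")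
  case True
  have "S : dobj D (A >< square)"
   unfolding S_def using fobj[OF D_fun[OF P sfun_prod(1)[OF inf A sfun_sub_square(1)[OF inf le(3,4)]]] Q] .
  then show ?thesis using univ_id_square_iff[OF inf D A] True by simp
 next
  case False
  then obtain a0 where a0: "a0 : Obj A" by blast
  note S = corner_edge(1)[OF inf P A a0 le(3,4) Q, folded S_def]
  show ?thesis unfolding univ_id_square_iff[OF inf D A S]
  proof
   fix a assume a: "a : Obj A"
   note e1 = corner_edge[OF inf P A a le(1,2) Q] and e2 = corner_edge[OF inf P A a le(2,4) Q]
    and e3 = corner_edge[OF inf P A a le(3,4) Q, folded S_def]
   have 1: "univ (dfun D (to_one ul)) (dob D (sub_square 0 1 *. i_ul) (dob D (at_left A two_one a) Q))
     (dob D (pt two_one (pos 1 1)) (dob D (at_left A two_one a) Q)) (dnt D (edge_cocone 0 1) (dob D (at_left A two_one a) Q))"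
    using u1(2) a unfolding univ_id_square_iff[OF inf D A u1(1)] e1(3-5)[symmetric] by blast
   have 2: "univ (dfun D (to_one ul)) (dob D (sub_square 1 2 *. i_ul) (dob D (at_left A two_one a) Q))
     (dob D (pt two_one (pos 2 1)) (dob D (at_left A two_one a) Q)) (dnt D (edge_cocone 1 2) (dob D (at_left A two_one a) Q))"
    using u2(2) a unfolding univ_id_square_iff[OF inf D A u2(1)] e2(3-5)[symmetric] by blast
   show "univ (dfun D (to_one ul)) (dob D (at_left A ul a) (dob D (A ** i_ul) S))
     (dob D (pt (A >< square) (Tup a (pos 1 1))) S) (dnt D (corner_cocone A a) S)"
    unfolding e3(3-5) using pushout_pasting[OF inf D e3(2) 1 2] .
  qed
 qed
qed

text \<open>Restriction functors preserve terminal objects since they have left adjoints.\<close>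

lemma terminal_restrict:
 fixes D :: "('k, 'o, 'm) derivator"
 assumes D: "is_derivator D" and v: "sfun v A B" and t: "terminal_obj (dcat D B) Z"
 shows "terminal_obj (dcat D A) (dob D v Z)"
proof -
 note P = derD(1)[OF D]
 note dv = D_fun[OF P v] and L = lan_adj[OF derD(4)[OF D] P v]
 have Z: "Z : dobj D B" and uq: "\<And>x. x : dobj D B ==> \<exists>!f. f : dhom D B x Z"
  using t by (auto simp: terminal_obj_def)
 show ?thesis unfolding terminal_obj_def
 proof (intro conjI ballI)
  show "dob D v Z : dobj D A" using fobj[OF dv Z] .
  fix W assume W: "W : dobj D A"
  note u = adj_univ[OF L W]
  note uu = univD[OF dv u]
  obtain h where h: "h : dhom D B (Fobj (lan D v) W) Z" using uq[OF uu(1)] by blast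
  have "dar D v h *[dcat D A] Ncomp (lan_unit D v) W : dhom D A W (dob D v Z)"
   using cat_comp[OF funD(5)[OF dv] fhom[OF dv h] uu(2)] .
  moreover have "f = dar D v h *[dcat D A] Ncomp (lan_unit D v) W" if "f : dhom D A W (dob D v Z)" for f
   using uu(4)[OF that Z] h uq[OF uu(1)] by blast
  ultimately show "\<exists>!f. f : dhom D A W (dob D v Z)" by blast
 qed
qed

text \<open>At \<open>p0\<close> nothing changes, and at the other objects the value of a Kan extension along an empty slice is initial.\<close>

lemma lan_counit_iso:
 fixes D :: "('k, 'o, 'm) derivator" and A P :: "'k scat"
 assumes inf: "infinite (UNIV :: 'k set)" and D: "left_derivator D" and A: "small_cat A" and P: "small_cat P" and p0: "p0 : Obj P"
  and src: "\<And>p h. h : Hom P p0 p ==> p = p0 & h = Id P p0"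
  and Y: "Y : dobj D (A >< P)"
  and ini: "\<And>a p. a : Obj A ==> p : Obj P ==> p ~= p0 ==> initial_obj (dcat D one_cat) (dob D (pt (A >< P) (Tup a p)) Y)"
 shows "iso_arr (dcat D (A >< P)) (Ncomp (lan_counit D (A ** pt P p0)) Y)"
proof -
 let ?t = "A ** pt P p0" and ?AP = "A >< P" and ?A1 = "A >< one_cat"
 note PD = lderD(1)[OF D] and fp = final_point[OF inf A P p0 src]
 note tt = sfun_prod(1)[OF inf A sfun_pt[OF inf P p0]]
 note dt = D_fun[OF PD tt] and L = lan_adj[OF lderD(4)[OF D] PD tt]
 note tY = fobj[OF dt Y] and AP = sfunD(5)[OF tt]
 let ?id = "Id (dcat D ?A1) (dob D ?t Y)"
 note ih = cat_id[OF funD(5)[OF dt] tY]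
 have "univ (dfun D ?t) (dob D ?t Y) Y ?id"
 proof (rule univ_pointwise[OF inf D tt ih Y])
  fix b assume bo: "b : Obj ?AP"
  then obtain a p where b: "b = Tup a p" "a : Obj A" "p : Obj P" by (auto simp: prod_simps)
  note pb = sfun_pt[OF inf AP bo]
  note bY = fobj[OF D_fun[OF PD pb] Y]
  show "\<exists>k J \<kappa>. final_cocone ?t ?A1 ?AP b k J \<kappa> &
   univ (dfun D (to_one J)) (dob D k (dob D ?t Y)) (dob D (pt ?AP b) Y) (restr D J k \<kappa> Y ?id)"
  proof (cases "p = p0")
   case True
   note fc = fp(1)[OF _ b(2)]
   have c: "cocone ?t ?A1 ?AP b (pt ?A1 (Tup a (Num 0))) one_cat (idN (pt ?AP b))"
    using fc b True by (simp add: final_cocone_def)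
   note C = coconeD[OF c]
   have e: "dob D (pt ?A1 (Tup a (Num 0))) (dob D ?t Y) = dob D (pt ?AP b) Y"
    using D_cob[OF PD C(3,1) Y] ncellD(2)[OF C(4)] by simp
   have "univ (dfun D (to_one one_cat)) (dob D (pt ?A1 (Tup a (Num 0))) (dob D ?t Y)) (dob D (pt ?AP b) Y)
    (restr D one_cat (pt ?A1 (Tup a (Num 0))) (idN (pt ?AP b)) Y ?id)"
    unfolding restr_id[OF PD c Y] D_idN[OF PD pb Y] e
    using univ_one_iff[OF inf PD cat_id[OF D_cat[OF PD small_ord[OF inf]] bY]] iso_id[OF D_cat[OF PD small_ord[OF inf]] bY] by simp
   then show ?thesis using fc b True by blast
  next
   case False
   obtain k \<kappa> where fc: "final_cocone ?t ?A1 ?AP b k empty_cat \<kappa>" using fp(2)[OF _ b(2,3) False] b(1) by blast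
   then have c: "cocone ?t ?A1 ?AP b k empty_cat \<kappa>" by (simp add: final_cocone_def)
   have "univ (dfun D (to_one empty_cat)) (dob D k (dob D ?t Y)) (dob D (pt ?AP b) Y) (restr D empty_cat k \<kappa> Y ?id)"
    using univ_empty_iff[OF lderD(2)[OF D] PD coconeD(5)[OF c] bY restr_hom[OF PD c Y ih]] ini[OF b(2,3) False] b(1) by simp
   then show ?thesis using fc by blast
  qed
 qed
 then have "iso_arr (dcat D ?AP) (Ncomp (lan_counit D ?t) Y *[dcat D ?AP] Farr (lan D ?t) ?id)"
  using adjunction_transpose(3)[OF L ih Y] by simp
 then show ?thesis
  using fident[OF L(2) tY] cat_idr[OF funD(5)[OF L(2)] adjD(3)[OF L Y]] by simp
qed

text \<open>An object over the corner is the extension by zero of its value at the source if its other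
 two values are terminal.\<close>

lemma ran_unit_iso:
 fixes D :: "('k, 'o, 'm) derivator" and A :: "'k scat"
 assumes inf: "infinite (UNIV :: 'k set)" and D: "is_derivator D" and A: "small_cat A"
  and Y: "Y : dobj D (A >< ul)"
  and t: "terminal_obj (dcat D (A >< one_cat)) (dob D (A ** pt ul (pos 1 0)) Y)"
   "terminal_obj (dcat D (A >< one_cat)) (dob D (A ** pt ul (pos 0 1)) Y)"
 shows "iso_arr (dcat D (A >< ul)) (Ncomp (ran_unit D (A ** i_00)) Y)"
proof -
 let ?t = "A ** i_00" and ?AU = "A >< ul"
 note P = derD(1)[OF D] and U = small_ul[OF inf] and op = op_point[OF inf A]
 note tt = sfun_prod(1)[OF inf A sfun_i_00[OF inf]]
 have c: "category A" "category (ul :: 'k scat)" using A U by (simp_all add: small_cat_def)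
 note AU = sfunD(5)[OF tt]
 have oo: "opc (opc A >< opc ul) = ?AU" using op_prod[OF c] opc_opc[OF sfunD(8)[OF tt]] by simp
 have ot: "opF ((opc A) ** pt (opc ul) (pos 0 0)) = ?t" unfolding op(1)[symmetric] by (rule sfun_op_op[OF tt])
 have "initial_obj (dcat (opD D) one_cat) (dob (opD D) (pt (opc A >< opc ul) (Tup a p)) Y)"
  if "a : Obj (opc A)" "p : Obj (opc ul)" "p ~= pos 0 0" for a p
 proof -
  have ap: "a : Obj A" "p : Obj ul" and b: "Tup a p : Obj ?AU" using that by (simp_all add: prod_simps)
  have pp: "p = pos 1 0 \<or> p = pos 0 1" using ap(2) that(3) by (auto simp: ul_simps)
  have a0: "Tup a (Num 0) : Obj (A >< one_cat)" using ap by (simp add: prod_simps)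
  note v = sfun_pt[OF inf sfunD(4)[OF tt] a0] and w = sfun_prod[OF inf A sfun_pt[OF inf U ap(2)]]
  have "(A ** pt ul p) *. pt (A >< one_cat) (Tup a (Num 0)) = pt ?AU (Tup a p)"
   using pt_comp[OF inf w(1) a0] w(2)[OF ap(1), of "Num 0"] by (simp add: pt_def)
  then have "terminal_obj (dcat D one_cat) (dob D (pt ?AU (Tup a p)) Y)"
   using terminal_restrict[OF D v, of "dob D (A ** pt ul p) Y"] t pp D_cob[OF P v w(1) Y] by auto
  moreover have "opF (pt (opc A >< opc ul) (Tup a p)) = pt ?AU (Tup a p)"
   using op_pt[OF inf AU b] sfun_op_op[OF sfun_pt[OF inf AU b]] op_prod[OF c] by simp
  ultimately show ?thesis by (simp add: initial_op op_one)
 qed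
 from lan_counit_iso[OF inf left_derivator_op[OF inf D] small_op[OF A] op(2-4) _ this] Y
 have "iso_arr (opc (dcat D ?AU)) (Ncomp (ran_unit D ?t) Y)" by (simp add: oo ot)
 then show ?thesis
  using iso_op(1)[OF D_cat[OF P AU] adjD(2)[OF ran_adj(1)[OF derD(4)[OF D] P tt] D_fun[OF P tt] Y]] by simp
qed

section \<open>Binary coproducts and products\<close>

definition two :: "'k uni set" where "two = {Num 0, Num 1}"

text \<open>The coproduct of two copies of \<open>A\<close>. By Der1 its diagrams are pairs of diagrams of shape \<open>A\<close>, and left Kan extension
along \<open>fold\<close> is the coproduct of the two.\<close>

definition twice :: "'k scat => 'k scat" where
 "twice A = coprod_cat two (\<lambda>_. A)"

definition copy :: "'k scat => 'k uni => 'k sfun" where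
 "copy A i = coprod_inj two (\<lambda>_. A) i"

definition fold :: "'k scat => 'k sfun" where
 "fold A = mk_fun (twice A) A usnd usnd"

definition corner_of :: "'k uni => 'k uni" where
 "corner_of i = (if i = Num 0 then pos 1 0 else pos 0 1)"

text \<open>Places the two copies of \<open>A\<close> at the two end points of a span. This factors \<open>fold\<close> into \<open>spread\<close>, which extends by
an initial object, and a projection, whose Kan extensions are pushouts.\<close>

definition spread :: "'k scat => 'k scat => 'k sfun" where
 "spread A P = mk_fun (twice A) (A >< P) (\<lambda>x. Tup (usnd x) (corner_of (ufst x))) (\<lambda>h. Tup (usnd h) (Id P (corner_of (ufst h))))"

lemma twice_simps:
 "x : Obj (twice A) \<longleftrightarrow> (\<exists>i a. x = Tup i a & i : two & a : Obj A)"
 "h : Hom (twice A) x y \<longleftrightarrow> (\<exists>i a a' f. x = Tup i a & y = Tup i a' & h = Tup i f & i : two & f : Hom A a a')"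
 "i : two ==> a : Obj A ==> Id (twice A) (Tup i a) = Tup i (Id A a)"
 "i : two ==> g : Hom A a' a'' ==> f : Hom A a a' ==> Tup i g *[twice A] Tup i f = Tup i (g *[A] f)"
 by (auto simp: twice_def coprod_cat_def Hom_mk_cat Hom_def)

lemma small_two: "infinite (UNIV :: 'k set) ==> small (two :: 'k uni set)"
 by (rule small_finite) (auto simp: two_def)

lemma small_twice:
 fixes A :: "'k scat"
 assumes inf: "infinite (UNIV :: 'k set)" and A: "small_cat A"
 shows "small_cat (twice A)"
proof -
 have cA: "category A" using A by (simp add: small_cat_def)
 have a: "\<And>g f. g : Arr A ==> f : Arr A ==> Cod A f = Dom A g ==> g *[A] f : Arr A & Dom A (g *[A] f) = Dom A f & Cod A (g *[A] f) = Cod A g"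
  using cat_comp[OF cA, unfolded Hom_def] by auto
 have "category (twice A)" unfolding twice_def coprod_cat_def
  by (rule category_mk_cat)
   (auto simp: cat_dom[OF cA] cat_cod[OF cA] HomD[OF cat_id[OF cA]] a
    cat_idl[OF cA HomI] cat_idr[OF cA HomI] cat_assoc[OF cA, unfolded Hom_def, simplified])
 then show ?thesis using small_image2[OF inf small_two[OF inf], of _ Tup] A
  unfolding small_cat_def by (auto simp: twice_def coprod_cat_def)
qed

lemma sfun_copy:
 fixes A :: "'k scat"
 assumes inf: "infinite (UNIV :: 'k set)" and A: "small_cat A" and i: "i : two"
 shows "sfun (copy A i) A (twice A)" "sfun (fold A) (twice A) A" "fold A *. copy A i = idF A"
proof -
 have cA: "category A" using A by (simp add: small_cat_def)
 show c: "sfun (copy A i) A (twice A)" unfolding copy_def coprod_inj_def twice_def[symmetric]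
  by (rule sfun_mk_fun[OF A small_twice[OF inf A]]) (auto simp: twice_simps i)
 show f: "sfun (fold A) (twice A) A" unfolding fold_def
 proof (rule sfun_mk_fun[OF small_twice[OF inf A] A])
  fix g f x y z assume "g : Hom (twice A) y z" "f : Hom (twice A) x y"
  then show "usnd (g *[twice A] f) = usnd g *[A] usnd f" by (auto simp: twice_simps)
 qed (auto simp: twice_simps)
 have ar: "f : Hom A a a' ==> Tup i f : Arr (twice A)" for f a a'
  using i HomD(1)[of "Tup i f" "twice A" "Tup i a" "Tup i a'"] by (auto simp: twice_simps(2))
 show "fold A *. copy A i = idF A"
 proof (rule sfun_eqI[OF sfun_comp[OF c f] sfun_id[OF A]])
  show "a : Obj A ==> Fobj (fold A *. copy A i) a = Fobj (idF A) a" for a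
   using i by (simp add: compF_obj[OF sfunD(6)[OF c]] copy_def coprod_inj_def fold_def twice_simps(1))
  show "h : Hom A a a' ==> Farr (fold A *. copy A i) h = Farr (idF A) h" for h a a'
   using ar HomD(1)[of h A] by (simp add: compF_arr[OF sfunD(6)[OF c]] copy_def coprod_inj_def fold_def)
 qed
qed

lemma sfun_proj1:
 fixes A :: "'k scat"
 assumes inf: "infinite (UNIV :: 'k set)" and A: "small_cat A" and P: "small_cat P"
 shows "sfun (proj1 A P) (A >< P) A"
 unfolding proj1_def
proof (rule sfun_mk_fun[OF small_prod[OF inf A P] A])
 fix g f x y z assume "g : Hom (A >< P) y z" "f : Hom (A >< P) x y"
 then show "ufst (g *[A >< P] f) = ufst g *[A] ufst f"
  unfolding prod_simps(2) by (elim exE conjE) (simp add: prod_simps(4))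
qed (auto simp: prod_simps)

lemma sfun_spread:
 fixes A :: "'k scat"
 assumes inf: "infinite (UNIV :: 'k set)" and A: "small_cat A" and P: "small_cat P" "pos 1 0 : Obj P" "pos 0 1 : Obj P"
 shows "sfun (spread A P) (twice A) (A >< P)" "sfun (proj1 A P) (A >< P) A" "proj1 A P *. spread A P = fold A"
  "i : two ==> a : Obj A ==> Fobj (spread A P) (Tup i a) = Tup a (corner_of i)"
  "i : two ==> f : Hom A a a' ==> Farr (spread A P) (Tup i f) = Tup f (Id P (corner_of i))"
proof -
 have cA: "category A" and cP: "category P" using A P by (simp_all add: small_cat_def)
 have co: "corner_of i : Obj P" for i using P by (simp add: corner_of_def)
 note ci = cat_id[OF cP co]
 show s: "sfun (spread A P) (twice A) (A >< P)" unfolding spread_def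
 proof (rule sfun_mk_fun[OF small_twice[OF inf A] small_prod[OF inf A P(1)]])
  fix g f x y z assume "g : Hom (twice A) y z" "f : Hom (twice A) x y"
  then obtain i a a' a'' f' g' where "x = Tup i a" "y = Tup i a'" "z = Tup i a''" "f = Tup i f'" "g = Tup i g'" "i : two"
   and h: "f' : Hom A a a'" "g' : Hom A a' a''" by (auto simp: twice_simps)
  then show "Tup (usnd (g *[twice A] f)) (Id P (corner_of (ufst (g *[twice A] f)))) =
   Tup (usnd g) (Id P (corner_of (ufst g))) *[A >< P] Tup (usnd f) (Id P (corner_of (ufst f)))"
   using prod_simps(4)[OF h(2) ci h(1) ci] cat_idl[OF cP ci] by (simp add: twice_simps(4))
 qed (auto simp: twice_simps prod_simps co ci)
 show p: "sfun (proj1 A P) (A >< P) A" by (rule sfun_proj1[OF inf A P(1)])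
 show so: "i : two ==> a : Obj A ==> Fobj (spread A P) (Tup i a) = Tup a (corner_of i)" for i a
  by (simp add: spread_def twice_simps(1))
 show sa: "i : two ==> f : Hom A a a' ==> Farr (spread A P) (Tup i f) = Tup f (Id P (corner_of i))" for i f a a'
  using HomD(1)[of "Tup i f" "twice A" "Tup i a" "Tup i a'"] by (simp add: spread_def twice_simps(2))
 show "proj1 A P *. spread A P = fold A"
 proof (rule sfun_eqI[OF sfun_comp[OF s p]])
  have "(Num 0 :: 'k uni) : two" by (simp add: two_def)
  from sfun_copy(2)[OF inf A this] show "sfun (fold A) (twice A) A" .
  fix x assume "x : Obj (twice A)"
  then show "Fobj (proj1 A P *. spread A P) x = Fobj (fold A) x"
   using so co by (auto simp: compF_obj[OF sfunD(6)[OF s]] proj1_def fold_def prod_simps(1) twice_simps(1))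
 next
  fix h x y assume h: "h : Hom (twice A) x y"
  then obtain i a a' f where h': "h = Tup i f" "i : two" "f : Hom A a a'" by (auto simp: twice_simps)
  have "Tup f (Id P (corner_of i)) : Hom (A >< P) (Tup a (corner_of i)) (Tup a' (corner_of i))" using h' ci by (simp add: prod_simps)
  from HomD(1)[OF this] show "Farr (proj1 A P *. spread A P) h = Farr (fold A) h"
   unfolding compF_arr[OF sfunD(6)[OF s] h] using sa[OF h'(2,3)] h'(1) HomD(1)[OF h] by (simp add: proj1_def fold_def)
 qed
qed

text \<open>The end points of the span have no arrows to other objects. The shapes of pushouts and, in the opposite category, of
pullbacks satisfy this.\<close>

definition span :: "'k scat => bool" where
 "span P \<longleftrightarrow> small_cat P & pos 1 0 : Obj P & pos 0 1 : Obj P &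
  (\<forall>i\<in>two. \<forall>p. \<forall>h\<in>Hom P (corner_of i) p. p = corner_of i & h = Id P (corner_of i))"

lemma span_ul:
 assumes inf: "infinite (UNIV :: 'k set)"
 shows "span (ul :: 'k scat)" "span (opc lr :: 'k scat)"
proof -
 have c: "category (ul :: 'k scat)" "category (lr :: 'k scat)" using small_ul[OF inf] small_lr[OF inf] by (simp_all add: small_cat_def)
 have o: "(pos 1 0 :: 'k uni) : Obj ul" "(pos 0 1 :: 'k uni) : Obj ul" "(pos 1 0 :: 'k uni) : Obj lr" "(pos 0 1 :: 'k uni) : Obj lr"
  by (auto simp: ul_simps lr_simps)
 show "span (ul :: 'k scat)" unfolding span_def using small_ul[OF inf] o cat_id[OF c(1) o(1)] cat_id[OF c(1) o(2)]
  by (auto simp: two_def corner_of_def ul_simps square_simps)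
 show "span (opc lr :: 'k scat)" unfolding span_def using small_op[OF small_lr[OF inf]] o cat_id[OF c(2) o(3)] cat_id[OF c(2) o(4)]
  by (auto simp: two_def corner_of_def lr_simps square_simps)
qed

text \<open>A coproduct is a pushout over an initial object, and \<open>F\<close> preserves both.\<close>

lemma fold_pres:
 fixes D :: "('k, 'o, 'm) derivator" and E :: "('k, 'p, 'n) derivator" and A P :: "'k scat"
 assumes inf: "infinite (UNIV :: 'k set)" and D: "left_derivator D" and E: "left_derivator E" and M: "is_dmorphism D E F"
  and pe: "pres_univ D E F (to_one empty_cat)" and pp: "pres_univ D E F (to_one P)" and sp: "span P" and A: "small_cat A"
 shows "pres_univ D E F (fold A)"
proof -
 note al = lderD(1)[OF D] lderD(1)[OF E] M lderD(4)[OF D] lderD(4)[OF E]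
 note one = pres_one[OF al inf] and S = prod_simps
 have P: "small_cat P" "pos 1 0 : Obj P" "pos 0 1 : Obj P" using sp by (simp_all add: span_def)
 have cA: "category A" and cP: "category P" using A P by (simp_all add: small_cat_def)
 note sP = sfun_spread[OF inf A P]
 have tw: "i : two \<longleftrightarrow> i = Num 0 \<or> i = Num 1" for i :: "'k uni" by (auto simp: two_def)
 have ci: "i : two ==> j : two ==> corner_of i = corner_of j ==> i = j" for i j :: "'k uni" by (auto simp: tw corner_of_def)
 have iP: "\<And>i p h. i : two ==> h : Hom P (corner_of i) p ==> p = corner_of i"
  "\<And>i j h. i : two ==> j : two ==> h : Hom P (corner_of i) (corner_of j) ==> i = j & h = Id P (corner_of i)"
  using sp ci unfolding span_def by metis+
 have 1: "pres_univ D E F (spread A P)"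
 proof (rule pres_univ_pointwise[OF inf D E M sP(1)])
  fix b assume bo: "b : Obj (A >< P)"
  then obtain a p where b: "b = Tup a p" "a : Obj A" "p : Obj P" by (auto simp: S)
  show "\<exists>k J \<kappa>. final_cocone (spread A P) (twice A) (A >< P) b k J \<kappa> & pres_univ D E F (to_one J)"
  proof (cases "p : {corner_of (Num 0), corner_of (Num 1)}")
   case False
   have "Hom (A >< P) (Fobj (spread A P) x) b = {}" if "x : Obj (twice A)" for x
    using that sP(4) iP(1) False unfolding b(1) by (auto simp: twice_simps S tw)
   from final_cocone_empty[OF inf sP(1) bo this] show ?thesis using pe by blast
  next
   case True
   then obtain i where i: "i : two" "p = corner_of i" using tw[of "Num 0"] tw[of "Num 1"] by blast
   have ia: "Tup i a : Obj (twice A)" using i b by (simp add: twice_simps)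
   have "\<exists>!g. g : Hom (twice A) x (Tup i a) & Farr (spread A P) g = f"
    if x: "x : Obj (twice A)" and f: "f : Hom (A >< P) (Fobj (spread A P) x) (Fobj (spread A P) (Tup i a))" for x f
   proof -
    obtain j a' where x': "x = Tup j a'" "j : two" "a' : Obj A" using x by (auto simp: twice_simps)
    obtain f1 f2 where f': "f = Tup f1 f2" "f1 : Hom A a' a" "f2 : Hom P (corner_of j) (corner_of i)"
     using f sP(4)[OF i(1) b(2)] sP(4)[OF x'(2,3)] x'(1) by (auto simp: S)
    note ji = iP(2)[OF x'(2) i(1) f'(3)]
    have x'': "x = Tup i a'" and f'': "f = Tup f1 (Id P (corner_of i))" using ji x'(1) f'(1) by simp_all
    note sp = sP(5)[OF i(1)]
    show ?thesis
    proof (rule ex1I[of _ "Tup i f1"])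
     show "Tup i f1 : Hom (twice A) x (Tup i a) & Farr (spread A P) (Tup i f1) = f"
      using sp[OF f'(2)] f'(2) i(1) unfolding x'' f'' by (simp add: twice_simps(2))
     fix g assume "g : Hom (twice A) x (Tup i a) & Farr (spread A P) g = f"
     then obtain g' where "g = Tup i g'" "g' : Hom A a' a" "Farr (spread A P) g = f"
      unfolding x'' by (auto simp: twice_simps(2))
     then show "g = Tup i f1" using sp[of g' a' a] unfolding f'' by simp
    qed
   qed
   from final_cocone_pt[OF inf sP(1) ia this] have "final_cocone (spread A P) (twice A) (A >< P) b (pt (twice A) (Tup i a)) one_cat (idN (pt (A >< P) b))"
    using sP(4)[OF i(1) b(2)] i(2) b(1) by simp
   then show ?thesis using one by blast
  qed
 qed
 have 2: "pres_univ D E F (proj1 A P)"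
 proof (rule pres_univ_pointwise[OF inf D E M sP(2)])
  fix a assume a: "a : Obj A"
  have po: "Fobj (proj1 A P) (Tup x j) = x" if "x : Obj A" "j : Obj P" for x j using that by (simp add: proj1_def S(1))
  have pa: "Farr (proj1 A P) (Tup f g) = f" if "f : Hom A x y" "g : Hom P i j" for f g x y i j
   using HomD(1)[of "Tup f g" "A >< P" "Tup x i" "Tup y j"] that by (simp add: proj1_def S(2))
  note i = cat_id[OF cA a]
  have "final_cocone (proj1 A P) (A >< P) A a (at_left A P a) P (mk_nat (proj1 A P *. at_left A P a) (pt A a *. to_one P) (\<lambda>_. Id A a))"
  proof (rule final_cocone_slice[OF inf A P(1) sP(2) a a])
   show "j : Obj P ==> Id A a : Hom A (Fobj (proj1 A P) (Tup a j)) a" for j using po[OF a] i by simp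
   show "h : Hom P x y ==> Id A a *[A] Farr (proj1 A P) (Tup (Id A a) h) = Id A a" for h x y
    using pa[OF i] cat_idl[OF cA i] by simp
   fix x j f assume x: "x : Obj A" and j: "j : Obj P" and f: "f : Hom A (Fobj (proj1 A P) (Tup x j)) a"
   show "\<exists>!g. g : Hom A x a & Id A a *[A] Farr (proj1 A P) (Tup g (Id P j)) = f"
    by (rule ex1I[of _ f]) (use f po[OF x j] pa[OF _ cat_id[OF cP j]] cat_idl[OF cA] in auto)
  qed
  then show "\<exists>k J \<kappa>. final_cocone (proj1 A P) (A >< P) A a k J \<kappa> & pres_univ D E F (to_one J)" using pp by blast
 qed
 show "pres_univ D E F (fold A)" using pres_univ_compF[OF al sP(1,2) 1 2] sP(3) by simp
qed

section \<open>Morphisms preserve biproducts\<close>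

definition is_coprod :: "('o, 'm) cat => 'o => 'o => 'o => 'm => 'm => bool" where
 "is_coprod C x y b i j \<longleftrightarrow> i : Hom C x b & j : Hom C y b &
  (\<forall>z\<in>Obj C. \<forall>f\<in>Hom C x z. \<forall>g\<in>Hom C y z. \<exists>!h. h : Hom C b z & h *[C] i = f & h *[C] j = g)"

definition is_prod :: "('o, 'm) cat => 'o => 'o => 'o => 'm => 'm => bool" where
 "is_prod C x y b p q \<longleftrightarrow> p : Hom C b x & q : Hom C b y &
  (\<forall>z\<in>Obj C. \<forall>f\<in>Hom C z x. \<forall>g\<in>Hom C z y. \<exists>!h. h : Hom C z b & p *[C] h = f & q *[C] h = g)"

lemma iso_comp_eq_iff:
 assumes C: "category C" and e: "e : Hom C x y" "iso_arr C e" and f: "f : Hom C y z" and g: "g : Hom C x z"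
 shows "f *[C] e = g \<longleftrightarrow> f = g *[C] inv_arr C e"
 using inv_cancel(3)[OF C e f] inv_cancel(4)[OF C e g] by auto

lemma is_coprod_iso:
 assumes C: "category C" and c: "is_coprod C x y b i j"
  and e: "e : Hom C x' x" "iso_arr C e" and e': "e' : Hom C y' y" "iso_arr C e'"
 shows "is_coprod C x' y' b (i *[C] e) (j *[C] e')"
 unfolding is_coprod_def
proof (intro conjI ballI)
 have i: "i : Hom C x b" and j: "j : Hom C y b" using c by (auto simp: is_coprod_def)
 show "i *[C] e : Hom C x' b" "j *[C] e' : Hom C y' b" using cat_comp[OF C i e(1)] cat_comp[OF C j e'(1)] .
 fix z f g assume z: "z : Obj C" and f: "f : Hom C x' z" and g: "g : Hom C y' z"
 have "(h : Hom C b z & h *[C] (i *[C] e) = f & h *[C] (j *[C] e') = g) \<longleftrightarrow>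
  (h : Hom C b z & h *[C] i = f *[C] inv_arr C e & h *[C] j = g *[C] inv_arr C e')" for h
  using cat_assoc[OF C _ i e(1), of h z] cat_assoc[OF C _ j e'(1), of h z]
   iso_comp_eq_iff[OF C e cat_comp[OF C _ i] f, of h] iso_comp_eq_iff[OF C e' cat_comp[OF C _ j] g, of h] by auto
 then show "\<exists>!h. h : Hom C b z & h *[C] (i *[C] e) = f & h *[C] (j *[C] e') = g"
  using c z cat_comp[OF C f inv_arr(1)[OF C e]] cat_comp[OF C g inv_arr(1)[OF C e']] unfolding is_coprod_def by simp
qed

abbreviation "n0 \<equiv> Num 0"
abbreviation "n1 \<equiv> Num 1"

text \<open>Der1 for a family of two: diagrams of two objects, up to isomorphism, and their morphisms are pairs.\<close>

lemma twice_pairs: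
 fixes D :: "('k, 'o, 'm, 'z) prederivator_scheme" and A :: "'k scat"
 assumes inf: "infinite (UNIV :: 'k set)" and D1: "Der1 D" and P: "is_prederivator D" and A: "small_cat A"
 shows "x : dobj D A ==> y : dobj D A ==> \<exists>V\<in>dobj D (twice A).
   iso_objs (dcat D A) (dob D (copy A n0) V) x & iso_objs (dcat D A) (dob D (copy A n1) V) y"
  "V : dobj D (twice A) ==> V' : dobj D (twice A) ==>
   f : dhom D A (dob D (copy A n0) V) (dob D (copy A n0) V') ==>
   g : dhom D A (dob D (copy A n1) V) (dob D (copy A n1) V') ==>
   \<exists>!h. h : dhom D (twice A) V V' & dar D (copy A n0) h = f & dar D (copy A n1) h = g"
proof -
 let ?F = "to_prod D two (\<lambda>_. A)" and ?P = "prod_family (two :: 'k uni set) (\<lambda>_. dcat D A)"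
 have t: "(n0 :: 'k uni) : two" "(n1 :: 'k uni) : two" "(n0 :: 'k uni) ~= n1" by (auto simp: two_def)
 have all2: "(\<forall>i\<in>(two :: 'k uni set). Q i) \<longleftrightarrow> Q n0 & Q n1" for Q by (auto simp: two_def)
 have e: "equivalence ?F" using D1[unfolded Der1_def, rule_format, of two "\<lambda>_. A"] small_two[OF inf] A by simp
 have d: "Fdom ?F = dcat D (twice A)" "Fcod ?F = ?P"
  "\<And>X. X : dobj D (twice A) ==> Fobj ?F X = (\<lambda>i\<in>two. dob D (copy A i) X)"
  "\<And>f. f : Arr (dcat D (twice A)) ==> Farr ?F f = (\<lambda>i\<in>two. dar D (copy A i) f)"
  by (simp_all add: to_prod_def twice_def copy_def)
 have F: "full ?F" "faithful ?F" "ess_surj ?F" using e unfolding equivalence_def by auto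
 have Po: "X : Obj ?P \<longleftrightarrow> X : (\<Pi>\<^sub>E i\<in>two. dobj D A)" for X by (simp add: prod_family_def)
 have Ph: "k : Hom ?P X Y \<longleftrightarrow> k : (\<Pi>\<^sub>E i\<in>two. Arr (dcat D A)) & (\<lambda>i\<in>two. Dom (dcat D A) (k i)) = X & (\<lambda>i\<in>two. Cod (dcat D A) (k i)) = Y" for k X Y
  by (auto simp: prod_family_def Hom_mk_cat)
 have res: "(\<lambda>i\<in>(two :: 'k uni set). q i) = (\<lambda>i\<in>two. q' i) \<longleftrightarrow> q n0 = q' n0 & q n1 = q' n1" for q q'
  using t by (auto simp: fun_eq_iff restrict_def two_def)
 { assume x: "x : dobj D A" and y: "y : dobj D A"
  let ?X = "\<lambda>i\<in>two. if i = n0 then x else y"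
  have "?X : Obj ?P" unfolding Po using x y by auto
  then obtain V where V: "V : dobj D (twice A)" "iso_objs ?P (Fobj ?F V) ?X" using F(3) unfolding ess_surj_def d(1,2) by blast
  then obtain k l where k: "k : Hom ?P (Fobj ?F V) ?X" and kl: "inverse_arrs ?P k l" unfolding iso_objs_def iso_arr_def by blast
  have l: "l : Hom ?P ?X (Fobj ?F V)" and lk: "l *[?P] k = Id ?P (Fobj ?F V)" "k *[?P] l = Id ?P ?X"
   using kl k by (auto simp: inverse_arrs_def Hom_def)
  note kk = k[unfolded Ph, THEN conjunct1] k[unfolded Ph, THEN conjunct2, THEN conjunct1] k[unfolded Ph, THEN conjunct2, THEN conjunct2]
  note ll = l[unfolded Ph, THEN conjunct1] l[unfolded Ph, THEN conjunct2, THEN conjunct1] l[unfolded Ph, THEN conjunct2, THEN conjunct2]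
  have FV: "Fobj ?F V = (\<lambda>i\<in>two. dob D (copy A i) V)" by (rule d(3)[OF V(1)])
  have Vi: "dob D (copy A i) V : dobj D A" if "i : two" for i
   using fobj[OF D_fun[OF P sfun_copy(1)[OF inf A that]] V(1)] .
  have "iso_objs (dcat D A) (dob D (copy A i) V) (if i = n0 then x else y)" if i: "i : two" for i
  proof -
   have ki: "k i : dhom D A (dob D (copy A i) V) (if i = n0 then x else y)"
    and li: "l i : dhom D A (if i = n0 then x else y) (dob D (copy A i) V)"
    using PiE_mem[OF kk(1) i] fun_cong[OF kk(2), of i] fun_cong[OF kk(3), of i] PiE_mem[OF ll(1) i] fun_cong[OF ll(2), of i] fun_cong[OF ll(3), of i] i
    unfolding FV by (simp_all add: Hom_def)
   have ob: "Fobj ?F V : Obj ?P" "?X : Obj ?P" unfolding Po FV using Vi x y by auto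
   have kA: "k : Arr ?P" "l : Arr ?P" "Cod ?P k = Dom ?P l" "Cod ?P l = Dom ?P k" using k l by (auto simp: Hom_def)
   have c1: "l *[?P] k = (\<lambda>i\<in>two. l i *[dcat D A] k i)" and c2: "k *[?P] l = (\<lambda>i\<in>two. k i *[dcat D A] l i)"
    using kA unfolding prod_family_def by (simp_all add: mk_cat_def)
   have i1: "Id ?P (Fobj ?F V) = (\<lambda>i\<in>two. Id (dcat D A) (Fobj ?F V i))" "Id ?P ?X = (\<lambda>i\<in>two. Id (dcat D A) (?X i))"
    using ob unfolding prod_family_def by (simp_all add: mk_cat_def)
   have "l i *[dcat D A] k i = Id (dcat D A) (dob D (copy A i) V)"
    using fun_cong[OF lk(1)[unfolded c1 i1], of i] i FV by simp
   moreover have "k i *[dcat D A] l i = Id (dcat D A) (if i = n0 then x else y)"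
    using fun_cong[OF lk(2)[unfolded c2 i1], of i] i by simp
   ultimately show ?thesis using iso_arrI(1)[OF D_cat[OF P A] ki li] ki unfolding iso_objs_def by blast
  qed
  from this[OF t(1)] this[OF t(2)] show "\<exists>V\<in>dobj D (twice A).
   iso_objs (dcat D A) (dob D (copy A n0) V) x & iso_objs (dcat D A) (dob D (copy A n1) V) y"
   using V(1) t(3) by (intro bexI[of _ V]) auto }
 assume V: "V : dobj D (twice A)" and V': "V' : dobj D (twice A)"
  and f: "f : dhom D A (dob D (copy A n0) V) (dob D (copy A n0) V')"
  and g: "g : dhom D A (dob D (copy A n1) V) (dob D (copy A n1) V')"
 let ?k = "\<lambda>i\<in>two. if i = n0 then f else g"
 have k: "?k : Hom ?P (Fobj ?F V) (Fobj ?F V')"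
  unfolding Ph d(3)[OF V] d(3)[OF V'] res using f g t unfolding Hom_def by auto
 have iff: "Farr ?F h = ?k \<longleftrightarrow> dar D (copy A n0) h = f & dar D (copy A n1) h = g" if "h : dhom D (twice A) V V'" for h
  unfolding d(4)[OF HomD(1)[OF that]] res using t by auto
 obtain h where h: "h : dhom D (twice A) V V'" "Farr ?F h = ?k"
  using subsetD[OF F(1)[unfolded full_def d(1,2), rule_format, OF V V'] k] by (elim imageE) simp
 moreover have "h' = h" if "h' : dhom D (twice A) V V'" "Farr ?F h' = ?k" for h'
  by (rule inj_onD[OF F(2)[unfolded faithful_def d(1), rule_format, OF V V'] _ that(1) h(1)]) (simp add: that(2) h(2))
 ultimately show "\<exists>!h. h : dhom D (twice A) V V' & dar D (copy A n0) h = f & dar D (copy A n1) h = g"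
  using iff[OF h(1)] iff by (intro ex1I[of _ h]) blast+
qed

text \<open>Under the equivalence with pairs a universal arrow for \<open>fold\<close> becomes a pair of coprojections.\<close>

lemma univ_fold_iff:
 fixes D :: "('k, 'o, 'm, 'z) prederivator_scheme" and A :: "'k scat"
 assumes inf: "infinite (UNIV :: 'k set)" and D1: "Der1 D" and P: "is_prederivator D" and A: "small_cat A"
  and b: "b : dobj D A" and f: "f : dhom D (twice A) V (dob D (fold A) b)"
 shows "univ (dfun D (fold A)) V b f \<longleftrightarrow> is_coprod (dcat D A) (dob D (copy A n0) V) (dob D (copy A n1) V) b
  (dar D (copy A n0) f) (dar D (copy A n1) f)"
proof -
 have t: "(n0 :: 'k uni) : two" "(n1 :: 'k uni) : two" by (auto simp: two_def)
 note c0 = sfun_copy[OF inf A t(1)] and c1 = sfun_copy[OF inf A t(2)]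
 note d0 = D_fun[OF P c0(1)] and d1 = D_fun[OF P c1(1)] and df = D_fun[OF P c0(2)]
 note W = funD(5)[OF df] and V = cat_ob(1)[OF funD(5)[OF df] f]
 have o: "dob D (copy A n0) (dob D (fold A) z) = z" "dob D (copy A n1) (dob D (fold A) z) = z" if "z : dobj D A" for z
  using D_cob[OF P c0(1,2) that] D_cob[OF P c1(1,2) that] c0(3) c1(3) D_idF[OF P A] that by simp_all
 have a: "dar D (copy A n0) (dar D (fold A) h) = h" "dar D (copy A n1) (dar D (fold A) h) = h" if "h : dhom D A z z'" for h z z'
  using D_car[OF P c0(1,2) that] D_car[OF P c1(1,2) that] c0(3) c1(3) D_idF[OF P A] HomD(1)[OF that] by simp_all
 note f0 = fhom[OF d0 f, unfolded o[OF b]] and f1 = fhom[OF d1 f, unfolded o[OF b]]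
 let ?f0 = "dar D (copy A n0) f" and ?f1 = "dar D (copy A n1) f"
 have key: "(dar D (fold A) h *[dcat D (twice A)] f = g) \<longleftrightarrow>
   (h *[dcat D A] ?f0 = dar D (copy A n0) g & h *[dcat D A] ?f1 = dar D (copy A n1) g)"
  if z: "z : dobj D A" and h: "h : dhom D A b z" and g: "g : dhom D (twice A) V (dob D (fold A) z)" for z h g
 proof -
  note hf = fhom[OF df h]
  note l = cat_comp[OF W hf f]
  have "dar D (copy A n0) (dar D (fold A) h *[dcat D (twice A)] f) = h *[dcat D A] ?f0"
   "dar D (copy A n1) (dar D (fold A) h *[dcat D (twice A)] f) = h *[dcat D A] ?f1"
   using fcomp[OF d0 hf f] fcomp[OF d1 hf f] a[OF h] by simp_all
  then show ?thesis
   using twice_pairs(2)[OF inf D1 P A V fobj[OF df z] fhom[OF d0 g] fhom[OF d1 g]] l g by metis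
 qed
 have iff: "(\<exists>!h. h : dhom D A b z & dar D (fold A) h *[dcat D (twice A)] f = g) \<longleftrightarrow>
  (\<exists>!h. h : dhom D A b z & h *[dcat D A] ?f0 = dar D (copy A n0) g & h *[dcat D A] ?f1 = dar D (copy A n1) g)"
  if "z : dobj D A" "g : dhom D (twice A) V (dob D (fold A) z)" for z g
  using key[OF that(1) _ that(2)] by metis
 show ?thesis
 proof
  assume u: "univ (dfun D (fold A)) V b f"
  show "is_coprod (dcat D A) (dob D (copy A n0) V) (dob D (copy A n1) V) b ?f0 ?f1"
   unfolding is_coprod_def
  proof (intro conjI ballI f0 f1)
   fix z g0 g1 assume z: "z : dobj D A" and g0: "g0 : dhom D A (dob D (copy A n0) V) z" and g1: "g1 : dhom D A (dob D (copy A n1) V) z"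
   obtain g where g: "g : dhom D (twice A) V (dob D (fold A) z)" "dar D (copy A n0) g = g0" "dar D (copy A n1) g = g1"
    using twice_pairs(2)[OF inf D1 P A V fobj[OF df z], of g0 g1] g0 g1 o[OF z] by auto
   have "\<exists>!h. h : dhom D A b z & dar D (fold A) h *[dcat D (twice A)] f = g"
    using u z g(1) funD(2,3)[OF df] unfolding univ_def by simp
   then show "\<exists>!h. h : dhom D A b z & h *[dcat D A] ?f0 = g0 & h *[dcat D A] ?f1 = g1"
    unfolding iff[OF z g(1)] g(2,3) .
  qed
 next
  assume c: "is_coprod (dcat D A) (dob D (copy A n0) V) (dob D (copy A n1) V) b ?f0 ?f1"
  show "univ (dfun D (fold A)) V b f" unfolding univ_def funD(2,3)[OF df]
  proof (intro conjI ballI b f)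
   fix z g assume z: "z : dobj D A" and g: "g : dhom D (twice A) V (dob D (fold A) z)"
   show "\<exists>!h. h : dhom D A b z & dar D (fold A) h *[dcat D (twice A)] f = g"
    unfolding iff[OF z g] using c z fhom[OF d0 g] fhom[OF d1 g] o[OF z] unfolding is_coprod_def by simp
  qed
 qed
qed

text \<open>Replace the coproduct diagram by a universal arrow along \<open>fold\<close>, whose image is universal, and read off the
coprojections of the image.\<close>

lemma mfun_coprod:
 fixes D :: "('k, 'o, 'm) derivator" and E :: "('k, 'p, 'n) derivator" and A P :: "'k scat"
 assumes inf: "infinite (UNIV :: 'k set)" and D: "left_derivator D" and E: "left_derivator E" and M: "is_dmorphism D E F"
  and pe: "pres_univ D E F (to_one empty_cat)" and pp: "pres_univ D E F (to_one P)" and sp: "span P"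
  and A: "small_cat A" and c: "is_coprod (dcat D A) x y b i j"
 shows "is_coprod (dcat E A) (mob F A x) (mob F A y) (mob F A b) (mar F A i) (mar F A j)"
proof -
 note PD = lderD(1)[OF D] and PE = lderD(1)[OF E] and D1 = lderD(2)[OF D] and E1 = lderD(2)[OF E]
 have t: "(n0 :: 'k uni) : two" "(n1 :: 'k uni) : two" by (auto simp: two_def)
 note c0 = sfun_copy[OF inf A t(1)] and c1 = sfun_copy[OF inf A t(2)]
 note DA = D_cat[OF PD A] and EA = D_cat[OF PE A] and FA = M_fun[OF PD PE M A]
 have i: "i : dhom D A x b" and j: "j : dhom D A y b" using c by (auto simp: is_coprod_def)
 note x = cat_ob(1)[OF DA i] and y = cat_ob(1)[OF DA j] and b = cat_ob(2)[OF DA i]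
 obtain V e0 e1 where V: "V : dobj D (twice A)"
  and e0: "e0 : dhom D A (dob D (copy A n0) V) x" "iso_arr (dcat D A) e0"
  and e1: "e1 : dhom D A (dob D (copy A n1) V) y" "iso_arr (dcat D A) e1"
  using twice_pairs(1)[OF inf D1 PD A x y] unfolding iso_objs_def by blast
 note df = D_fun[OF PD c0(2)]
 have o: "dob D (copy A n0) (dob D (fold A) b) = b" "dob D (copy A n1) (dob D (fold A) b) = b"
  using D_cob[OF PD c0(1,2) b] D_cob[OF PD c1(1,2) b] c0(3) c1(3) D_idF[OF PD A] b by simp_all
 obtain f where f: "f : dhom D (twice A) V (dob D (fold A) b)"
  and fe: "dar D (copy A n0) f = i *[dcat D A] e0" "dar D (copy A n1) f = j *[dcat D A] e1"
  using twice_pairs(2)[OF inf D1 PD A V fobj[OF df b], of "i *[dcat D A] e0" "j *[dcat D A] e1"]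
   cat_comp[OF DA i e0(1)] cat_comp[OF DA j e1(1)] o by auto
 have "univ (dfun D (fold A)) V b f"
  using univ_fold_iff[OF inf D1 PD A b f] is_coprod_iso[OF DA c e0 e1] fe by simp
 then have u: "univ (dfun E (fold A)) (mob F (twice A) V) (mob F A b) (mimg E F (fold A) b f)"
  using fold_pres[OF inf D E M pe pp sp A] sfunD(2,3)[OF c0(2)] unfolding pres_univ_def by auto
 note m = mimg_hom[OF PD PE M c0(2) b f] and Fb = fobj[OF FA b]
 have val: "dar E (copy A k) (mimg E F (fold A) b f) = mar F A (dar D (copy A k) f) *[dcat E A] gam F (copy A k) V"
  if "k : two" for k
 proof -
  note c = sfun_copy[OF inf A that] 
  note Ec = D_fun[OF PE c(1)] and W = sfunD(4)[OF c(2)]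
  note cm = fhom[OF Ec m(1)] and fb = fobj[OF df b]
  have eo: "dob E (copy A k) (dob E (fold A) (mob F A b)) = mob F A b"
   using D_cob[OF PE c(1,2) Fb] c(3) D_idF[OF PE A] Fb by simp
  note cm' = cm[unfolded eo]
  have "gam F (copy A k) (dob D (fold A) b) *[dcat E A] dar E (copy A k) (gam F (fold A) b) = Id (dcat E A) (mob F A b)"
   using gam_comp[OF PD PE M c(1,2) b] c(3) gam_idF[OF PD PE M A b] by simp
  then have "dar E (copy A k) (mimg E F (fold A) b f) = (gam F (copy A k) (dob D (fold A) b) *[dcat E A] dar E (copy A k) (gam F (fold A) b)) *[dcat E A] dar E (copy A k) (mimg E F (fold A) b f)"
   using cat_idl[OF EA cm'] by simp
  also have "\<dots> = gam F (copy A k) (dob D (fold A) b) *[dcat E A] dar E (copy A k) (mar F (twice A) f)"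
   unfolding m(2)[symmetric] fcomp[OF Ec gam_hom(1)[OF PD PE M c(2) b] m(1)]
   using cat_assoc[OF EA gam_hom(1)[OF PD PE M c(1) fb] fhom[OF Ec gam_hom(1)[OF PD PE M c(2) b]] cm] .
  also have "\<dots> = mar F A (dar D (copy A k) f) *[dcat E A] gam F (copy A k) V"
   using gam_natural[OF PD PE M c(1) f] .
  finally show ?thesis .
 qed
 note g0 = gam_hom[OF PD PE M c0(1) V] and g1 = gam_hom[OF PD PE M c1(1) V]
 note Fi = fhom[OF FA i] and Fj = fhom[OF FA j] and Fe0 = fhom[OF FA e0(1)] and Fe1 = fhom[OF FA e1(1)]
 let ?E = "dcat E A"
 let ?h0 = "mar F A e0 *[?E] gam F (copy A n0) V" and ?h1 = "mar F A e1 *[?E] gam F (copy A n1) V"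
 have h0: "?h0 : Hom ?E (dob E (copy A n0) (mob F (twice A) V)) (mob F A x)" "iso_arr ?E ?h0"
  and h1: "?h1 : Hom ?E (dob E (copy A n1) (mob F (twice A) V)) (mob F A y)" "iso_arr ?E ?h1"
  using cat_comp[OF EA Fe0 g0(1)] cat_comp[OF EA Fe1 g1(1)] iso_comp(1)[OF EA Fe0 g0(1) fiso[OF FA e0] g0(2)]
   iso_comp(1)[OF EA Fe1 g1(1) fiso[OF FA e1] g1(2)] by auto
 have "is_coprod ?E (dob E (copy A n0) (mob F (twice A) V)) (dob E (copy A n1) (mob F (twice A) V)) (mob F A b)
   (mar F A i *[?E] ?h0) (mar F A j *[?E] ?h1)"
  using u unfolding univ_fold_iff[OF inf E1 PE A Fb m(1)] val[OF t(1)] val[OF t(2)] fe fcomp[OF FA i e0(1)] fcomp[OF FA j e1(1)]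
  using cat_assoc[OF EA Fi Fe0 g0(1)] cat_assoc[OF EA Fj Fe1 g1(1)] by simp
 from is_coprod_iso[OF EA this inv_arr(1)[OF EA h0] inv_arr(4)[OF EA h0] inv_arr(1)[OF EA h1] inv_arr(4)[OF EA h1]]
 show ?thesis using inv_cancel(3)[OF EA h0 Fi] inv_cancel(3)[OF EA h1 Fj] by simp
qed

lemma is_coprod_op: "is_coprod (opc C) x y b p q \<longleftrightarrow> is_prod C x y b p q"
proof (cases "p : Hom C b x & q : Hom C b y")
 case True
 have "(h : Hom C z b & h *[opc C] p = f & h *[opc C] q = g) \<longleftrightarrow> (h : Hom C z b & p *[C] h = f & q *[C] h = g)" for h z f g
  using True opc_comp[of p C b x h z] opc_comp[of q C b y h z] by auto
 then show ?thesis unfolding is_coprod_def is_prod_def opc_simps by simp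
qed (auto simp: is_coprod_def is_prod_def)

lemma mfun_prod:
 fixes D :: "('k, 'o, 'm) derivator" and A :: "'k scat"
 assumes inf: "infinite (UNIV :: 'k set)" and D: "is_derivator D" and E: "is_derivator E" and F: "exact_dmorphism D E F"
  and A: "small_cat A" and c: "is_prod (dcat D A) x y b i j"
 shows "is_prod (dcat E A) (mob F A x) (mob F A y) (mob F A b) (mar F A i) (mar F A j)"
proof -
 have M: "is_dmorphism D E F" using F by (simp add: exact_dmorphism_def)
 note PD = derD(1)[OF D] and PE = derD(1)[OF E] and ex = exact_pres[OF inf D E F]
 have oo: "opc (opc A) = A" by (rule opc_opc) (use A in \<open>simp add: small_cat_def\<close>)
 show ?thesis
  using mfun_coprod[OF inf left_derivator_op[OF inf D] left_derivator_op[OF inf E] is_dmorphism_op[OF PD PE M] ex(3,4) span_ul(2)[OF inf] small_op[OF A], of x y b i j]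
   c by (simp add: oo is_coprod_op)
qed

text \<open>Sums are defined from biproducts, which \<open>F\<close> preserves as coproducts and products with zero cross terms.\<close>

lemma mfun_additive:
 fixes D :: "('k, 'o, 'm) derivator" and A :: "'k scat"
 assumes inf: "infinite (UNIV :: 'k set)" and D: "is_derivator D" and E: "is_derivator E" and F: "exact_dmorphism D E F"
  and A: "small_cat A"
 shows "additive_functor (mfun F A)"
proof -
 have M: "is_dmorphism D E F" using F by (simp add: exact_dmorphism_def)
 note PD = derD(1)[OF D] and PE = derD(1)[OF E]
 note FA = M_fun[OF PD PE M A] and DA = D_cat[OF PD A] and EA = D_cat[OF PE A]
 note fs = funD[OF FA] and hom = fhom[OF FA] and comp = fcomp[OF FA]
 let ?F = "mar F A" and ?f = "mob F A"
 have z: "zero_arr (dcat E A) (?F k)" if zk: "zero_arr (dcat D A) k" for k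
 proof -
  obtain z g h where k: "k : Arr (dcat D A)" "zero_obj (dcat D A) z" "g : dhom D A (Dom (dcat D A) k) z"
   "h : dhom D A z (Cod (dcat D A) k)" "k = h *[dcat D A] g" using zk unfolding zero_arr_def by blast
  note kk = HomD[OF hom[OF HomI[OF k(1)]]]
  show ?thesis unfolding zero_arr_def kk(2,3)
   using kk(1) pres_zero[OF inf D E F A k(2)] hom[OF k(3)] hom[OF k(4)] comp[OF k(4,3)] k(5) by metis
 qed
 have bi: "biproduct (dcat E A) (?f x) (?f y) (?f b) (?F i) (?F j) (?F p) (?F q)" if B: "biproduct (dcat D A) x y b i j p q" for x y b i j p q
 proof -
  have h: "i : dhom D A x b" "j : dhom D A y b" "p : dhom D A b x" "q : dhom D A b y"
   and e: "p *[dcat D A] i = Id (dcat D A) x" "q *[dcat D A] j = Id (dcat D A) y" "zero_arr (dcat D A) (q *[dcat D A] i)" "zero_arr (dcat D A) (p *[dcat D A] j)"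
   and c: "is_coprod (dcat D A) x y b i j" "is_prod (dcat D A) x y b p q"
   using B unfolding biproduct_def is_coprod_def is_prod_def by blast+
  have xy: "x : dobj D A" "y : dobj D A" using cat_ob[OF DA h(1)] cat_ob[OF DA h(2)] by auto
  have "?F p *[dcat E A] ?F i = Id (dcat E A) (?f x)" "?F q *[dcat E A] ?F j = Id (dcat E A) (?f y)"
   "zero_arr (dcat E A) (?F q *[dcat E A] ?F i)" "zero_arr (dcat E A) (?F p *[dcat E A] ?F j)"
   using comp[OF h(3,1)] comp[OF h(4,2)] comp[OF h(4,1)] comp[OF h(3,2)] e fident[OF FA xy(1)] fident[OF FA xy(2)]
    z[OF e(3)] z[OF e(4)] by simp_all
  then show ?thesis
   using hom[OF h(1)] hom[OF h(2)] hom[OF h(3)] hom[OF h(4)] mfun_coprod[OF inf derivator_left[OF inf D] derivator_left[OF inf E] M exact_pres(1,2)[OF inf D E F] span_ul(1)[OF inf] A c(1)] mfun_prod[OF inf D E F A c(2)]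
   unfolding biproduct_def is_coprod_def is_prod_def by blast
 qed
 show ?thesis unfolding additive_functor_def fs(2,3)
 proof (intro conjI allI impI fs(1))
  fix f g h assume "is_sum (dcat D A) f g h"
  then obtain b i j p q d t where f: "f : Arr (dcat D A)" and g: "g : dhom D A (Dom (dcat D A) f) (Cod (dcat D A) f)"
   and B: "biproduct (dcat D A) (Cod (dcat D A) f) (Cod (dcat D A) f) b i j p q"
   and t: "t : dhom D A (Dom (dcat D A) f) b" "p *[dcat D A] t = f" "q *[dcat D A] t = g"
   and d: "d : dhom D A b (Cod (dcat D A) f)" "d *[dcat D A] i = Id (dcat D A) (Cod (dcat D A) f)" "d *[dcat D A] j = Id (dcat D A) (Cod (dcat D A) f)"
   and h: "h = d *[dcat D A] t" unfolding is_sum_def by blast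
  have hh: "i : dhom D A (Cod (dcat D A) f) b" "j : dhom D A (Cod (dcat D A) f) b"
   "p : dhom D A b (Cod (dcat D A) f)" "q : dhom D A b (Cod (dcat D A) f)"
   using B unfolding biproduct_def by auto
  note ff = HomD[OF hom[OF HomI[OF f]]] and y = cat_cod[OF DA f]
  have "?F p *[dcat E A] ?F t = ?F f" "?F q *[dcat E A] ?F t = ?F g" "?F h = ?F d *[dcat E A] ?F t"
   "?F d *[dcat E A] ?F i = Id (dcat E A) (?f (Cod (dcat D A) f))" "?F d *[dcat E A] ?F j = Id (dcat E A) (?f (Cod (dcat D A) f))"
   using comp[OF hh(3) t(1)] comp[OF hh(4) t(1)] comp[OF d(1) t(1)] comp[OF d(1) hh(1)] comp[OF d(1) hh(2)] t d h fident[OF FA y] by simp_all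
  then show "is_sum (dcat E A) (?F f) (?F g) (?F h)"
   unfolding is_sum_def ff(2,3) using ff(1) hom[OF g] bi[OF B] hom[OF t(1)] hom[OF d(1)] by blast
 qed
qed

section \<open>Shifted prederivators and their morphisms\<close>

context
 fixes A :: "'k scat"
 assumes inf: "infinite (UNIV :: 'k set)" and A: "small_cat A"
begin

lemma id_prod_id: "small_cat B ==> A ** idF B = idF (A >< B)"
proof -
 assume B: "small_cat B"
 have cB: "category B" using B by (simp add: small_cat_def)
 note p = sfun_prod[OF inf A sfun_id[OF B]]
 have id: "Farr (idF C) f = f" if "f : Hom C x y" for f x y and C :: "'k scat" using HomD(1)[OF that] by simp
 show ?thesis
 proof (rule sfun_eqI[OF p(1) sfun_id[OF small_prod[OF inf A B]]])
  fix x assume x: "x : Obj (A >< B)"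
  then obtain a b where ab: "x = Tup a b" "a : Obj A" "b : Obj B" by (auto simp: prod_simps(1))
  show "Fobj (A ** idF B) x = Fobj (idF (A >< B)) x" using p(2)[OF ab(2,3)] x ab by simp
 next
  fix h x y assume h: "h : Hom (A >< B) x y"
  then obtain a b a' b' f g where fg: "h = Tup f g" "f : Hom A a a'" "g : Hom B b b'" by (auto simp: prod_simps(2))
  show "Farr (A ** idF B) h = Farr (idF (A >< B)) h"
   unfolding id[OF h] unfolding fg(1) p(3)[OF fg(2,3)] id[OF fg(3)] ..
 qed
qed

lemma id_prod_comp:
 assumes u: "sfun u I J" and v: "sfun v J K"
 shows "A ** (v *. u) = (A ** v) *. (A ** u)"
proof -
 note pu = sfun_prod[OF inf A u] and pv = sfun_prod[OF inf A v] and pc = sfun_prod[OF inf A sfun_comp[OF u v]]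
 note us = sfunD[OF u] and cs = sfunD[OF pu(1)]
 show ?thesis
 proof (rule sfun_eqI[OF pc(1) sfun_comp[OF pu(1) pv(1)]])
  fix x assume x: "x : Obj (A >< I)"
  then obtain a b where ab: "x = Tup a b" "a : Obj A" "b : Obj I" by (auto simp: prod_simps(1))
  show "Fobj (A ** (v *. u)) x = Fobj ((A ** v) *. (A ** u)) x"
   unfolding compF_obj[OF cs(6) x] unfolding ab(1) pc(2)[OF ab(2,3)] pu(2)[OF ab(2,3)]
    pv(2)[OF ab(2) fobj[OF us(6) ab(3)]] compF_obj[OF us(6) ab(3)] ..
 next
  fix h x y assume h: "h : Hom (A >< I) x y"
  then obtain a b a' b' f g where fg: "h = Tup f g" "f : Hom A a a'" "g : Hom I b b'" by (auto simp: prod_simps(2))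
  show "Farr (A ** (v *. u)) h = Farr ((A ** v) *. (A ** u)) h"
   unfolding compF_arr[OF cs(6) h] unfolding fg(1) pc(3)[OF fg(2,3)] pu(3)[OF fg(2,3)]
    pv(3)[OF fg(2) fhom[OF us(6) fg(3)]] compF_arr[OF us(6) fg(3)] ..
 qed
qed

lemma ncell_id_prod:
 assumes a: "ncell \<alpha> u v J K"
 shows "ncell (id_prod_nat A \<alpha>) (A ** u) (A ** v) (A >< J) (A >< K)"
  and id_prod_nat_at: "x : Obj A ==> j : Obj J ==> Ncomp (id_prod_nat A \<alpha>) (Tup x j) = Tup (Id A x) (Ncomp \<alpha> j)"
proof -
 note as = ncellD[OF a]
 have cA: "category A" using A by (simp add: small_cat_def)
 note pu = sfun_prod[OF inf A as(5)] and pv = sfun_prod[OF inf A as(6)]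
 note us = sfunD[OF as(5)] and vs = sfunD[OF as(6)]
 have nd: "id_prod_nat A \<alpha> = mk_nat (A ** u) (A ** v) (\<lambda>x. Tup (Id A (ufst x)) (Ncomp \<alpha> (usnd x)))"
  by (simp add: id_prod_nat_def as(2,3))
 show "ncell (id_prod_nat A \<alpha>) (A ** u) (A ** v) (A >< J) (A >< K)" unfolding nd
 proof (rule ncell_mk_nat[OF pu(1) pv(1)])
  fix x assume x: "x : Obj (A >< J)"
  then obtain y j where yj: "x = Tup y j" "y : Obj A" "j : Obj J" by (auto simp: prod_simps(1))
  show "Tup (Id A (ufst x)) (Ncomp \<alpha> (usnd x)) : Hom (A >< K) (Fobj (A ** u) x) (Fobj (A ** v) x)"
   unfolding yj(1) pu(2)[OF yj(2,3)] pv(2)[OF yj(2,3)] using cat_id[OF cA yj(2)] as(7)[OF yj(3)] by (simp add: prod_simps(2))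
 next
  fix h x y assume h: "h : Hom (A >< J) x y"
  then obtain a b a' b' f g where fg: "x = Tup a b" "y = Tup a' b'" "h = Tup f g" "f : Hom A a a'" "g : Hom J b b'"
   by (auto simp: prod_simps(2))
  have o: "a : Obj A" "a' : Obj A" "b : Obj J" "b' : Obj J" using cat_ob[OF cA fg(4)] cat_ob[OF us(7) fg(5)] by auto
  show "Tup (Id A (ufst y)) (Ncomp \<alpha> (usnd y)) *[A >< K] Farr (A ** u) h =
   Farr (A ** v) h *[A >< K] Tup (Id A (ufst x)) (Ncomp \<alpha> (usnd x))"
   unfolding fg(1,2,3) pu(3)[OF fg(4,5)] pv(3)[OF fg(4,5)] uni.sel
    prod_simps(4)[OF cat_id[OF cA o(2)] as(7)[OF o(4)] fg(4) fhom[OF us(6) fg(5)]]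
    prod_simps(4)[OF fg(4) fhom[OF vs(6) fg(5)] cat_id[OF cA o(1)] as(7)[OF o(3)]]
    as(8)[OF fg(5)] cat_idl[OF cA fg(4)] cat_idr[OF cA fg(4)] ..
 qed
 show "Ncomp (id_prod_nat A \<alpha>) (Tup x j) = Tup (Id A x) (Ncomp \<alpha> j)" if "x : Obj A" "j : Obj J"
  using that sfunD(2)[OF pu(1)] unfolding nd by (simp add: prod_simps(1))
qed

lemma id_prod_nat_laws:
 fixes B :: "'k scat"
 shows "sfun u J K ==> id_prod_nat A (idN u) = idN (A ** u)"
  "ncell \<alpha> u v J K ==> ncell \<beta> v w J K ==> id_prod_nat A (\<beta> *N \<alpha>) = id_prod_nat A \<beta> *N id_prod_nat A \<alpha>"
  "ncell \<alpha> u v J K ==> sfun t K L ==> id_prod_nat A (t *L \<alpha>) = (A ** t) *L id_prod_nat A \<alpha>"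
  "ncell \<alpha> u v J K ==> sfun s I J ==> id_prod_nat A (\<alpha> *R s) = id_prod_nat A \<alpha> *R (A ** s)"
proof -
 have cA: "category A" using A by (simp add: small_cat_def)
 { assume u: "sfun u J K"
  note us = sfunD[OF u] and pu = sfun_prod[OF inf A u]
  show "id_prod_nat A (idN u) = idN (A ** u)"
  proof (rule ncell_eqI[OF ncell_id_prod(1)[OF ncell_id[OF u]] ncell_id[OF pu(1)]])
   fix x assume x: "x : Obj (A >< J)"
   then obtain y j where yj: "x = Tup y j" "y : Obj A" "j : Obj J" by (auto simp: prod_simps(1))
   have "Ncomp (idN (A ** u)) x = Id (A >< K) (Tup y (Fobj u j))"
    using x sfunD(2,3)[OF pu(1)] pu(2)[OF yj(2,3)] yj(1) by simp
   also have "\<dots> = Tup (Id A y) (Id K (Fobj u j))" by (rule prod_simps(3)[OF yj(2) fobj[OF us(6) yj(3)]])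
   finally show "Ncomp (id_prod_nat A (idN u)) x = Ncomp (idN (A ** u)) x"
    using id_prod_nat_at[OF ncell_id[OF u] yj(2,3)] us(2,3) yj by simp
  qed }
 { assume a: "ncell \<alpha> u v J K" and b: "ncell \<beta> v w J K"
  note as = ncellD[OF a] and bs = ncellD[OF b] and na = ncell_id_prod(1)[OF a] and nb = ncell_id_prod(1)[OF b]
  note us = sfunD[OF as(5)]
  show "id_prod_nat A (\<beta> *N \<alpha>) = id_prod_nat A \<beta> *N id_prod_nat A \<alpha>"
  proof (rule ncell_eqI[OF ncell_id_prod(1)[OF ncell_vcomp[OF a b]] ncell_vcomp[OF na nb]])
   fix x assume x: "x : Obj (A >< J)"
   then obtain y j where yj: "x = Tup y j" "y : Obj A" "j : Obj J" by (auto simp: prod_simps(1))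
   have "Ncomp (id_prod_nat A \<beta> *N id_prod_nat A \<alpha>) x = Ncomp (id_prod_nat A \<beta>) x *[A >< K] Ncomp (id_prod_nat A \<alpha>) x"
    using x ncellD(2)[OF na] sfunD(2,3)[OF ncellD(5)[OF na]] by simp
   also have "\<dots> = Tup (Id A y) (Ncomp \<beta> j *[K] Ncomp \<alpha> j)"
    unfolding yj(1) id_prod_nat_at[OF a yj(2,3)] id_prod_nat_at[OF b yj(2,3)]
     prod_simps(4)[OF cat_id[OF cA yj(2)] bs(7)[OF yj(3)] cat_id[OF cA yj(2)] as(7)[OF yj(3)]]
     cat_idl[OF cA cat_id[OF cA yj(2)]] ..
   also have "\<dots> = Ncomp (id_prod_nat A (\<beta> *N \<alpha>)) x"
    unfolding yj(1) id_prod_nat_at[OF ncell_vcomp[OF a b] yj(2,3)] using yj(3) as(2) us(2,3) by simp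
   finally show "Ncomp (id_prod_nat A (\<beta> *N \<alpha>)) x = Ncomp (id_prod_nat A \<beta> *N id_prod_nat A \<alpha>) x" ..
  qed }
 { assume a: "ncell \<alpha> u v J K" and t: "sfun t K L"
  note as = ncellD[OF a] and na = ncell_id_prod(1)[OF a] and us = sfunD[OF ncellD(5)[OF a]] and pt = sfun_prod[OF inf A t]
  note n1 = ncell_id_prod(1)[OF ncell_whiskL[OF a t]] and n2 = ncell_whiskL[OF na pt(1)]
  show "id_prod_nat A (t *L \<alpha>) = (A ** t) *L id_prod_nat A \<alpha>"
  proof (rule ncell_eqI[OF n1[unfolded id_prod_comp[OF as(5) t] id_prod_comp[OF as(6) t]] n2])
   fix x assume x: "x : Obj (A >< J)"
   then obtain y j where yj: "x = Tup y j" "y : Obj A" "j : Obj J" by (auto simp: prod_simps(1))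
   have "Ncomp ((A ** t) *L id_prod_nat A \<alpha>) x = Farr (A ** t) (Ncomp (id_prod_nat A \<alpha>) x)"
    using x ncellD(2)[OF na] sfunD(2,3)[OF ncellD(5)[OF na]] by simp
   also have "\<dots> = Tup (Id A y) (Farr t (Ncomp \<alpha> j))"
    unfolding yj(1) id_prod_nat_at[OF a yj(2,3)] pt(3)[OF cat_id[OF cA yj(2)] as(7)[OF yj(3)]] ..
   also have "\<dots> = Ncomp (id_prod_nat A (t *L \<alpha>)) x"
    unfolding yj(1) id_prod_nat_at[OF ncell_whiskL[OF a t] yj(2,3)] using yj(3) as(2) us(2,3) by simp
   finally show "Ncomp (id_prod_nat A (t *L \<alpha>)) x = Ncomp ((A ** t) *L id_prod_nat A \<alpha>) x" ..
  qed }
 { assume a: "ncell \<alpha> u v J K" and s: "sfun s I J"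
  note as = ncellD[OF a] and na = ncell_id_prod(1)[OF a] and ss = sfunD[OF s] and ps = sfun_prod[OF inf A s]
  note n1 = ncell_id_prod(1)[OF ncell_whiskR[OF a s]] and n2 = ncell_whiskR[OF na ps(1)]
  show "id_prod_nat A (\<alpha> *R s) = id_prod_nat A \<alpha> *R (A ** s)"
  proof (rule ncell_eqI[OF n1[unfolded id_prod_comp[OF s as(5)] id_prod_comp[OF s as(6)]] n2])
   fix x assume x: "x : Obj (A >< I)"
   then obtain y j where yj: "x = Tup y j" "y : Obj A" "j : Obj I" by (auto simp: prod_simps(1))
   have "Ncomp (id_prod_nat A \<alpha> *R (A ** s)) x = Ncomp (id_prod_nat A \<alpha>) (Fobj (A ** s) x)"
    using x sfunD(2,3)[OF ps(1)] by simp
   also have "\<dots> = Tup (Id A y) (Ncomp \<alpha> (Fobj s j))"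
    unfolding yj(1) ps(2)[OF yj(2,3)] id_prod_nat_at[OF a yj(2) fobj[OF ss(6) yj(3)]] ..
   also have "\<dots> = Ncomp (id_prod_nat A (\<alpha> *R s)) x"
    unfolding yj(1) id_prod_nat_at[OF ncell_whiskR[OF a s] yj(2,3)] using yj(3) ss(2) by simp
   finally show "Ncomp (id_prod_nat A (\<alpha> *R s)) x = Ncomp (id_prod_nat A \<alpha> *R (A ** s)) x" ..
  qed }
qed

lemma is_prederivator_shift:
 fixes D :: "('k, 'o, 'm) derivator"
 assumes P: "is_prederivator D"
 shows "is_prederivator (shift D A)"
proof -
 have sm: "small_fun (A ** u) & Fdom (A ** u) = A >< Fdom u & Fcod (A ** u) = A >< Fcod u" if "small_fun u" for u :: "'k sfun"
  using sfunD(1,2,3)[OF sfun_prod(1)[OF inf A small_fun_sfun[OF that]]] by simp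
 have sn: "small_nat (id_prod_nat A \<alpha>) & Nsrc (id_prod_nat A \<alpha>) = A ** Nsrc \<alpha> & Ntgt (id_prod_nat A \<alpha>) = A ** Ntgt \<alpha>" 
  if "small_nat \<alpha>" for \<alpha> :: "'k snat"
  using ncellD(1,2,3)[OF ncell_id_prod(1)[OF small_nat_ncell[OF that]]] by simp
 have nf: "small_fun (Nsrc \<alpha>)" "small_fun (Ntgt \<alpha>)" "Fdom (Ntgt \<alpha>) = Fdom (Nsrc \<alpha>)" "Fcod (Ntgt \<alpha>) = Fcod (Nsrc \<alpha>)" 
  if "small_nat \<alpha>" for \<alpha> :: "'k snat"
  using that unfolding small_nat_def is_ntrans_def Let_def by auto
 note PP = P[unfolded is_prederivator_def]
 show ?thesis unfolding is_prederivator_def shift_def prederivator.simps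
 proof (intro conjI allI impI)
  fix B :: "'k scat" assume B: "small_cat B"
  show "category (dcat D (A >< B))" by (rule D_cat[OF P small_prod[OF inf A B]])
  show "dfun D (A ** idF B) = idF (dcat D (A >< B))"
   unfolding id_prod_id[OF B] by (rule D_idF[OF P small_prod[OF inf A B]])
 next
  fix u :: "'k sfun" assume u: "small_fun u"
  note p = sfun_prod(1)[OF inf A small_fun_sfun[OF u]]
  show "is_functor (dfun D (A ** u))" "Fdom (dfun D (A ** u)) = dcat D (A >< Fcod u)"
   "Fcod (dfun D (A ** u)) = dcat D (A >< Fdom u)" using funD(1,2,3)[OF D_fun[OF P p]] .
  show "dnat D (id_prod_nat A (idN u)) = idN (dfun D (A ** u))"
   unfolding id_prod_nat_laws(1)[OF small_fun_sfun[OF u]] using PP sfunD(1)[OF p] by blast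
 next
  fix \<alpha> :: "'k snat" assume a: "small_nat \<alpha>"
  note p = ncell_id_prod(1)[OF small_nat_ncell[OF a]]
  show "is_ntrans (dnat D (id_prod_nat A \<alpha>))" "Nsrc (dnat D (id_prod_nat A \<alpha>)) = dfun D (A ** Nsrc \<alpha>)"
   "Ntgt (dnat D (id_prod_nat A \<alpha>)) = dfun D (A ** Ntgt \<alpha>)" using D_nat[OF P p] by auto
 next
  fix u v :: "'k sfun" assume u: "small_fun u" and v: "small_fun v" and uv: "Fcod u = Fdom v"
  note su = small_fun_sfun[OF u] and sv = small_fun_sfun[OF v, folded uv]
  show "dfun D (A ** (v *. u)) = dfun D (A ** u) *. dfun D (A ** v)"
   unfolding id_prod_comp[OF su sv] by (rule D_compF[OF P sfun_prod(1)[OF inf A su] sfun_prod(1)[OF inf A sv]])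
 next
  fix \<alpha> \<beta> :: "'k snat" assume a: "small_nat \<alpha>" and b: "small_nat \<beta>" and ab: "Ntgt \<alpha> = Nsrc \<beta>"
  note na = small_nat_ncell[OF a]
  have nb: "ncell \<beta> (Ntgt \<alpha>) (Ntgt \<beta>) (Fdom (Nsrc \<alpha>)) (Fcod (Nsrc \<alpha>))" 
   using small_nat_ncell[OF b] nf(3,4)[OF a] unfolding ab[symmetric] by simp
  show "dnat D (id_prod_nat A (\<beta> *N \<alpha>)) = dnat D (id_prod_nat A \<beta>) *N dnat D (id_prod_nat A \<alpha>)"
   unfolding id_prod_nat_laws(2)[OF na nb] using PP sn[OF a] sn[OF b] ab by simp
 next
  fix w :: "'k sfun" and \<alpha> :: "'k snat" assume w: "small_fun w" and a: "small_nat \<alpha>" and e: "Fcod (Nsrc \<alpha>) = Fdom w"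
  note na = small_nat_ncell[OF a] and sw = small_fun_sfun[OF w, folded e]
  show "dnat D (id_prod_nat A (w *L \<alpha>)) = dnat D (id_prod_nat A \<alpha>) *R dfun D (A ** w)"
   unfolding id_prod_nat_laws(3)[OF na sw] using PP sn[OF a] sm[OF w] sm[OF nf(1)[OF a]] e by simp
 next
  fix w :: "'k sfun" and \<alpha> :: "'k snat" assume a: "small_nat \<alpha>" and w: "small_fun w" and e: "Fcod w = Fdom (Nsrc \<alpha>)"
  note na = small_nat_ncell[OF a] and sw = small_fun_sfun[OF w, unfolded e]
  show "dnat D (id_prod_nat A (\<alpha> *R w)) = dfun D (A ** w) *L dnat D (id_prod_nat A \<alpha>)"
   unfolding id_prod_nat_laws(4)[OF na sw] using PP sn[OF a] sm[OF w] sm[OF nf(1)[OF a]] e by simp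
 qed
qed

lemma Der3_shift:
 fixes D :: "('k, 'o, 'm) derivator"
 shows "Der3 D ==> Der3 (shift D A)"
 unfolding Der3_def shift_def derivator.simps prederivator.simps
 using sfunD(1)[OF sfun_prod(1)[OF inf A small_fun_sfun]] by blast

lemma is_dmorphism_shift:
 fixes D :: "('k, 'o, 'm) derivator" and E :: "('k, 'p, 'n) derivator"
 assumes M: "is_dmorphism D E F"
 shows "is_dmorphism (shift D A) (shift E A) (mshift F A)"
proof -
 have sm: "small_fun (A ** u) & Fdom (A ** u) = A >< Fdom u & Fcod (A ** u) = A >< Fcod u" if "small_fun u" for u :: "'k sfun"
  using sfunD(1,2,3)[OF sfun_prod(1)[OF inf A small_fun_sfun[OF that]]] by simp
 have sn: "small_nat (id_prod_nat A \<alpha>) & Nsrc (id_prod_nat A \<alpha>) = A ** Nsrc \<alpha> & Ntgt (id_prod_nat A \<alpha>) = A ** Ntgt \<alpha>" 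
  if "small_nat \<alpha>" for \<alpha> :: "'k snat"
  using ncellD(1,2,3)[OF ncell_id_prod(1)[OF small_nat_ncell[OF that]]] by simp
 have nf: "small_fun (Nsrc \<alpha>)" if "small_nat \<alpha>" for \<alpha> :: "'k snat"
  using that unfolding small_nat_def by auto
 have M1: "is_functor (mfun F B) & Fdom (mfun F B) = dcat D B & Fcod (mfun F B) = dcat E B"
   "mgam F (idF B) = idN (mfun F B)" if "small_cat B" for B using M that unfolding is_dmorphism_def by blast+
 have M2: "nat_iso (mgam F u) & Nsrc (mgam F u) = dfun E u *. mfun F (Fcod u) & Ntgt (mgam F u) = mfun F (Fdom u) *. dfun D u" if "small_fun u" for u
  using M that unfolding is_dmorphism_def by blast
 have M3: "mgam F (v *. u) = (mgam F u *R dfun D v) *N (dfun E u *L mgam F v)" if "small_fun u" "small_fun v" "Fcod u = Fdom v" for u v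
  using M that unfolding is_dmorphism_def by blast
 have M4: "(mfun F (Fdom (Nsrc \<alpha>)) *L dnat D \<alpha>) *N mgam F (Nsrc \<alpha>) =
   mgam F (Ntgt \<alpha>) *N (dnat E \<alpha> *R mfun F (Fcod (Nsrc \<alpha>)))" if "small_nat \<alpha>" for \<alpha>
  using M that unfolding is_dmorphism_def by blast
 show ?thesis unfolding is_dmorphism_def shift_def mshift_def prederivator.simps dmorphism.simps
 proof (intro conjI allI impI)
  fix B :: "'k scat" assume B: "small_cat B"
  show "is_functor (mfun F (A >< B))" "Fdom (mfun F (A >< B)) = dcat D (A >< B)" "Fcod (mfun F (A >< B)) = dcat E (A >< B)"
   "mgam F (A ** idF B) = idN (mfun F (A >< B))"
   using M1[OF small_prod[OF inf A B]] id_prod_id[OF B] by auto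
 next
  fix u :: "'k sfun" assume u: "small_fun u"
  show "nat_iso (mgam F (A ** u))"
   "Nsrc (mgam F (A ** u)) = dfun E (A ** u) *. mfun F (A >< Fcod u)"
   "Ntgt (mgam F (A ** u)) = mfun F (A >< Fdom u) *. dfun D (A ** u)"
   using M2[of "A ** u"] sm[OF u] by auto
 next
  fix u v :: "'k sfun" assume u: "small_fun u" and v: "small_fun v" and uv: "Fcod u = Fdom v"
  note su = small_fun_sfun[OF u] and sv = small_fun_sfun[OF v, folded uv]
  show "mgam F (A ** (v *. u)) = (mgam F (A ** u) *R dfun D (A ** v)) *N (dfun E (A ** u) *L mgam F (A ** v))"
   unfolding id_prod_comp[OF su sv] by (rule M3) (use sm[OF u] sm[OF v] uv in auto)
 next
  fix \<alpha> :: "'k snat" assume a: "small_nat \<alpha>"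
  show "(mfun F (A >< Fdom (Nsrc \<alpha>)) *L dnat D (id_prod_nat A \<alpha>)) *N mgam F (A ** Nsrc \<alpha>) =
   mgam F (A ** Ntgt \<alpha>) *N (dnat E (id_prod_nat A \<alpha>) *R mfun F (A >< Fcod (Nsrc \<alpha>)))"
   using M4[of "id_prod_nat A \<alpha>"] sn[OF a] sm[OF nf[OF a]] by simp
 qed
qed

end

section \<open>Suspension, comparison map and the maps phi\<close>

lemma Susp_fun:
 fixes D :: "('k, 'o, 'm) derivator"
 assumes inf: "infinite (UNIV :: 'k set)" and P: "is_prederivator D" and D3: "Der3 D"
 shows "is_fun (Susp D) (dcat D one_cat) (dcat D one_cat)"
  "W : dobj D one_cat ==> Fobj (Susp D) W = dob D (pt square (pos 1 1)) (Fobj (lan D i_ul) (Fobj (ran D i_00) W))"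
  "w : dhom D one_cat W W' ==> Farr (Susp D) w = dar D (pt square (pos 1 1)) (Farr (lan D i_ul) (Farr (ran D i_00) w))"
proof -
 have c: "pos 1 1 : Obj (square :: 'k scat)" by (simp add: square_simps)
 note e = D_fun[OF P sfun_pt[OF inf small_square[OF inf] c]]
 note l = lan_adj(2)[OF D3 P sfun_i_ul(1)[OF inf]] and r = ran_adj(2)[OF D3 P sfun_i_00[OF inf]]
 note lr = comp_fun[OF r l]
 show "is_fun (Susp D) (dcat D one_cat) (dcat D one_cat)" unfolding Susp_def by (rule comp_fun[OF lr e])
 show "W : dobj D one_cat ==> Fobj (Susp D) W = dob D (pt square (pos 1 1)) (Fobj (lan D i_ul) (Fobj (ran D i_00) W))"
  unfolding Susp_def by (simp add: compF_obj[OF lr] compF_obj[OF r])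
 show "w : dhom D one_cat W W' ==> Farr (Susp D) w = dar D (pt square (pos 1 1)) (Farr (lan D i_ul) (Farr (ran D i_00) w))"
  unfolding Susp_def by (simp add: compF_arr[OF lr] compF_arr[OF r])
qed

text \<open>Let \<open>a: Y \<rightarrow> i_ul\<^sup>* Z\<close>, and let \<open>b: Y\<^sub>0\<^sub>0 \<rightarrow> W\<close> exhibit \<open>Y\<close> as \<open>i\<^sub>* W\<close>, through \<open>c\<close>. Then \<open>a\<close> extends uniquely to a map \<open>h\<close> from
\<open>(i_ul)\<^sub>! i\<^sub>* W\<close> to \<open>Z\<close>, and \<open>t: \<Sigma> W \<rightarrow> Z\<^sub>1\<^sub>1\<close> is its value at \<open>(1,1)\<close>. For \<open>Y = i_ul\<^sup>* Z\<close> and identities this is \<open>\<phi>\<close>; for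
the images under \<open>F\<close> of unit and counit it is \<open>\<psi>\<close>.\<close>

definition susp_map :: "('k, 'o, 'm) derivator => 'o => 'o => 'o => 'm => 'm => 'm => bool" where
 "susp_map D Z Y W a b t \<longleftrightarrow>
  Z : dobj D square & W : dobj D one_cat &
  a : dhom D ul Y (dob D i_ul Z) & b : dhom D one_cat (dob D i_00 Y) W &
  (\<exists>h c. h : dhom D square (Fobj (lan D i_ul) (Fobj (ran D i_00) W)) Z &
   c : dhom D ul Y (Fobj (ran D i_00) W) & iso_arr (dcat D ul) c &
   Ncomp (ran_counit D i_00) W *[dcat D one_cat] dar D i_00 c = b &
   dar D i_ul h *[dcat D ul] (Ncomp (lan_unit D i_ul) (Fobj (ran D i_00) W) *[dcat D ul] c) = a &
   t = dar D (pt square (pos 1 1)) h)"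

lemma susp_mapI:
 fixes D :: "('k, 'o, 'm) derivator"
 assumes "Z : dobj D square" "W : dobj D one_cat"
  "a : dhom D ul Y (dob D i_ul Z)" "b : dhom D one_cat (dob D i_00 Y) W"
  "h : dhom D square (Fobj (lan D i_ul) (Fobj (ran D i_00) W)) Z"
  "c : dhom D ul Y (Fobj (ran D i_00) W)" "iso_arr (dcat D ul) c"
  "Ncomp (ran_counit D i_00) W *[dcat D one_cat] dar D i_00 c = b"
  "dar D i_ul h *[dcat D ul] (Ncomp (lan_unit D i_ul) (Fobj (ran D i_00) W) *[dcat D ul] c) = a"
 shows "susp_map D Z Y W a b (dar D (pt square (pos 1 1)) h)"
 using assms unfolding susp_map_def by blast

lemma susp_map_hom:
 fixes D :: "('k, 'o, 'm) derivator"
 assumes inf: "infinite (UNIV :: 'k set)" and P: "is_prederivator D" and D3: "Der3 D"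
  and s: "susp_map D Z Y W a b t"
 shows "t : dhom D one_cat (Fobj (Susp D) W) (dob D (pt square (pos 1 1)) Z)"
proof -
 have c: "pos 1 1 : Obj (square :: 'k scat)" by (simp add: square_simps)
 have W: "W : dobj D one_cat" using s unfolding susp_map_def by blast
 obtain h where h: "h : dhom D square (Fobj (lan D i_ul) (Fobj (ran D i_00) W)) Z" "t = dar D (pt square (pos 1 1)) h"
  using s unfolding susp_map_def by blast
 show ?thesis unfolding h(2) Susp_fun(2)[OF inf P D3 W]
  by (rule fhom[OF D_fun[OF P sfun_pt[OF inf small_square[OF inf] c]] h(1)])
qed

text \<open>Both extensions are determined by their restrictions along \<open>i_ul\<close> and at \<open>(0,0)\<close>, where the squares commute.\<close>

lemma susp_map_natural:
 fixes D :: "('k, 'o, 'm) derivator"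
 assumes inf: "infinite (UNIV :: 'k set)" and P: "is_prederivator D" and D3: "Der3 D"
  and s: "susp_map D Z Y W a b t" and s': "susp_map D Z' Y' W' a' b' t'"
  and z: "z : dhom D square Z Z'" and y: "y : dhom D ul Y Y'" and w: "w : dhom D one_cat W W'"
  and az: "dar D i_ul z *[dcat D ul] a = a' *[dcat D ul] y"
  and bw: "w *[dcat D one_cat] b = b' *[dcat D one_cat] dar D i_00 y"
 shows "t' *[dcat D one_cat] Farr (Susp D) w = dar D (pt square (pos 1 1)) z *[dcat D one_cat] t"
proof -
 have cn: "pos 1 1 : Obj (square :: 'k scat)" by (simp add: square_simps)
 note su = sfun_i_ul(1)[OF inf] and si = sfun_i_00[OF inf]
 note Fe = D_fun[OF P sfun_pt[OF inf small_square[OF inf] cn]] and Fs = D_fun[OF P su] and Fi = D_fun[OF P si]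
 note L = lan_adj[OF D3 P su] and R = ran_adj[OF D3 P si]
 note DU = funD(5)[OF Fs] and D1 = funD(5)[OF Fi] and DS = funD(4)[OF Fs]
 let ?S = "dcat D square" and ?U = "dcat D ul" and ?O = "dcat D one_cat"
 let ?s = "dar D i_ul" and ?i = "dar D i_00" and ?l = "Farr (lan D i_ul)" and ?r = "Farr (ran D i_00)"
 let ?iW = "Fobj (ran D i_00) W" and ?iW' = "Fobj (ran D i_00) W'"
 let ?n = "Ncomp (lan_unit D i_ul) ?iW" and ?n' = "Ncomp (lan_unit D i_ul) ?iW'" and ?k = "Ncomp (ran_counit D i_00)"
 have W: "W : Obj ?O" and W': "W' : Obj ?O" using s s' unfolding susp_map_def by blast+
 obtain h c where h: "h : Hom ?S (Fobj (lan D i_ul) ?iW) Z" and c: "c : Hom ?U Y ?iW" "iso_arr ?U c" "?k W *[?O] ?i c = b"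
  and hc: "?s h *[?U] (?n *[?U] c) = a" and t: "t = dar D (pt square (pos 1 1)) h"
  using s unfolding susp_map_def by blast
 obtain h' c' where h': "h' : Hom ?S (Fobj (lan D i_ul) ?iW') Z'" and c': "c' : Hom ?U Y' ?iW'" "?k W' *[?O] ?i c' = b'"
  and hc': "?s h' *[?U] (?n' *[?U] c') = a'" and t': "t' = dar D (pt square (pos 1 1)) h'"
  using s' unfolding susp_map_def by blast
 note iW = fobj[OF R(2) W] and iW' = fobj[OF R(2) W']
 note n = adjD(2)[OF L iW] and n' = adjD(2)[OF L iW'] and k = adjD(3)[OF R(1) Fi W] and k' = adjD(3)[OF R(1) Fi W']
 note rw = fhom[OF R(2) w] and lrw = fhom[OF L(2) fhom[OF R(2) w]]
 note sh = fhom[OF Fs h] and sh' = fhom[OF Fs h'] and sz = fhom[OF Fs z] and slw = fhom[OF Fs lrw]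
 note hl = cat_comp[OF DS h' lrw] and zh = cat_comp[OF DS z h]
 \<comment> \<open>the transposes of the two left legs agree after the counit\<close>
 have 1: "?r w *[?U] c = c' *[?U] y"
 proof (rule counivD(5)[OF Fi adjunction_couniv[OF R(1) Fi W'] cat_comp[OF DU rw c(1)] cat_comp[OF DU c'(1) y]])
  have "?k W' *[?O] ?i (?r w *[?U] c) = (?k W' *[?O] ?i (?r w)) *[?O] ?i c"
   unfolding fcomp[OF Fi rw c(1)] using cat_assoc[OF D1 k' fhom[OF Fi rw] fhom[OF Fi c(1)]] by simp
  also have "\<dots> = w *[?O] (?k W *[?O] ?i c)"
   unfolding adjD(5)[OF R(1) Fi w] by (rule cat_assoc[OF D1 w k fhom[OF Fi c(1)]])
  also have "\<dots> = (?k W' *[?O] ?i c') *[?O] ?i y" unfolding c(3) c'(2) by (rule bw)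
  also have "\<dots> = ?k W' *[?O] ?i (c' *[?U] y)"
   unfolding fcomp[OF Fi c'(1) y] by (rule cat_assoc[OF D1 k' fhom[OF Fi c'(1)] fhom[OF Fi y]])
  finally show "?k W' *[?O] ?i (?r w *[?U] c) = ?k W' *[?O] ?i (c' *[?U] y)" .
 qed
 have 2: "(?s (h' *[?S] ?l (?r w)) *[?U] ?n) *[?U] c = (?s (z *[?S] h) *[?U] ?n) *[?U] c"
 proof -
  have "(?s (h' *[?S] ?l (?r w)) *[?U] ?n) *[?U] c = ?s h' *[?U] ((?s (?l (?r w)) *[?U] ?n) *[?U] c)"
   unfolding fcomp[OF Fs h' lrw] cat_assoc[OF DU sh' slw n] by (rule cat_assoc[OF DU sh' cat_comp[OF DU slw n] c(1)])
  also have "\<dots> = ?s h' *[?U] (?n' *[?U] (?r w *[?U] c))"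
   unfolding adjD(4)[OF L rw] cat_assoc[OF DU n' rw c(1)] ..
  also have "\<dots> = a' *[?U] y"
   unfolding 1 hc'[symmetric] using cat_assoc[OF DU n' c'(1) y] cat_assoc[OF DU sh' cat_comp[OF DU n' c'(1)] y] by simp
  also have "\<dots> = ?s z *[?U] (?s h *[?U] (?n *[?U] c))" unfolding hc az ..
  also have "\<dots> = (?s (z *[?S] h) *[?U] ?n) *[?U] c"
   unfolding fcomp[OF Fs z h] cat_assoc[OF DU cat_comp[OF DU sz sh] n c(1)]
   by (rule cat_assoc[OF DU sz sh cat_comp[OF DU n c(1)], symmetric])
  finally show ?thesis .
 qed
 note i = inv_cancel(3)[OF DU c(1,2)]
 have 3: "?s (h' *[?S] ?l (?r w)) *[?U] ?n = ?s (z *[?S] h) *[?U] ?n"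
  using i[OF cat_comp[OF DU fhom[OF Fs hl] n]] i[OF cat_comp[OF DU fhom[OF Fs zh] n]] unfolding 2 by metis
 have "h' *[?S] ?l (?r w) = z *[?S] h"
  by (rule univD(5)[OF Fs adj_univ[OF L iW] hl zh 3])
 then show ?thesis unfolding t t' Susp_fun(3)[OF inf P D3 w]
  using fcomp[OF Fe h' lrw] fcomp[OF Fe z h] by simp
qed

lemma phi_susp_map:
 fixes D :: "('k, 'o, 'm) derivator"
 assumes inf: "infinite (UNIV :: 'k set)" and P: "is_prederivator D" and D3: "Der3 D"
  and S: "S : dobj D square"
  and i: "iso_arr (dcat D ul) (Ncomp (ran_unit D i_00) (dob D i_ul S))"
 defines "Y \<equiv> dob D i_ul S"
 shows "susp_map D S Y (dob D i_00 Y) (Id (dcat D ul) Y) (Id (dcat D one_cat) (dob D i_00 Y)) (phi D S)"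
  "univ (dfun D i_ul) Y S (Id (dcat D ul) Y) ==> iso_arr (dcat D one_cat) (phi D S)"
proof -
 have cn: "pos 1 1 : Obj (square :: 'k scat)" by (simp add: square_simps)
 note su = sfun_i_ul(1)[OF inf] and si = sfun_i_00[OF inf]
 note Fe = D_fun[OF P sfun_pt[OF inf small_square[OF inf] cn]] and Fs = D_fun[OF P su] and Fi = D_fun[OF P si]
 note L = lan_adj[OF D3 P su] and R = ran_adj[OF D3 P si]
 note DU = funD(5)[OF Fs] and D1 = funD(5)[OF Fi] and DS = funD(4)[OF Fs]
 have Y: "Y : dobj D ul" using fobj[OF Fs S] unfolding Y_def .
 note W = fobj[OF Fi Y]
 let ?n = "Ncomp (ran_unit D i_00) Y"
 note n = adjD(2)[OF R(1) Fi Y] and i' = i[folded Y_def]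
 note ni = inv_arr[OF DU n i']
 let ?h = "Ncomp (lan_counit D i_ul) S *[dcat D square] Farr (lan D i_ul) (inv_arr (dcat D ul) ?n)"
 have ni1: "inv_arr (dcat D ul) ?n : dhom D ul (Fobj (ran D i_00) (dob D i_00 Y)) (dob D i_ul S)" using ni(1) unfolding Y_def .
 note T = adjunction_transpose[OF L ni1 S]
 have e: "dar D i_ul ?h *[dcat D ul] (Ncomp (lan_unit D i_ul) (Fobj (ran D i_00) (dob D i_00 Y)) *[dcat D ul] ?n) = Id (dcat D ul) Y"
  using cat_assoc[OF DU fhom[OF Fs T(1)] adjD(2)[OF L fobj[OF R(2) W]] n] T(2) ni(2) by simp
 have ph: "phi D S = dar D (pt square (pos 1 1)) ?h" unfolding phi_def Let_def Y_def ..
 show "susp_map D S Y (dob D i_00 Y) (Id (dcat D ul) Y) (Id (dcat D one_cat) (dob D i_00 Y)) (phi D S)"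
  unfolding ph
 proof (rule susp_mapI[OF S W _ _ T(1) n i' _ e])
  show "Id (dcat D ul) Y : dhom D ul Y (dob D i_ul S)" using cat_id[OF DU Y] unfolding Y_def .
  show "Id (dcat D one_cat) (dob D i_00 Y) : dhom D one_cat (dob D i_00 Y) (dob D i_00 Y)" by (rule cat_id[OF D1 W])
  show "Ncomp (ran_counit D i_00) (dob D i_00 Y) *[dcat D one_cat] dar D i_00 ?n = Id (dcat D one_cat) (dob D i_00 Y)"
   by (rule adjD(6)[OF R(1) Fi Y])
 qed
 assume u: "univ (dfun D i_ul) Y S (Id (dcat D ul) Y)"
 have "Id (dcat D ul) Y : dhom D ul Y (dob D i_ul S)" using cat_id[OF DU Y] unfolding Y_def .
 from univ_precomp_iso[OF Fs u ni(1,4)]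
 have "univ (dfun D i_ul) (Fobj (ran D i_00) (dob D i_00 Y)) S (inv_arr (dcat D ul) ?n)" using cat_idl[OF DU ni(1)] by simp
 then have "iso_arr (dcat D square) ?h" using T(3) by simp
 then show "iso_arr (dcat D one_cat) (phi D S)" unfolding ph using fiso[OF Fe T(1)] by simp
qed

context
 fixes D :: "('k, 'o, 'm) derivator" and E :: "('k, 'p, 'n) derivator" and F :: "('k, 'o, 'm, 'p, 'n) dmorphism"
 assumes inf: "infinite (UNIV :: 'k set)" and PD: "is_prederivator D" and PE: "is_prederivator E" and M: "is_dmorphism D E F"
  and D3: "Der3 D" and E3: "Der3 E"
  and pl: "preserves_lan D E F i_ul" and pr: "preserves_ran D E F i_00"
begin

lemma mimg_precomp:
 assumes u: "sfun u A B" and Y: "Y : dobj D B" and f: "f : dhom D A X (dob D u Y)" and g: "g : dhom D A X' X"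
 shows "mimg E F u Y (f *[dcat D A] g) = mimg E F u Y f *[dcat E A] mar F A g"
proof -
 note FA = M_fun[OF PD PE M sfunD(4)[OF u]] and EA = D_cat[OF PE sfunD(4)[OF u]]
 show ?thesis unfolding mimg_def sfunD(2)[OF u] fcomp[OF FA f g]
  by (rule cat_assoc[OF EA inv_arr(1)[OF EA gam_hom[OF PD PE M u Y]] fhom[OF FA f] fhom[OF FA g], symmetric])
qed

lemma mcoimg_postcomp:
 assumes u: "sfun u A B" and Y: "Y : dobj D B" and f: "f : dhom D A (dob D u Y) X" and g: "g : dhom D A X X'"
 shows "mcoimg E F u Y (g *[dcat D A] f) = mar F A g *[dcat E A] mcoimg E F u Y f"
proof -
 note FA = M_fun[OF PD PE M sfunD(4)[OF u]] and EA = D_cat[OF PE sfunD(4)[OF u]]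
 show ?thesis unfolding mcoimg_def sfunD(2)[OF u] fcomp[OF FA g f]
  by (rule cat_assoc[OF EA fhom[OF FA g] fhom[OF FA f] gam_hom(1)[OF PD PE M u Y]])
qed

text \<open>The data in \<open>E\<close> are the images of those in \<open>D\<close>, corrected by \<open>\<gamma>\<close>; the mates of which \<open>\<psi>\<close> is composed compare the
universal maps.\<close>

lemma susp_map_image:
 assumes s: "susp_map D Z Y W a b t"
 shows "\<exists>t'. susp_map E (mob F square Z) (mob F ul Y) (mob F one_cat W) (mimg E F i_ul Z a) (mcoimg E F i_00 Y b) t' &
  gam F (pt square (pos 1 1)) Z *[dcat E one_cat] t' = mar F one_cat t *[dcat E one_cat] Ncomp (psi D E F) W"
  "Z = Fobj (lan D i_ul) (Fobj (ran D i_00) W) ==> a = Ncomp (lan_unit D i_ul) (Fobj (ran D i_00) W) ==> b = Ncomp (ran_counit D i_00) W ==> 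
    Ncomp (psi D E F) W : dhom E one_cat (Fobj (Susp E) (mob F one_cat W)) (mob F one_cat (Fobj (Susp D) W)) &
    iso_arr (dcat E one_cat) (Ncomp (psi D E F) W)"
proof -
 have cn: "pos 1 1 : Obj (square :: 'k scat)" by (simp add: square_simps)
 note su = sfun_i_ul(1)[OF inf] and si = sfun_i_00[OF inf] and sp = sfun_pt[OF inf small_square[OF inf] cn]
 note De = D_fun[OF PD sp] and Ds = D_fun[OF PD su] and Di = D_fun[OF PD si]
 note Ee = D_fun[OF PE sp] and Es = D_fun[OF PE su] and Ei = D_fun[OF PE si]
 note L = lan_adj[OF D3 PD su] and R = ran_adj[OF D3 PD si]
 note LE = lan_adj[OF E3 PE su] and RE = ran_adj[OF E3 PE si]
 note FU = M_fun[OF PD PE M small_ul[OF inf]] and FS = M_fun[OF PD PE M small_square[OF inf]] and F1 = M_fun[OF PD PE M small_ord[OF inf, of 0]]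
 note EU = funD(5)[OF Es] and E1 = funD(5)[OF Ei] and ES = funD(4)[OF Es]
 let ?S = "dcat E square" and ?U = "dcat E ul" and ?O = "dcat E one_cat"
 let ?iW = "Fobj (ran D i_00) W" and ?FW = "mob F one_cat W" and ?e = "pt square (pos 1 1) :: 'k sfun"
 let ?LW = "Fobj (lan D i_ul) ?iW"
 let ?n = "Ncomp (lan_unit D i_ul) ?iW" and ?k = "Ncomp (ran_counit D i_00) W"
 have W: "W : dobj D one_cat" and Z: "Z : dobj D square"
  and ab: "a : dhom D ul Y (dob D i_ul Z)" "b : dhom D one_cat (dob D i_00 Y) W" using s unfolding susp_map_def by blast+
 have Y: "Y : dobj D ul" using cat_ob(1)[OF funD(4)[OF FU] ab(1)] .
 obtain h c where h: "h : dhom D square ?LW Z" and c: "c : dhom D ul Y ?iW" "iso_arr (dcat D ul) c" "?k *[dcat D one_cat] dar D i_00 c = b"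
  and hc: "dar D i_ul h *[dcat D ul] (?n *[dcat D ul] c) = a" and t: "t = dar D ?e h"
  using s unfolding susp_map_def by blast
 note iW = fobj[OF R(2) W] and LW = fobj[OF L(2) fobj[OF R(2) W]]
 note n = adjD(2)[OF L iW] and k = adjD(3)[OF R(1) Di W] and FW = fobj[OF F1 W]
 note lm = lan_mate_univ[OF PD PE M D3 E3 su iW] and rm = ran_mate_couniv[OF PD PE M D3 E3 si W]
 let ?lm = "lan_mate D E F i_ul ?iW" and ?rm = "ran_mate D E F i_00 W"
 have ri: "iso_arr ?U ?rm" using pr W sfunD(2,3)[OF si] unfolding preserves_ran_def by simp
 have li: "iso_arr ?S ?lm" using pl iW sfunD(2,3)[OF su] unfolding preserves_lan_def by simp
 note ir = inv_arr[OF EU rm(1) ri]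
 note lir = fhom[OF LE(2) ir(1)]
 define H where "H = ?lm *[?S] Farr (lan E i_ul) (inv_arr ?U ?rm)"
 have H: "H : Hom ?S (Fobj (lan E i_ul) (Fobj (ran E i_00) ?FW)) (mob F square ?LW)"
  unfolding H_def by (rule cat_comp[OF ES lm(1) lir])
 have Hi: "iso_arr ?S H" unfolding H_def by (rule iso_comp(1)[OF ES lm(1) lir li fiso[OF LE(2) ir(1,4)]])
 note g = gam_hom[OF PD PE M sp LW]
 have psi: "Ncomp (psi D E F) W = gam F ?e ?LW *[?O] dar E ?e H"
 proof -
  have "Fdom (Susp E *. mfun F one_cat) = dcat D one_cat" using funD(2)[OF F1] by simp
  then have "Ncomp (psi D E F) W = gam F ?e ?LW *[?O] (dar E ?e ?lm *[?O] dar E ?e (Farr (lan E i_ul) (inv_arr ?U ?rm)))"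
   using W unfolding psi_def Let_def by simp
  then show ?thesis unfolding H_def fcomp[OF Ee lm(1) lir] .
 qed
 note eH = fhom[OF Ee H]
 { show "Ncomp (psi D E F) W : Hom ?O (Fobj (Susp E) ?FW) (mob F one_cat (Fobj (Susp D) W)) & iso_arr ?O (Ncomp (psi D E F) W)"
   unfolding psi Susp_fun(2)[OF inf PE E3 FW] Susp_fun(2)[OF inf PD D3 W]
   using cat_comp[OF E1 g(1) eH] iso_comp(1)[OF E1 g(1) eH g(2) fiso[OF Ee H Hi]] by simp }
 have sH: "dar E i_ul H *[?U] (Ncomp (lan_unit E i_ul) (Fobj (ran E i_00) ?FW) *[?U] ?rm) = mimg E F i_ul ?LW ?n"
 proof -
  note n0 = adjD(2)[OF LE fobj[OF RE(2) FW]] and n1 = adjD(2)[OF LE fobj[OF FU iW]]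
  note sl = fhom[OF Es lm(1)] and slr = fhom[OF Es lir]
  have "dar E i_ul H *[?U] Ncomp (lan_unit E i_ul) (Fobj (ran E i_00) ?FW)
   = dar E i_ul ?lm *[?U] (Ncomp (lan_unit E i_ul) (mob F ul ?iW) *[?U] inv_arr ?U ?rm)"
   unfolding H_def fcomp[OF Es lm(1) lir] cat_assoc[OF EU sl slr n0] adjD(4)[OF LE ir(1)] ..
  also have "\<dots> = mimg E F i_ul ?LW ?n *[?U] inv_arr ?U ?rm"
   using cat_assoc[OF EU sl n1 ir(1)] lm(2) by simp
  finally have "(dar E i_ul H *[?U] Ncomp (lan_unit E i_ul) (Fobj (ran E i_00) ?FW)) *[?U] ?rm = mimg E F i_ul ?LW ?n"
   using inv_cancel(4)[OF EU rm(1) ri mimg_hom(1)[OF PD PE M su LW n]] by simp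
  then show ?thesis using cat_assoc[OF EU fhom[OF Es H] n0 rm(1)] by simp
 qed
 note Fh = fhom[OF FS h] and Fc = fhom[OF FU c(1)]
 let ?h = "mar F square h *[?S] H" and ?c = "?rm *[?U] mar F ul c"
 have hh: "?h : Hom ?S (Fobj (lan E i_ul) (Fobj (ran E i_00) ?FW)) (mob F square Z)" by (rule cat_comp[OF ES Fh H])
 have cc: "?c : Hom ?U (mob F ul Y) (Fobj (ran E i_00) ?FW)" by (rule cat_comp[OF EU rm(1) Fc])
 have "susp_map E (mob F square Z) (mob F ul Y) ?FW (mimg E F i_ul Z a) (mcoimg E F i_00 Y b) (dar E ?e ?h)"
 proof (rule susp_mapI[OF fobj[OF FS Z] FW _ _ hh cc])
  show "mimg E F i_ul Z a : Hom ?U (mob F ul Y) (dob E i_ul (mob F square Z))" by (rule mimg_hom(1)[OF PD PE M su Z ab(1)])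
  show "mcoimg E F i_00 Y b : Hom ?O (dob E i_00 (mob F ul Y)) ?FW" by (rule mcoimg_hom[OF PD PE M si Y ab(2)])
  show "iso_arr ?U ?c" by (rule iso_comp(1)[OF EU rm(1) Fc ri fiso[OF FU c(1,2)]])
  note k0 = adjD(3)[OF RE(1) Ei FW]
  have "Ncomp (ran_counit E i_00) ?FW *[?O] dar E i_00 ?c = mcoimg E F i_00 ?iW ?k *[?O] dar E i_00 (mar F ul c)"
   unfolding fcomp[OF Ei rm(1) Fc] rm(2)[symmetric]
   by (rule cat_assoc[OF E1 k0 fhom[OF Ei rm(1)] fhom[OF Ei Fc], symmetric])
  then show "Ncomp (ran_counit E i_00) ?FW *[?O] dar E i_00 ?c = mcoimg E F i_00 Y b"
   using mcoimg_comp[OF PD PE M si k c(1)] c(3) by simp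
  note n0 = adjD(2)[OF LE fobj[OF RE(2) FW]] and sFh = fhom[OF Es Fh] and sH' = fhom[OF Es H]
  note m = mimg_hom(1)[OF PD PE M su LW n] and sn = fhom[OF Ds h]
  have "dar E i_ul ?h *[?U] (Ncomp (lan_unit E i_ul) (Fobj (ran E i_00) ?FW) *[?U] ?c)
   = dar E i_ul (mar F square h) *[?U] (dar E i_ul H *[?U] ((Ncomp (lan_unit E i_ul) (Fobj (ran E i_00) ?FW) *[?U] ?rm) *[?U] mar F ul c))"
   unfolding fcomp[OF Es Fh H] cat_assoc[OF EU n0 rm(1) Fc] by (rule cat_assoc[OF EU sFh sH' cat_comp[OF EU n0 cc]])
  also have "\<dots> = dar E i_ul (mar F square h) *[?U] (mimg E F i_ul ?LW ?n *[?U] mar F ul c)"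
   unfolding cat_assoc[OF EU sH' cat_comp[OF EU n0 rm(1)] Fc, symmetric] sH ..
  also have "\<dots> = mimg E F i_ul Z (dar D i_ul h *[dcat D ul] ?n) *[?U] mar F ul c"
   unfolding mimg_comp[OF PD PE M su n h] by (rule cat_assoc[OF EU sFh m Fc, symmetric])
  also have "\<dots> = mimg E F i_ul Z a"
   unfolding mimg_precomp[OF su Z cat_comp[OF funD(4)[OF FU] sn n] c(1), symmetric] cat_assoc[OF funD(4)[OF FU] sn n c(1)] hc ..
  finally show "dar E i_ul ?h *[?U] (Ncomp (lan_unit E i_ul) (Fobj (ran E i_00) ?FW) *[?U] ?c) = mimg E F i_ul Z a" .
 qed
 moreover have "gam F ?e Z *[?O] dar E ?e ?h = mar F one_cat t *[?O] Ncomp (psi D E F) W"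
 proof -
  note gZ = gam_hom(1)[OF PD PE M sp Z] and eFh = fhom[OF Ee Fh] and Feh = fhom[OF F1 fhom[OF De h]]
  have "gam F ?e Z *[?O] dar E ?e ?h = (gam F ?e Z *[?O] dar E ?e (mar F square h)) *[?O] dar E ?e H"
   unfolding fcomp[OF Ee Fh H] by (rule cat_assoc[OF E1 gZ eFh eH, symmetric])
  also have "\<dots> = mar F one_cat t *[?O] Ncomp (psi D E F) W"
   unfolding gam_natural[OF PD PE M sp h] t psi by (rule cat_assoc[OF E1 Feh g(1) eH])
  finally show ?thesis .
 qed
 ultimately show "\<exists>t'. susp_map E (mob F square Z) (mob F ul Y) ?FW (mimg E F i_ul Z a) (mcoimg E F i_00 Y b) t' &
  gam F ?e Z *[?O] t' = mar F one_cat t *[?O] Ncomp (psi D E F) W" by blast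
qed

end

text \<open>Unit and counit determine the identity of \<open>\<Sigma> W\<close>.\<close>

lemma susp_map_unit:
 fixes D :: "('k, 'o, 'm) derivator"
 assumes inf: "infinite (UNIV :: 'k set)" and P: "is_prederivator D" and D3: "Der3 D" and W: "W : dobj D one_cat"
 shows "susp_map D (Fobj (lan D i_ul) (Fobj (ran D i_00) W)) (Fobj (ran D i_00) W) W
  (Ncomp (lan_unit D i_ul) (Fobj (ran D i_00) W)) (Ncomp (ran_counit D i_00) W) (Id (dcat D one_cat) (Fobj (Susp D) W))"
proof -
 have cn: "pos 1 1 : Obj (square :: 'k scat)" by (simp add: square_simps)
 note su = sfun_i_ul(1)[OF inf] and si = sfun_i_00[OF inf]
 note Fe = D_fun[OF P sfun_pt[OF inf small_square[OF inf] cn]] and Fs = D_fun[OF P su] and Fi = D_fun[OF P si]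
 note L = lan_adj[OF D3 P su] and R = ran_adj[OF D3 P si]
 note DU = funD(5)[OF Fs] and D1 = funD(5)[OF Fi] and DS = funD(4)[OF Fs]
 note iW = fobj[OF R(2) W] note LW = fobj[OF L(2) iW]
 note n = adjD(2)[OF L iW] and k = adjD(3)[OF R(1) Fi W]
 have e: "Id (dcat D one_cat) (Fobj (Susp D) W) = dar D (pt square (pos 1 1)) (Id (dcat D square) (Fobj (lan D i_ul) (Fobj (ran D i_00) W)))"
  unfolding Susp_fun(2)[OF inf P D3 W] fident[OF Fe LW] ..
 show ?thesis unfolding e
  by (rule susp_mapI[OF LW W n k cat_id[OF DS LW] cat_id[OF DU iW] iso_id[OF DU iW]])
   (simp_all add: fident[OF Fi iW] fident[OF Fs LW] cat_idr[OF D1 k] cat_idr[OF DU n] cat_idl[OF DU n])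
qed

lemma mimg_id:
 assumes PD: "is_prederivator D" and PE: "is_prederivator E" and M: "is_dmorphism D E F" and u: "sfun u A B" and Y: "Y : dobj D B"
 shows "mimg E F u Y (Id (dcat D A) (dob D u Y)) = inv_arr (dcat E A) (gam F u Y)"
  "mcoimg E F u Y (Id (dcat D A) (dob D u Y)) = gam F u Y"
proof -
 note FA = M_fun[OF PD PE M sfunD(4)[OF u]] and EA = D_cat[OF PE sfunD(4)[OF u]] and g = gam_hom[OF PD PE M u Y]
 note uY = fobj[OF D_fun[OF PD u] Y]
 show "mimg E F u Y (Id (dcat D A) (dob D u Y)) = inv_arr (dcat E A) (gam F u Y)"
  "mcoimg E F u Y (Id (dcat D A) (dob D u Y)) = gam F u Y"
  unfolding mimg_def mcoimg_def sfunD(2)[OF u] fident[OF FA uY]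
  using cat_idr[OF EA inv_arr(1)[OF EA g]] cat_idl[OF EA g(1)] by simp_all
qed

lemma ncell_pt_nat:
 fixes A :: "'k scat"
 assumes inf: "infinite (UNIV :: 'k set)" and A: "small_cat A" and f: "f : Hom A a b"
 shows "ncell (pt_nat A f) (pt A a) (pt A b) one_cat A"
proof -
 have cA: "category A" using A by (simp add: small_cat_def)
 note ab = cat_ob[OF cA f]
 show ?thesis unfolding pt_nat_def HomD(2,3)[OF f]
  by (rule ncell_mk_nat[OF sfun_pt[OF inf A ab(1)] sfun_pt[OF inf A ab(2)]])
   (use f in \<open>auto simp: pt_def cat_idl[OF cA f] cat_idr[OF cA f]\<close>)
qed

lemma square_inverse:
 assumes C: "category C" and a: "a : Hom C x x'" "iso_arr C a" and b: "b : Hom C y y'" "iso_arr C b"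
  and f: "f : Hom C x y" and f': "f' : Hom C x' y'" and e: "b *[C] f = f' *[C] a"
 shows "inv_arr C b *[C] f' = f *[C] inv_arr C a"
proof -
 note i = inv_arr[OF C a] and j = inv_arr[OF C b]
 have "f *[C] inv_arr C a = (inv_arr C b *[C] (b *[C] f)) *[C] inv_arr C a" using inv_cancel(1)[OF C b f] by simp
 also have "\<dots> = ((inv_arr C b *[C] f') *[C] a) *[C] inv_arr C a" unfolding e cat_assoc[OF C j(1) f' a(1)] ..
 also have "\<dots> = inv_arr C b *[C] f'" by (rule inv_cancel(3)[OF C a cat_comp[OF C j(1) f']])
 finally show ?thesis ..
qed

lemma square_paste:
 assumes C: "category C" and a: "a : Hom C x x'" and a': "a' : Hom C x' x''" and b: "b : Hom C y y'" and b': "b' : Hom C y' y''"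
  and f: "f : Hom C x y" and f': "f' : Hom C x' y'" and f'': "f'' : Hom C x'' y''"
  and e: "b *[C] f = f' *[C] a" "b' *[C] f' = f'' *[C] a'"
 shows "(b' *[C] b) *[C] f = f'' *[C] (a' *[C] a)"
proof -
 have "(b' *[C] b) *[C] f = (b' *[C] f') *[C] a" unfolding cat_assoc[OF C b' b f] e(1) cat_assoc[OF C b' f' a] ..
 then show ?thesis unfolding e(2) cat_assoc[OF C f'' a' a] .
qed

lemma triangles_iff: "(f, g, h) : triangles C S \<longleftrightarrow> (\<exists>x y z. f : Hom C x y & g : Hom C y z & h : Hom C z (Fobj S x))"
 unfolding triangles_def Hom_def by auto

lemma tri_iso_iff:
 assumes "f : Hom C x y" "g : Hom C y z" "h : Hom C z (Fobj S x)" "f' : Hom C x' y'" "g' : Hom C y' z'" "h' : Hom C z' (Fobj S x')"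
 shows "tri_iso C S (f, g, h) (f', g', h') \<longleftrightarrow> (\<exists>a b c. a : Hom C x x' & iso_arr C a & b : Hom C y y' & iso_arr C b &
  c : Hom C z z' & iso_arr C c & b *[C] f = f' *[C] a & c *[C] g = g' *[C] b & Farr S a *[C] h = h' *[C] c)"
 unfolding tri_iso_def prod.case HomD(2)[OF assms(1)] HomD(2)[OF assms(2)] HomD(2)[OF assms(3)]
  HomD(2)[OF assms(4)] HomD(2)[OF assms(5)] HomD(2)[OF assms(6)] ..

lemma tri_iso_sym:
 assumes S: "is_fun S C C" and t: "(f, g, h) : triangles C S" and t': "(f', g', h') : triangles C S" and i: "tri_iso C S (f, g, h) (f', g', h')"
 shows "tri_iso C S (f', g', h') (f, g, h)"
proof -
 note C = funD(4)[OF S]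
 obtain x y z where T: "f : Hom C x y" "g : Hom C y z" "h : Hom C z (Fobj S x)" using t unfolding triangles_iff by blast
 obtain x' y' z' where T': "f' : Hom C x' y'" "g' : Hom C y' z'" "h' : Hom C z' (Fobj S x')" using t' unfolding triangles_iff by blast
 obtain a b c where a: "a : Hom C x x'" "iso_arr C a" and b: "b : Hom C y y'" "iso_arr C b" and c: "c : Hom C z z'" "iso_arr C c"
  and e: "b *[C] f = f' *[C] a" "c *[C] g = g' *[C] b" "Farr S a *[C] h = h' *[C] c"
  using i unfolding tri_iso_iff[OF T T'] by blast
 have "Farr S (inv_arr C a) *[C] h' = h *[C] inv_arr C c"
  using square_inverse[OF C c fhom[OF S a(1)] fiso[OF S a] T(3) T'(3) e(3)] finv[OF S a] by simp
 then show ?thesis unfolding tri_iso_iff[OF T' T]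
  using inv_arr(1,4)[OF C a] inv_arr(1,4)[OF C b] inv_arr(1,4)[OF C c]
   square_inverse[OF C a b T(1) T'(1) e(1)] square_inverse[OF C b c T(2) T'(2) e(2)] by blast
qed

lemma tri_iso_trans:
 assumes S: "is_fun S C C" and t: "(f, g, h) : triangles C S" and t': "(f', g', h') : triangles C S" and t'': "(f'', g'', h'') : triangles C S"
  and i: "tri_iso C S (f, g, h) (f', g', h')" and i': "tri_iso C S (f', g', h') (f'', g'', h'')"
 shows "tri_iso C S (f, g, h) (f'', g'', h'')"
proof -
 note C = funD(4)[OF S]
 obtain x y z where T: "f : Hom C x y" "g : Hom C y z" "h : Hom C z (Fobj S x)" using t unfolding triangles_iff by blast
 obtain x' y' z' where T': "f' : Hom C x' y'" "g' : Hom C y' z'" "h' : Hom C z' (Fobj S x')" using t' unfolding triangles_iff by blast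
 obtain x'' y'' z'' where T'': "f'' : Hom C x'' y''" "g'' : Hom C y'' z''" "h'' : Hom C z'' (Fobj S x'')" using t'' unfolding triangles_iff by blast
 obtain a b c where a: "a : Hom C x x'" "iso_arr C a" and b: "b : Hom C y y'" "iso_arr C b" and c: "c : Hom C z z'" "iso_arr C c"
  and e: "b *[C] f = f' *[C] a" "c *[C] g = g' *[C] b" "Farr S a *[C] h = h' *[C] c"
  using i unfolding tri_iso_iff[OF T T'] by blast
 obtain a' b' c' where a': "a' : Hom C x' x''" "iso_arr C a'" and b': "b' : Hom C y' y''" "iso_arr C b'" and c': "c' : Hom C z' z''" "iso_arr C c'"
  and e': "b' *[C] f' = f'' *[C] a'" "c' *[C] g' = g'' *[C] b'" "Farr S a' *[C] h' = h'' *[C] c'"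
  using i' unfolding tri_iso_iff[OF T' T''] by blast
 have "Farr S (a' *[C] a) *[C] h = h'' *[C] (c' *[C] c)" unfolding fcomp[OF S a'(1) a(1)]
  by (rule square_paste[OF C c(1) c'(1) fhom[OF S a(1)] fhom[OF S a'(1)] T(3) T'(3) T''(3) e(3) e'(3)])
 then show ?thesis unfolding tri_iso_iff[OF T T'']
  using cat_comp[OF C a'(1) a(1)] iso_comp(1)[OF C a'(1) a(1) a'(2) a(2)] cat_comp[OF C b'(1) b(1)] iso_comp(1)[OF C b'(1) b(1) b'(2) b(2)]
   cat_comp[OF C c'(1) c(1)] iso_comp(1)[OF C c'(1) c(1) c'(2) c(2)]
   square_paste[OF C a(1) a'(1) b(1) b'(1) T(1) T'(1) T''(1) e(1) e'(1)] square_paste[OF C b(1) b'(1) c(1) c'(1) T(2) T'(2) T''(2) e(2) e'(2)] by blast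
qed

lemma canon_tri_one_iso_closed:
 assumes S: "is_fun (Susp D) (dcat D one_cat) (dcat D one_cat)"
  and t: "(f, g, h) : triangles (dcat D one_cat) (Susp D)" and t': "(f', g', h') : tdist (canon_tri_one D)"
  and std: "\<And>Q. cof_seq D Q ==> std_tri D Q : triangles (dcat D one_cat) (Susp D)"
  and i: "tri_iso (dcat D one_cat) (Susp D) (f, g, h) (f', g', h')"
 shows "(f, g, h) : tdist (canon_tri_one D)"
proof -
 obtain Q where Q: "cof_seq D Q" "tri_iso (dcat D one_cat) (Susp D) (f', g', h') (std_tri D Q)" and T': "(f', g', h') : triangles (dcat D one_cat) (Susp D)"
  using t' unfolding canon_tri_one_def by auto
 obtain f0 g0 h0 where s: "std_tri D Q = (f0, g0, h0)" by (cases "std_tri D Q")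
 show ?thesis using t Q(1) tri_iso_trans[OF S t T' std[OF Q(1), unfolded s] i Q(2)[unfolded s]] s unfolding canon_tri_one_def by auto
qed

lemma std_tri_triangle:
 fixes D :: "('k, 'o, 'm) derivator"
 assumes inf: "infinite (UNIV :: 'k set)" and P: "is_prederivator D" and D3: "Der3 D" and Q: "Q : dobj D two_one"
 defines "S \<equiv> dob D (sub_square 0 2) Q" and "q \<equiv> \<lambda>i j. dob D (pt two_one (pos i j)) Q" 
 assumes ph: "susp_map D S Y W a b (phi D S)" "W = q 0 0" "iso_arr (dcat D one_cat) (phi D S)"
 shows "phi D S : dhom D one_cat (Fobj (Susp D) (q 0 0)) (q 2 1)"
  "i \<le> i' ==> i' \<le> 2 ==> j \<le> j' ==> j' \<le> 1 ==> dnt D (pt_nat two_one (step i j i' j')) Q : dhom D one_cat (q i j) (q i' j')"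
  "inv_arr (dcat D one_cat) (phi D S) *[dcat D one_cat] dnt D (pt_nat two_one (step 1 1 2 1)) Q : dhom D one_cat (q 1 1) (Fobj (Susp D) (q 0 0))"
  "std_tri D Q : triangles (dcat D one_cat) (Susp D)"
proof -
 have cn: "pos 1 1 : Obj (square :: 'k scat)" by (simp add: square_simps)
 note s02 = sfun_sub_square[OF inf, of 0 2, simplified]
 have e: "sub_square 0 2 *. pt square (pos 1 1) = (pt two_one (pos 2 1) :: 'k sfun)"
  using pt_comp[OF inf s02(1) cn] s02(2)[of 1 1] by simp
 have S11: "dob D (pt square (pos 1 1)) S = q 2 1"
  unfolding S_def q_def e[symmetric] using D_cob[OF P sfun_pt[OF inf small_square[OF inf] cn] s02(1) Q] by simp
 show 1: "phi D S : dhom D one_cat (Fobj (Susp D) (q 0 0)) (q 2 1)"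
  using susp_map_hom[OF inf P D3 ph(1)] unfolding ph(2) S11 .
 have 2: "dnt D (pt_nat two_one (step i j i' j')) Q : dhom D one_cat (q i j) (q i' j')" if "i \<le> i'" "i' \<le> 2" "j \<le> j'" "j' \<le> 1" for i j i' j'
 proof -
  have "step i j i' j' : Hom (two_one :: 'k scat) (pos i j) (pos i' j')" using that by (simp add: two_one_simps)
  from D_nat_hom[OF P ncell_pt_nat[OF inf small_two_one[OF inf] this] Q] show ?thesis unfolding q_def .
 qed
 then show "i \<le> i' ==> i' \<le> 2 ==> j \<le> j' ==> j' \<le> 1 ==> dnt D (pt_nat two_one (step i j i' j')) Q : dhom D one_cat (q i j) (q i' j')" .
 note D1 = D_cat[OF P small_ord[OF inf, of 0]]
 show 3: "inv_arr (dcat D one_cat) (phi D S) *[dcat D one_cat] dnt D (pt_nat two_one (step 1 1 2 1)) Q : dhom D one_cat (q 1 1) (Fobj (Susp D) (q 0 0))"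
  by (rule cat_comp[OF D1 inv_arr(1)[OF D1 1 ph(3)] 2]) simp_all
 show "std_tri D Q : triangles (dcat D one_cat) (Susp D)"
  unfolding std_tri_def Let_def triangles_iff S_def[symmetric] using 2[of 0 1 0 0] 2[of 1 1 0 1] 3 by auto
qed

context
 fixes D :: "('k, 'o, 'm) derivator" and E :: "('k, 'p, 'n) derivator" and F :: "('k, 'o, 'm, 'p, 'n) dmorphism"
 assumes inf: "infinite (UNIV :: 'k set)" and PD: "is_prederivator D" and PE: "is_prederivator E" and M: "is_dmorphism D E F"
  and D3: "Der3 D" and E3: "Der3 E"
  and pl: "preserves_lan D E F i_ul" and pr: "preserves_ran D E F i_00"
begin

lemma psi_hom:
 assumes W: "W : dobj D one_cat"
 shows "Ncomp (psi D E F) W : dhom E one_cat (Fobj (Susp E) (mob F one_cat W)) (mob F one_cat (Fobj (Susp D) W))"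
  "iso_arr (dcat E one_cat) (Ncomp (psi D E F) W)"
 using susp_map_image(2)[OF inf PD PE M D3 E3 pl pr susp_map_unit[OF inf PD D3 W] refl refl refl] by blast+

text \<open>The components of \<open>\<psi>\<close> come from the images of unit and counit, to which \<open>susp_map_natural\<close> applies.\<close>

lemma psi_natural:
 assumes f: "f : dhom D one_cat W W'"
 shows "Ncomp (psi D E F) W' *[dcat E one_cat] Farr (Susp E) (mar F one_cat f)
  = mar F one_cat (Farr (Susp D) f) *[dcat E one_cat] Ncomp (psi D E F) W"
proof -
 have cn: "pos 1 1 : Obj (square :: 'k scat)" by (simp add: square_simps)
 note su = sfun_i_ul(1)[OF inf] and si = sfun_i_00[OF inf] and sp = sfun_pt[OF inf small_square[OF inf] cn]
 note De = D_fun[OF PD sp] and Ds = D_fun[OF PD su] and Di = D_fun[OF PD si] and Ee = D_fun[OF PE sp]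
 note L = lan_adj[OF D3 PD su] and R = ran_adj[OF D3 PD si]
 note FU = M_fun[OF PD PE M small_ul[OF inf]] and FS = M_fun[OF PD PE M small_square[OF inf]] and F1 = M_fun[OF PD PE M small_ord[OF inf, of 0]]
 note E1 = funD(5)[OF F1] and D1 = funD(4)[OF F1]
 note WW = cat_ob[OF D1 f]
 let ?O = "dcat E one_cat" and ?e = "pt square (pos 1 1) :: 'k sfun"
 let ?if = "Farr (ran D i_00) f" and ?Lf = "Farr (lan D i_ul) (Farr (ran D i_00) f)"
 let ?iW = "Fobj (ran D i_00) W" and ?iW' = "Fobj (ran D i_00) W'"
 let ?LW = "Fobj (lan D i_ul) ?iW" and ?LW' = "Fobj (lan D i_ul) ?iW'"
 note i = fhom[OF R(2) f] note l = fhom[OF L(2) i]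
 note iW = fobj[OF R(2) WW(1)] and iW' = fobj[OF R(2) WW(2)]
 note n = adjD(2)[OF L iW] and n' = adjD(2)[OF L iW'] and k = adjD(3)[OF R(1) Di WW(1)] and k' = adjD(3)[OF R(1) Di WW(2)]
 have ex: "\<exists>t. susp_map E (mob F square (Fobj (lan D i_ul) (Fobj (ran D i_00) X))) (mob F ul (Fobj (ran D i_00) X)) (mob F one_cat X)
   (mimg E F i_ul (Fobj (lan D i_ul) (Fobj (ran D i_00) X)) (Ncomp (lan_unit D i_ul) (Fobj (ran D i_00) X)))
   (mcoimg E F i_00 (Fobj (ran D i_00) X) (Ncomp (ran_counit D i_00) X)) t &
  gam F ?e (Fobj (lan D i_ul) (Fobj (ran D i_00) X)) *[?O] t = Ncomp (psi D E F) X" if X: "X : dobj D one_cat" for X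
  using susp_map_image(1)[OF inf PD PE M D3 E3 pl pr susp_map_unit[OF inf PD D3 X]]
   fident[OF F1 fobj[OF Susp_fun(1)[OF inf PD D3] X]] cat_idl[OF E1 psi_hom(1)[OF X]] by simp
 obtain t where t: "susp_map E (mob F square ?LW) (mob F ul ?iW) (mob F one_cat W)
   (mimg E F i_ul ?LW (Ncomp (lan_unit D i_ul) ?iW)) (mcoimg E F i_00 ?iW (Ncomp (ran_counit D i_00) W)) t"
  "gam F ?e ?LW *[?O] t = Ncomp (psi D E F) W" using ex[OF WW(1)] by blast
 obtain t' where t': "susp_map E (mob F square ?LW') (mob F ul ?iW') (mob F one_cat W')
   (mimg E F i_ul ?LW' (Ncomp (lan_unit D i_ul) ?iW')) (mcoimg E F i_00 ?iW' (Ncomp (ran_counit D i_00) W')) t'"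
  "gam F ?e ?LW' *[?O] t' = Ncomp (psi D E F) W'" using ex[OF WW(2)] by blast
 note Fl = fhom[OF FS l] and Fi = fhom[OF FU i] and Ff = fhom[OF F1 f]
 have eq: "t' *[?O] Farr (Susp E) (mar F one_cat f) = dar E ?e (mar F square ?Lf) *[?O] t"
 proof (rule susp_map_natural[OF inf PE E3 t(1) t'(1) Fl Fi Ff])
  show "dar E i_ul (mar F square ?Lf) *[dcat E ul] mimg E F i_ul ?LW (Ncomp (lan_unit D i_ul) ?iW)
   = mimg E F i_ul ?LW' (Ncomp (lan_unit D i_ul) ?iW') *[dcat E ul] mar F ul ?if"
   unfolding mimg_comp[OF PD PE M su n l, symmetric] adjD(4)[OF L i]
   by (rule mimg_precomp[OF inf PD PE M D3 E3 pl pr su cat_ob(2)[OF funD(4)[OF FS] l] n' i])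
  show "mar F one_cat f *[?O] mcoimg E F i_00 ?iW (Ncomp (ran_counit D i_00) W)
   = mcoimg E F i_00 ?iW' (Ncomp (ran_counit D i_00) W') *[?O] dar E i_00 (mar F ul ?if)"
   unfolding mcoimg_comp[OF PD PE M si k' i, symmetric] adjD(5)[OF R(1) Di f]
   by (rule mcoimg_postcomp[OF inf PD PE M D3 E3 pl pr si iW k f, symmetric])
 qed
 note th = susp_map_hom[OF inf PE E3 t(1)] and th' = susp_map_hom[OF inf PE E3 t'(1)]
 note LWo = cat_ob[OF funD(4)[OF FS] l]
 note g = gam_hom(1)[OF PD PE M sp LWo(1)] and g' = gam_hom(1)[OF PD PE M sp LWo(2)] and SF = fhom[OF Susp_fun(1)[OF inf PE E3] Ff]
 have "Ncomp (psi D E F) W' *[?O] Farr (Susp E) (mar F one_cat f) = gam F ?e ?LW' *[?O] (dar E ?e (mar F square ?Lf) *[?O] t)"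
  unfolding t'(2)[symmetric] cat_assoc[OF E1 g' th' SF] eq ..
 also have "\<dots> = mar F one_cat (dar D ?e ?Lf) *[?O] Ncomp (psi D E F) W"
  unfolding cat_assoc[OF E1 g' fhom[OF Ee Fl] th, symmetric] gam_natural[OF PD PE M sp l] t(2)[symmetric]
  by (rule cat_assoc[OF E1 fhom[OF F1 fhom[OF De l]] g th])
 finally show ?thesis unfolding Susp_fun(3)[OF inf PD D3 f] .
qed

text \<open>The image of the map \<open>\<phi>\<close> of \<open>S\<close> is a suspension map for \<open>F S\<close> by \<open>susp_map_image\<close>, and \<open>g\<close> compares it with \<open>\<phi>\<close> of
\<open>S'\<close> by \<open>susp_map_natural\<close>. The case of interest is \<open>g = \<gamma>\<close>.\<close>

lemma phi_compat:
 assumes S: "S : dobj D square" and S': "S' : dobj E square" and g: "g : dhom E square S' (mob F square S)"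
  and i: "iso_arr (dcat D ul) (Ncomp (ran_unit D i_00) (dob D i_ul S))"
  and i': "iso_arr (dcat E ul) (Ncomp (ran_unit E i_00) (dob E i_ul S'))"
 defines "v \<equiv> pt square (pos 0 0)" and "e \<equiv> pt square (pos 1 1)"
 shows "gam F e S *[dcat E one_cat] (dar E e g *[dcat E one_cat] phi E S') =
  mar F one_cat (phi D S) *[dcat E one_cat] (Ncomp (psi D E F) (dob D v S) *[dcat E one_cat]
   Farr (Susp E) (gam F v S *[dcat E one_cat] dar E v g))"
proof -
 have cn: "pos 1 1 : Obj (square :: 'k scat)" "pos 0 0 : Obj (square :: 'k scat)" by (simp_all add: square_simps)
 note su = sfun_i_ul(1)[OF inf] and si = sfun_i_00[OF inf] and sp = sfun_pt[OF inf small_square[OF inf] cn(1), folded e_def]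
 have v: "v = i_ul *. i_00" unfolding v_def i_00_def
  using pt_comp[OF inf su, of "pos 0 0"] sfun_i_ul(2)[OF inf, of "pos 0 0"] by (simp add: ul_simps)
 note De = D_fun[OF PD sp] and Ds = D_fun[OF PD su] and Di = D_fun[OF PD si]
 note Ee = D_fun[OF PE sp] and Es = D_fun[OF PE su] and Ei = D_fun[OF PE si]
 note FU = M_fun[OF PD PE M small_ul[OF inf]] and FS = M_fun[OF PD PE M small_square[OF inf]] and F1 = M_fun[OF PD PE M small_ord[OF inf, of 0]]
 note E1 = funD(5)[OF F1] and EU = funD(5)[OF FU]
 let ?O = "dcat E one_cat" and ?U = "dcat E ul"
 let ?Y = "dob D i_ul S" and ?Y' = "dob E i_ul S'"
 note Y = fobj[OF Ds S] and Y' = fobj[OF Es S']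
 let ?W = "dob D i_00 ?Y" and ?W' = "dob E i_00 ?Y'"
 note W = fobj[OF Di Y] and W' = fobj[OF Ei Y']
 note p = phi_susp_map(1)[OF inf PD D3 S i] and p' = phi_susp_map(1)[OF inf PE E3 S' i']
 note gs = gam_hom[OF PD PE M su S] and gi = gam_hom[OF PD PE M si Y]
 obtain t where t: "susp_map E (mob F square S) (mob F ul ?Y) (mob F one_cat ?W) (inv_arr ?U (gam F i_ul S)) (gam F i_00 ?Y) t"
  "gam F e S *[?O] t = mar F one_cat (phi D S) *[?O] Ncomp (psi D E F) ?W"
  using susp_map_image(1)[OF inf PD PE M D3 E3 pl pr p] unfolding mimg_id[OF PD PE M su S] mimg_id[OF PD PE M si Y] e_def by blast
 note sg = fhom[OF Es g]
 let ?y = "gam F i_ul S *[?U] dar E i_ul g"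
 note y = cat_comp[OF EU gs(1) sg]
 let ?w = "gam F i_00 ?Y *[?O] dar E i_00 ?y"
 note iy = fhom[OF Ei y] note w = cat_comp[OF E1 gi(1) iy]
 have eq: "t *[?O] Farr (Susp E) ?w = dar E e g *[?O] phi E S'" unfolding e_def
 proof (rule susp_map_natural[OF inf PE E3 p' t(1) g y w])
  show "dar E i_ul g *[?U] Id ?U ?Y' = inv_arr ?U (gam F i_ul S) *[?U] ?y"
   using cat_idr[OF EU sg] inv_cancel(1)[OF EU gs sg] by simp
  show "?w *[?O] Id ?O ?W' = gam F i_00 ?Y *[?O] dar E i_00 ?y" by (rule cat_idr[OF E1 w])
 qed
 have ww: "?w = gam F v S *[?O] dar E v g"
  unfolding v gam_comp[OF PD PE M si su S] D_car[OF PE si su g] fcomp[OF Ei gs(1) sg]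
  by (rule cat_assoc[OF E1 gi(1) fhom[OF Ei gs(1)] fhom[OF Ei sg], symmetric])
 have vS: "dob D v S = ?W" unfolding v by (rule D_cob[OF PD si su S])
 note th = susp_map_hom[OF inf PE E3 t(1), folded e_def] and ge = gam_hom(1)[OF PD PE M sp S]
 note Sw = fhom[OF Susp_fun(1)[OF inf PE E3] w]
 note Fp = fhom[OF F1 susp_map_hom[OF inf PD D3 p]]
 show ?thesis unfolding ww[symmetric] vS eq[symmetric]
  using cat_assoc[OF E1 ge th Sw] cat_assoc[OF E1 Fp psi_hom(1)[OF W] Sw] t(2) by simp
qed

lemma phi_compat_sub:
 assumes Q: "Q : dobj D two_one"
 defines "S \<equiv> dob D (sub_square 0 2) Q" and "S' \<equiv> dob E (sub_square 0 2) (mob F two_one Q)"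
 assumes i: "iso_arr (dcat D ul) (Ncomp (ran_unit D i_00) (dob D i_ul S))"
  and i': "iso_arr (dcat E ul) (Ncomp (ran_unit E i_00) (dob E i_ul S'))"
 shows "gam F (pt two_one (pos 2 1)) Q *[dcat E one_cat] phi E S' =
  mar F one_cat (phi D S) *[dcat E one_cat] (Ncomp (psi D E F) (dob D (pt two_one (pos 0 0)) Q) *[dcat E one_cat]
   Farr (Susp E) (gam F (pt two_one (pos 0 0)) Q))"
  "dob D (pt two_one (pos 0 0)) Q = dob D i_00 (dob D i_ul S)"
  "dob E (pt two_one (pos 0 0)) (mob F two_one Q) = dob E i_00 (dob E i_ul S')"
proof -
 have cn: "pos 1 1 : Obj (square :: 'k scat)" "pos 0 0 : Obj (square :: 'k scat)" by (simp_all add: square_simps)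
 note s02 = sfun_sub_square[OF inf, of 0 2, simplified]
 note p11 = sfun_pt[OF inf small_square[OF inf] cn(1)] and p00 = sfun_pt[OF inf small_square[OF inf] cn(2)]
 have e: "pt two_one (pos 2 1) = (sub_square 0 2 *. pt square (pos 1 1) :: 'k sfun)" "pt two_one (pos 0 0) = (sub_square 0 2 *. pt square (pos 0 0) :: 'k sfun)"
  using pt_comp[OF inf s02(1) cn(1)] pt_comp[OF inf s02(1) cn(2)] s02(2)[of 1 1] s02(2)[of 0 0] by simp_all
 note FQ = fobj[OF M_fun[OF PD PE M small_two_one[OF inf]] Q]
 have S: "S : dobj D square" and S': "S' : dobj E square"
  unfolding S_def S'_def using fobj[OF D_fun[OF PD s02(1)] Q] fobj[OF D_fun[OF PE s02(1)] FQ] .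
 note g = gam_hom(1)[OF PD PE M s02(1) Q, folded S_def S'_def]
 have v: "(pt square (pos 0 0) :: 'k sfun) = i_ul *. i_00" unfolding i_00_def
  using pt_comp[OF inf sfun_i_ul(1)[OF inf], of "pos 0 0"] sfun_i_ul(2)[OF inf, of "pos 0 0"] by (simp add: ul_simps)
 have o: "dob D (pt two_one (pos 0 0)) Q = dob D (pt square (pos 0 0)) S"
  "dob E (pt two_one (pos 0 0)) (mob F two_one Q) = dob E (pt square (pos 0 0)) S'"
  unfolding e S_def S'_def using D_cob[OF PD p00 s02(1) Q] D_cob[OF PE p00 s02(1) FQ] .
 show "dob D (pt two_one (pos 0 0)) Q = dob D i_00 (dob D i_ul S)"
  "dob E (pt two_one (pos 0 0)) (mob F two_one Q) = dob E i_00 (dob E i_ul S')"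
  unfolding o v by (rule D_cob[OF PD sfun_i_00[OF inf] sfun_i_ul(1)[OF inf] S], rule D_cob[OF PE sfun_i_00[OF inf] sfun_i_ul(1)[OF inf] S'])
 have ph: "phi E S' : dhom E one_cat (Fobj (Susp E) (dob E i_00 (dob E i_ul S'))) (dob E (pt square (pos 1 1)) S')"
  by (rule susp_map_hom[OF inf PE E3 phi_susp_map(1)[OF inf PE E3 S' i']])
 note E1 = D_cat[OF PE small_ord[OF inf, of 0]]
 note gS = gam_hom(1)[OF PD PE M p11 S] and eg = fhom[OF D_fun[OF PE p11] g]
 have "gam F (pt two_one (pos 2 1)) Q *[dcat E one_cat] phi E S' = 
  gam F (pt square (pos 1 1)) S *[dcat E one_cat] (dar E (pt square (pos 1 1)) (gam F (sub_square 0 2) Q) *[dcat E one_cat] phi E S')"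
  unfolding e(1) gam_comp[OF PD PE M p11 s02(1) Q, folded S_def] by (rule cat_assoc[OF E1 gS eg ph])
 also have "\<dots> = mar F one_cat (phi D S) *[dcat E one_cat] (Ncomp (psi D E F) (dob D (pt two_one (pos 0 0)) Q) *[dcat E one_cat]
   Farr (Susp E) (gam F (pt two_one (pos 0 0)) Q))"
  unfolding o(1) unfolding e(2) gam_comp[OF PD PE M p00 s02(1) Q, folded S_def] by (rule phi_compat[OF S S' g i i'])
 finally show "gam F (pt two_one (pos 2 1)) Q *[dcat E one_cat] phi E S' =
  mar F one_cat (phi D S) *[dcat E one_cat] (Ncomp (psi D E F) (dob D (pt two_one (pos 0 0)) Q) *[dcat E one_cat]
   Farr (Susp E) (gam F (pt two_one (pos 0 0)) Q))" .
qed

end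

lemma zero_obj_iso:
 assumes C: "category C" and f: "f : Hom C z z'" "iso_arr C f" and z: "zero_obj C z"
 shows "zero_obj C z'"
proof -
 note g = inv_arr[OF C f] and o = cat_ob[OF C f(1)]
 let ?g = "inv_arr C f"
 have i: "\<exists>!k. k : Hom C z' x" if x: "x : Obj C" for x
 proof -
  obtain k where k: "k : Hom C z x" "\<And>k'. k' : Hom C z x ==> k' = k" using z x unfolding zero_obj_def initial_obj_def by blast
  show ?thesis
  proof (rule ex1I[of _ "k *[C] ?g"])
   show "k *[C] ?g : Hom C z' x" by (rule cat_comp[OF C k(1) g(1)])
   fix l assume l: "l : Hom C z' x"
   have "l = (l *[C] f) *[C] ?g" using inv_cancel(3)[OF C f l] by simp
   then show "l = k *[C] ?g" unfolding k(2)[OF cat_comp[OF C l f(1)]] .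
  qed
 qed
 have t: "\<exists>!k. k : Hom C x z'" if x: "x : Obj C" for x
 proof -
  obtain k where k: "k : Hom C x z" "\<And>k'. k' : Hom C x z ==> k' = k" using z x unfolding zero_obj_def terminal_obj_def by blast
  show ?thesis
  proof (rule ex1I[of _ "f *[C] k"])
   show "f *[C] k : Hom C x z'" by (rule cat_comp[OF C f(1) k(1)])
   fix l assume l: "l : Hom C x z'"
   have "l = f *[C] (?g *[C] l)" using inv_cancel(2)[OF C f l] by simp
   then show "l = f *[C] k" unfolding k(2)[OF cat_comp[OF C g(1) l]] .
  qed
 qed
 show ?thesis unfolding zero_obj_def initial_obj_def terminal_obj_def using i t o(2) by blast
qed

context
 fixes D :: "('k, 'o, 'm) derivator" and E :: "('k, 'p, 'n) derivator" and F :: "('k, 'o, 'm, 'p, 'n) dmorphism"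
 assumes inf: "infinite (UNIV :: 'k set)" and PD: "is_prederivator D" and PE: "is_prederivator E" and M: "is_dmorphism D E F"
  and D3: "Der3 D" and E3: "Der3 E"
  and pl: "preserves_lan D E F i_ul" and pr: "preserves_ran D E F i_00"
begin

lemma nat_iso_psi: "nat_iso (psi D E F)"
proof -
 note F1 = M_fun[OF PD PE M small_ord[OF inf, of 0]]
 note a = inf PD PE M D3 E3 pl pr
 note SD = Susp_fun(1)[OF inf PD D3] and SE = Susp_fun(1)[OF inf PE E3]
 note sE = funD[OF comp_fun[OF F1 SE]] and sD = funD[OF comp_fun[OF SD F1]]
 have e: "psi D E F = mk_nat (Susp E *. mfun F one_cat) (mfun F one_cat *. Susp D) (Ncomp (psi D E F))"
  by (simp add: psi_def mk_nat_def restrict_def fun_eq_iff)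
 have "is_ntrans (mk_nat (Susp E *. mfun F one_cat) (mfun F one_cat *. Susp D) (Ncomp (psi D E F)))"
 proof (rule is_ntrans_mk_nat, unfold sE(2,3) sD(2,3))
  fix X assume "X : dobj D one_cat"
  then show "Ncomp (psi D E F) X : dhom E one_cat (Fobj (Susp E *. mfun F one_cat) X) (Fobj (mfun F one_cat *. Susp D) X)"
   using psi_hom(1)[OF a] by (simp add: compF_obj[OF F1] compF_obj[OF SD])
 next
  fix f X Y assume f: "f : dhom D one_cat X Y"
  show "Ncomp (psi D E F) Y *[dcat E one_cat] Farr (Susp E *. mfun F one_cat) f = Farr (mfun F one_cat *. Susp D) f *[dcat E one_cat] Ncomp (psi D E F) X"
   unfolding compF_arr[OF F1 f] compF_arr[OF SD f] by (rule psi_natural[OF a f])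
 qed (use sE sD in auto)
 then have n: "is_ntrans (psi D E F)" unfolding e[symmetric] .
 have "Nsrc (psi D E F) = Susp E *. mfun F one_cat" by (simp add: psi_def)
 then show ?thesis unfolding nat_iso_def using n sE(2,3) psi_hom(2)[OF a] by simp
qed

text \<open>The isomorphism of triangles has components \<open>\<gamma>\<close> at three points; in the last square \<open>phi_compat_sub\<close> is used to
exchange the inverses of \<open>\<phi>\<close> and \<open>\<psi>\<close>.\<close>

lemma std_tri_image:
 assumes Q: "Q : dobj D two_one"
 defines "S \<equiv> dob D (sub_square 0 2) Q" and "S' \<equiv> dob E (sub_square 0 2) (mob F two_one Q)"
 assumes i: "iso_arr (dcat D ul) (Ncomp (ran_unit D i_00) (dob D i_ul S))"
  and i': "iso_arr (dcat E ul) (Ncomp (ran_unit E i_00) (dob E i_ul S'))"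
  and ph: "iso_arr (dcat D one_cat) (phi D S)" and ph': "iso_arr (dcat E one_cat) (phi E S')"
  and t: "std_tri D Q = (f, g, h)"
 shows "tri_iso (dcat E one_cat) (Susp E) (std_tri E (mob F two_one Q))
   (mar F one_cat f, mar F one_cat g, inv_arr (dcat E one_cat) (Ncomp (psi D E F) (Dom (dcat D one_cat) f)) *[dcat E one_cat] mar F one_cat h)"
  "std_tri E (mob F two_one Q) : triangles (dcat E one_cat) (Susp E)"
proof -
 note a = inf PD PE M D3 E3 pl pr
 let ?FQ = "mob F two_one Q" and ?O = "dcat E one_cat" and ?F = "mar F one_cat"
 let ?q = "\<lambda>i j. dob D (pt two_one (pos i j)) Q" and ?r = "\<lambda>i j. dob E (pt two_one (pos i j)) ?FQ"
 let ?g = "\<lambda>i j. gam F (pt two_one (pos i j)) Q"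
 let ?ev = "\<lambda>f. dnt D (pt_nat two_one f) Q" and ?ev' = "\<lambda>f. dnt E (pt_nat two_one f) ?FQ"
 note F1 = M_fun[OF PD PE M small_ord[OF inf, of 0]]
 note E1 = funD(5)[OF F1] and D1 = funD(4)[OF F1]
 note FQ = fobj[OF M_fun[OF PD PE M small_two_one[OF inf]] Q]
 note s02 = sfun_sub_square[OF inf, of 0 2, simplified]
 have SS: "S : dobj D square" "S' : dobj E square"
  unfolding S_def S'_def using fobj[OF D_fun[OF PD s02(1)] Q] fobj[OF D_fun[OF PE s02(1)] FQ] .
 note C = phi_compat_sub[OF a Q, folded S_def S'_def, OF i i']
 note p = phi_susp_map(1)[OF inf PD D3 SS(1) i] and p' = phi_susp_map(1)[OF inf PE E3 SS(2) i']
 note T = std_tri_triangle[OF inf PD D3 Q, folded S_def, OF p C(2)[symmetric] ph]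
 note T' = std_tri_triangle[OF inf PE E3 FQ, folded S'_def, OF p' C(3)[symmetric] ph']
 show "std_tri E ?FQ : triangles ?O (Susp E)" by (rule T'(4))
 have q: "?q i j : dobj D one_cat" if "i \<le> 2" "j \<le> 1" for i j
  using fobj[OF D_fun[OF PD sfun_pt[OF inf small_two_one[OF inf]]] Q, of "pos i j"] that by (simp add: two_one_simps)
 have gm: "?g i j : Hom ?O (?r i j) (mob F one_cat (?q i j))" "iso_arr ?O (?g i j)" if "i \<le> 2" "j \<le> 1" for i j
  using gam_hom[OF PD PE M sfun_pt[OF inf small_two_one[OF inf]] Q, of "pos i j"] that by (simp_all add: two_one_simps)
 have nat: "?F (?ev (step i j i' j')) *[?O] ?g i j = ?g i' j' *[?O] ?ev' (step i j i' j')" if "i \<le> i'" "i' \<le> 2" "j \<le> j'" "j' \<le> 1" for i j i' j'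
 proof -
  have "step i j i' j' : Hom (two_one :: 'k scat) (pos i j) (pos i' j')" using that by (simp add: two_one_simps)
  from gam_2cell[OF PD PE M ncell_pt_nat[OF inf small_two_one[OF inf] this] Q] show ?thesis .
 qed
 have q00: "?q 0 0 : dobj D one_cat" by (rule q) simp_all
 note psi = psi_hom[OF a q00]
 let ?psi = "Ncomp (psi D E F) (?q 0 0)"
 have g00: "?g 0 0 : Hom ?O (?r 0 0) (mob F one_cat (?q 0 0))" "iso_arr ?O (?g 0 0)" using gm[of 0 0] by simp_all
 have g10: "?g 1 0 : Hom ?O (?r 1 0) (mob F one_cat (?q 1 0))" "iso_arr ?O (?g 1 0)" using gm[of 1 0] by simp_all
 have g11: "?g 1 1 : Hom ?O (?r 1 1) (mob F one_cat (?q 1 1))" "iso_arr ?O (?g 1 1)" using gm[of 1 1] by simp_all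
 have g21: "?g 2 1 : Hom ?O (?r 2 1) (mob F one_cat (?q 2 1))" using gm[of 2 1] by simp
 have e1: "?ev (step 0 0 1 0) : dhom D one_cat (?q 0 0) (?q 1 0)" and e2: "?ev (step 1 0 1 1) : dhom D one_cat (?q 1 0) (?q 1 1)"
  and e3: "?ev (step 1 1 2 1) : dhom D one_cat (?q 1 1) (?q 2 1)"
  using T(2)[of 0 1 0 0] T(2)[of 1 1 0 1] T(2)[of 1 2 1 1] by simp_all
 have e1': "?ev' (step 0 0 1 0) : Hom ?O (?r 0 0) (?r 1 0)" and e2': "?ev' (step 1 0 1 1) : Hom ?O (?r 1 0) (?r 1 1)"
  and e3': "?ev' (step 1 1 2 1) : Hom ?O (?r 1 1) (?r 2 1)"
  using T'(2)[of 0 1 0 0] T'(2)[of 1 1 0 1] T'(2)[of 1 2 1 1] by simp_all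
 note Fp = fhom[OF F1 T(1)] and Fpi = fiso[OF F1 T(1) ph]
 note SE = Susp_fun(1)[OF inf PE E3]
 note Sg = fhom[OF SE g00(1)]
 note Fpp = cat_comp[OF E1 Fp psi(1)]
 \<comment> \<open>the compatibility of \<open>\<phi>\<close> and \<open>\<psi>\<close>, solved for the inverses\<close>
 have key: "Farr (Susp E) (?g 0 0) *[?O] inv_arr ?O (phi E S') = (inv_arr ?O ?psi *[?O] ?F (inv_arr (dcat D one_cat) (phi D S))) *[?O] ?g 2 1"
 proof -
  have "(?F (phi D S) *[?O] ?psi) *[?O] Farr (Susp E) (?g 0 0) = ?g 2 1 *[?O] phi E S'"
   unfolding C(1) by (rule cat_assoc[OF E1 Fp psi(1) Sg])
  from square_inverse[OF E1 T'(1) ph' Fpp iso_comp(1)[OF E1 Fp psi(1) Fpi psi(2)] Sg g21 this]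
  show ?thesis unfolding iso_comp(2)[OF E1 Fp psi(1) Fpi psi(2)] finv[OF F1 T(1) ph] ..
 qed
 note ip = inv_arr(1)[OF D1 T(1) ph] and ip' = inv_arr(1)[OF E1 T'(1) ph'] and ips = inv_arr(1)[OF E1 psi]
 note Fip = fhom[OF F1 ip] and Fe3 = fhom[OF F1 e3]
 have 3: "Farr (Susp E) (?g 0 0) *[?O] (inv_arr ?O (phi E S') *[?O] ?ev' (step 1 1 2 1)) =
  (inv_arr ?O ?psi *[?O] ?F (inv_arr (dcat D one_cat) (phi D S) *[dcat D one_cat] ?ev (step 1 1 2 1))) *[?O] ?g 1 1"
 proof -
  have "Farr (Susp E) (?g 0 0) *[?O] (inv_arr ?O (phi E S') *[?O] ?ev' (step 1 1 2 1)) =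
   (inv_arr ?O ?psi *[?O] ?F (inv_arr (dcat D one_cat) (phi D S))) *[?O] (?g 2 1 *[?O] ?ev' (step 1 1 2 1))"
   unfolding cat_assoc[OF E1 Sg ip' e3', symmetric] key by (rule cat_assoc[OF E1 cat_comp[OF E1 ips Fip] g21 e3'])
  also have "\<dots> = ((inv_arr ?O ?psi *[?O] ?F (inv_arr (dcat D one_cat) (phi D S))) *[?O] ?F (?ev (step 1 1 2 1))) *[?O] ?g 1 1"
   using nat[of 1 2 1 1] cat_assoc[OF E1 cat_comp[OF E1 ips Fip] Fe3 g11(1)] by simp
  also have "\<dots> = (inv_arr ?O ?psi *[?O] ?F (inv_arr (dcat D one_cat) (phi D S) *[dcat D one_cat] ?ev (step 1 1 2 1))) *[?O] ?g 1 1"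
   unfolding fcomp[OF F1 ip e3] cat_assoc[OF E1 ips Fip Fe3] ..
  finally show ?thesis .
 qed
 have st: "f = ?ev (step 0 0 1 0)" "g = ?ev (step 1 0 1 1)" "h = inv_arr (dcat D one_cat) (phi D S) *[dcat D one_cat] ?ev (step 1 1 2 1)"
  using t unfolding std_tri_def Let_def S_def by simp_all
 note h3 = T(3) and h3' = T'(3)
 show "tri_iso ?O (Susp E) (std_tri E ?FQ) (?F f, ?F g, inv_arr ?O (Ncomp (psi D E F) (Dom (dcat D one_cat) f)) *[?O] ?F h)"
  unfolding std_tri_def Let_def S'_def[symmetric] st HomD(2)[OF e1]
   tri_iso_iff[OF e1' e2' h3' fhom[OF F1 e1] fhom[OF F1 e2] cat_comp[OF E1 ips fhom[OF F1 h3]]]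
  by (rule exI[of _ "?g 0 0"], rule exI[of _ "?g 1 0"], rule exI[of _ "?g 1 1"], intro conjI g00 g10 g11 3)
   (use nat[of 0 1 0 0] nat[of 1 1 0 1] in simp_all)
qed

text \<open>A distinguished triangle is isomorphic to a standard one, and by naturality of \<open>\<psi>\<close> the isomorphism survives the
application of \<open>F\<close>.\<close>

lemma canon_tri_one_image:
 assumes cE: "\<And>Q. cof_seq D Q ==> cof_seq E (mob F two_one Q)"
  and okD: "\<And>Q. cof_seq D Q ==> iso_arr (dcat D ul) (Ncomp (ran_unit D i_00) (dob D i_ul (dob D (sub_square 0 2) Q))) &
   iso_arr (dcat D one_cat) (phi D (dob D (sub_square 0 2) Q))"
  and okE: "\<And>Q. cof_seq E Q ==> iso_arr (dcat E ul) (Ncomp (ran_unit E i_00) (dob E i_ul (dob E (sub_square 0 2) Q))) &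
   iso_arr (dcat E one_cat) (phi E (dob E (sub_square 0 2) Q))"
  and t: "(f, g, h) : tdist (canon_tri_one D)"
 shows "(mar F one_cat f, mar F one_cat g, inv_arr (dcat E one_cat) (Ncomp (psi D E F) (Dom (dcat D one_cat) f)) *[dcat E one_cat] mar F one_cat h)
  : tdist (canon_tri_one E)"
proof -
 note a = inf PD PE M D3 E3 pl pr
 let ?F = "mar F one_cat" and ?O = "dcat E one_cat" and ?D1 = "dcat D one_cat"
 let ?psi = "\<lambda>x. Ncomp (psi D E F) x"
 note F1 = M_fun[OF PD PE M small_ord[OF inf, of 0]]
 note E1 = funD(5)[OF F1] and D1 = funD(4)[OF F1]
 note SD = Susp_fun(1)[OF inf PD D3] and SE = Susp_fun(1)[OF inf PE E3]
 obtain Q where Q: "cof_seq D Q" and ti: "tri_iso ?D1 (Susp D) (f, g, h) (std_tri D Q)" and tr: "(f, g, h) : triangles ?D1 (Susp D)"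
  using t unfolding canon_tri_one_def by auto
 obtain f0 g0 h0 where s: "std_tri D Q = (f0, g0, h0)" by (cases "std_tri D Q")
 have Qo: "Q : dobj D two_one" using Q unfolding cof_seq_def by blast
 note okQ = okD[OF Q] and okFQ = okE[OF cE[OF Q]]
 note s02 = sfun_sub_square(1)[OF inf, of 0 2, simplified]
 have SS: "dob D (sub_square 0 2) Q : dobj D square" by (rule fobj[OF D_fun[OF PD s02] Qo])
 have s0: "(f0, g0, h0) : triangles ?D1 (Susp D)" unfolding s[symmetric]
  by (rule std_tri_triangle(4)[OF inf PD D3 Qo phi_susp_map(1)[OF inf PD D3 SS conjunct1[OF okQ]] phi_compat_sub(2)[OF a Qo, symmetric] conjunct2[OF okQ]])
   (use okQ okFQ in blast)+
 note si = std_tri_image[OF Qo conjunct1[OF okQ] conjunct1[OF okFQ] conjunct2[OF okQ] conjunct2[OF okFQ] s]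
 obtain x y z where T: "f : Hom ?D1 x y" "g : Hom ?D1 y z" "h : Hom ?D1 z (Fobj (Susp D) x)" using tr unfolding triangles_iff by blast
 obtain x0 y0 z0 where T0: "f0 : Hom ?D1 x0 y0" "g0 : Hom ?D1 y0 z0" "h0 : Hom ?D1 z0 (Fobj (Susp D) x0)" using s0 unfolding triangles_iff by blast
 note x = cat_ob(1)[OF D1 T(1)] and x0 = cat_ob(1)[OF D1 T0(1)]
 note px = psi_hom[OF a x] and px0 = psi_hom[OF a x0]
 note ix = inv_arr(1)[OF E1 px] and ix0 = inv_arr(1)[OF E1 px0]
 have FT: "?F f : Hom ?O (mob F one_cat x) (mob F one_cat y)" "?F g : Hom ?O (mob F one_cat y) (mob F one_cat z)"
  "inv_arr ?O (?psi x) *[?O] ?F h : Hom ?O (mob F one_cat z) (Fobj (Susp E) (mob F one_cat x))"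
  using fhom[OF F1 T(1)] fhom[OF F1 T(2)] cat_comp[OF E1 ix fhom[OF F1 T(3)]] .
 have FT0: "?F f0 : Hom ?O (mob F one_cat x0) (mob F one_cat y0)" "?F g0 : Hom ?O (mob F one_cat y0) (mob F one_cat z0)"
  "inv_arr ?O (?psi x0) *[?O] ?F h0 : Hom ?O (mob F one_cat z0) (Fobj (Susp E) (mob F one_cat x0))"
  using fhom[OF F1 T0(1)] fhom[OF F1 T0(2)] cat_comp[OF E1 ix0 fhom[OF F1 T0(3)]] .
 obtain u v w where u: "u : Hom ?D1 x x0" "iso_arr ?D1 u" and v: "v : Hom ?D1 y y0" "iso_arr ?D1 v" and w: "w : Hom ?D1 z z0" "iso_arr ?D1 w"
  and e: "v *[?D1] f = f0 *[?D1] u" "w *[?D1] g = g0 *[?D1] v" "Farr (Susp D) u *[?D1] h = h0 *[?D1] w"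
  using ti unfolding s tri_iso_iff[OF T T0] by blast
 note Fu = fhom[OF F1 u(1)] and Fv = fhom[OF F1 v(1)] and Fw = fhom[OF F1 w(1)]
 note SFu = fhom[OF SE Fu] and FSu = fhom[OF F1 fhom[OF SD u(1)]] and Fh = fhom[OF F1 T(3)] and Fh0 = fhom[OF F1 T0(3)]
 have 3: "Farr (Susp E) (?F u) *[?O] (inv_arr ?O (?psi x) *[?O] ?F h) = (inv_arr ?O (?psi x0) *[?O] ?F h0) *[?O] ?F w"
 proof -
  have "Farr (Susp E) (?F u) *[?O] (inv_arr ?O (?psi x) *[?O] ?F h) = (inv_arr ?O (?psi x0) *[?O] ?F (Farr (Susp D) u)) *[?O] ?F h"
   unfolding cat_assoc[OF E1 SFu ix Fh, symmetric] square_inverse[OF E1 px px0 SFu FSu psi_natural[OF a u(1)]] ..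
  also have "\<dots> = inv_arr ?O (?psi x0) *[?O] ?F (h0 *[?D1] w)"
   unfolding e(3)[symmetric] fcomp[OF F1 fhom[OF SD u(1)] T(3)] by (rule cat_assoc[OF E1 ix0 FSu Fh])
  also have "\<dots> = (inv_arr ?O (?psi x0) *[?O] ?F h0) *[?O] ?F w"
   unfolding fcomp[OF F1 T0(3) w(1)] by (rule cat_assoc[OF E1 ix0 Fh0 Fw, symmetric])
  finally show ?thesis .
 qed
 have i1: "tri_iso ?O (Susp E) (?F f, ?F g, inv_arr ?O (?psi x) *[?O] ?F h) (?F f0, ?F g0, inv_arr ?O (?psi x0) *[?O] ?F h0)"
  unfolding tri_iso_iff[OF FT FT0]
 proof (rule exI[of _ "?F u"], rule exI[of _ "?F v"], rule exI[of _ "?F w"], intro conjI Fu Fv Fw 3)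
  show "iso_arr ?O (?F u)" "iso_arr ?O (?F v)" "iso_arr ?O (?F w)" using fiso[OF F1 u] fiso[OF F1 v] fiso[OF F1 w] .
  show "?F v *[?O] ?F f = ?F f0 *[?O] ?F u" using fcomp[OF F1 v(1) T(1)] fcomp[OF F1 T0(1) u(1)] e(1) by simp
  show "?F w *[?O] ?F g = ?F g0 *[?O] ?F v" using fcomp[OF F1 w(1) T(2)] fcomp[OF F1 T0(2) v(1)] e(2) by simp
 qed
 obtain f1 g1 h1 where s1: "std_tri E (mob F two_one Q) = (f1, g1, h1)" by (cases "std_tri E (mob F two_one Q)")
 have tr0: "(?F f0, ?F g0, inv_arr ?O (?psi x0) *[?O] ?F h0) : triangles ?O (Susp E)" unfolding triangles_iff using FT0 by blast
 have tr1: "(?F f, ?F g, inv_arr ?O (?psi x) *[?O] ?F h) : triangles ?O (Susp E)" unfolding triangles_iff using FT by blast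
 note i2 = tri_iso_sym[OF SE si(2)[unfolded s1] tr0 si(1)[unfolded s1 HomD(2)[OF T0(1)]]]
 have "tri_iso ?O (Susp E) (?F f, ?F g, inv_arr ?O (?psi x) *[?O] ?F h) (std_tri E (mob F two_one Q))"
  unfolding s1 by (rule tri_iso_trans[OF SE tr1 tr0 si(2)[unfolded s1] i1 i2])
 then show ?thesis unfolding canon_tri_one_def HomD(2)[OF T(1)] using tr1 cE[OF Q] by auto
qed

lemma cocartesian_image:
 assumes X: "cocartesian D X"
 shows "cocartesian E (mob F square X)"
proof -
 note su = sfun_i_ul(1)[OF inf]
 note FU = M_fun[OF PD PE M small_ul[OF inf]] and FS = M_fun[OF PD PE M small_square[OF inf]]
 obtain Y k where Y: "Y : dobj D ul" and k: "k : dhom D square (Fobj (lan D i_ul) Y) X" "iso_arr (dcat D square) k" and Xo: "X : dobj D square"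
  using X unfolding cocartesian_def iso_objs_def by blast
 note lm = lan_mate_univ(1)[OF PD PE M D3 E3 su Y] and Fk = fhom[OF FS k(1)]
 have li: "iso_arr (dcat E square) (lan_mate D E F i_ul Y)" using pl Y sfunD(2,3)[OF su] unfolding preserves_lan_def by simp
 show ?thesis unfolding cocartesian_def iso_objs_def
  using fobj[OF FU Y] fobj[OF FS Xo] cat_comp[OF funD(5)[OF FS] Fk lm] iso_comp(1)[OF funD(5)[OF FS] Fk lm fiso[OF FS k] li] by blast
qed

lemma cocartesian_iso:
 assumes P: "is_prederivator H" and X: "cocartesian H X" and k: "k : dhom H square X X'" "iso_arr (dcat H square) k"
 shows "cocartesian (H :: ('k, 'q, 'r) derivator) X'"
proof -
 note C = D_cat[OF P small_square[OF inf]]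
 show ?thesis using X cat_ob(2)[OF C k(1)] cat_comp[OF C k(1)] iso_comp(1)[OF C k(1) _ k(2)] unfolding cocartesian_def iso_objs_def by blast
qed

lemma cof_seq_image:
 assumes z: "\<And>Z. zero_obj (dcat D one_cat) Z ==> zero_obj (dcat E one_cat) (mob F one_cat Z)" and Q: "cof_seq D Q"
 shows "cof_seq E (mob F two_one Q)"
proof -
 note E1 = D_cat[OF PE small_ord[OF inf, of 0]] and ES = D_cat[OF PE small_square[OF inf]]
 have Qo: "Q : dobj D two_one" using Q unfolding cof_seq_def by blast
 have ze: "zero_obj (dcat E one_cat) (dob E (pt two_one (pos i j)) (mob F two_one Q))"
  if ij: "i \<le> 2" "j \<le> 1" and zq: "zero_obj (dcat D one_cat) (dob D (pt two_one (pos i j)) Q)" for i j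
 proof -
  have "pos i j : Obj (two_one :: 'k scat)" using ij by (simp add: two_one_simps)
  note g = gam_hom[OF PD PE M sfun_pt[OF inf small_two_one[OF inf] this] Qo]
  show ?thesis by (rule zero_obj_iso[OF E1 inv_arr(1,4)[OF E1 g] z[OF zq]])
 qed
 have co: "cocartesian E (dob E (sub_square x y) (mob F two_one Q))"
  if xy: "x \<le> y" "y \<le> 2" and c: "cocartesian D (dob D (sub_square x y) Q)" for x y
 proof -
  note g = gam_hom[OF PD PE M sfun_sub_square(1)[OF inf xy] Qo]
  show ?thesis by (rule cocartesian_iso[OF PE cocartesian_image[OF c] inv_arr(1,4)[OF ES g]])
 qed
 show ?thesis unfolding cof_seq_def
  using fobj[OF M_fun[OF PD PE M small_two_one[OF inf]] Qo] ze[of 2 0] ze[of 0 1] co[of 0 1] co[of 1 2] Q unfolding cof_seq_def by simp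
qed

end

section \<open>The shifted derivator at the terminal category\<close>

lemma shift_simps:
 "dcat (shift D A) = (\<lambda>B. dcat D (A >< B))" "dfun (shift D A) = (\<lambda>u. dfun D (A ** u))"
 "ran_unit (shift D A) = (\<lambda>u. ran_unit D (A ** u))"
 "mfun (mshift F A) = (\<lambda>B. mfun F (A >< B))"
 by (simp_all add: shift_def mshift_def)

lemma shift_preserves:
 fixes D :: "('k, 'o, 'm) derivator" and A :: "'k scat"
 assumes inf: "infinite (UNIV :: 'k set)" and D: "is_derivator D" and E: "is_derivator E" and F: "exact_dmorphism D E F" and A: "small_cat A"
 shows "preserves_lan (shift D A) (shift E A) (mshift F A) i_ul" "preserves_ran (shift D A) (shift E A) (mshift F A) i_00"
proof -
 note u = sfun_prod(1)[OF inf A sfun_i_ul(1)[OF inf]] and i = sfun_prod(1)[OF inf A sfun_i_00[OF inf]]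
 have "preserves_lan D E F (A ** i_ul)" "preserves_ran D E F (A ** i_00)"
  by (rule pres_square[OF inf D E F A])+
 then show "preserves_lan (shift D A) (shift E A) (mshift F A) i_ul" "preserves_ran (shift D A) (shift E A) (mshift F A) i_00"
  unfolding preserves_lan_def preserves_ran_def lan_mate_def ran_mate_def Let_def sfunD(2,3)[OF u] sfunD(2,3)[OF i]
   sfunD(2,3)[OF sfun_i_ul(1)[OF inf]] sfunD(2,3)[OF sfun_i_00[OF inf]] by (simp_all add: shift_def mshift_def)
qed

text \<open>The corner of the outer square vanishes at \<open>(1,0)\<close> and \<open>(0,1)\<close>, so it is the extension by zero of its value at \<open>(0,0)\<close>;
with the cocartesian outer square this makes \<open>\<phi>\<close> invertible.\<close>

lemma shift_cof_seq:
 fixes D :: "('k, 'o, 'm) derivator" and A :: "'k scat"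
 assumes inf: "infinite (UNIV :: 'k set)" and D: "is_derivator D" and A: "small_cat A" and Q: "cof_seq (shift D A) Q"
 defines "S \<equiv> dob (shift D A) (sub_square 0 2) Q"
 shows "iso_arr (dcat (shift D A) ul) (Ncomp (ran_unit (shift D A) i_00) (dob (shift D A) i_ul S))"
  "iso_arr (dcat (shift D A) one_cat) (phi (shift D A) S)"
proof -
 let ?D = "shift D A"
 note P = is_prederivator_shift[OF inf A derD(1)[OF D]] and D3 = Der3_shift[OF inf A derD(4)[OF D]]
 have Qo: "Q : dobj ?D two_one" and z: "zero_obj (dcat ?D one_cat) (dob ?D (pt two_one (pos 2 0)) Q)"
  "zero_obj (dcat ?D one_cat) (dob ?D (pt two_one (pos 0 1)) Q)"
  and c: "cocartesian ?D (dob ?D (sub_square 0 1) Q)" "cocartesian ?D (dob ?D (sub_square 1 2) Q)" using Q unfolding cof_seq_def by auto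
 note s02 = sfun_sub_square[OF inf, of 0 2, simplified] and su = sfun_i_ul[OF inf]
 have S: "S : dobj ?D square" unfolding S_def by (rule fobj[OF D_fun[OF P s02(1)] Qo])
 let ?Y = "dob ?D i_ul S"
 have Y: "?Y : dobj ?D ul" by (rule fobj[OF D_fun[OF P su(1)] S])
 have at: "dob ?D (pt ul (pos i j)) ?Y = dob ?D (pt two_one (pos (if i = 0 then 0 else 2) j)) Q" if ij: "pos i j : Obj (ul :: 'k scat)" "i \<le> 1" "j \<le> 1" for i j
 proof -
  note p = sfun_pt[OF inf small_ul[OF inf] ij(1)]
  have sq: "pos i j : Obj (square :: 'k scat)" using ij(1) by (auto simp: ul_simps square_simps)
  have "i_ul *. pt ul (pos i j) = pt square (pos i j :: 'k uni)" using pt_comp[OF inf su(1) ij(1)] su(2)[OF ij(1)] by simp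
  moreover have "sub_square 0 2 *. pt square (pos i j) = (pt two_one (pos (if i = 0 then 0 else 2) j) :: 'k sfun)"
   using pt_comp[OF inf s02(1) sq] s02(2)[OF ij(2,3)] by simp
  ultimately show ?thesis unfolding S_def using D_cob[OF P p su(1) S] D_cob[OF P sfun_pt[OF inf small_square[OF inf] sq] s02(1) Qo] by (simp add: S_def)
 qed
 have t: "terminal_obj (dcat ?D one_cat) (dob ?D (pt ul (pos 1 0)) ?Y)" "terminal_obj (dcat ?D one_cat) (dob ?D (pt ul (pos 0 1)) ?Y)"
  using z at[of 1 0] at[of 0 1] by (simp_all add: zero_obj_def ul_simps)
 show i: "iso_arr (dcat ?D ul) (Ncomp (ran_unit ?D i_00) ?Y)"
  using ran_unit_iso[OF inf D A, of ?Y] Y t unfolding shift_simps by blast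
 have "univ (dfun ?D i_ul) ?Y S (Id (dcat ?D ul) ?Y)"
  using outer_square_univ[OF inf derivator_left[OF inf D] A, of Q] Qo c unfolding shift_simps S_def by blast
 from phi_susp_map(2)[OF inf P D3 S i this] show "iso_arr (dcat ?D one_cat) (phi ?D S)" .
qed

lemma corner_of_sub:
 fixes D :: "('k, 'o, 'm) derivator"
 assumes inf: "infinite (UNIV :: 'k set)" and P: "is_prederivator D" and Q: "Q : dobj D two_one"
 shows "dob D i_00 (dob D i_ul (dob D (sub_square 0 2) Q)) = dob D (pt two_one (pos 0 0)) Q"
proof -
 note s02 = sfun_sub_square[OF inf, of 0 2, simplified] and su = sfun_i_ul[OF inf] and si = sfun_i_00[OF inf]
 have o: "pos 0 0 : Obj (ul :: 'k scat)" "pos 0 0 : Obj (square :: 'k scat)" by (simp_all add: ul_simps square_simps)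
 have "i_ul *. i_00 = (pt square (pos 0 0) :: 'k sfun)" using pt_comp[OF inf su(1) o(1)] su(2)[OF o(1)] by (simp add: i_00_def)
 moreover have "sub_square 0 2 *. pt square (pos 0 0) = (pt two_one (pos 0 0) :: 'k sfun)"
  using pt_comp[OF inf s02(1) o(2)] s02(2)[of 0 0] by simp
 ultimately show ?thesis
  using D_cob[OF P si su(1) fobj[OF D_fun[OF P s02(1)] Q]] D_cob[OF P sfun_pt[OF inf small_square[OF inf] o(2)] s02(1) Q] by simp
qed

section \<open>Transport to the given small category\<close>

lemma compF_fun_assoc: "is_fun F B C ==> is_fun G C C' ==> is_fun H C' C'' ==> (H *. G) *. F = H *. (G *. F)"
 by (rule compF_assoc) (auto dest: funD)

lemma sfun_to_A1:
 fixes A :: "'k scat"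
 assumes inf: "infinite (UNIV :: 'k set)" and A: "small_cat A"
 shows "sfun (from_A1 A) (A >< one_cat) A" "sfun (to_A1 A) A (A >< one_cat)" "to_A1 A *. from_A1 A = idF (A >< one_cat)"
proof -
 note S = prod_simps
 have cA: "category A" using A by (simp add: small_cat_def)
 note A1 = small_prod[OF inf A small_ord[OF inf, of 0]]
 show p: "sfun (from_A1 A) (A >< one_cat) A" by (rule sfun_proj1[OF inf A small_ord[OF inf]])
 show q: "sfun (to_A1 A) A (A >< one_cat)" unfolding slice_at_def
 proof (rule sfun_mk_fun[OF A A1])
  show "x : Obj A ==> Tup x (Num 0) : Obj (A >< one_cat)" for x by (simp add: S(1))
  show "f : Hom A x y ==> Tup f (Id one_cat (Num 0)) : Hom (A >< one_cat) (Tup x (Num 0)) (Tup y (Num 0))" for f x y by (simp add: S(2))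
  show "x : Obj A ==> Tup (Id A x) (Id one_cat (Num 0)) = Id (A >< one_cat) (Tup x (Num 0))" for x by (simp add: S(3))
  fix g f x y z assume gf: "g : Hom A y z" "f : Hom A x y"
  have o: "Id one_cat (Num 0) : Hom (one_cat :: 'k scat) (Num 0) (Num 0)" by simp
  show "Tup (g *[A] f) (Id one_cat (Num 0)) = Tup g (Id one_cat (Num 0)) *[A >< one_cat] Tup f (Id one_cat (Num 0))"
   unfolding S(4)[OF gf(1) o gf(2) o] by simp
 qed
 have o: "x = Tup a (Num 0) & a : Obj A" if "x : Obj (A >< one_cat)" "x = Tup a b" for x a b using that by (auto simp: S(1))
 show "to_A1 A *. from_A1 A = idF (A >< one_cat)"
 proof (rule sfun_eqI[OF sfun_comp[OF p q] sfun_id[OF A1]])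
  fix x :: "'k uni" assume x: "x : Obj (A >< one_cat)"
  then obtain a where "x = Tup a (Num 0)" "a : Obj A" by (auto simp: S(1))
  then show "Fobj (to_A1 A *. from_A1 A) x = Fobj (idF (A >< one_cat)) x"
   using compF_obj[OF sfunD(6)[OF p] x, of "to_A1 A"] x by (simp add: proj1_def slice_at_def)
 next
  fix h x y :: "'k uni" assume h: "h : Hom (A >< one_cat) x y"
  then obtain f a b where f: "h = Tup f (Tup (Num 0) (Num 0))" "f : Hom A a b" by (auto simp: S(2))
  then show "Farr (to_A1 A *. from_A1 A) h = Farr (idF (A >< one_cat)) h"
   using compF_arr[OF sfunD(6)[OF p] h, of "to_A1 A"] HomD(1)[OF h] HomD(1)[OF f(2)] by (simp add: proj1_def slice_at_def)
 qed
qed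

theorem theorem10p6:
  fixes D :: "('k, 'o, 'm) derivator"
    and E :: "('k, 'p, 'n) derivator"
    and F :: "('k, 'o, 'm, 'p, 'n) dmorphism"
    and A :: "'k scat"
  assumes "regular_universe TYPE('k)"
    and "strong_derivator D" and "stable_derivator D"
    and "strong_derivator E" and "stable_derivator E"
    and "exact_dmorphism D E F"
    and "small_cat A"
  shows "nat_iso (psi_at D E F A) \<and>
    exact_functor (canon_tri D A) (canon_tri E A) (mfun F A) (sigma_at D E F A)"
proof -
 have inf: "infinite (UNIV :: 'k set)" using assms(1) by (simp add: regular_universe_def)
 have D: "is_derivator D" and E: "is_derivator E" using assms(3,5) by (simp_all add: stable_derivator_def pointed_def)
 note F = assms(6) and A = assms(7)
 have M: "is_dmorphism D E F" using F by (simp add: exact_dmorphism_def)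
 note PD = derD(1)[OF D] and PE = derD(1)[OF E]
 let ?D = "shift D A" and ?E = "shift E A" and ?F = "mshift F A" and ?A1 = "A >< one_cat"
 note a = inf is_prederivator_shift[OF inf A PD] is_prederivator_shift[OF inf A PE] is_dmorphism_shift[OF inf A M]
  Der3_shift[OF inf A derD(4)[OF D]] Der3_shift[OF inf A derD(4)[OF E]] shift_preserves[OF inf D E F A]
 note P = sfun_to_A1[OF inf A]
 note A1 = sfunD(4)[OF P(1)]
 let ?p = "from_A1 A" and ?q = "to_A1 A"
 note pD = D_fun[OF PD P(1)] and pE = D_fun[OF PE P(1)] and qD = D_fun[OF PD P(2)] and qE = D_fun[OF PE P(2)]
 note FA = M_fun[OF PD PE M A] and F1 = M_fun[OF PD PE M A1]
 note SD = Susp_fun(1)[OF a(1) a(2) a(5), unfolded shift_simps] and SE = Susp_fun(1)[OF a(1) a(3) a(6), unfolded shift_simps]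
 note EA = funD(5)[OF FA] and E1 = funD(5)[OF F1] and DA = funD(4)[OF FA]
 let ?psi = "psi ?D ?E ?F" and ?SD = "Susp ?D" and ?SE = "Susp ?E"
 let ?OA = "dcat E A" and ?O1 = "dcat E ?A1"
 note SpD = comp_fun[OF pD SD] and qSE = comp_fun[OF SE qE]
 note ph = psi_hom[OF a, unfolded shift_simps]
 have psi: "nat_iso ?psi" "Nsrc ?psi = ?SE *. mfun F ?A1" "Ntgt ?psi = mfun F ?A1 *. ?SD"
  using nat_iso_psi[OF a] by (simp_all add: psi_def shift_simps)
 let ?n1 = "mgam F ?q *R (?SD *. dfun D ?p)" and ?n2 = "dfun E ?q *L ?psi *R dfun D ?p" and ?n3 = "(dfun E ?q *. ?SE) *L mgam F ?p"
 note gq = M_gam[OF PD PE M P(2)] and gp = M_gam[OF PD PE M P(1)]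
 note SEF = comp_fun[OF F1 SE] and FSD = comp_fun[OF SD F1] and pEF = comp_fun[OF FA pE] and FpD = comp_fun[OF pD F1]
  and qEF = comp_fun[OF F1 qE] and FqD = comp_fun[OF qD FA]
 have n1: "is_ntrans ?n1" "Nsrc ?n1 = (dfun E ?q *. mfun F ?A1) *. (?SD *. dfun D ?p)" "Ntgt ?n1 = (mfun F A *. dfun D ?q) *. (?SD *. dfun D ?p)"
  using is_ntrans_whiskR[of "mgam F ?q" "?SD *. dfun D ?p"] gq funD[OF SpD] funD[OF qEF] by (simp_all add: nat_iso_def)
 have n2: "is_ntrans ?n2" "Nsrc ?n2 = dfun E ?q *. ((?SE *. mfun F ?A1) *. dfun D ?p)" "Ntgt ?n2 = dfun E ?q *. ((mfun F ?A1 *. ?SD) *. dfun D ?p)"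
 proof -
  have "is_ntrans (?psi *R dfun D ?p)" using psi funD[OF pD] funD[OF SEF] by (intro is_ntrans_whiskR) (simp_all add: nat_iso_def)
  then show "is_ntrans ?n2" using psi(2) funD[OF comp_fun[OF pD SEF]] funD[OF qE] by (intro is_ntrans_whiskL) simp_all
 qed (simp_all add: psi)
 have n3: "is_ntrans ?n3" "Nsrc ?n3 = (dfun E ?q *. ?SE) *. (dfun E ?p *. mfun F A)" "Ntgt ?n3 = (dfun E ?q *. ?SE) *. (mfun F ?A1 *. dfun D ?p)"
  using is_ntrans_whiskL[of "mgam F ?p" "dfun E ?q *. ?SE"] gp funD[OF qSE] funD[OF pEF] by (simp_all add: nat_iso_def)
 have e32: "Ntgt ?n3 = Nsrc ?n2" unfolding n2 n3
  using compF_fun_assoc[OF FpD SE qE] compF_fun_assoc[OF pD F1 SE] by simp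
 have e21: "Ntgt ?n2 = Nsrc ?n1" unfolding n1 n2
  using compF_fun_assoc[OF SpD F1 qE] compF_fun_assoc[OF pD SD F1] by simp
 have pa: "psi_at D E F A = ?n1 *N ?n2 *N ?n3" by (simp add: psi_at_def)
 have src: "Nsrc (psi_at D E F A) = Susp_at E A *. mfun F A"
  unfolding pa Susp_at_def using n3(2) compF_fun_assoc[OF FA comp_fun[OF pE SE] qE] compF_fun_assoc[OF FA pE SE] compF_fun_assoc[OF pEF SE qE] by simp
 have tgt: "Ntgt (psi_at D E F A) = mfun F A *. Susp_at D A"
  unfolding pa Susp_at_def using n1(3) compF_fun_assoc[OF SpD qD FA] by simp
 have n: "is_ntrans (psi_at D E F A)" unfolding pa
  by (rule is_ntrans_vcomp[OF n1(1) is_ntrans_vcomp[OF n2(1) n3(1) e32]], unfold vcomp_simps, rule e21)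
 note SAD = comp_fun[OF SpD qD] and SAE = comp_fun[OF comp_fun[OF pE SE] qE]
 note sE = comp_fun[OF FA SAE, folded Susp_at_def]
 let ?gp = "\<lambda>X. gam F ?p X" and ?gq = "\<lambda>X. gam F ?q X"
 let ?W = "\<lambda>X. Fobj ?SD (dob D ?p X)"
 have at: "Ncomp (psi_at D E F A) X = ?gq (?W X) *[?OA] (dar E ?q (Ncomp ?psi (dob D ?p X)) *[?OA] dar E ?q (Farr ?SE (?gp X)))"
  if X: "X : dobj D A" for X
 proof -
  have g: "?gp X : Hom ?O1 (dob E ?p (mob F A X)) (mob F ?A1 (dob D ?p X))" by (rule gam_hom(1)[OF PD PE M P(1) X])
  have f: "Fdom (Nsrc ?n3) = dcat D A" "Fcod (Nsrc ?n3) = ?OA" "Fdom (Nsrc (?n2 *N ?n3)) = dcat D A" "Fcod (Nsrc (?n2 *N ?n3)) = ?OA"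
   unfolding vcomp_simps n3(2) using funD(2,3)[OF comp_fun[OF pEF qSE]] by simp_all
  have c1: "Ncomp ?n1 X = ?gq (?W X)" using X funD(2)[OF SpD] compF_obj[OF pD X] by simp
  have d2: "Fdom (Nsrc (?psi *R dfun D ?p)) = dcat D A" using funD(2)[OF pD] by simp
  have c2: "Ncomp ?n2 X = dar E ?q (Ncomp ?psi (dob D ?p X))" using X funD(2)[OF pD] d2 by simp
  have d3: "Fdom (Nsrc (mgam F ?p)) = dcat D A" using gp funD(2)[OF pEF] by simp
  have c3: "Ncomp ?n3 X = dar E ?q (Farr ?SE (?gp X))" using X d3 compF_arr[OF SE g] by simp
  show ?thesis unfolding pa using X f c1 c2 c3 by simp
 qed
 have hom: "Ncomp (psi_at D E F A) X : Hom ?OA (Fobj (Susp_at E A) (mob F A X)) (mob F A (Fobj (Susp_at D A) X))"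
  if X: "X : dobj D A" for X
  using ntD(5)[OF n src tgt funD(2,3)[OF sE] X] unfolding compF_obj[OF FA X] compF_obj[OF SAD X, folded Susp_at_def] using compF_obj[OF SAD[folded Susp_at_def] X] by simp
 have iso: "iso_arr ?OA (Ncomp (psi_at D E F A) X)" if X: "X : dobj D A" for X
 proof -
  note pX = fobj[OF pD X] note WX = fobj[OF SD pX]
  note g = gam_hom[OF PD PE M P(1) X] and g' = gam_hom[OF PD PE M P(2) WX]
  note s = fhom[OF SE g(1)] fiso[OF SE g]
  note h1 = fhom[OF qE s(1)] fiso[OF qE s] and h2 = fhom[OF qE ph(1)[OF pX]] fiso[OF qE ph[OF pX]]
  show ?thesis unfolding at[OF X]
   by (rule iso_comp(1)[OF EA g'(1) cat_comp[OF EA h2(1) h1(1)] g'(2) iso_comp(1)[OF EA h2(1) h1(1) h2(2) h1(2)]])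
 qed
 have ni: "nat_iso (psi_at D E F A)" unfolding nat_iso_def src funD(2,3)[OF sE] using n iso by blast
 let ?s = "Ncomp (sigma_at D E F A)"
 have sig: "?s X = inv_arr ?OA (Ncomp (psi_at D E F A) X)" if X: "X : dobj D A" for X
  unfolding sigma_at_def using X funD(2,3)[OF sE] ntD(3)[OF n src tgt funD(2,3)[OF sE]] by (simp add: src tgt)
 have sn: "is_ntrans (sigma_at D E F A)" "Nsrc (sigma_at D E F A) = mfun F A *. Susp_at D A" "Ntgt (sigma_at D E F A) = Susp_at E A *. mfun F A"
  unfolding sigma_at_def using is_ntrans_inv_nat[OF ni] by (simp_all add: src tgt)
 note SDo = compF_obj[OF SpD, folded Susp_at_def]
 \<comment> \<open>comparison of sigma at A with sigma of the shifted morphism\<close>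
 have key: "Farr ?SE (?gp X) *[?O1] dar E ?p (?s X) = inv_arr ?O1 (Ncomp ?psi (dob D ?p X)) *[?O1] ?gp (Fobj (Susp_at D A) X)"
  if X: "X : dobj D A" for X
 proof -
  note pX = fobj[OF pD X] note WX = fobj[OF SD pX]
  have Z: "Fobj (Susp_at D A) X = dob D ?q (?W X)" unfolding Susp_at_def by (simp add: compF_obj[OF SpD X] compF_obj[OF pD X])
  note g = gam_hom[OF PD PE M P(1) X] and g' = gam_hom[OF PD PE M P(2) WX]
  note s = fhom[OF SE g(1)] fiso[OF SE g]
  note h1 = fhom[OF qE s(1)] and h2 = fhom[OF qE ph(1)[OF pX]]
  have qW: "dob D ?q (?W X) : dobj D A" by (rule fobj[OF qD WX])
  have pZ: "dob D ?p (dob D ?q (?W X)) = ?W X"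
   using D_cob[OF PD P(1,2) WX] P(3) D_idF[OF PD A1] WX by simp
  have idE: "dar E ?p (dar E ?q k) = k" if k: "k : Hom ?O1 x y" for k x y
   using D_car[OF PE P(1,2) k] P(3) D_idF[OF PE A1] HomD(1)[OF k] by simp
  have pk: "dar E ?p (Ncomp (psi_at D E F A) X) = dar E ?p (?gq (?W X)) *[?O1] (Ncomp ?psi (dob D ?p X) *[?O1] Farr ?SE (?gp X))"
   unfolding at[OF X] fcomp[OF pE g'(1) cat_comp[OF EA h2 h1]] fcomp[OF pE h2 h1] idE[OF s(1)] idE[OF ph(1)[OF pX]] ..
  have gg: "?gp (dob D ?q (?W X)) *[?O1] dar E ?p (?gq (?W X)) = Id ?O1 (mob F ?A1 (?W X))"
   using gam_comp[OF PD PE M P(1,2) WX] gam_idF[OF PD PE M A1 WX] P(3) by simp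
  note gW = gam_hom(1)[OF PD PE M P(1) qW, unfolded pZ] and pgq = fhom[OF pE g'(1)]
  have idp: "dob E ?p (dob E ?q y) = y" if y: "y : Obj ?O1" for y
   using D_cob[OF PE P(1,2) y] P(3) D_idF[OF PE A1] y by simp
  note c = cat_comp[OF E1 ph(1)[OF pX] s(1)]
  note pgq' = pgq[unfolded idp[OF fobj[OF F1 WX]]]
  have "?gp (dob D ?q (?W X)) *[?O1] dar E ?p (Ncomp (psi_at D E F A) X) = Ncomp ?psi (dob D ?p X) *[?O1] Farr ?SE (?gp X)"
   unfolding pk cat_assoc[OF E1 gW pgq' c, symmetric] gg by (rule cat_idl[OF E1 c])
  note e = this[symmetric]
  have SX: "Fobj (Susp_at E A) (mob F A X) = dob E ?q (Fobj ?SE (dob E ?p (mob F A X)))"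
   unfolding Susp_at_def by (simp add: compF_obj[OF comp_fun[OF pE SE] fobj[OF FA X]] compF_obj[OF pE fobj[OF FA X]])
  note pp = fhom[OF pE hom[OF X]] fiso[OF pE hom[OF X] iso[OF X]]
  have pp': "dar E ?p (Ncomp (psi_at D E F A) X) : Hom ?O1 (Fobj ?SE (dob E ?p (mob F A X))) (dob E ?p (mob F A (dob D ?q (?W X))))"
   using pp(1) unfolding SX Z idp[OF fobj[OF SE fobj[OF pE fobj[OF FA X]]]] .
  show ?thesis unfolding sig[OF X] finv[OF pE hom[OF X] iso[OF X], symmetric] Z
   by (rule square_inverse[OF E1 pp' pp(2) ph[OF pX] s(1) gW e, symmetric])
 qed
 have zF: "\<And>Z. zero_obj (dcat ?D one_cat) Z ==> zero_obj (dcat ?E one_cat) (mob ?F one_cat Z)"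
  unfolding shift_simps by (rule pres_zero[OF inf D E F A1])
 have dist: "(mar F A f, mar F A g, ?s (Dom (dcat D A) f) *[?OA] mar F A h) : tdist (canon_tri E A)"
  if t: "(f, g, h) : tdist (canon_tri D A)" for f g h
 proof -
  have tr: "(f, g, h) : triangles (dcat D A) (Susp_at D A)"
   and t1: "(dar D ?p f, dar D ?p g, dar D ?p h) : tdist (canon_tri_one ?D)"
   using t unfolding canon_tri_def by auto
  obtain x y z where f: "f : dhom D A x y" and g: "g : dhom D A y z" and h: "h : dhom D A z (Fobj (Susp_at D A) x)"
   using tr unfolding triangles_iff by blast
  note xyz = cat_ob[OF DA f] cat_ob(2)[OF DA g]
  note X = xyz(1) note pX = fobj[OF pD X]
  note t2 = canon_tri_one_image[OF a cof_seq_image[OF a zF] conjI[OF shift_cof_seq[OF inf D A]] conjI[OF shift_cof_seq[OF inf E A]] t1, unfolded shift_simps]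
  note pf = fhom[OF pD f] and pg = fhom[OF pD g] and ph' = fhom[OF pD h]
  note Ff = fhom[OF FA f] and Fg = fhom[OF FA g] and Fh = fhom[OF FA h]
  have s: "?s x : Hom ?OA (mob F A (Fobj (Susp_at D A) x)) (Fobj (Susp_at E A) (mob F A x))"
   unfolding sig[OF X] by (rule inv_arr(1)[OF EA hom[OF X] iso[OF X]])
  note sFh = cat_comp[OF EA s Fh]
  have T: "(mar F A f, mar F A g, ?s x *[?OA] mar F A h) : triangles ?OA (Susp_at E A)"
   unfolding triangles_iff using Ff Fg sFh by blast
  let ?pE = "dar E ?p" and ?F1 = "mar F ?A1"
  have SXE: "dob E ?p (Fobj (Susp_at E A) Y) = Fobj ?SE (dob E ?p Y)" if Y: "Y : Obj ?OA" for Y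
  proof -
   note b = fobj[OF SE fobj[OF pE Y]]
   have "Fobj (Susp_at E A) Y = dob E ?q (Fobj ?SE (dob E ?p Y))"
    unfolding Susp_at_def by (simp add: compF_obj[OF comp_fun[OF pE SE] Y] compF_obj[OF pE Y])
   then show ?thesis using D_cob[OF PE P(1,2) b] P(3) D_idF[OF PE A1] b by simp
  qed
  have SXD: "dob D ?p (Fobj (Susp_at D A) Y) = Fobj ?SD (dob D ?p Y)" if Y: "Y : dobj D A" for Y
  proof -
   note b = fobj[OF SD fobj[OF pD Y]]
   have "Fobj (Susp_at D A) Y = dob D ?q (Fobj ?SD (dob D ?p Y))"
    unfolding Susp_at_def by (simp add: compF_obj[OF SpD Y] compF_obj[OF pD Y])
   then show ?thesis using D_cob[OF PD P(1,2) b] P(3) D_idF[OF PD A1] b by simp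
  qed
  note R = fhom[OF pE Ff] fhom[OF pE Fg] fhom[OF pE sFh, unfolded SXE[OF fobj[OF FA X]]]
  note ip = inv_arr(1)[OF E1 ph[OF pX]]
  note Fph = fhom[OF F1 ph', unfolded SXD[OF X]]
  note R' = fhom[OF F1 pf] fhom[OF F1 pg] cat_comp[OF E1 ip Fph]
  note gx = gam_hom[OF PD PE M P(1) xyz(1)] and gy = gam_hom[OF PD PE M P(1) xyz(2)] and gz = gam_hom[OF PD PE M P(1) xyz(3)]
  have Sx: "Fobj (Susp_at D A) x : dobj D A" using cat_ob(2)[OF DA h] .
  note gS = gam_hom(1)[OF PD PE M P(1) Sx, unfolded SXD[OF X]]
  have 3: "Farr ?SE (?gp x) *[?O1] ?pE (?s x *[?OA] mar F A h) = (inv_arr ?O1 (Ncomp ?psi (dob D ?p x)) *[?O1] ?F1 (dar D ?p h)) *[?O1] ?gp z"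
  proof -
   note ps = fhom[OF pE s, unfolded SXE[OF fobj[OF FA X]]] and pFh = fhom[OF pE Fh] and Sg = fhom[OF SE gx(1)]
   have "Farr ?SE (?gp x) *[?O1] ?pE (?s x *[?OA] mar F A h) = (Farr ?SE (?gp x) *[?O1] ?pE (?s x)) *[?O1] ?pE (mar F A h)"
    unfolding fcomp[OF pE s Fh] by (rule cat_assoc[OF E1 Sg ps pFh, symmetric])
   also have "\<dots> = inv_arr ?O1 (Ncomp ?psi (dob D ?p x)) *[?O1] (?F1 (dar D ?p h) *[?O1] ?gp z)"
    unfolding key[OF X] gam_natural[OF PD PE M P(1) h, symmetric] by (rule cat_assoc[OF E1 ip gS pFh])
   also have "\<dots> = (inv_arr ?O1 (Ncomp ?psi (dob D ?p x)) *[?O1] ?F1 (dar D ?p h)) *[?O1] ?gp z"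
    by (rule cat_assoc[OF E1 ip Fph gz(1), symmetric])
   finally show ?thesis .
  qed
  have ti: "tri_iso ?O1 ?SE (?pE (mar F A f), ?pE (mar F A g), ?pE (?s x *[?OA] mar F A h))
    (?F1 (dar D ?p f), ?F1 (dar D ?p g), inv_arr ?O1 (Ncomp ?psi (dob D ?p x)) *[?O1] ?F1 (dar D ?p h))"
   unfolding tri_iso_iff[OF R R']
   by (rule exI[of _ "?gp x"], rule exI[of _ "?gp y"], rule exI[of _ "?gp z"], intro conjI gx gy gz 3
     gam_natural[OF PD PE M P(1) f] gam_natural[OF PD PE M P(1) g])
  have std: "\<And>Q. cof_seq ?E Q ==> std_tri ?E Q : triangles (dcat ?E one_cat) ?SE"
  proof -
   fix Q assume Q: "cof_seq ?E Q"
   have Qo: "Q : dobj ?E two_one" using Q unfolding cof_seq_def by blast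
   note s02 = sfun_sub_square[OF inf, of 0 2, simplified]
   have S: "dob ?E (sub_square 0 2) Q : dobj ?E square" by (rule fobj[OF D_fun[OF a(3) s02(1)] Qo])
   show "std_tri ?E Q : triangles (dcat ?E one_cat) ?SE"
    by (rule std_tri_triangle(4)[OF a(1) a(3) a(6) Qo phi_susp_map(1)[OF a(1) a(3) a(6) S shift_cof_seq(1)[OF inf E A Q]] corner_of_sub[OF inf a(3) Qo] shift_cof_seq(2)[OF inf E A Q]])
  qed
  have TR: "(?pE (mar F A f), ?pE (mar F A g), ?pE (?s x *[?OA] mar F A h)) : triangles (dcat ?E one_cat) ?SE"
   unfolding shift_simps triangles_iff using R by blast
  have "(?pE (mar F A f), ?pE (mar F A g), ?pE (?s x *[?OA] mar F A h)) : tdist (canon_tri_one ?E)"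
   by (rule canon_tri_one_iso_closed[OF Susp_fun(1)[OF a(1) a(3) a(6)] TR t2[unfolded HomD(2)[OF pf]] std]) (use ti in \<open>simp_all add: shift_simps\<close>)
  then show ?thesis unfolding canon_tri_def HomD(2)[OF f] using T by simp
 qed
 have "additive_functor (mfun F A)" by (rule mfun_additive[OF inf D E F A])
 then have "exact_functor (canon_tri D A) (canon_tri E A) (mfun F A) (sigma_at D E F A)"
  unfolding exact_functor_def using funD(2,3)[OF FA] sn dist by (simp add: canon_tri_def)
 then show ?thesis using ni by blast
qed

end
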